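(* Let $0<\operatorname{Re}(\alpha)<\frac12$ and \begin{align*} B>&\left|\frac{1}{\left(1-q^{-\frac12-\alpha}\right)\left(1-q^{\frac12-\alpha}\right)}\right|\\&\times\prod_{\substack{P\,\text{monic}\\\text{irreducible}}}\left[\frac12\left(\left(1-\frac{1}{|P|^{\frac12+\alpha}}\right)^{-1}\left(1-\frac{1}{|P|^{\frac12+\overline\alpha}}\right)^{-1}+\left(1+\frac{1}{|P|^{\frac12+\alpha}}\right)^{-1}\left(1+\frac{1}{|P|^{\frac12+\overline\alpha}}\right)^{-1}\right)+\frac{1}{|P|}\right]^{1/2}\\&\times\left(1+\frac{1}{|P|}\right)^{-1/2}. \end{align*} Then $(q,1/2+\alpha,B)$ does not satisfy the Northcott property, i.e. $S_{q,1/2+\alpha,B}=\{[K]:|\zeta_K^*(1/2+\alpha)|\le B\}$ is infinite.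
   Context: $q\equiv1\pmod4$. $K$ ranges over isomorphism classes of global function fields in one variable with constant field $\mathbb F_q$; $\zeta_K^*(s)$ is the first nonzero Taylor coefficient of $\zeta_K$ at $s$. The product is over monic irreducible $P\in\mathbb F_q[T]$, with $|P|=q^{\deg P}$. *)

theory Defs
  imports
    "HOL-Algebra.Algebra"
    "HOL-Computational_Algebra.Computational_Algebra"
    "HOL-Complex_Analysis.Complex_Analysis"
begin

text \<open>
  Unordered infinite product: the limit of the finite partial products along the net of
  finite subsets, in analogy with \<^const>\<open>infsum\<close>.
\<close>

definition infprod :: "('i \<Rightarrow> 'a::{t2_space,comm_monoid_mult}) \<Rightarrow> 'i set \<Rightarrow> 'a" where
  "infprod f A = Lim (finite_subsets_at_top A) (prod f)"

lemma infprod_eqI: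
  "((prod f) \<longlongrightarrow> p) (finite_subsets_at_top A) \<Longrightarrow> infprod f A = p"
  by (simp add: infprod_def tendsto_Lim)

text \<open>
  \<open>K\<close> is an algebraic function field in one variable whose (exact) constant field is \<open>k\<close>:
  \<open>K\<close> is finite over \<open>k(x)\<close> for some \<open>x\<close> transcendental over \<open>k\<close>, and \<open>k\<close> is algebraically
  closed in \<open>K\<close>.
\<close>

definition function_field :: "'a set \<Rightarrow> 'a ring \<Rightarrow> bool" where
  "function_field k K \<longleftrightarrow>
     field K \<and> subfield k K \<and>
     (\<exists>x\<in>carrier K. ring.transcendental K k x \<and>
        ring.finite_dimension K (generate_field K (insert x k)) (carrier K)) \<and>
     (\<forall>y\<in>carrier K. ring.algebraic K k y \<longrightarrow> y \<in> k)"

text \<open>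
  A place is represented by its valuation ring \<open>V\<close>, with \<open>k \<subset> V \<subset> K\<close>; its prime is the
  maximal ideal of non-units of \<open>V\<close>.
\<close>

definition places :: "'a set \<Rightarrow> 'a ring \<Rightarrow> 'a set set" where
  "places k K = {V. subring V K \<and> k \<subset> V \<and> V \<subset> carrier K \<and>
     (\<forall>z\<in>carrier K - {\<zero>\<^bsub>K\<^esub>}. z \<in> V \<or> inv\<^bsub>K\<^esub> z \<in> V)}"

definition place_ideal :: "'a ring \<Rightarrow> 'a set \<Rightarrow> 'a set" where
  "place_ideal K V = {z\<in>V. z = \<zero>\<^bsub>K\<^esub> \<or> inv\<^bsub>K\<^esub> z \<notin> V}"

definition place_norm :: "'a ring \<Rightarrow> 'a set \<Rightarrow> nat" where
  "place_norm K V = card (carrier (K\<lparr>carrier := V\<rparr> Quot place_ideal K V))"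

text \<open>
  The Dedekind zeta function of \<open>K\<close>: the meromorphic continuation to the whole plane of the
  Euler product over all places. Meromorphic functions in the library are total; asking for
  \<^emph>\<open>nicely\<close> meromorphic fixes the value at a pole to be 0 and so makes the continuation unique.
\<close>

definition zeta :: "'a set \<Rightarrow> 'a ring \<Rightarrow> complex \<Rightarrow> complex" where
  "zeta k K = (THE f. f nicely_meromorphic_on UNIV \<and>
     (\<forall>s. Re s > 1 \<longrightarrow>
        f s = infprod (\<lambda>V. inverse (1 - of_nat (place_norm K V) powr (- s))) (places k K)))"

text \<open>The first nonzero coefficient of the expansion of the zeta function in powers of \<open>w - s\<close>.\<close>

definition zeta_star :: "'a set \<Rightarrow> 'a ring \<Rightarrow> complex \<Rightarrow> complex" where
  "zeta_star k K s =
     (let L = laurent_expansion (zeta k K) s in fls_nth L (fls_subdegree L))"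

text \<open>
  Function fields over finite fields are countable, so each of them is isomorphic to one whose
  carrier is a set of natural numbers; the isomorphism classes can thus be formed among
  \<^typ>\<open>nat ring\<close>. Isomorphisms are ring isomorphisms, not required to respect an identification
  of the constant field with a fixed field of \<open>q\<close> elements.
\<close>

definition function_fields :: "nat \<Rightarrow> nat ring set" where
  "function_fields q = {K. \<exists>k. function_field k K \<and> finite k \<and> card k = q}"

definition function_field_iso :: "nat \<Rightarrow> (nat ring \<times> nat ring) set" where
  "function_field_iso q =
     {(K, L). K \<in> function_fields q \<and> L \<in> function_fields q \<and> K \<simeq> L}"

definition northcott_set :: "nat \<Rightarrow> complex \<Rightarrow> real \<Rightarrow> nat ring set set" where
  "northcott_set q s B =
     {C \<in> function_fields q // function_field_iso q.
        \<exists>K\<in>C. \<exists>k. function_field k K \<and> finite k \<and> card k = q \<and> cmod (zeta_star k K s) \<le> B}"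

definition northcott_property :: "nat \<Rightarrow> complex \<Rightarrow> real \<Rightarrow> bool" where
  "northcott_property q s B \<longleftrightarrow> finite (northcott_set q s B)"

definition monic_irreducibles :: "'f::field poly set" where
  "monic_irreducibles = {P. Polynomial.lead_coeff P = 1 \<and> Factorial_Ring.irreducible P}"

definition pnorm :: "'f::{field,finite} poly \<Rightarrow> real" where
  "pnorm P = real CARD('f) ^ Polynomial.degree P"

text \<open>
  The expression in square brackets in the bound for \<open>B\<close>, with \<open>t = |P|\<close>. It is written with
  complex powers but takes positive real values.
\<close>

definition bracket :: "complex \<Rightarrow> real \<Rightarrow> complex" where
  "bracket \<alpha> t =
     1/2 * (inverse (1 - 1 / of_real t powr (1/2 + \<alpha>)) * inverse (1 - 1 / of_real t powr (1/2 + cnj \<alpha>)) +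
            inverse (1 + 1 / of_real t powr (1/2 + \<alpha>)) * inverse (1 + 1 / of_real t powr (1/2 + cnj \<alpha>)))
     + 1 / of_real t"

lemma bracket_pos:
  assumes "t > 0"
  shows "bracket \<alpha> t \<in> \<real>" and "Re (bracket \<alpha> t) > 0"
proof -
  define x where "x = 1 / of_real t powr (1/2 + \<alpha>)"
  have cx: "1 / of_real t powr (1/2 + cnj \<alpha>) = cnj x"
    using assms by (simp add: x_def cnj_powr)
  have "bracket \<alpha> t = 1/2 * (inverse (1 - x) * cnj (inverse (1 - x)) +
     inverse (1 + x) * cnj (inverse (1 + x))) + 1 / of_real t"
    unfolding bracket_def cx by (simp add: x_def)
  also have "\<dots> = of_real (1/2 * ((cmod (inverse (1 - x)))\<^sup>2 + (cmod (inverse (1 + x)))\<^sup>2) + 1 / t)"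
    by (simp only: complex_norm_square [symmetric] of_real_add of_real_mult of_real_divide
        of_real_1 of_real_numeral)
  finally have eq: "bracket \<alpha> t = \<dots>" .
  show "bracket \<alpha> t \<in> \<real>" unfolding eq by (rule Reals_of_real)
  show "Re (bracket \<alpha> t) > 0" unfolding eq Re_complex_of_real
    using assms by (intro add_nonneg_pos) auto
qed

end

theory Submission
  imports
    Defs
    "HOL-Algebra.Algebraic_Closure_Type"
    "HOL-Number_Theory.Cong"
    "HOL-Analysis.Kronecker_Approximation_Theorem"
begin

text \<open>
  The right hand side of the bound is nonnegative, so it suffices that \<open>zeta\<close> takes arbitrarily small
  nonzero values at \<open>1/2 + \<alpha>\<close>: values of different absolute value belong to different classes. This
  happens already for the Artin--Schreier fields \<open>F\<^sub>q(T)(y)\<close>, \<open>y\<^sup>p - y = f\<close>, with \<open>f\<close> monic of degree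
  prime to \<open>p\<close>. With \<open>u = q powr (-s)\<close> their zeta function is \<open>Lprod f u / ((1 - u) (1 - q u))\<close>, where \<open>Lprod\<close>
  is a product of \<open>p - 1\<close> L-polynomials whose coefficients are sums of additive characters of the
  traces \<open>lam f g\<close>.

  At the point in question \<open>1/q < cmod u < 1/sqrt q\<close>. By the first inequality the Euler product diverges
  absolutely: after aligning the phases of \<open>u ^ n\<close> for suitable degrees \<open>n\<close>, prescribing \<open>f\<close> modulo
  finitely many primes makes the corresponding finite Euler product as small as desired. By the
  second inequality, a second moment computation over the \<open>f\<close> in this residue class shows that the
  remaining factors are close to \<open>1\<close> for some \<open>f\<close>; the functional equation cuts the sums down to a
  length for which the moment is computed exactly.
\<close>

text \<open>The Artin--Schreier family is tractable because \<open>lam\<close> is additive in its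
  first argument: for fixed \<open>g1\<close>, \<open>g2\<close> the product of the two characters
  is, up to a constant, an additive character of \<open>h\<close> in \<open>f = R + M * h\<close>.
  Averages over \<open>h\<close> are therefore exact, and a condition modulo \<open>M\<close> costs
  nothing for polynomials prime to \<open>M\<close>. The obstacle is length: exactness stops at half
  the number of free coefficients of \<open>h\<close>, while the L-polynomials reach degree
  \<open>degree f - 1\<close>. The pairs that survive the averaging are not only the equal ones,
  since p-th powers are invisible to logarithmic derivatives. There are at most
  \<open>sqrt q ^ n\<close> of degree \<open>n\<close>, so that \<open>sqrt q * cmod u < 1\<close>
  controls them as well. That \<open>p\<close> does not divide \<open>degree f\<close> is used
  twice: it makes the character primitive, which gives the functional equation, and it makes
  infinity totally ramified, which gives one place of norm \<open>q\<close> there and an exact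
  constant field. Isomorphisms need not respect constants; the constant field is therefore recovered
  inside the ring as the solutions of \<open>x ^ q = x\<close>.\<close>

hide_const (open) Divisibility.irreducible Divisibility.prime Divisibility.properfactor
  Polynomials.degree Polynomials.lead_coeff

text \<open>The statement takes its finite field from the sort \<open>{field,finite}\<close>,
  whereas the argument works in \<open>finite_field\<close> and \<open>field_gcd\<close>. The
  fraction field of a field is a copy of it, and \<open>'f fract\<close> has both sorts. The
  instances also make the rational function field \<open>'g poly fract\<close> a
  \<open>field_gcd\<close>, so that Bezout relations hold for polynomials over it.\<close>

instantiation fract :: (idom)
  "{unique_euclidean_ring, normalization_euclidean_semiring, normalization_semidom_multiplicative}"
begin
definition [simp]: "normalize_fract = (normalize_field :: 'a fract \<Rightarrow> _)"
definition [simp]: "unit_factor_fract = (unit_factor_field :: 'a fract \<Rightarrow> _)"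
definition [simp]: "modulo_fract = (mod_field :: 'a fract \<Rightarrow> _)"
definition [simp]: "euclidean_size_fract = (euclidean_size_field :: 'a fract \<Rightarrow> _)"
definition [simp]: "division_segment (x :: 'a fract) = 1"
instance
  by standard (simp_all add: dvd_field_iff field_split_simps split: if_splits)
end

instantiation fract :: (idom) euclidean_ring_gcd
begin
definition gcd_fract :: "'a fract \<Rightarrow> 'a fract \<Rightarrow> 'a fract" where
  "gcd_fract = Euclidean_Algorithm.gcd"
definition lcm_fract :: "'a fract \<Rightarrow> 'a fract \<Rightarrow> 'a fract" where
  "lcm_fract = Euclidean_Algorithm.lcm"
definition Gcd_fract :: "'a fract set \<Rightarrow> 'a fract" where
  "Gcd_fract = Euclidean_Algorithm.Gcd"
definition Lcm_fract :: "'a fract set \<Rightarrow> 'a fract" where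
  "Lcm_fract = Euclidean_Algorithm.Lcm"
instance by standard (simp_all add: gcd_fract_def lcm_fract_def Gcd_fract_def Lcm_fract_def)
end

instance fract :: (idom) field_gcd ..

lemma range_to_fract_field: "range (to_fract :: 'a::field \<Rightarrow> 'a fract) = UNIV"
proof -
  have "z \<in> range to_fract" for z :: "'a fract"
  proof (cases z)
    case (Fract a b)
    then have "z = to_fract (a / b)" by (simp add: to_fract_def eq_fract)
    then show ?thesis by blast
  qed
  then show ?thesis by auto
qed

lemma card_UNIV_fract_field: "CARD('a::field fract) = CARD('a)"
proof -
  have "inj (to_fract :: 'a \<Rightarrow> 'a fract)" by (auto intro: injI)
  then have "card (range (to_fract :: 'a \<Rightarrow> 'a fract)) = CARD('a)" by (rule card_image)
  then show ?thesis by (simp add: range_to_fract_field)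
qed

instance fract :: ("{finite,field}") finite_field
proof
  show "finite (UNIV :: 'a fract set)"
    using range_to_fract_field[where 'a='a] by (metis finite finite_imageI)
qed

subsection \<open>Finite fields\<close>

text \<open>An additively closed set whose size is the largest possible power of \<open>p\<close>
  must be everything: an element \<open>x\<close> outside would contribute \<open>p\<close> disjoint
  translates, because a multiple of \<open>x\<close> by a number prime to \<open>p\<close> cannot
  fall back into the set.\<close>

lemma finite_field_card_power_CHAR: "\<exists>e. CARD('g::finite_field) = CHAR('g) ^ e"
proof -
  define p where "p = CHAR('g)"
  have p: "prime p" by (simp add: p_def)
  define good where "good e \<longleftrightarrow> (\<exists>S::'g set. 0 \<in> S \<and> (\<forall>x\<in>S. \<forall>y\<in>S. x + y \<in> S) \<and> card S = p ^ e)" for e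
  have g0: "good 0" unfolding good_def by (intro exI[of _ "{0}"]) auto
  have bd: "e \<le> CARD('g)" if "good e" for e
  proof -
    from that obtain S :: "'g set" where "card S = p ^ e" unfolding good_def by blast
    then have "p ^ e \<le> CARD('g)" by (metis card_mono finite subset_UNIV)
    moreover have "e < p ^ e" using p prime_gt_1_nat by (simp add: less_exp power_gt_expt)
    ultimately show ?thesis by linarith
  qed
  define e where "e = Max {e. good e}"
  have fin: "finite {e. good e}" using bd by (meson finite_nat_set_iff_bounded_le mem_Collect_eq)
  have ge: "good e" unfolding e_def using Max_in[OF fin] g0 by blast
  then obtain S :: "'g set" where S: "0 \<in> S" "\<And>x y. x \<in> S \<Longrightarrow> y \<in> S \<Longrightarrow> x + y \<in> S" "card S = p ^ e"
    unfolding good_def by blast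
  have nmul: "of_nat n * x \<in> S" if "x \<in> S" for n x
    by (induction n) (auto simp: S that algebra_simps)
  have neg: "- x \<in> S" if "x \<in> S" for x
  proof -
    have "of_nat (p - 1) * x + x = of_nat p * x" using p prime_gt_0_nat[OF p]
      by (simp add: of_nat_diff algebra_simps Suc_leI)
    also have "\<dots> = 0" by (simp add: p_def)
    finally have "of_nat (p - 1) * x = - x" by (simp add: eq_neg_iff_add_eq_0)
    then show ?thesis using nmul[OF that, of "p - 1"] by simp
  qed
  have "S = UNIV"
  proof (rule ccontr)
    assume "S \<noteq> UNIV"
    then obtain x where x: "x \<notin> S" by blast
    define f where "f = (\<lambda>(s, n). s + of_nat n * x)"
    define S' where "S' = f ` (S \<times> {..<p})"
    have inj: "inj_on f (S \<times> {..<p})"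
    proof (rule inj_onI)
      have aux: "a = b" if "s \<in> S" "t \<in> S" "a \<le> b" "b < p" "s + of_nat a * x = t + of_nat b * x" for s t a b
      proof (rule ccontr)
        assume "a \<noteq> b"
        then have ab: "0 < b - a" "b - a < p" using that by auto
        have *: "of_nat (b - a) * x = s + (- t)" using that by (simp add: of_nat_diff algebra_simps)
        then have in_S: "of_nat (b - a) * x \<in> S" using S that neg by metis
        have "coprime (b - a) p" using ab p
          by (metis coprime_commute dvd_imp_le leD prime_imp_coprime)
        then obtain c where c: "[(b - a) * c = 1] (mod p)" using cong_solve_coprime_nat by (metis One_nat_def)
        then have "(of_nat ((b - a) * c) :: 'g) = of_nat 1"
          unfolding p_def by (subst of_nat_eq_iff_cong_CHAR)
        then have "of_nat c * of_nat (b - a) = (1 :: 'g)" by (simp add: mult.commute)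
        then have "x = of_nat c * (of_nat (b - a) * x)" by (simp only: mult.assoc[symmetric] mult_1)
        then have "x \<in> S" using nmul[OF in_S, of c] by argo
        then show False using x by simp
      qed
      fix u v assume uv: "u \<in> S \<times> {..<p}" "v \<in> S \<times> {..<p}" "f u = f v"
      obtain s a where u: "u = (s, a)" by (cases u)
      obtain t b where v: "v = (t, b)" by (cases v)
      have "a = b" using uv aux[of s t a b] aux[of t s b a] unfolding u v f_def by (cases "a \<le> b") auto
      then show "u = v" using uv by (auto simp: f_def u v)
    qed
    have cS: "card S' = p ^ Suc e" unfolding S'_def using card_image[OF inj] S by (simp add: card_cartesian_product)
    have "u + v \<in> S'" if uv: "u \<in> S'" "v \<in> S'" for u v
    proof -
      from uv obtain s a t b where st: "s \<in> S" "t \<in> S" "u = s + of_nat a * x" "v = t + of_nat b * x"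
        unfolding S'_def f_def by auto
      have "of_nat ((a + b) mod p) = (of_nat (a + b) :: 'g)"
        unfolding p_def by (subst of_nat_eq_iff_cong_CHAR) (simp add: cong_def)
      then have "u + v = f (s + t, (a + b) mod p)" using st by (simp add: f_def algebra_simps)
      moreover have "(s + t, (a + b) mod p) \<in> S \<times> {..<p}" using st S p prime_gt_0_nat by auto
      ultimately show ?thesis unfolding S'_def by blast
    qed
    moreover have "0 \<in> S'" unfolding S'_def f_def using S p prime_gt_0_nat[OF p]
      by (intro image_eqI[where x="(0,0)"]) auto
    ultimately have "good (Suc e)" unfolding good_def using cS by blast
    then have "Suc e \<le> e" unfolding e_def using fin by (metis Max_ge mem_Collect_eq)
    then show False by simp
  qed
  then show ?thesis using S p_def by auto
qed

section \<open>The absolute trace and the standard additive character\<close>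

definition ffexp :: "'g::finite_field itself \<Rightarrow> nat" where
  "ffexp _ = (SOME e. CARD('g) = CHAR('g) ^ e)"

lemma CARD_ffexp: "CARD('g::finite_field) = CHAR('g) ^ ffexp TYPE('g)"
  unfolding ffexp_def by (rule someI_ex[OF finite_field_card_power_CHAR])

lemma CARD_gt_1: "CARD('g::finite_field) > 1"
proof -
  have "card {0, 1::'g} \<le> CARD('g)" by (rule card_mono) auto
  then show ?thesis by simp
qed

lemma ffexp_pos: "ffexp TYPE('g::finite_field) > 0"
  using CARD_ffexp[where 'g='g] CARD_gt_1[where 'g='g] by (metis gr0I less_irrefl power_0)

text \<open>The absolute trace, kept as an element of the field itself; \<open>abs_tr_frob\<close>
  places it in the prime field.\<close>

definition abs_tr :: "'g::finite_field \<Rightarrow> 'g" where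
  "abs_tr x = (\<Sum>i<ffexp TYPE('g). x ^ (CHAR('g) ^ i))"

lemma abs_tr_add: "abs_tr (x + y) = abs_tr x + abs_tr y"
  unfolding abs_tr_def by (subst freshmans_dream'[OF _ refl]) (auto simp: sum.distrib)

lemma abs_tr_0 [simp]: "abs_tr 0 = 0"
  unfolding abs_tr_def by (rule sum.neutral) (simp add: power_0_left)

lemma abs_tr_frob: "abs_tr x ^ CHAR('g) = abs_tr (x::'g::finite_field)"
proof -
  have "abs_tr x ^ CHAR('g) = (\<Sum>i<ffexp TYPE('g). x ^ (CHAR('g) ^ Suc i))"
    unfolding abs_tr_def by (subst freshmans_dream_sum) (auto simp: power_mult[symmetric] mult.commute)
  also have "\<dots> + x ^ (CHAR('g) ^ 0) = (\<Sum>i<Suc (ffexp TYPE('g)). x ^ (CHAR('g) ^ i))"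
    by (subst sum.lessThan_Suc_shift) simp
  also have "\<dots> = abs_tr x + x ^ (CHAR('g) ^ ffexp TYPE('g))" by (simp add: abs_tr_def)
  also have "x ^ (CHAR('g) ^ ffexp TYPE('g)) = x" using CARD_ffexp[where 'g='g]
    by (metis finite_field_power_card_eq_same)
  finally show ?thesis by simp
qed

text \<open>The polynomial \<open>X ^ p - X\<close> has no room for further roots: the images of
  \<open>0, ..., p - 1\<close> already exhaust its degree.\<close>

lemma root_frob_prime_field:
  fixes z :: "'a::idom"
  assumes "prime CHAR('a)" "z ^ CHAR('a) = z"
  shows "\<exists>n<CHAR('a). z = of_nat n"
proof -
  let ?p = "CHAR('a)"
  define f :: "'a poly" where "f = Polynomial.monom 1 ?p - Polynomial.monom 1 1"
  have p1: "?p > 1" using assms prime_gt_1_nat by blast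
  have "coeff f ?p = 1" using p1 by (simp add: f_def)
  then have f0: "f \<noteq> 0" by auto
  have deg: "degree f \<le> ?p" unfolding f_def by (rule degree_diff_le) (use p1 in \<open>auto simp: degree_monom_eq\<close>)
  have roots: "{x. poly f x = 0} = {x. x ^ ?p = x}" by (auto simp: f_def poly_monom)
  have sub: "of_nat ` {..<?p} \<subseteq> {x::'a. poly f x = 0}"
  proof -
    have "(of_nat n :: 'a) ^ ?p = of_nat n" for n
    proof (induction n)
      case 0 then show ?case using p1 by (simp add: power_0_left)
    next
      case (Suc n)
      then show ?case using freshmans_dream[OF assms(1) refl, of 1 "of_nat n"] by simp
    qed
    then show ?thesis unfolding roots by auto
  qed
  have inj: "inj_on (of_nat :: nat \<Rightarrow> 'a) {..<?p}"
    by (rule inj_onI) (auto simp: of_nat_eq_iff_cong_CHAR cong_def)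
  have "card {x. poly f x = 0} \<le> card ((of_nat :: nat \<Rightarrow> 'a) ` {..<?p})"
    using card_poly_roots_bound[OF f0] deg card_image[OF inj] by simp
  then have "of_nat ` {..<?p} = {x::'a. poly f x = 0}"
    using card_seteq[OF poly_roots_finite[OF f0] sub] by simp
  then show ?thesis using assms(2) roots by blast
qed

text \<open>Any natural number that represents the trace may be chosen; \<open>psi_eq\<close> shows
  that the value does not depend on it.\<close>

definition psi :: "'g::finite_field \<Rightarrow> complex" where
  "psi x = cis (2 * pi * real (SOME n. of_nat n = abs_tr x) / real CHAR('g))"

lemma psi_eq:
  assumes "of_nat n = abs_tr (x::'g::finite_field)"
  shows "psi x = cis (2 * pi * real n / real CHAR('g))"
proof -
  define m where "m = (SOME n. of_nat n = abs_tr x)"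
  have "of_nat m = abs_tr x" unfolding m_def by (rule someI[of "\<lambda>n. of_nat n = abs_tr x", OF assms])
  then have "(of_nat m :: 'g) = of_nat n" using assms by simp
  then have "[m = n] (mod CHAR('g))" by (simp add: of_nat_eq_iff_cong_CHAR)
  then have "[int m = int n] (mod int CHAR('g))" by (simp add: cong_int_iff)
  then obtain k where k: "int m = int n + int CHAR('g) * k" by (metis cong_iff_lin cong_sym)
  have kk: "real m = real n + real CHAR('g) * of_int k" using k by (metis of_int_add of_int_mult of_int_of_nat_eq)
  have "2 * pi * real m / real CHAR('g) = 2 * pi * real n / real CHAR('g) + 2 * pi * of_int k"
    using kk by (simp add: field_simps)
  then have "cis (2 * pi * real m / real CHAR('g)) = cis (2 * pi * real n / real CHAR('g)) * cis (2 * pi * of_int k)"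
    by (metis cis_mult)
  then show ?thesis unfolding psi_def m_def[symmetric] by simp
qed

lemma abs_tr_of_nat: obtains n where "n < CHAR('g)" "of_nat n = abs_tr (x::'g::finite_field)"
  using root_frob_prime_field[of "abs_tr x"] abs_tr_frob[of x] by auto

lemma psi_add: "psi (x + y) = psi x * psi (y::'g::finite_field)"
proof -
  obtain a where a: "of_nat a = abs_tr x" using abs_tr_of_nat by blast
  obtain b where b: "of_nat b = abs_tr y" using abs_tr_of_nat by blast
  have "of_nat (a + b) = abs_tr (x + y)" using a b by (simp add: abs_tr_add)
  then show ?thesis using psi_eq[OF a] psi_eq[OF b] psi_eq[of "a + b" "x + y"]
    by (simp add: cis_mult add_divide_distrib distrib_left)
qed

lemma psi_0 [simp]: "psi 0 = 1"
  using psi_eq[of 0 "0::'g::finite_field"] by simp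

lemma cmod_psi [simp]: "cmod (psi x) = 1"
  by (simp add: psi_def)

lemma psi_power_CHAR: "psi (x::'g::finite_field) ^ CHAR('g) = 1"
proof -
  have "psi x ^ n = psi (of_nat n * x)" for n
    by (induction n) (auto simp: psi_add algebra_simps)
  then show ?thesis by simp
qed

lemma psi_eq_1_iff: "psi x = 1 \<longleftrightarrow> abs_tr (x::'g::finite_field) = 0"
proof
  assume "abs_tr x = 0"
  then show "psi x = 1" using psi_eq[of 0 x] by simp
next
  assume *: "psi x = 1"
  obtain n where n: "n < CHAR('g)" "of_nat n = abs_tr x" using abs_tr_of_nat by blast
  have "cis (2 * pi * real n / real CHAR('g)) = 1" using * psi_eq[OF n(2)] by simp
  then have "cos (2 * pi * real n / real CHAR('g)) = 1" by (simp add: complex_eq_iff)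
  then obtain k :: int where "2 * pi * real n / real CHAR('g) = of_int k * 2 * pi"
    using cos_one_2pi_int by blast
  then have "real n = real_of_int k * real CHAR('g)" by (simp add: field_simps)
  then have "int n = k * int CHAR('g)" by (metis of_int_eq_iff of_int_mult of_int_of_nat_eq)
  then have "n = 0" using n(1)
    by (metis dvd_imp_le dvd_triv_right int_dvd_int_iff leD not_gr_zero)
  then show "abs_tr x = 0" using n by simp
qed

text \<open>The trace is a polynomial function of degree at most \<open>?p ^ (?e - 1)\<close>, less
  than the number of elements, and hence cannot vanish everywhere.\<close>

lemma psi_nontrivial: "\<exists>x::'g::finite_field. psi x \<noteq> 1"
proof (rule ccontr)
  assume "\<not> ?thesis"
  then have all: "abs_tr x = 0" for x :: 'g using psi_eq_1_iff by blast
  let ?e = "ffexp TYPE('g)" and ?p = "CHAR('g)"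
  have p1: "?p > 1" using prime_gt_1_nat by simp
  define f :: "'g poly" where "f = (\<Sum>i<?e. Polynomial.monom 1 (?p ^ i))"
  have "coeff f (?p ^ (?e - 1)) = (\<Sum>i<?e. if ?p ^ i = ?p ^ (?e - 1) then 1 else 0)"
    unfolding f_def by (simp add: coeff_sum)
  also have "\<dots> = (\<Sum>i<?e. if i = ?e - 1 then 1 else 0)"
    using p1 by (intro sum.cong refl) auto
  also have "\<dots> = 1" using ffexp_pos[where 'g='g] by simp
  finally have f0: "f \<noteq> 0" by auto
  have "degree f \<le> ?p ^ (?e - 1)" unfolding f_def
    by (rule degree_sum_le) (use p1 in \<open>auto simp: degree_monom_eq\<close>)
  also have "\<dots> < ?p ^ ?e" using p1 ffexp_pos[where 'g='g] by (intro power_strict_increasing) auto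
  also have "\<dots> = CARD('g)" by (simp add: CARD_ffexp)
  finally have "degree f < CARD('g)" .
  moreover have "{x. poly f x = 0} = UNIV" using all
    by (auto simp: f_def poly_sum poly_monom abs_tr_def)
  ultimately show False using card_poly_roots_bound[OF f0] by simp
qed

subsection \<open>Irreducible polynomials and the algebraic closure of a finite field\<close>

abbreviation ac :: "'a::field poly \<Rightarrow> 'a alg_closure poly" where "ac \<equiv> map_poly to_ac"

lemma ac_add: "ac (A + B) = ac A + ac B"
  by (intro poly_eqI) (simp add: coeff_map_poly)

lemma ac_diff: "ac (A - B) = ac A - ac B"
  by (intro poly_eqI) (simp add: coeff_map_poly)

lemma ac_mult: "ac (A * B) = ac A * ac B"
  by (intro poly_eqI) (simp add: coeff_map_poly coeff_mult to_ac_sum)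

lemma ac_smult: "ac (Polynomial.smult c B) = Polynomial.smult (to_ac c) (ac B)"
  by (intro poly_eqI) (simp add: coeff_map_poly)

lemma degree_ac [simp]: "degree (ac A) = degree A"
  by (rule degree_map_poly) simp

lemma ac_eq_0_iff [simp]: "ac A = 0 \<longleftrightarrow> A = 0"
  by (rule map_poly_eq_0_iff) auto

lemma pderiv_ac: "pderiv (ac A) = ac (pderiv A)"
  by (intro poly_eqI) (simp add: coeff_map_poly coeff_pderiv)

lemma monic_irreducible_bezout:
  fixes P A :: "'a::field_gcd poly"
  assumes "Factorial_Ring.irreducible P" "\<not> P dvd A"
  obtains U V where "U * P + V * A = 1"
proof -
  have "coprime P A"
    using assms by (simp add: prime_elem_imp_coprime irreducible_imp_prime_elem)
  then have "gcd P A = 1" by simp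
  then show thesis using bezout_coefficients_fst_snd[of P A] that by metis
qed

lemma finite_degree_less: "finite {A :: 'a::{finite,zero} poly. degree A < n}"
  and card_degree_less: "n > 0 \<Longrightarrow> card {A :: 'a poly. degree A < n} = CARD('a) ^ n"
proof -
  have fin: "finite {A :: 'a poly. degree A < n}" and
    card: "n > 0 \<longrightarrow> card {A :: 'a poly. degree A < n} = CARD('a) ^ n" for n
  proof (induction n)
    case (Suc n)
    have eq: "{A :: 'a poly. degree A < Suc n} = (\<lambda>(c, A). pCons c A) ` (UNIV \<times> (if n = 0 then {0} else {A. degree A < n}))"
    proof -
      have "A \<in> (\<lambda>(c, A). pCons c A) ` (UNIV \<times> (if n = 0 then {0} else {A. degree A < n}))" if "degree A < Suc n" for A :: "'a poly"
        using that by (cases A) (auto simp: image_iff split: if_splits)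
      moreover have "degree (pCons c A) < Suc n" if "A \<in> (if n = 0 then {0} else {A. degree A < n})" for c and A :: "'a poly"
        using that by (auto split: if_splits)
      ultimately show ?thesis by (auto split del: if_split)
    qed
    have inj: "inj_on (\<lambda>(c, A). pCons c A) Y" for Y :: "('a \<times> 'a poly) set" by (auto intro!: inj_onI)
    { case 1 then show ?case unfolding eq using Suc by simp }
    { case 2 then show ?case unfolding eq using Suc by (auto simp: card_image[OF inj] card_cartesian_product) }
  qed auto
  show "finite {A :: 'a poly. degree A < n}" by (rule fin)
  show "n > 0 \<Longrightarrow> card {A :: 'a poly. degree A < n} = CARD('a) ^ n" using card by blast
qed

definition monics :: "nat \<Rightarrow> 'a::field poly set" where
  "monics n = {g. lead_coeff g = 1 \<and> degree g = n}"

lemma monics_eq: "monics n = (\<lambda>A. Polynomial.monom 1 n + A) ` (if n = 0 then {0} else {A::'a::field poly. degree A < n})"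
proof (cases "n = 0")
  case True
  then show ?thesis by (auto simp: monics_def elim!: degree_eq_zeroE simp: monom_0 one_pCons)
next
  case False
  have "g - Polynomial.monom 1 n \<in> {A. degree A < n}" if "g \<in> monics n" for g :: "'a poly"
  proof -
    have "degree (g - Polynomial.monom 1 n) < n"
      using that False by (intro degree_lessI) (auto simp: monics_def coeff_eq_0 le_eq_less_or_eq)
    then show ?thesis by simp
  qed
  then have "g \<in> (\<lambda>A. Polynomial.monom 1 n + A) ` {A. degree A < n}" if "g \<in> monics n" for g :: "'a poly"
    using that by (intro image_eqI[of _ _ "g - Polynomial.monom 1 n"]) auto
  moreover have "Polynomial.monom 1 n + A \<in> monics n" if "degree A < n" for A :: "'a poly"
  proof -
    have "degree (Polynomial.monom 1 n + A) = n"
      using that degree_add_eq_left[of A "Polynomial.monom 1 n"] by (simp add: degree_monom_eq)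
    then show ?thesis using that by (simp add: monics_def coeff_eq_0)
  qed
  ultimately show ?thesis using False by auto
qed

lemma finite_monics [simp]: "finite (monics n :: 'a::{finite,field} poly set)"
  unfolding monics_eq using finite_degree_less by auto

lemma card_monics: "card (monics n :: 'a::{finite,field} poly set) = CARD('a) ^ n"
  unfolding monics_eq using card_degree_less[where 'a='a, of n] by (subst card_image) auto

lemma monics_mult: "g \<in> monics m \<Longrightarrow> h \<in> monics n \<Longrightarrow> g * h \<in> monics (m + n)"
  unfolding monics_def by (auto simp: lead_coeff_mult degree_mult_eq)
     (metis coeff_mult_degree_sum mult_1 degree_mult_eq leading_coeff_0_iff zero_neq_one)+

section \<open>Powers of Frobenius on the algebraic closure and their fixed fields\<close>

lemma frob_add:
  fixes x y :: "'g::finite_field alg_closure"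
  shows "(x + y) ^ (CARD('g) ^ j) = x ^ (CARD('g) ^ j) + y ^ (CARD('g) ^ j)"
  by (rule freshmans_dream'[where n="ffexp TYPE('g) * j"]) (simp_all add: CARD_ffexp power_mult)

lemma frob_diff:
  fixes x y :: "'g::finite_field alg_closure"
  shows "(x - y) ^ (CARD('g) ^ j) = x ^ (CARD('g) ^ j) - y ^ (CARD('g) ^ j)"
  using frob_add[of "x - y" y j] by simp

lemma frob_inj:
  fixes x y :: "'g::finite_field alg_closure"
  shows "x ^ (CARD('g) ^ j) = y ^ (CARD('g) ^ j) \<longleftrightarrow> x = y"
  using frob_diff[of x y j] by auto

lemma frob_frob: "((x :: 'g::finite_field alg_closure) ^ (CARD('g) ^ i)) ^ (CARD('g) ^ j) = x ^ (CARD('g) ^ (i + j))"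
  by (simp add: power_mult[symmetric] power_add)

lemma frob_to_ac [simp]: "to_ac (c::'g::finite_field) ^ (CARD('g) ^ j) = to_ac c"
  by (metis finite_field_power_card_power_eq_same to_ac_power)

lemma poly_ac_frob:
  fixes A :: "'g::finite_field poly"
  shows "poly (ac A) z ^ (CARD('g) ^ j) = poly (ac A) (z ^ (CARD('g) ^ j))"
proof (induction A)
  case 0
  then show ?case using CARD_gt_1[where 'g='g] by (simp add: power_0_left)
next
  case (pCons a A)
  then show ?case by (simp add: map_poly_pCons frob_add power_mult_distrib)
qed

lemma frob_fixed_mult: "(z :: 'g::finite_field alg_closure) ^ (CARD('g) ^ m) = z \<Longrightarrow> z ^ (CARD('g) ^ (m * k)) = z"
proof (induction k)
  case (Suc k)
  then show ?case using frob_frob[of z "m * k" m] by (simp add: add.commute)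
qed auto

lemma frob_fixed_poly:
  fixes n :: nat assumes "n > 0"
  defines "f \<equiv> Polynomial.monom 1 (CARD('g) ^ n) - Polynomial.monom (1 :: 'g::finite_field alg_closure) 1"
  shows "f \<noteq> 0" "degree f = CARD('g) ^ n" "poly f z = z ^ (CARD('g) ^ n) - z" "pderiv f = -1"
proof -
  have 1: "CARD('g) ^ n > 1" using CARD_gt_1[where 'g='g] assms by (intro one_less_power) auto
  have "degree (Polynomial.monom 1 1 :: 'g alg_closure poly) < degree (Polynomial.monom 1 (CARD('g) ^ n) :: 'g alg_closure poly)"
    using 1 by (simp add: degree_monom_eq)
  then show d: "degree f = CARD('g) ^ n" unfolding f_def diff_conv_add_uminus
    by (subst degree_add_eq_left) (simp_all add: degree_monom_eq)
  then show "f \<noteq> 0" using 1 by auto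
  show "poly f z = z ^ (CARD('g) ^ n) - z" by (simp add: f_def poly_monom)
  have "of_nat CHAR('g) = (0 :: 'g alg_closure)" by (metis CHAR_alg_closure of_nat_CHAR)
  then have "(of_nat (CARD('g) ^ n) :: 'g alg_closure) = 0"
    using assms ffexp_pos[where 'g='g] by (simp add: CARD_ffexp power_0_left)
  then show "pderiv f = -1" by (simp add: f_def pderiv_diff pderiv_monom monom_0 one_pCons del: of_nat_power)
qed

lemma frob_fixed_finite: "n > 0 \<Longrightarrow> finite {z :: 'g::finite_field alg_closure. z ^ (CARD('g) ^ n) = z}"
  using poly_roots_finite[OF frob_fixed_poly(1)[where 'g='g], of n] by (simp add: poly_monom)

lemma frob_fixed_card_le: "n > 0 \<Longrightarrow> card {z :: 'g::finite_field alg_closure. z ^ (CARD('g) ^ n) = z} \<le> CARD('g) ^ n"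
  using card_poly_roots_bound[OF frob_fixed_poly(1)[where 'g='g], of n]
    frob_fixed_poly(2)[where 'g='g, of n] by (simp add: poly_monom)

lemma frob_fixed_card:
  assumes n: "n > 0"
  shows "card {z :: 'g::finite_field alg_closure. z ^ (CARD('g) ^ n) = z} = CARD('g) ^ n"
proof -
  define f where "f = Polynomial.monom 1 (CARD('g) ^ n) - Polynomial.monom (1 :: 'g alg_closure) 1"
  note f = frob_fixed_poly[OF n, where 'g='g, folded f_def]
  obtain A where A: "size A = degree f" "f = Polynomial.smult (lead_coeff f) (\<Prod>x\<in>#A. [:-x, 1:])"
    using alg_closed_imp_factorization[OF f(1)] by blast
  have roots: "{z. poly f z = 0} = set_mset A"
  proof -
    have "poly f z = lead_coeff f * (\<Prod>x\<in>#A. z - x)" for z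
      by (subst A(2)) (simp add: poly_prod_mset image_mset.compositionality o_def)
    then show ?thesis using f(1) by auto
  qed
  have "count A x \<le> 1" for x
  proof (rule ccontr)
    assume "\<not> ?thesis"
    then have "{#x, x#} \<subseteq># A" by (auto simp: subseteq_mset_def)
    then obtain C where C: "A = {#x, x#} + C" by (metis subset_mset.add_diff_inverse)
    define h where "h = Polynomial.smult (lead_coeff f) (\<Prod>x\<in>#C. [:-x, 1:])"
    have fh: "f = [:-x,1:] * ([:-x,1:] * h)"
      by (subst A(2)) (simp only: C h_def image_mset_union prod_mset.union image_mset_add_mset image_mset_empty
          prod_mset.add_mset prod_mset.empty mult_smult_right mult_1 mult_1_right mult.assoc)
    have "poly (pderiv f) x = 0" unfolding fh by (simp add: pderiv_mult pderiv_pCons del: mult_pCons_left)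
    then show False using f by simp
  qed
  then have "count A x = count (mset_set (set_mset A)) x" for x
    using count_greater_eq_one_iff[of A x] not_in_iff[of x A] by (cases "x \<in># A") (auto intro: antisym)
  then have "A = mset_set (set_mset A)" by (intro multiset_eqI)
  then have "size A = card (set_mset A)" by (metis size_mset_set)
  then show ?thesis using A(1) f roots by simp
qed

lemma monic_irreducible_ac_root:
  fixes P :: "'a::field poly"
  assumes "P \<in> monic_irreducibles"
  obtains \<theta> where "poly (ac P) \<theta> = 0"
proof -
  have "degree P > 0" using assms
    by (auto simp: monic_irreducibles_def Factorial_Ring.irreducible_def is_unit_iff_degree)
  then show thesis using alg_closed_imp_poly_has_root[of "ac P"] that by auto
qed

lemma minimal_polynomial_exists:
  fixes z :: "'g::field_gcd alg_closure"
  assumes "A0 \<noteq> 0" "poly (ac A0) z = 0"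
  obtains P where "P \<in> monic_irreducibles" "poly (ac P) z = 0"
proof -
  define Q where "Q A \<longleftrightarrow> A \<noteq> 0 \<and> poly (ac A) z = 0" for A
  obtain A where A: "Q A" "\<And>B. Q B \<Longrightarrow> degree A \<le> degree B"
    using ex_has_least_nat[of Q A0 degree] assms by (auto simp: Q_def)
  define P where "P = Polynomial.smult (inverse (lead_coeff A)) A"
  have P: "Q P" "degree P = degree A" "lead_coeff P = 1" using A(1) by (auto simp: Q_def P_def ac_smult)
  have "Factorial_Ring.irreducible P"
  proof (rule Factorial_Ring.irreducibleI)
    show "P \<noteq> 0" using P by (auto simp: Q_def)
    have "degree P \<noteq> 0" 
    proof
      assume "degree P = 0"
      then obtain c where "P = [:c:]" by (elim degree_eq_zeroE)
      then show False using P(1) by (simp add: Q_def map_poly_pCons)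
    qed
    then show "\<not> P dvd 1" using is_unit_iff_degree[OF \<open>P \<noteq> 0\<close>] by simp
    fix B C assume BC: "P = B * C"
    then have nz: "B \<noteq> 0" "C \<noteq> 0" using \<open>P \<noteq> 0\<close> by auto
    have "poly (ac B) z * poly (ac C) z = 0" using P(1) BC by (simp add: Q_def ac_mult)
    then have "degree A \<le> degree B \<or> degree A \<le> degree C" using A(2) nz by (auto simp: Q_def)
    moreover have "degree P = degree B + degree C" using BC nz by (simp add: degree_mult_eq)
    ultimately have "degree B = 0 \<or> degree C = 0" using P(2) by auto
    then show "B dvd 1 \<or> C dvd 1" using nz is_unit_iff_degree by blast
  qed
  then show thesis using that[of P] P unfolding monic_irreducibles_def Q_def by blast
qed

section \<open>Roots and residue field of a monic irreducible polynomial\<close>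

locale irr_root =
  fixes P :: "'g::{finite_field,field_gcd} poly" and \<theta> :: "'g alg_closure"
  assumes P: "P \<in> monic_irreducibles" and root: "poly (ac P) \<theta> = 0"
begin

abbreviation "m \<equiv> degree P"

lemma monic: "lead_coeff P = 1" and irr: "Factorial_Ring.irreducible P" and P0: "P \<noteq> 0"
  using P by (auto simp: monic_irreducibles_def)

lemma m_pos: "m > 0"
  using irr by (auto simp: Factorial_Ring.irreducible_def is_unit_iff_degree)

text \<open>Evaluation at \<open>\<theta>\<close> thereby becomes reduction modulo \<open>P\<close>,
  and the residue field of \<open>P\<close> is found inside the algebraic closure of the
  constants.\<close>

lemma eval_0_iff: "poly (ac A) \<theta> = 0 \<longleftrightarrow> P dvd A"
proof
  assume A: "poly (ac A) \<theta> = 0"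
  show "P dvd A"
  proof (rule ccontr)
    assume "\<not> ?thesis"
    then obtain U V where "U * P + V * A = 1" using monic_irreducible_bezout[OF irr] by blast
    then have "ac (U * P + V * A) = 1" by simp
    then have "poly (ac (U * P + V * A)) \<theta> = 1" by simp
    then show False using A root by (simp add: ac_add ac_mult)
  qed
qed (auto simp: ac_mult root)

lemma eval_inj: "inj_on (\<lambda>A. poly (ac A) \<theta>) {A. degree A < m}"
proof (rule inj_onI)
  fix A B assume AB: "A \<in> {A. degree A < m}" "B \<in> {A. degree A < m}" "poly (ac A) \<theta> = poly (ac B) \<theta>"
  then have "P dvd A - B" by (simp flip: eval_0_iff add: ac_diff)
  moreover have "degree (A - B) < m" using AB by (simp add: degree_diff_less)
  ultimately have "A - B = 0" using dvd_imp_degree_le[of P "A - B"] by (metis leD)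
  then show "A = B" by simp
qed

text \<open>If \<open>\<theta>\<close> is fixed, so are all \<open>CARD('g) ^ m\<close> residues
  modulo \<open>P\<close>, but the \<open>j\<close>-th power of Frobenius fixes at most
  \<open>CARD('g) ^ j\<close> elements.\<close>

lemma frob_fixed_le:
  assumes "j > 0" "\<theta> ^ (CARD('g) ^ j) = \<theta>" shows "m \<le> j"
proof -
  have "(\<lambda>A. poly (ac A) \<theta>) ` {A. degree A < m} \<subseteq> {z. z ^ (CARD('g) ^ j) = z}"
    using assms(2) by (auto simp: poly_ac_frob)
  then have "CARD('g) ^ m \<le> CARD('g) ^ j"
  proof -
    have "CARD('g) ^ m = card ((\<lambda>A. poly (ac A) \<theta>) ` {A. degree A < m})"
      using card_image[OF eval_inj] card_degree_less[OF m_pos, where 'a='g] by simp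
    also have "\<dots> \<le> card {z :: 'g alg_closure. z ^ (CARD('g) ^ j) = z}"
      using \<open>_ \<subseteq> _\<close> by (rule card_mono[OF frob_fixed_finite[OF assms(1)]])
    also have "\<dots> \<le> CARD('g) ^ j" by (rule frob_fixed_card_le[OF assms(1)])
    finally show ?thesis .
  qed
  then show ?thesis by (rule power_le_imp_le_exp[OF CARD_gt_1])
qed

lemma frob_root: "poly (ac P) (\<theta> ^ (CARD('g) ^ j)) = 0"
  using poly_ac_frob[of P \<theta> j] root by (simp add: power_0_left)

lemma frob_distinct: "inj_on (\<lambda>j. \<theta> ^ (CARD('g) ^ j)) {..<m}"
proof (rule inj_onI)
  have aux: "i = j" if "i \<le> j" "j < m" "\<theta> ^ (CARD('g) ^ i) = \<theta> ^ (CARD('g) ^ j)" for i j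
  proof (rule ccontr)
    assume "i \<noteq> j"
    have "(\<theta> ^ (CARD('g) ^ (j - i))) ^ (CARD('g) ^ i) = \<theta> ^ (CARD('g) ^ i)"
      using that by (simp add: frob_frob)
    then have "\<theta> ^ (CARD('g) ^ (j - i)) = \<theta>" by (simp add: frob_inj)
    then have "m \<le> j - i" using frob_fixed_le \<open>i \<noteq> j\<close> that by simp
    then show False using that \<open>i \<noteq> j\<close> by simp
  qed
  fix i j assume "i \<in> {..<m}" "j \<in> {..<m}" "\<theta> ^ (CARD('g) ^ i) = \<theta> ^ (CARD('g) ^ j)"
  then show "i = j" using aux[of i j] aux[of j i] by (cases "i \<le> j") auto
qed

lemma roots_eq: "{z. poly (ac P) z = 0} = (\<lambda>j. \<theta> ^ (CARD('g) ^ j)) ` {..<m}"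
proof (rule card_seteq[symmetric])
  show "finite {z. poly (ac P) z = 0}" using poly_roots_finite[of "ac P"] P0 by simp
  show "(\<lambda>j. \<theta> ^ (CARD('g) ^ j)) ` {..<m} \<subseteq> {z. poly (ac P) z = 0}" using frob_root by auto
  show "card {z. poly (ac P) z = 0} \<le> card ((\<lambda>j. \<theta> ^ (CARD('g) ^ j)) ` {..<m})"
    using card_poly_roots_bound[of "ac P"] P0 by (simp add: card_image[OF frob_distinct])
qed

lemma frob_m: "\<theta> ^ (CARD('g) ^ m) = \<theta>"
proof -
  obtain j where j: "j < m" "\<theta> ^ (CARD('g) ^ m) = \<theta> ^ (CARD('g) ^ j)"
    using frob_root[of m] roots_eq by auto
  have "(\<theta> ^ (CARD('g) ^ (m - j))) ^ (CARD('g) ^ j) = \<theta> ^ (CARD('g) ^ j)"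
    using j by (simp add: frob_frob)
  then have "\<theta> ^ (CARD('g) ^ (m - j)) = \<theta>" by (simp add: frob_inj)
  then have "m \<le> m - j" using frob_fixed_le j by simp
  then have "j = 0" using m_pos by simp
  then show ?thesis using j by simp
qed

lemma ac_P_eq: "ac P = (\<Prod>j<m. [:- (\<theta> ^ (CARD('g) ^ j)), 1:])"
proof -
  let ?R = "(\<lambda>j. \<theta> ^ (CARD('g) ^ j)) ` {..<m}"
  have prod: "(\<Prod>j<m. [:- (\<theta> ^ (CARD('g) ^ j)), 1:]) = (\<Prod>z\<in>?R. [:- z, 1:])"
    using frob_distinct by (simp add: prod.reindex)
  have dvd: "(\<Prod>z\<in>S. [:- z, 1:]) dvd ac P" if "finite S" "S \<subseteq> ?R" for S
    using that
  proof (induction S rule: finite_induct)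
    case (insert x S)
    then obtain C where C: "ac P = (\<Prod>z\<in>S. [:- z, 1:]) * C" by auto
    have "x \<in> ?R" using insert.prems by blast
    then have "poly (ac P) x = 0" using roots_eq by blast
    then have "poly C x = 0" using insert.hyps unfolding C by (auto simp: poly_prod)
    then have "[:-x,1:] dvd C" by (simp add: poly_eq_0_iff_dvd)
    then have "[:-x,1:] * (\<Prod>z\<in>S. [:- z, 1:]) dvd C * (\<Prod>z\<in>S. [:- z, 1:])" by (rule mult_dvd_mono) simp
    then show ?case using insert.hyps unfolding C by (simp add: mult.commute del: mult_pCons_left mult_pCons_right)
  qed simp
  obtain C where C: "ac P = (\<Prod>z\<in>?R. [:- z, 1:]) * C" using dvd[of ?R] by auto
  have lc: "lead_coeff (\<Prod>z\<in>?R. [:- z, 1:]) = 1" by (simp add: lead_coeff_prod)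
  have "degree (\<Prod>z\<in>?R. [:- z, 1:]) = card ?R" by (subst degree_prod_sum_eq) auto
  then have deg: "degree (\<Prod>z\<in>?R. [:- z, 1:]) = m" by (simp add: card_image[OF frob_distinct])
  have "C \<noteq> 0" using C P0 by auto
  then have "degree C = 0" using deg arg_cong[OF C, of degree] lc
    by (subst (asm) degree_mult_eq) auto
  then obtain c where c: "C = [:c:]" by (elim degree_eq_zeroE)
  have "1 = c" using arg_cong[OF C, of lead_coeff] lc monic unfolding lead_coeff_mult by (simp add: c coeff_map_poly)
  then show ?thesis using C c prod by simp
qed

lemma residue_field: "range (\<lambda>A. poly (ac A) \<theta>) = {z. z ^ (CARD('g) ^ m) = z}"
  and residue_field': "(\<lambda>A. poly (ac A) \<theta>) ` {A. degree A < m} = {z. z ^ (CARD('g) ^ m) = z}"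
proof -
  have sub: "range (\<lambda>A. poly (ac A) \<theta>) \<subseteq> {z. z ^ (CARD('g) ^ m) = z}"
    by (auto simp: poly_ac_frob frob_m)
  moreover have "(\<lambda>A. poly (ac A) \<theta>) ` {A. degree A < m} = {z. z ^ (CARD('g) ^ m) = z}"
  proof (rule card_seteq)
    show "card {z :: 'g alg_closure. z ^ (CARD('g) ^ m) = z} \<le> card ((\<lambda>A. poly (ac A) \<theta>) ` {A. degree A < m})"
      using frob_fixed_card_le[OF m_pos, where 'g='g] by (simp add: card_image[OF eval_inj] card_degree_less m_pos)
  qed (use frob_fixed_finite[OF m_pos] sub in auto)
  ultimately show "range (\<lambda>A. poly (ac A) \<theta>) = {z. z ^ (CARD('g) ^ m) = z}"
    "(\<lambda>A. poly (ac A) \<theta>) ` {A. degree A < m} = {z. z ^ (CARD('g) ^ m) = z}" by blast+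
qed

text \<open>Separability of \<open>P\<close>: its linear factors belong to the \<open>m\<close>
  distinct conjugates of \<open>\<theta>\<close>.\<close>

lemma pderiv_root_nz: "poly (ac (pderiv P)) \<theta> \<noteq> 0"
proof
  let ?Q = "\<Prod>j\<in>{..<m}-{0}. [:- (\<theta> ^ (CARD('g) ^ j)), 1:]"
  assume "poly (ac (pderiv P)) \<theta> = 0"
  moreover have "ac P = [:-\<theta>,1:] * ?Q" unfolding ac_P_eq using m_pos by (subst prod.remove[of _ 0]) auto
  ultimately have "poly ?Q \<theta> = 0" by (simp add: pderiv_ac[symmetric] pderiv_mult pderiv_pCons del: mult_pCons_left)
  then obtain j where "j \<in> {..<m} - {0}" "\<theta> ^ (CARD('g) ^ j) = \<theta>" by (force simp: poly_prod)
  then show False using inj_onD[OF frob_distinct, of j 0] m_pos by auto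
qed

end

text \<open>The \<open>n\<close>-th power of Frobenius fixes exactly \<open>CARD('g) ^ n\<close>
  elements. Each is a root of a monic irreducible polynomial of degree \<open>n\<close>, or of one
  whose degree properly divides \<open>n\<close> and so is at most \<open>n div 2\<close>.
  Discarding all the latter at once is accurate enough for a lower bound.\<close>

lemma card_monic_irreducibles_ge:
  assumes n: "n > 0"
  shows "real n * real (card {P :: 'g::{finite_field,field_gcd} poly. P \<in> monic_irreducibles \<and> degree P = n})
    \<ge> real CARD('g) ^ n - (\<Sum>j\<in>{1..n div 2}. real CARD('g) ^ j)"
proof -
  define Z where "Z j = {z :: 'g alg_closure. z ^ (CARD('g) ^ j) = z}" for j
  define I where "I = {P :: 'g poly. P \<in> monic_irreducibles \<and> degree P = n}"
  have finI: "finite I" by (rule finite_subset[OF _ finite_degree_less[of "Suc n"]]) (auto simp: I_def)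
  have "Z n \<subseteq> (\<Union>P\<in>I. {z. poly (ac P) z = 0}) \<union> (\<Union>j\<in>{1..n div 2}. Z j)"
  proof
    fix z assume z: "z \<in> Z n"
    define A0 :: "'g poly" where "A0 = Polynomial.monom 1 (CARD('g) ^ n) - Polynomial.monom 1 1"
    have "ac A0 = Polynomial.monom 1 (CARD('g) ^ n) - Polynomial.monom 1 1"
      by (simp add: A0_def ac_diff map_poly_monom)
    then have "ac A0 \<noteq> 0" "poly (ac A0) z = 0" using frob_fixed_poly[OF n, where 'g='g] z by (auto simp: Z_def)
    then obtain P where P: "P \<in> monic_irreducibles" "poly (ac P) z = 0"
      using minimal_polynomial_exists[of A0 z] by auto
    interpret irr_root P z by unfold_locales (use P in auto)
    have "n mod m = 0"
    proof (rule ccontr)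
      assume "n mod m \<noteq> 0"
      have "z ^ (CARD('g) ^ (m * (n div m))) = z" using frob_m by (rule frob_fixed_mult)
      then have "z ^ (CARD('g) ^ (n mod m)) = (z ^ (CARD('g) ^ (m * (n div m)))) ^ (CARD('g) ^ (n mod m))" by simp
      also have "\<dots> = z ^ (CARD('g) ^ n)" by (simp only: frob_frob mult_div_mod_eq)
      finally have "z ^ (CARD('g) ^ (n mod m)) = z" using z by (simp add: Z_def)
      then have "m \<le> n mod m" using frob_fixed_le \<open>n mod m \<noteq> 0\<close> by simp
      then show False using mod_less_divisor[OF m_pos, of n] by simp
    qed
    then have dvd: "m dvd n" by auto
    show "z \<in> (\<Union>P\<in>I. {z. poly (ac P) z = 0}) \<union> (\<Union>j\<in>{1..n div 2}. Z j)"
    proof (cases "m = n")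
      case True then show ?thesis using P root by (auto simp: I_def)
    next
      case False
      obtain k where k: "n = m * k" using dvd by auto
      then have "k \<ge> 2" using False n by (cases k; cases "k - 1") auto
      then have "m \<le> n div 2" unfolding k by (simp add: less_eq_div_iff_mult_less_eq)
      then show ?thesis using frob_m m_pos by (auto simp: Z_def Suc_le_eq)
    qed
  qed
  then have "card (Z n) \<le> card ((\<Union>P\<in>I. {z. poly (ac P) z = 0}) \<union> (\<Union>j\<in>{1..n div 2}. Z j))"
  proof (intro card_mono finite_UnI)
    show "finite (\<Union>P\<in>I. {z. poly (ac P) z = 0})"
      by (rule finite_UN_I[OF finI]) (auto intro!: poly_roots_finite simp: I_def monic_irreducibles_def)
    show "finite (\<Union>j\<in>{1..n div 2}. Z j)" by (auto intro!: frob_fixed_finite simp: Z_def)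
  qed
  also have "\<dots> \<le> card (\<Union>P\<in>I. {z. poly (ac P) z = 0}) + card (\<Union>j\<in>{1..n div 2}. Z j)"
    by (rule card_Un_le)
  also have "card (\<Union>P\<in>I. {z. poly (ac P) z = 0}) \<le> (\<Sum>P\<in>I. card {z. poly (ac P) z = 0})"
    by (rule card_UN_le[OF finI])
  also have "\<dots> \<le> (\<Sum>P\<in>I. n)"
  proof (rule sum_mono)
    fix P assume "P \<in> I"
    then have "ac P \<noteq> 0" "degree (ac P) = n" by (auto simp: I_def monic_irreducibles_def)
    then show "card {z. poly (ac P) z = 0} \<le> n" using card_poly_roots_bound[of "ac P"] by simp
  qed
  also have "card (\<Union>j\<in>{1..n div 2}. Z j) \<le> (\<Sum>j\<in>{1..n div 2}. card (Z j))"
    by (rule card_UN_le) simp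
  also have "\<dots> \<le> (\<Sum>j\<in>{1..n div 2}. CARD('g) ^ j)"
    by (intro sum_mono) (auto simp: Z_def intro!: frob_fixed_card_le)
  finally have "CARD('g) ^ n \<le> n * card I + (\<Sum>j\<in>{1..n div 2}. CARD('g) ^ j)"
    using frob_fixed_card[OF n, where 'g='g] by (simp add: Z_def mult.commute)
  then have "real (CARD('g) ^ n) \<le> real (n * card I + (\<Sum>j\<in>{1..n div 2}. CARD('g) ^ j))" by (rule of_nat_mono)
  then show ?thesis unfolding I_def[symmetric] by simp
qed

subsection \<open>The trace form and its additivity\<close>

text \<open>\<open>lam F g\<close> is the sum of \<open>F\<close> over the roots of the monic polynomial \<open>g\<close>,
  i.e. the residue at infinity of \<open>F g'/g\<close>.\<close>

definition lam :: "'a::field poly \<Rightarrow> 'a poly \<Rightarrow> 'a" where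
  "lam F g = coeff ((F * pderiv g) mod g) (degree g - 1)"

text \<open>Laurent series in \<open>1/T\<close>: the completion of \<open>F(T)\<close> at infinity.\<close>

definition at_inf :: "'a::field poly \<Rightarrow> 'a fls" where
  "at_inf A = poly (map_poly fls_const A) fls_X_inv"

lemma at_inf_0 [simp]: "at_inf 0 = 0" by (simp add: at_inf_def)

lemma at_inf_pCons: "at_inf (pCons a A) = fls_const a + fls_X_inv * at_inf A"
  by (simp add: at_inf_def map_poly_pCons)

lemma at_inf_add: "at_inf (A + B) = at_inf A + at_inf B"
proof -
  have "map_poly fls_const (A + B) = map_poly fls_const A + map_poly fls_const B"
    by (intro poly_eqI) (simp add: coeff_map_poly fls_plus_const)
  then show ?thesis by (simp add: at_inf_def)
qed

lemma at_inf_smult: "at_inf (Polynomial.smult a B) = fls_const a * at_inf B"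
proof (induction B)
  case (pCons b B)
  then show ?case by (simp add: at_inf_pCons algebra_simps)
qed simp

lemma at_inf_mult: "at_inf (A * B) = at_inf A * at_inf B"
proof (induction A)
  case (pCons a A)
  then show ?case by (simp add: at_inf_pCons at_inf_add at_inf_smult algebra_simps)
qed simp

lemma at_inf_minus: "at_inf (- A) = - at_inf A"
  using at_inf_add[of A "- A"] by (simp add: eq_neg_iff_add_eq_0 add.commute)

lemma at_inf_diff: "at_inf (A - B) = at_inf A - at_inf B"
  using at_inf_add[of A "- B"] by (simp add: at_inf_minus)

lemma at_inf_nth: "fls_nth (at_inf A) k = (if k \<le> 0 then coeff A (nat (- k)) else 0)"
proof (induction A arbitrary: k)
  case (pCons a A)
  show ?case
  proof (cases "k < 0")
    case True
    then have "nat (- k) = Suc (nat (- (k + 1)))" by auto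
    then show ?thesis using True
      by (simp add: at_inf_pCons fls_X_inv_times_conv_shift pCons.IH)
  next
    case False
    then show ?thesis
      by (auto simp: at_inf_pCons fls_X_inv_times_conv_shift pCons.IH)
  qed
qed simp

lemma at_inf_eq_0_iff [simp]: "at_inf A = 0 \<longleftrightarrow> A = 0"
proof
  assume 0: "at_inf A = 0"
  show "A = 0"
  proof (rule poly_eqI)
    fix i show "coeff A i = coeff 0 i" using at_inf_nth[of A "- int i"] 0 by simp
  qed
qed simp

lemma at_inf_subdegree: "A \<noteq> 0 \<Longrightarrow> fls_subdegree (at_inf A) = - int (degree A)"
  by (rule fls_subdegree_eqI) (auto simp: at_inf_nth intro!: coeff_eq_0)

lemma at_inf_monom: "at_inf (Polynomial.monom 1 n) = fls_X_inv ^ n"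
  by (induction n) (auto simp: monom_0 monom_Suc at_inf_pCons)

lemma at_inf_quotient_nth_1:
  assumes "lead_coeff g = 1" "degree g > 0" "degree N < degree g"
  shows "fls_nth (at_inf N / at_inf g) 1 = coeff N (degree g - 1)"
proof (cases "N = 0")
  case False
  let ?R = "at_inf N / at_inf g" and ?n = "int (degree g)"
  have g0: "g \<noteq> 0" using assms by auto
  have sub: "fls_subdegree ?R = ?n - int (degree N)"
    using g0 False by (simp add: fls_divide_subdegree at_inf_subdegree)
  have "at_inf N = ?R * at_inf g" using g0 by simp
  then have "fls_nth (at_inf N) (1 - ?n) = fls_nth (?R * at_inf g) (1 - ?n)" by simp
  also have "\<dots> = (\<Sum>i=fls_subdegree ?R..1 - ?n - fls_subdegree (at_inf g). fls_nth ?R i * fls_nth (at_inf g) (1 - ?n - i))"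
    by (rule fls_times_nth)
  also have "\<dots> = (\<Sum>i\<in>{fls_subdegree ?R..1}. fls_nth ?R i * fls_nth (at_inf g) (1 - ?n - i))"
    using g0 by (simp add: at_inf_subdegree)
  also have "\<dots> = (\<Sum>i\<in>{1}. fls_nth ?R i * fls_nth (at_inf g) (1 - ?n - i))"
    by (rule sum.mono_neutral_cong) (use sub assms(3) in auto)
  also have "\<dots> = fls_nth ?R 1" using assms(1) by (simp add: at_inf_nth)
  finally show ?thesis using assms(2) by (simp add: at_inf_nth nat_diff_distrib)
qed simp

lemma degree_pderiv_le': "degree (pderiv A) \<le> degree A - 1"
  by (rule degree_le) (auto simp: coeff_pderiv coeff_eq_0)

text \<open>The polynomial part of \<open>F g' / g\<close> has no term in \<open>1/T\<close>, so
  only the remainder modulo \<open>g\<close> is seen. In this form additivity in \<open>g\<close> is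
  the rule for the logarithmic derivative of a product.\<close>

lemma lam_at_inf:
  assumes "lead_coeff g = 1"
  shows "lam F g = fls_nth (at_inf F * at_inf (pderiv g) / at_inf g) 1"
proof (cases "degree g = 0")
  case True
  then obtain c where "g = [:c:]" by (elim degree_eq_zeroE)
  then show ?thesis by (simp add: lam_def pderiv_pCons)
next
  case False
  define N where "N = (F * pderiv g) mod g"
  define Q where "Q = (F * pderiv g) div g"
  have g0: "g \<noteq> 0" using assms by auto
  have degN: "degree N < degree g" using degree_mod_less[OF g0, of "F * pderiv g"] False by (auto simp: N_def)
  have "at_inf F * at_inf (pderiv g) = at_inf (Q * g + N)" by (simp add: at_inf_mult[symmetric] N_def Q_def)
  then have "at_inf F * at_inf (pderiv g) / at_inf g = at_inf Q + at_inf N / at_inf g"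
    using g0 by (simp add: at_inf_add at_inf_mult field_simps)
  then show ?thesis using at_inf_quotient_nth_1[OF assms _ degN] False
    by (simp add: at_inf_nth lam_def N_def)
qed

lemma lam_mult:
  assumes "lead_coeff g = 1" "lead_coeff h = 1"
  shows "lam F (g * h) = lam F g + lam F h"
proof -
  have nz: "at_inf g \<noteq> 0" "at_inf h \<noteq> 0" using assms by auto
  have lc: "lead_coeff (g * h) = 1" using assms by (simp add: lead_coeff_mult)
  have "at_inf F * at_inf (pderiv (g * h)) / at_inf (g * h) =
    at_inf F * at_inf (pderiv g) / at_inf g + at_inf F * at_inf (pderiv h) / at_inf h"
    using nz by (simp add: pderiv_mult at_inf_add at_inf_mult field_simps)
  then show ?thesis unfolding lam_at_inf[OF lc] lam_at_inf[OF assms(1)] lam_at_inf[OF assms(2)] by simp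
qed

lemma lam_1 [simp]: "lam F 1 = 0" by (simp add: lam_def)

lemma lam_add: "lam (F + G) g = lam F g + lam G g"
  by (simp add: lam_def algebra_simps poly_mod_add_left)

lemma lam_smult: "lam (Polynomial.smult c F) g = c * lam F g"
  by (simp add: lam_def mod_smult_left)

lemma lam_0 [simp]: "lam 0 g = 0" by (simp add: lam_def)

lemma lam_cong_mod:
  assumes "g dvd F - G" shows "lam F g = lam G g"
proof -
  have "(F * pderiv g) mod g = (G * pderiv g) mod g"
    using assms by (metis dvd_mult2 left_diff_distrib mod_eq_dvd_iff)
  then show ?thesis by (simp add: lam_def)
qed

text \<open>\<open>V / G\<close> is the difference of the two logarithmic derivatives. Were the
  fractional part of \<open>M V / G\<close> nonzero, a suitable power of \<open>T\<close> would
  detect its leading term. So \<open>G\<close> divides \<open>M V\<close>, hence \<open>V\<close> by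
  coprimality, and \<open>V\<close> has smaller degree than \<open>G\<close> unless it is
  zero.\<close>

lemma pderiv_proportional:
  fixes g1 g2 M :: "'a::field_gcd poly"
  assumes g: "lead_coeff g1 = 1" "lead_coeff g2 = 1" and D: "degree g1 + degree g2 \<le> D"
    and cop: "coprime M g1" "coprime M g2"
    and eq: "\<And>h. degree h < D \<Longrightarrow> lam (M * h) g1 = lam (M * h) g2"
  shows "pderiv g1 * g2 = g1 * pderiv g2"
proof -
  define G where "G = g1 * g2"
  define V where "V = pderiv g1 * g2 - g1 * pderiv g2"
  have nz: "g1 \<noteq> 0" "g2 \<noteq> 0" "G \<noteq> 0" using g by (auto simp: G_def)
  have dG: "degree G = degree g1 + degree g2" using nz by (simp add: G_def degree_mult_eq)
  have "G dvd M * V"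
  proof (rule ccontr)
    assume ndvd: "\<not> G dvd M * V"
    define N where "N = (M * V) mod G"
    define Q where "Q = (M * V) div G"
    have N0: "N \<noteq> 0" using ndvd by (auto simp: N_def dvd_eq_mod_eq_0)
    have dN: "degree N < degree G" using degree_mod_less_degree[OF nz(3) ndvd] by (simp add: N_def)
    \<comment> \<open>The exponent for which multiplication by \<open>T ^ j\<close> moves the
      leading term of \<open>N / G\<close> to \<open>1/T\<close>, the coefficient that
      \<open>lam\<close> reads.\<close>
    define j where "j = degree G - degree N - 1"
    define h where "h = (Polynomial.monom 1 j :: 'a poly)"
    define R where "R = at_inf N / at_inf G"
    have R0: "R \<noteq> 0" using N0 nz by (simp add: R_def)
    have subR: "fls_subdegree R = int j + 1" using N0 nz dN
      by (simp add: R_def fls_divide_subdegree at_inf_subdegree j_def)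
    have "lam (M * h) g1 - lam (M * h) g2 =
      fls_nth (at_inf (M * h) * at_inf (pderiv g1) / at_inf g1 - at_inf (M * h) * at_inf (pderiv g2) / at_inf g2) 1"
      by (simp add: lam_at_inf g)
    also have "at_inf (M * h) * at_inf (pderiv g1) / at_inf g1 - at_inf (M * h) * at_inf (pderiv g2) / at_inf g2
      = at_inf h * at_inf (M * V) / at_inf G"
      using nz by (simp add: V_def G_def at_inf_mult at_inf_diff field_simps)
    also have "M * V = Q * G + N" by (simp add: Q_def N_def)
    also have "at_inf h * at_inf (Q * G + N) / at_inf G = at_inf (h * Q) + at_inf h * R"
      using nz by (simp add: at_inf_mult at_inf_add R_def field_simps)
    also have "fls_nth \<dots> 1 = fls_nth (fls_X_inv ^ j * R) 1"
      by (simp add: at_inf_nth h_def at_inf_monom)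
    also have "fls_X_inv ^ j * R = fls_shift (int j) R"
      by (simp add: fls_X_inv_power_conv_shift_1 fls_shifted_times_simps)
    also have "fls_nth \<dots> 1 = fls_nth R (fls_subdegree R)" by (simp add: subR add.commute)
    also have "\<dots> \<noteq> 0" using R0 by simp
    finally have "lam (M * h) g1 \<noteq> lam (M * h) g2" by simp
    moreover have "degree h < D" using dN D dG by (simp add: h_def degree_monom_eq j_def)
    ultimately show False using eq by blast
  qed
  moreover have "coprime G M" using cop by (simp add: G_def coprime_commute)
  ultimately have dvd: "G dvd V" by (simp add: coprime_dvd_mult_right_iff)
  have "V = 0"
  proof (rule ccontr)
    assume V0: "V \<noteq> 0"
    then have le: "degree G \<le> degree V" using dvd dvd_imp_degree_le by blast
    have "degree V < degree G"
    proof (cases "degree G = 0")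
      case True
      then have "degree g1 = 0" "degree g2 = 0" using dG by auto
      then have "V = 0" by (auto simp: V_def elim!: degree_eq_zeroE simp: pderiv_pCons)
      then show ?thesis using V0 by simp
    next
      case False
      have "degree (pderiv g1 * g2) < degree G"
      proof (cases "degree g1 = 0")
        case True then show ?thesis using False by (auto elim!: degree_eq_zeroE simp: pderiv_pCons)
      next
        case g1: False
        then show ?thesis using degree_mult_le[of "pderiv g1" g2] degree_pderiv_le'[of g1] dG by linarith
      qed
      moreover have "degree (g1 * pderiv g2) < degree G"
      proof (cases "degree g2 = 0")
        case True then show ?thesis using False by (auto elim!: degree_eq_zeroE simp: pderiv_pCons)
      next
        case g1: False
        then show ?thesis using degree_mult_le[of g1 "pderiv g2"] degree_pderiv_le'[of g2] dG by linarith
      qed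
      ultimately show ?thesis unfolding V_def by (rule degree_diff_less)
    qed
    then show False using le by simp
  qed
  then show ?thesis by (simp add: V_def)
qed

text \<open>Division by the monic gcd leaves coprime \<open>A\<close>, \<open>B\<close> with
  \<open>A' B = A B'\<close>. Then each of them divides its own derivative, which has smaller degree
  and so must be zero.\<close>

lemma pderiv_proportional_decompose:
  fixes g1 g2 :: "'a::field_gcd poly"
  assumes g: "lead_coeff g1 = 1" "lead_coeff g2 = 1" and eq: "pderiv g1 * g2 = g1 * pderiv g2"
  obtains c A B where "g1 = c * A" "g2 = c * B" "lead_coeff c = 1" "lead_coeff A = 1" "lead_coeff B = 1"
    "pderiv A = 0" "pderiv B = 0"
proof -
  define d where "d = gcd g1 g2"
  have nz: "g1 \<noteq> 0" "g2 \<noteq> 0" using g by auto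
  have d0: "d \<noteq> 0" using nz by (simp add: d_def)
  define c where "c = Polynomial.smult (inverse (lead_coeff d)) d"
  have lc: "lead_coeff c = 1" using d0 by (simp add: c_def)
  have c0: "c \<noteq> 0" using lc by auto
  have cd: "c dvd d" "d dvd c" using d0 by (auto simp: c_def smult_dvd_iff dvd_smult_iff)
  then have "c dvd g1" "c dvd g2" unfolding d_def by (meson dvd_trans gcd_dvd1 gcd_dvd2)+
  then obtain A B where AB: "g1 = c * A" "g2 = c * B" by (elim dvdE)
  have lA: "lead_coeff A = 1" "lead_coeff B = 1" using g lc unfolding AB lead_coeff_mult by auto
  have cop: "coprime A B"
  proof (rule coprimeI)
    fix e assume "e dvd A" "e dvd B"
    then have "c * e dvd d" unfolding d_def AB by (intro gcd_greatest mult_dvd_mono) auto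
    then have "c * e dvd c * 1" using cd by (metis dvd_trans mult_1_right)
    then show "is_unit e" using c0 by (simp only: dvd_mult_cancel_left) auto
  qed
  have AB': "pderiv A * B = A * pderiv B"
  proof -
    have "c * c * (pderiv A * B) = c * c * (A * pderiv B)" using eq unfolding AB
      by (simp add: pderiv_mult algebra_simps)
    then show ?thesis using c0 by simp
  qed
  have zero: "pderiv Y = 0" if "Y dvd pderiv Y" "Y \<noteq> 0" for Y :: "'a poly"
  proof (rule ccontr)
    assume "pderiv Y \<noteq> 0"
    then have "degree Y \<le> degree (pderiv Y)" using that dvd_imp_degree_le by blast
    moreover have "degree Y \<noteq> 0" using \<open>pderiv Y \<noteq> 0\<close> by (metis degree_eq_zeroE pderiv_pCons pderiv_0 pCons_0_0 smult_0_right add_0)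
    ultimately show False using degree_pderiv_le'[of Y] by linarith
  qed
  have "A dvd pderiv A * B" using AB' by simp
  then have A': "A dvd pderiv A" using cop by (simp add: coprime_dvd_mult_left_iff)
  have "B dvd A * pderiv B" using AB' by (metis dvd_triv_right)
  then have B': "B dvd pderiv B" using cop by (metis coprime_commute coprime_dvd_mult_right_iff)
  show thesis
  proof (rule that[OF AB lc lA])
    have "A \<noteq> 0" "B \<noteq> 0" using lA by auto
    then show "pderiv A = 0" "pderiv B = 0" using zero[OF A'] zero[OF B'] by blast+
  qed
qed

definition monics0 :: "nat \<Rightarrow> 'a::field poly set" where
  "monics0 n = {A \<in> monics n. pderiv A = 0}"

text \<open>A vanishing derivative leaves only exponents divisible by \<open>?p\<close>, so
  \<open>\<phi>\<close> forgets nothing. The square root comes from \<open>?p \<ge> 2\<close>, which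
  bounds \<open>n div ?p\<close> by half of \<open>n\<close>.\<close>

lemma card_monics0: "real (card (monics0 n :: 'g::finite_field poly set)) \<le> sqrt (real CARD('g)) ^ n"
proof -
  let ?p = "CHAR('g)"
  have p2: "?p \<ge> 2" using prime_ge_2_nat by simp
  define \<phi> where "\<phi> A = Poly (map (\<lambda>i. coeff A (?p * i)) [0..<Suc (n div ?p)])" for A :: "'g poly"
  have cphi: "coeff (\<phi> A) i = (if i \<le> n div ?p then coeff A (?p * i) else 0)" for A i
    by (auto simp: \<phi>_def nth_default_def simp del: upt_Suc)
  have van: "coeff A i = 0" if "A \<in> monics0 n" "\<not> ?p dvd i" for A :: "'g poly" and i
  proof -
    obtain k where k: "i = Suc k" using \<open>\<not> ?p dvd i\<close> by (cases i) auto
    have "coeff (pderiv A) k = 0" using that by (simp add: monics0_def)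
    then show ?thesis using that k by (simp add: coeff_pderiv of_nat_eq_0_iff_char_dvd del: of_nat_Suc)
  qed
  have "coeff A i = coeff B i" if "A \<in> monics0 n" "B \<in> monics0 n" "\<phi> A = \<phi> B" for A B i
  proof (cases "?p dvd i")
    case True
    then obtain k where k: "i = ?p * k" by auto
    show ?thesis
    proof (cases "k \<le> n div ?p")
      case True then show ?thesis using arg_cong[OF that(3), of "\<lambda>C. coeff C k"] by (simp add: cphi k)
    next
      case False
      then have "i > n" using p2 k by (metis div_le_mono leI nonzero_mult_div_cancel_left not_numeral_le_zero)
      then show ?thesis using that by (simp add: monics0_def monics_def coeff_eq_0)
    qed
  next
    case False then show ?thesis using van that by simp
  qed
  then have inj: "inj_on \<phi> (monics0 n)" by (auto intro!: inj_onI poly_eqI)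
  have img: "\<phi> ` monics0 n \<subseteq> monics (n div ?p)"
  proof clarify
    fix A :: "'g poly" assume A: "A \<in> monics0 n"
    have "coeff A n \<noteq> 0" using A by (auto simp: monics0_def monics_def)
    then have "?p dvd n" using van[OF A, of n] by blast
    then have "?p * (n div ?p) = n" by simp
    moreover have "coeff A n = 1" using A by (auto simp: monics0_def monics_def)
    ultimately have lead: "coeff (\<phi> A) (n div ?p) = 1" by (metis cphi order_refl)
    have "degree (\<phi> A) \<le> n div ?p" by (rule degree_le) (simp add: cphi)
    moreover have "n div ?p \<le> degree (\<phi> A)" by (rule le_degree) (simp add: lead)
    ultimately have "degree (\<phi> A) = n div ?p" by simp
    then show "\<phi> A \<in> monics (n div ?p)" using lead by (simp only: monics_def mem_Collect_eq)
  qed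
  have "card (monics0 n :: 'g poly set) \<le> CARD('g) ^ (n div ?p)"
    using card_mono[OF finite_monics img] card_image[OF inj] by (simp add: card_monics)
  then have "real (card (monics0 n :: 'g poly set)) \<le> real CARD('g) ^ (n div ?p)"
    by (metis of_nat_le_iff of_nat_power)
  also have "\<dots> = sqrt (real CARD('g)) ^ (2 * (n div ?p))" by (simp add: power_mult)
  also have "\<dots> \<le> sqrt (real CARD('g)) ^ n"
  proof (rule power_increasing)
    have "2 * (n div ?p) \<le> ?p * (n div ?p)" using p2 by (rule mult_le_mono1)
    also have "\<dots> \<le> n" by (rule times_div_less_eq_dividend)
    finally show "2 * (n div ?p) \<le> n" .
    show "1 \<le> sqrt (real CARD('g))" using CARD_gt_1[where 'g='g] by simp
  qed
  finally show ?thesis .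
qed

subsection \<open>Character sums and the second moment\<close>

definition chi :: "'g::finite_field \<Rightarrow> 'g poly \<Rightarrow> 'g poly \<Rightarrow> complex" where
  "chi c F g = psi (c * lam F g)"

text \<open>The \<open>n\<close>-th coefficient of the L-series of the character
  \<open>chi c F\<close>.\<close>

definition asum :: "'g::finite_field \<Rightarrow> 'g poly \<Rightarrow> nat \<Rightarrow> complex" where
  "asum c F n = (\<Sum>g\<in>monics n. chi c F g)"

lemma monicsD: "g \<in> monics n \<Longrightarrow> lead_coeff g = 1" "g \<in> monics n \<Longrightarrow> degree g = n"
  by (auto simp: monics_def)

lemma chi_mult: "lead_coeff g = 1 \<Longrightarrow> lead_coeff h = 1 \<Longrightarrow> chi c F (g * h) = chi c F g * chi c F h"
  by (simp add: chi_def lam_mult distrib_left psi_add)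

lemma chi_1 [simp]: "chi c F 1 = 1" by (simp add: chi_def)

lemma cmod_chi [simp]: "cmod (chi c F g) = 1" by (simp add: chi_def)

lemma sum_additive_character_eq_0:
  fixes \<psi> :: "'g::finite_field poly \<Rightarrow> complex"
  assumes add: "\<And>x y. \<psi> (x + y) = \<psi> x * \<psi> y" and h0: "degree h0 < D" "\<psi> h0 \<noteq> 1"
  shows "(\<Sum>h | degree h < D. \<psi> h) = 0"
proof -
  have "(\<Sum>h | degree h < D. \<psi> h) = (\<Sum>h | degree h < D. \<psi> (h + h0))"
    by (rule sum.reindex_bij_witness[of _ "\<lambda>h. h + h0" "\<lambda>h. h - h0"])
       (auto intro: degree_add_less degree_diff_less h0)
  also have "\<dots> = \<psi> h0 * (\<Sum>h | degree h < D. \<psi> h)"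
    by (simp add: add sum_distrib_left mult.commute)
  finally show ?thesis using h0(2) by (auto simp: algebra_simps)
qed

lemma psi_scaled_nontrivial:
  assumes "(\<delta> :: 'g::finite_field) \<noteq> 0" obtains a where "psi (a * \<delta>) \<noteq> 1"
proof -
  obtain x :: 'g where "psi x \<noteq> 1" using psi_nontrivial by blast
  then show thesis using that[of "x / \<delta>"] assms by simp
qed

text \<open>When the square is opened, a pair \<open>(g1, g2)\<close> depends on \<open>h\<close>
  through an additive character. By \<open>pderiv_proportional\<close> it is trivial only for
  proportional pairs, provided \<open>degree g1 + degree g2 \<le> D\<close>; this limits the degrees
  to half of \<open>D\<close>. Pairs that remain are estimated trivially.\<close>

lemma second_moment:
  fixes F0 M :: "'g::{finite_field,field_gcd} poly"
  assumes D: "D > 0" and c: "c \<noteq> 0" and fin: "finite G"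
    and G: "\<And>g. g \<in> G \<Longrightarrow> lead_coeff g = 1" "\<And>g. g \<in> G \<Longrightarrow> coprime M g" "\<And>g. g \<in> G \<Longrightarrow> 2 * degree g \<le> D"
  shows "(\<Sum>h | degree h < D. (cmod (\<Sum>g\<in>G. w g * chi c (F0 + M * h) g))\<^sup>2) \<le>
    real CARD('g) ^ D * (\<Sum>(g1, g2) | g1 \<in> G \<and> g2 \<in> G \<and> pderiv g1 * g2 = g1 * pderiv g2. cmod (w g1) * cmod (w g2))"
proof -
  define H where "H = {h :: 'g poly. degree h < D}"
  have finH: "finite H" and cardH: "card H = CARD('g) ^ D"
    using finite_degree_less card_degree_less[OF D] by (auto simp: H_def)
  define K where "K g1 g2 = (\<Sum>h\<in>H. chi c (F0 + M * h) g1 * cnj (chi c (F0 + M * h) g2))" for g1 g2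
  have K0: "K g1 g2 = 0" if g12: "g1 \<in> G" "g2 \<in> G" "pderiv g1 * g2 \<noteq> g1 * pderiv g2" for g1 g2
  proof -
    have "\<not> (\<forall>h. degree h < D \<longrightarrow> lam (M * h) g1 = lam (M * h) g2)"
    proof
      assume *: "\<forall>h. degree h < D \<longrightarrow> lam (M * h) g1 = lam (M * h) g2"
      have "pderiv g1 * g2 = g1 * pderiv g2"
      proof (rule pderiv_proportional[where M=M and D=D])
        show "degree g1 + degree g2 \<le> D" using G(3)[OF g12(1)] G(3)[OF g12(2)] by simp
      qed (use G g12 * in auto)
      then show False using g12 by simp
    qed
    then obtain h where h: "degree h < D" "lam (M * h) g1 - lam (M * h) g2 \<noteq> 0" by auto
    then have "c * (lam (M * h) g1 - lam (M * h) g2) \<noteq> 0" using c by simp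
    then obtain a where a: "psi (a * (c * (lam (M * h) g1 - lam (M * h) g2))) \<noteq> 1"
      using psi_scaled_nontrivial by blast
    define \<psi> where "\<psi> h = psi (c * (lam (M * h) g1 - lam (M * h) g2))" for h
    have "(\<Sum>h | degree h < D. \<psi> h) = 0"
    proof (rule sum_additive_character_eq_0)
      show "\<psi> (x + y) = \<psi> x * \<psi> y" for x y
        by (simp add: \<psi>_def psi_add[symmetric] distrib_left lam_add algebra_simps)
      show "degree (Polynomial.smult a h) < D" using h D by (cases "a = 0") auto
      show "\<psi> (Polynomial.smult a h) \<noteq> 1" using a by (simp add: \<psi>_def lam_smult algebra_simps)
    qed
    moreover have "chi c (F0 + M * h) g1 * cnj (chi c (F0 + M * h) g2) =
      chi c F0 g1 * cnj (chi c F0 g2) * \<psi> h" for h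
    proof -
      have inv: "cnj (psi z) = psi (- z)" for z :: 'g
      proof -
        have "psi z * psi (- z) = 1" by (simp add: psi_add[symmetric])
        moreover have "psi z * cnj (psi z) = 1" by (simp add: complex_norm_square[symmetric])
        ultimately show ?thesis by (metis mult.left_commute mult.right_neutral)
      qed
      show ?thesis by (simp add: chi_def inv \<psi>_def psi_add[symmetric] lam_add algebra_simps)
    qed
    ultimately show ?thesis by (simp add: K_def H_def sum_distrib_left[symmetric])
  qed
  have K1: "cmod (K g1 g2) \<le> real CARD('g) ^ D" for g1 g2
  proof -
    have "cmod (K g1 g2) \<le> (\<Sum>h\<in>H. cmod (chi c (F0 + M * h) g1 * cnj (chi c (F0 + M * h) g2)))"
      unfolding K_def by (rule norm_sum)
    also have "\<dots> = real CARD('g) ^ D" by (simp add: norm_mult cardH)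
    finally show ?thesis .
  qed
  define Pr where "Pr = {(g1, g2). g1 \<in> G \<and> g2 \<in> G \<and> pderiv g1 * g2 = g1 * pderiv g2}"
  have PrG: "Pr \<subseteq> G \<times> G" by (auto simp: Pr_def)
  have "complex_of_real (\<Sum>h\<in>H. (cmod (\<Sum>g\<in>G. w g * chi c (F0 + M * h) g))\<^sup>2) =
    (\<Sum>h\<in>H. (\<Sum>g\<in>G. w g * chi c (F0 + M * h) g) * cnj (\<Sum>g\<in>G. w g * chi c (F0 + M * h) g))"
    by (simp only: of_real_sum complex_norm_square)
  also have "\<dots> = (\<Sum>h\<in>H. \<Sum>(g1,g2)\<in>G \<times> G. w g1 * cnj (w g2) * (chi c (F0 + M * h) g1 * cnj (chi c (F0 + M * h) g2)))"
    by (simp add: sum_product sum.cartesian_product algebra_simps)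
  also have "\<dots> = (\<Sum>(g1,g2)\<in>G \<times> G. w g1 * cnj (w g2) * K g1 g2)"
    by (subst sum.swap) (simp add: K_def sum_distrib_left case_prod_unfold)
  also have "\<dots> = (\<Sum>(g1,g2)\<in>Pr. w g1 * cnj (w g2) * K g1 g2)"
  proof (rule sum.mono_neutral_right)
    show "\<forall>x\<in>G \<times> G - Pr. (case x of (g1, g2) \<Rightarrow> w g1 * cnj (w g2) * K g1 g2) = 0"
    proof clarify
      fix g1 g2 assume "g1 \<in> G" "g2 \<in> G" "(g1, g2) \<notin> Pr"
      then have "K g1 g2 = 0" by (intro K0) (auto simp: Pr_def)
      then show "w g1 * cnj (w g2) * K g1 g2 = 0" by simp
    qed
  qed (use fin PrG in auto)
  finally have eq: "complex_of_real (\<Sum>h\<in>H. (cmod (\<Sum>g\<in>G. w g * chi c (F0 + M * h) g))\<^sup>2) = (\<Sum>(g1,g2)\<in>Pr. w g1 * cnj (w g2) * K g1 g2)" .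
  have "(\<Sum>h\<in>H. (cmod (\<Sum>g\<in>G. w g * chi c (F0 + M * h) g))\<^sup>2) = cmod (complex_of_real (\<Sum>h\<in>H. (cmod (\<Sum>g\<in>G. w g * chi c (F0 + M * h) g))\<^sup>2))"
    by (subst norm_of_real) (simp add: sum_nonneg)
  also have "\<dots> \<le> (\<Sum>(g1,g2)\<in>Pr. cmod (w g1 * cnj (w g2) * K g1 g2))"
    unfolding eq using norm_sum[of "\<lambda>(g1,g2). w g1 * cnj (w g2) * K g1 g2" Pr] by (simp add: case_prod_unfold)
  also have "\<dots> \<le> (\<Sum>(g1,g2)\<in>Pr. cmod (w g1) * cmod (w g2) * real CARD('g) ^ D)"
    using K1 by (intro sum_mono) (auto simp: norm_mult intro!: mult_left_mono)
  also have "\<dots> = real CARD('g) ^ D * (\<Sum>(g1,g2)\<in>Pr. cmod (w g1) * cmod (w g2))"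
    by (simp add: sum_distrib_left case_prod_unfold mult.commute)
  finally show ?thesis by (simp add: H_def Pr_def)
qed

text \<open>Proportional pairs are parametrized by triples \<open>(c, A, B)\<close> with \<open>A' = B' = 0\<close>.\<close>

lemma proportional_pairs_sum_le:
  fixes T :: "('g::{finite_field,field_gcd} poly \<times> 'g poly \<times> 'g poly) set"
  assumes fin: "finite T" and r: "r \<ge> (0::real)"
    and sub: "\<And>g1 g2 c A B. (g1, g2) \<in> Pr \<Longrightarrow> g1 = c * A \<Longrightarrow> g2 = c * B \<Longrightarrow> lead_coeff c = 1 \<Longrightarrow> lead_coeff A = 1 \<Longrightarrow>
      lead_coeff B = 1 \<Longrightarrow> pderiv A = 0 \<Longrightarrow> pderiv B = 0 \<Longrightarrow> (c, A, B) \<in> T"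
    and Pr: "\<And>g1 g2. (g1, g2) \<in> Pr \<Longrightarrow> lead_coeff g1 = 1 \<and> lead_coeff g2 = 1 \<and> pderiv g1 * g2 = g1 * pderiv g2"
    and T: "\<And>c A B. (c, A, B) \<in> T \<Longrightarrow> c \<noteq> 0 \<and> A \<noteq> 0 \<and> B \<noteq> 0"
  shows "(\<Sum>(g1, g2)\<in>Pr. r ^ degree g1 * r ^ degree g2) \<le> (\<Sum>(c, A, B)\<in>T. r ^ (2 * degree c) * (r ^ degree A * r ^ degree B))"
proof -
  define f where "f = (\<lambda>(c, A, B). (c * A, c * B :: 'g poly))"
  have img: "Pr \<subseteq> f ` T"
  proof
    fix x assume x: "x \<in> Pr"
    obtain g1 g2 where g12: "x = (g1, g2)" by (cases x)
    have g: "lead_coeff g1 = 1" "lead_coeff g2 = 1" "pderiv g1 * g2 = g1 * pderiv g2" using Pr x g12 by auto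
    from pderiv_proportional_decompose[OF g] obtain c A B where *: "g1 = c * A" "g2 = c * B" "lead_coeff c = 1" "lead_coeff A = 1" "lead_coeff B = 1"
      "pderiv A = 0" "pderiv B = 0" by blast
    have "(c, A, B) \<in> T" using sub[of g1 g2 c A B] x g12 * by blast
    then show "x \<in> f ` T" unfolding f_def g12 using * by (intro image_eqI[of _ _ "(c, A, B)"]) auto
  qed
  have "(\<Sum>(g1, g2)\<in>Pr. r ^ degree g1 * r ^ degree g2) \<le> (\<Sum>(g1, g2)\<in>f ` T. r ^ degree g1 * r ^ degree g2)"
    using r fin img by (intro sum_mono2) auto
  also have "\<dots> \<le> sum ((\<lambda>(g1, g2). r ^ degree g1 * r ^ degree g2) \<circ> f) T"
    by (rule sum_image_le) (use fin r in \<open>auto simp: f_def\<close>)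
  also have "\<dots> = (\<Sum>(c, A, B)\<in>T. r ^ (2 * degree c) * (r ^ degree A * r ^ degree B))"
    by (rule sum.cong) (use T in \<open>auto simp: f_def degree_mult_eq power_add mult_2\<close>)
  finally show ?thesis .
qed

text \<open>Each of the \<open>l + 1\<close> possible common degrees \<open>j\<close> of
  \<open>A\<close> and \<open>B\<close> accounts for at most
  \<open>?q ^ (l - j) * (sqrt ?q ^ j * sqrt ?q ^ j) = ?q ^ l\<close> pairs.\<close>

lemma asum_second_moment_short:
  fixes F0 :: "'g::{finite_field,field_gcd} poly"
  assumes D: "D > 0" "2 * l \<le> D" and c: "c \<noteq> 0"
  shows "(\<Sum>h | degree h < D. (cmod (asum c (F0 + h) l))\<^sup>2) \<le> real CARD('g) ^ D * ((real l + 1) * real CARD('g) ^ l)"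
proof -
  let ?q = "real CARD('g)"
  define Pr where "Pr = {(g1, g2). g1 \<in> monics l \<and> g2 \<in> monics l \<and> pderiv g1 * g2 = g1 * pderiv (g2 :: 'g poly)}"
  define T where "T = (\<Union>j\<le>l. (monics (l - j) :: 'g poly set) \<times> (monics0 j :: 'g poly set) \<times> (monics0 j :: 'g poly set))"
  have fin0: "finite (monics0 j :: 'g poly set)" for j by (rule finite_subset[OF _ finite_monics[of j]]) (auto simp: monics0_def)
  have "(\<Sum>h | degree h < D. (cmod (\<Sum>g\<in>monics l. 1 * chi c (F0 + 1 * h) g))\<^sup>2) \<le> ?q ^ D *
    (\<Sum>(g1, g2) | g1 \<in> monics l \<and> g2 \<in> monics l \<and> pderiv g1 * g2 = g1 * pderiv (g2 :: 'g poly). cmod 1 * cmod 1)"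
    by (rule second_moment[where w="\<lambda>_. 1"]) (use D c in \<open>auto dest: monicsD\<close>)
  then have 1: "(\<Sum>h | degree h < D. (cmod (asum c (F0 + h) l))\<^sup>2) \<le> ?q ^ D * (\<Sum>(g1, g2)\<in>Pr. 1)"
    by (simp add: asum_def Pr_def)
  have "(\<Sum>(g1, g2)\<in>Pr. 1 ^ degree g1 * 1 ^ degree g2) \<le> (\<Sum>(c, A, B)\<in>T. 1 ^ (2 * degree c) * (1 ^ degree A * (1::real) ^ degree B))"
  proof (rule proportional_pairs_sum_le[where r=1 and T=T and Pr=Pr])
    show "finite T" using fin0 by (auto simp: T_def)
    fix g1 g2 c A B :: "'g poly"
    assume a: "(g1, g2) \<in> Pr" "g1 = c * A" "g2 = c * B" "lead_coeff c = 1" "lead_coeff A = 1"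
      "lead_coeff B = 1" "pderiv A = 0" "pderiv B = 0"
    then have nz: "c \<noteq> 0" "A \<noteq> 0" "B \<noteq> 0" by auto
    have "degree c + degree A = l" "degree c + degree B = l" using a nz by (auto simp: Pr_def monics_def degree_mult_eq)
    then show "(c, A, B) \<in> T" using a by (auto simp: T_def monics_def monics0_def intro!: bexI[of _ "degree A"])
  qed (auto simp: Pr_def T_def monics_def monics0_def)
  also have "\<dots> = real (card T)" by (simp add: case_prod_unfold)
  also have "\<dots> \<le> (\<Sum>j\<le>l. real (card ((monics (l - j) :: 'g poly set) \<times> (monics0 j :: 'g poly set) \<times> (monics0 j :: 'g poly set))))"
    unfolding T_def of_nat_sum[symmetric] of_nat_le_iff by (rule card_UN_le) simp
  also have "\<dots> \<le> (\<Sum>j\<le>l. ?q ^ l)"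
  proof (rule sum_mono)
    fix j assume j: "j \<in> {..l}"
    have "real (card ((monics (l - j) :: 'g poly set) \<times> (monics0 j :: 'g poly set) \<times> (monics0 j :: 'g poly set))) =
      ?q ^ (l - j) * (real (card (monics0 j :: 'g poly set)) * real (card (monics0 j :: 'g poly set)))"
      by (simp add: card_cartesian_product card_monics)
    also have "\<dots> \<le> ?q ^ (l - j) * (sqrt ?q ^ j * sqrt ?q ^ j)"
      by (intro mult_left_mono mult_mono card_monics0) auto
    also have "sqrt ?q ^ j * sqrt ?q ^ j = ?q ^ j" by (simp add: power_mult_distrib[symmetric])
    also have "?q ^ (l - j) * ?q ^ j = ?q ^ l" using j by (simp add: power_add[symmetric])
    finally show "real (card ((monics (l - j) :: 'g poly set) \<times> (monics0 j :: 'g poly set) \<times> (monics0 j :: 'g poly set))) \<le> ?q ^ l" .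
  qed
  also have "\<dots> = (real l + 1) * ?q ^ l" by simp
  finally have "(\<Sum>(g1, g2)\<in>Pr. 1) \<le> (real l + 1) * ?q ^ l" by simp
  then have "?q ^ D * (\<Sum>(g1, g2)\<in>Pr. 1) \<le> ?q ^ D * ((real l + 1) * ?q ^ l)" by (rule mult_left_mono) simp
  then show ?thesis using 1 by linarith
qed

subsection \<open>The functional equation\<close>

definition logd :: "'a::field fps \<Rightarrow> 'a fps" where "logd x = fps_deriv x * inverse x"

lemma logd_mult:
  assumes "fps_nth x 0 \<noteq> 0" "fps_nth y 0 \<noteq> (0::'a::field)"
  shows "logd (x * y) = logd x + logd y"
proof -
  have "x * inverse x = 1" "y * inverse y = 1" using assms by (simp_all add: inverse_mult_eq_1')
  then have *: "x * (inverse x * z) = z" "y * (inverse y * z) = z" for z by (simp_all add: mult.assoc[symmetric])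
  have "logd (x * y) = (fps_deriv x * y + x * fps_deriv y) * (inverse x * inverse y)"
    by (simp add: logd_def fps_inverse_mult)
  also have "\<dots> = y * (inverse y * (fps_deriv x * inverse x)) + x * (inverse x * (fps_deriv y * inverse y))"
    by (simp add: algebra_simps)
  finally show ?thesis by (simp add: * logd_def)
qed

lemma fps_cutoff_decompose: "x = fps_cutoff n x + fps_X ^ n * fps_shift n (x :: 'a::comm_ring_1 fps)"
  by (intro fps_ext) (simp add: fps_X_power_mult_nth)

text \<open>A change of \<open>x\<close> by a multiple of \<open>X ^ Suc d\<close> changes its
  derivative by a multiple of \<open>X ^ d\<close>. This makes \<open>mu F\<close> a function of
  \<open>x\<close> modulo \<open>X ^ (degree F + 1)\<close>.\<close>

lemma logd_cong:
  assumes eq: "\<And>i. i \<le> d \<Longrightarrow> fps_nth x i = fps_nth y i" and y0: "fps_nth y 0 \<noteq> (0::'a::field)" and j: "j < d"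
  shows "fps_nth (logd x) j = fps_nth (logd y) j"
proof -
  have x0: "fps_nth x 0 \<noteq> 0" using eq[of 0] y0 by simp
  define w where "w = fps_shift (Suc d) (x - y)"
  have "fps_cutoff (Suc d) (x - y) = 0" using eq by (intro fps_ext) simp
  then have xy: "x = y + fps_X ^ Suc d * w" using fps_cutoff_decompose[of "x - y" "Suc d"] by (simp add: w_def algebra_simps)
  have dx: "fps_deriv x = fps_deriv y + fps_X ^ d * (of_nat (Suc d) * w + fps_X * fps_deriv w)"
  proof -
    have dX: "fps_deriv (fps_X ^ Suc d :: 'a fps) = of_nat (Suc d) * fps_X ^ d"
      by (intro fps_ext) (auto simp: fps_X_power_nth fps_of_nat[symmetric] simp del: of_nat_Suc power_Suc)
    show ?thesis unfolding xy fps_deriv_add fps_deriv_mult dX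
      by (simp add: algebra_simps del: of_nat_Suc)
  qed
  have "logd x - logd y = (fps_deriv x * y - x * fps_deriv y) * (inverse x * inverse y)"
  proof -
    have i: "x * inverse x = 1" "y * inverse y = 1" using x0 y0 by (simp_all add: inverse_mult_eq_1')
    then have *: "x * (inverse x * z) = z" "y * (inverse y * z) = z" for z by (simp_all add: mult.assoc[symmetric])
    have "(fps_deriv x * y - x * fps_deriv y) * (inverse x * inverse y) =
      y * (inverse y * (fps_deriv x * inverse x)) - x * (inverse x * (fps_deriv y * inverse y))"
      by (simp add: algebra_simps)
    then show ?thesis by (simp add: * logd_def)
  qed
  also have "fps_deriv x * y - x * fps_deriv y = fps_X ^ d * ((of_nat (Suc d) * w + fps_X * fps_deriv w) * y - fps_X * w * fps_deriv y)"
  proof -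
    have "x * fps_deriv y = (y + fps_X ^ Suc d * w) * fps_deriv y" using xy by simp
    then show ?thesis unfolding dx by (simp add: algebra_simps del: of_nat_Suc)
  qed
  finally have "logd x - logd y = fps_X ^ d * (((of_nat (Suc d) * w + fps_X * fps_deriv w) * y - fps_X * w * fps_deriv y) * (inverse x * inverse y))"
    by (simp only: mult.assoc)
  then have "fps_nth (logd x - logd y) j = 0" using j by (simp add: fps_X_power_mult_nth)
  then show ?thesis by simp
qed

text \<open>The power sums of the roots of \<open>g\<close> are read off the logarithmic derivative of its reversal \<open>x\<close>,
  so that \<open>mu F x\<close> is \<open>lam F g\<close> up to the contribution of the constant term of \<open>F\<close>.\<close>

definition mu :: "'g::field poly \<Rightarrow> 'g poly \<Rightarrow> 'g" where
  "mu F x = - (\<Sum>i\<in>{1..degree F}. coeff F i * fps_nth (logd (fps_of_poly x)) (i - 1))"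

lemma mu_mult: "coeff x 0 \<noteq> 0 \<Longrightarrow> coeff y 0 \<noteq> 0 \<Longrightarrow> mu F (x * y) = mu F x + mu F y"
  by (simp add: mu_def fps_of_poly_mult logd_mult distrib_left sum.distrib)

lemma mu_cong:
  assumes "\<And>i. i \<le> degree F \<Longrightarrow> coeff x i = coeff y i" "coeff y 0 \<noteq> 0"
  shows "mu F x = mu F y"
proof -
  have "fps_nth (logd (fps_of_poly x)) (i - 1) = fps_nth (logd (fps_of_poly y)) (i - 1)" if "i \<in> {1..degree F}" for i
    by (rule logd_cong[where d="degree F"]) (use assms that in auto)
  then show ?thesis by (simp add: mu_def)
qed

lemma mu_smult: "a \<noteq> 0 \<Longrightarrow> mu F (Polynomial.smult a x) = mu F x"
proof -
  assume a: "a \<noteq> 0"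
  have "logd (fps_of_poly (Polynomial.smult a x)) = logd (fps_of_poly x)"
  proof -
    have e: "fps_of_poly (Polynomial.smult a x) = fps_const a * fps_of_poly x" by (simp add: fps_of_poly_smult)
    have *: "fps_const a * inverse (fps_const a) = 1" using a by (simp add: inverse_mult_eq_1')
    have "logd (fps_of_poly (Polynomial.smult a x)) =
        (fps_const a * inverse (fps_const a)) * (fps_deriv (fps_of_poly x) * inverse (fps_of_poly x))"
      unfolding logd_def e fps_inverse_mult fps_deriv_mult_const_left by (simp only: mult_ac)
    then show ?thesis unfolding * logd_def by simp
  qed
  then show ?thesis by (simp add: mu_def)
qed

text \<open>The Dirichlet character modulo \<open>X^(degree F + 1)\<close> attached to \<open>F\<close>.\<close>

definition dch :: "'g::finite_field \<Rightarrow> 'g poly \<Rightarrow> 'g poly \<Rightarrow> complex" where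
  "dch c F x = (if coeff x 0 = 0 then 0 else psi (c * mu F x))"

lemma dch_mult: "dch c F (x * y) = dch c F x * dch c F y"
  by (auto simp: dch_def mu_mult coeff_mult_0 distrib_left psi_add)

lemma dch_cutoff: "N \<ge> degree F \<Longrightarrow> dch c F (poly_cutoff (Suc N) x) = dch c F x"
proof -
  assume N: "N \<ge> degree F"
  have "mu F (poly_cutoff (Suc N) x) = mu F x" if "coeff x 0 \<noteq> 0"
    by (rule mu_cong) (use N that in \<open>auto simp: coeff_poly_cutoff\<close>)
  then show ?thesis by (auto simp: dch_def coeff_poly_cutoff)
qed

lemma coeff_mult_mono_cutoff:
  assumes "\<And>i. i \<le> N \<Longrightarrow> coeff x i = coeff y i" "k \<le> N"
  shows "coeff (x * z) k = coeff (y * (z::'a::comm_ring_1 poly)) k"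
  unfolding coeff_mult using assms by (intro sum.cong) auto

text \<open>Truncations represent the residues modulo \<open>X ^ Suc N\<close>, and multiplication
  by a unit of that ring permutes them; injectivity is checked with the inverse power series of
  \<open>u\<close>.\<close>

lemma cutoff_mult_bij:
  fixes u :: "'g::finite_field poly"
  assumes u: "coeff u 0 \<noteq> 0"
  shows "bij_betw (\<lambda>x. poly_cutoff (Suc N) (x * u)) {x. degree x < Suc N} {x. degree x < Suc N}"
proof -
  let ?f = "\<lambda>x. poly_cutoff (Suc N) (x * u)"
  have img: "?f ` {x. degree x < Suc N} \<subseteq> {x. degree x < Suc N}"
    by (auto intro!: degree_le simp: coeff_poly_cutoff less_Suc_eq_le)
  have inj: "inj_on ?f {x. degree x < Suc N}"
  proof (rule inj_onI)
    fix x y assume xy: "x \<in> {x. degree x < Suc N}" "y \<in> {x. degree x < Suc N}" "?f x = ?f y"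
    define z where "z = x - y"
    have "coeff (z * u) i = 0" if "i \<le> N" for i
      using arg_cong[OF xy(3), of "\<lambda>p. coeff p i"] that by (simp add: coeff_poly_cutoff z_def algebra_simps)
    then have *: "fps_nth (fps_of_poly z * fps_of_poly u) i = 0" if "i \<le> N" for i
      using that by (simp add: fps_of_poly_mult[symmetric])
    have "fps_of_poly z = (fps_of_poly z * fps_of_poly u) * inverse (fps_of_poly u)"
      using u by (simp add: mult.assoc inverse_mult_eq_1')
    then have "coeff z i = fps_nth ((fps_of_poly z * fps_of_poly u) * inverse (fps_of_poly u)) i" for i
      by (metis fps_of_poly_nth)
    then have "coeff z i = 0" if "i \<le> N" for i
      using * that unfolding fps_mult_nth[of "fps_of_poly z * fps_of_poly u"] by simp
    moreover have "coeff z i = 0" if "i > N" for i using xy that by (simp add: z_def coeff_eq_0)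
    ultimately have "z = 0" by (intro poly_eqI) (metis coeff_0 not_le)
    then show "x = y" by (simp add: z_def)
  qed
  have "?f ` {x. degree x < Suc N} = {x. degree x < Suc N}"
    using img card_image[OF inj] by (intro card_subset_eq finite_degree_less) auto
  then show ?thesis using inj by (simp add: bij_betw_def)
qed

locale fe =
  fixes F :: "'g::{finite_field,field_gcd} poly" and c :: 'g
  assumes c: "c \<noteq> 0" and d: "\<not> CHAR('g) dvd degree F"
begin

abbreviation "d \<equiv> degree F"

lemma d_pos: "d > 0" using d by (metis dvd_0_right gr0I)

text \<open>Primitivity of the character: the witness \<open>1 + a X ^ d\<close> has the value
  \<open>psi (- c * a * d * lead_coeff F)\<close>, which is not \<open>1\<close> for some
  \<open>a\<close> because the characteristic does not divide \<open>d\<close>.\<close>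

lemma unit_exists:
  obtains u where "coeff u 0 = 1" "\<And>i. 0 < i \<Longrightarrow> i < d \<Longrightarrow> coeff u i = 0" "degree u \<le> d" "dch c F u \<noteq> 1"
proof -
  have "c * (- (lead_coeff F * of_nat d)) \<noteq> 0" using c d d_pos by (auto simp: of_nat_eq_0_iff_char_dvd)
  then obtain a where a: "psi (a * (c * (- (lead_coeff F * of_nat d)))) \<noteq> 1" using psi_scaled_nontrivial by blast
  define u where "u = 1 + Polynomial.monom a d"
  have cu: "coeff u i = (if i = 0 then 1 else 0) + (if i = d then a else 0)" for i by (simp add: u_def)
  define U where "U = fps_of_poly u"
  have U: "U = 1 + fps_const a * fps_X ^ d" by (simp add: U_def u_def fps_of_poly_add fps_of_poly_monom)
  have dU: "fps_deriv U = fps_X ^ (d - 1) * fps_const (of_nat d * a)"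
    by (intro fps_ext) (use d_pos in \<open>auto simp: fps_X_power_mult_nth U_def cu\<close>)
  have nthl: "fps_nth (logd U) j = (if j < d - 1 then 0 else of_nat d * a)" if "j \<le> d - 1" for j
  proof -
    have "logd U = fps_X ^ (d - 1) * (fps_const (of_nat d * a) * inverse U)" by (simp add: logd_def dU mult.assoc)
    then show ?thesis using that d_pos by (simp add: fps_X_power_mult_nth U)
  qed
  have "mu F u = - (\<Sum>i\<in>{1..d}. coeff F i * (if i = d then of_nat d * a else 0))"
    unfolding mu_def U_def[symmetric]
  proof (intro arg_cong[of _ _ uminus] sum.cong refl)
    fix i assume i: "i \<in> {1..d}"
    show "coeff F i * fps_nth (logd U) (i - 1) = coeff F i * (if i = d then of_nat d * a else 0)"
    proof (cases "i = d")
      case False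
      then have "i - 1 < d - 1" using i by auto
      then show ?thesis using nthl[of "i - 1"] False by simp
    qed (use nthl[of "d - 1"] in simp)
  qed
  also have "\<dots> = - (lead_coeff F * (of_nat d * a))" using d_pos by (simp add: if_distrib sum.If_cases)
  finally have mu: "mu F u = - (lead_coeff F * (of_nat d * a))" .
  have cmu: "c * mu F u = a * (c * (- (lead_coeff F * of_nat d)))" unfolding mu by (simp add: algebra_simps)
  show thesis
  proof (rule that[of u])
    show "degree u \<le> d" by (rule degree_le) (simp add: cu)
    show "dch c F u \<noteq> 1" using a cmu d_pos by (simp add: dch_def cu)
  qed (use d_pos in \<open>auto simp: cu\<close>)
qed

text \<open>The Gauss sum of \<open>dch c F\<close> at the frequency \<open>y\<close>. Reading the
  \<open>d\<close>-th coefficient of a product is the pairing that makes the ring modulo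
  \<open>X ^ (d + 1)\<close> self-dual.\<close>

definition four :: "'g poly \<Rightarrow> complex" where
  "four y = (\<Sum>x | degree x < Suc d. dch c F x * psi (coeff (x * y) d))"

lemma four_shift:
  assumes u: "coeff u 0 \<noteq> 0"
  shows "four y = dch c F u * (\<Sum>x | degree x < Suc d. dch c F x * psi (coeff (x * u * y) d))"
proof -
  let ?f = "\<lambda>x. poly_cutoff (Suc d) (x * u)"
  have "four y = (\<Sum>x | degree x < Suc d. dch c F (?f x) * psi (coeff (?f x * y) d))"
    unfolding four_def by (rule sum.reindex_bij_betw[OF cutoff_mult_bij[OF u], symmetric])
  also have "\<dots> = (\<Sum>x | degree x < Suc d. dch c F u * (dch c F x * psi (coeff (x * u * y) d)))"
  proof (rule sum.cong[OF refl])
    fix x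
    have "coeff (?f x * y) d = coeff (x * u * y) d"
      by (rule coeff_mult_mono_cutoff[where N=d]) (auto simp: coeff_poly_cutoff)
    then show "dch c F (?f x) * psi (coeff (?f x * y) d) = dch c F u * (dch c F x * psi (coeff (x * u * y) d))"
      by (simp add: dch_cutoff dch_mult mult_ac)
  qed
  finally show ?thesis by (simp add: sum_distrib_left)
qed

text \<open>Primitivity in use: \<open>u - 1\<close> is a multiple of \<open>X ^ d\<close> and
  \<open>y\<close> of \<open>X\<close>, so the pairing does not notice \<open>u\<close>, while the
  character gains the factor \<open>dch c F u\<close>, which is not \<open>1\<close>.\<close>

lemma four_0: assumes y: "coeff y 0 = 0" shows "four y = 0"
proof -
  obtain u where u: "coeff u 0 = 1" "\<And>i. 0 < i \<Longrightarrow> i < d \<Longrightarrow> coeff u i = 0" "degree u \<le> d" "dch c F u \<noteq> 1"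
    using unit_exists by blast
  have "coeff (x * u * y) d = coeff (x * y) d" for x
  proof -
    have "coeff (x * u * y) d = (\<Sum>i\<le>d. coeff u i * coeff (x * y) (d - i))"
      by (simp add: coeff_mult[symmetric] mult_ac)
    also have "\<dots> = (\<Sum>i\<in>{0}. coeff u i * coeff (x * y) (d - i))"
    proof (rule sum.mono_neutral_right)
      show "\<forall>i\<in>{..d} - {0}. coeff u i * coeff (x * y) (d - i) = 0"
      proof
        fix i assume i: "i \<in> {..d} - {0}"
        show "coeff u i * coeff (x * y) (d - i) = 0"
          using i u(2)[of i] y by (cases "i = d") (auto simp: coeff_mult_0)
      qed
    qed auto
    also have "\<dots> = coeff (x * y) d" using u by simp
    finally show ?thesis .
  qed
  then have "four y = dch c F u * four y" using four_shift[of u y] u by (simp add: four_def)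
  then show ?thesis using u by simp
qed

lemma four_eq: "four y = cnj (dch c F y) * four 1"
proof (cases "coeff y 0 = 0")
  case False
  have "four 1 = dch c F y * four y" using four_shift[OF False, of 1] by (simp add: four_def)
  moreover have "cnj (dch c F y) * dch c F y = 1" using False
    by (simp add: dch_def mult.commute[of "cnj _"] complex_norm_square[symmetric])
  ultimately show ?thesis by (simp add: mult.assoc[symmetric])
qed (simp add: four_0 dch_def)

definition Sn :: "nat \<Rightarrow> complex" where "Sn n = (\<Sum>x | degree x < Suc n. dch c F x)"

text \<open>Poisson summation: within degree at most \<open>d\<close>, the polynomials of degree at
  most \<open>n\<close> are exactly those that pair trivially with all polynomials of degree below
  \<open>d - n\<close>.\<close>

lemma poisson:
  assumes n: "n < d"
  shows "of_nat (CARD('g) ^ (d - n)) * Sn n = four 1 * cnj (Sn (d - 1 - n))"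
proof -
  have "four 1 * cnj (Sn (d - 1 - n)) = (\<Sum>y | degree y < d - n. four y)"
    unfolding Sn_def using n by (subst four_eq) (simp add: sum_distrib_left mult.commute Suc_diff_Suc)
  also have "\<dots> = (\<Sum>x | degree x < Suc d. dch c F x * (\<Sum>y | degree y < d - n. psi (coeff (x * y) d)))"
    unfolding four_def by (subst sum.swap) (simp add: sum_distrib_left)
  also have "\<dots> = (\<Sum>x | degree x < Suc d. dch c F x * (if degree x < Suc n then of_nat (CARD('g) ^ (d - n)) else 0))"
  proof (rule sum.cong[OF refl])
    fix x :: "'g poly" assume x: "x \<in> {x. degree x < Suc d}"
    have "(\<Sum>y | degree y < d - n. psi (coeff (x * y) d)) = (if degree x < Suc n then of_nat (CARD('g) ^ (d - n)) else 0)"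
    proof (cases "degree x < Suc n")
      case True
      have "coeff (x * y) d = 0" if "degree y < d - n" for y
        by (rule coeff_eq_0) (use degree_mult_le[of x y] True that in linarith)
      then have "(\<Sum>y :: 'g poly | degree y < d - n. psi (coeff (x * y) d)) = (\<Sum>y :: 'g poly | degree y < d - n. 1)"
        by (intro sum.cong) auto
      then show ?thesis using True n by (simp add: card_degree_less)
    next
      case False
      then have lx: "lead_coeff x \<noteq> 0" by auto
      then obtain a where a: "psi (a * lead_coeff x) \<noteq> 1" using psi_scaled_nontrivial by blast
      have "(\<Sum>y | degree y < d - n. psi (coeff (x * y) d)) = 0"
      proof (rule sum_additive_character_eq_0)
        show "psi (coeff (x * (y + z)) d) = psi (coeff (x * y) d) * psi (coeff (x * z) d)" for y z
          by (simp add: distrib_left psi_add)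
        show "degree (Polynomial.monom a (d - degree x)) < d - n"
          using False n x degree_monom_le[of a "d - degree x"] by simp
        have "coeff (x * Polynomial.monom a (d - degree x)) d = a * lead_coeff x"
          using x by (simp add: mult.commute[of x] coeff_monom_mult)
        then show "psi (coeff (x * Polynomial.monom a (d - degree x)) d) \<noteq> 1" using a by simp
      qed
      then show ?thesis using False by simp
    qed
    then show "dch c F x * (\<Sum>y | degree y < d - n. psi (coeff (x * y) d)) =
      dch c F x * (if degree x < Suc n then of_nat (CARD('g) ^ (d - n)) else 0)" by simp
  qed
  also have "\<dots> = (\<Sum>x | degree x < Suc n. dch c F x * of_nat (CARD('g) ^ (d - n)))"
    by (rule sum.mono_neutral_cong_right) (use n finite_degree_less in auto)
  finally show ?thesis by (simp add: Sn_def sum_distrib_left mult.commute)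
qed

text \<open>Constant term \<open>1\<close> is what monic becomes under the reversal of
  coefficients.\<close>

definition b :: "nat \<Rightarrow> complex" where "b n = (\<Sum>x | degree x < Suc n \<and> coeff x 0 = 1. dch c F x)"

lemma Sn_b: "Sn n = of_nat (CARD('g) - 1) * b n"
proof -
  have "Sn n = (\<Sum>x | degree x < Suc n \<and> coeff x 0 \<noteq> 0. dch c F x)" unfolding Sn_def
    by (rule sum.mono_neutral_right) (use finite_degree_less[of "Suc n", where 'a='g] in \<open>auto simp: dch_def\<close>)
  also have "\<dots> = (\<Sum>(a, x)\<in>(UNIV - {0 :: 'g}) \<times> {x. degree x < Suc n \<and> coeff x 0 = 1}. dch c F x)"
    by (rule sum.reindex_bij_witness[of _ "\<lambda>(a, x). Polynomial.smult a x" "\<lambda>x. (coeff x 0, Polynomial.smult (inverse (coeff x 0)) x)"])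
       (auto simp: dch_def mu_smult)
  also have "\<dots> = of_nat (CARD('g) - 1) * b n"
    by (simp add: b_def sum.cartesian_product[symmetric] card_Diff_singleton)
  finally show ?thesis .
qed

lemma b_0: "b 0 = 1"
proof -
  have "{x :: 'g poly. degree x < Suc 0 \<and> coeff x 0 = 1} = {1}" by (auto elim!: degree_eq_zeroE simp: one_pCons)
  then show ?thesis by (simp add: b_def dch_def mu_def logd_def)
qed

text \<open>From \<open>n = d\<close> on, truncation at degree \<open>n\<close> keeps all the
  character depends on, so multiplication by the unit \<open>u\<close> permutes the sum and
  multiplies it by a number other than \<open>1\<close>.\<close>

lemma b_large:
  assumes n: "n \<ge> d" shows "b n = 0"
proof -
  obtain u where u: "coeff u 0 = 1" "\<And>i. 0 < i \<Longrightarrow> i < d \<Longrightarrow> coeff u i = 0" "degree u \<le> d" "dch c F u \<noteq> 1"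
    using unit_exists by blast
  let ?f = "\<lambda>x. poly_cutoff (Suc n) (x * u)"
  have u0: "coeff u 0 \<noteq> 0" using u by simp
  have "(\<Sum>x | degree x < Suc n \<and> coeff x 0 = 1. dch c F x) = (\<Sum>x | degree x < Suc n. if coeff x 0 = 1 then dch c F x else 0)"
    by (rule sum.mono_neutral_cong_left) (use finite_degree_less in auto)
  also have "\<dots> = (\<Sum>x | degree x < Suc n. if coeff (?f x) 0 = 1 then dch c F (?f x) else 0)"
    by (rule sum.reindex_bij_betw[OF cutoff_mult_bij[OF u0], symmetric])
  also have "\<dots> = (\<Sum>x | degree x < Suc n. dch c F u * (if coeff x 0 = 1 then dch c F x else 0))"
    by (rule sum.cong[OF refl]) (simp add: coeff_poly_cutoff coeff_mult_0 u dch_cutoff n dch_mult mult.commute)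
  also have "\<dots> = dch c F u * (\<Sum>x | degree x < Suc n. if coeff x 0 = 1 then dch c F x else 0)"
    by (rule sum_distrib_left[symmetric])
  also have "(\<Sum>x | degree x < Suc n. if coeff x 0 = 1 then dch c F x else 0) = (\<Sum>x | degree x < Suc n \<and> coeff x 0 = 1. dch c F x)"
    by (rule sum.mono_neutral_cong_right) (use finite_degree_less in auto)
  finally have "b n = dch c F u * b n" unfolding b_def .
  then show ?thesis using u by simp
qed

text \<open>Absolute values are all that is kept of the functional equation. The size of the Gauss
  sum \<open>four 1\<close> is obtained from \<open>poisson\<close> itself, by comparing
  \<open>n = 0\<close> with \<open>n = d - 1\<close> and using \<open>b 0 = 1\<close>.\<close>

lemma b_fe:
  assumes n: "n < d"
  shows "(cmod (b n))\<^sup>2 * real CARD('g) ^ (d - 1) = real CARD('g) ^ (2 * n) * (cmod (b (d - 1 - n)))\<^sup>2"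
proof -
  let ?q = "real CARD('g)"
  have q: "?q > 1" using CARD_gt_1[where 'g='g] by simp
  define k where "k = CARD('g) - 1"
  have q1: "real k > 0" using CARD_gt_1[where 'g='g] by (simp add: k_def)
  have eq: "?q ^ (d - n) * cmod (b n) = cmod (four 1) * cmod (b (d - 1 - n))" if "n < d" for n
  proof -
    have "cmod (of_nat (CARD('g) ^ (d - n)) * Sn n) = cmod (four 1 * cnj (Sn (d - 1 - n)))"
      using poisson[OF that] by simp
    then have "real k * (?q ^ (d - n) * cmod (b n)) = real k * (cmod (four 1) * cmod (b (d - 1 - n)))"
      by (simp add: norm_mult Sn_b[folded k_def] norm_power mult_ac del: of_nat_diff)
    then show ?thesis using q1 by (metis mult_cancel_left less_irrefl)
  qed
  have e1: "?q ^ d = cmod (four 1) * cmod (b (d - 1))" using eq[of 0] d_pos by (simp add: b_0)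
  have e2: "?q * cmod (b (d - 1)) = cmod (four 1)" using eq[of "d - 1"] d_pos by (simp add: b_0)
  have tau: "(cmod (four 1))\<^sup>2 = ?q ^ (d + 1)"
    using e1 e2 by (simp add: power2_eq_square)
  have "(?q ^ (d - n) * cmod (b n))\<^sup>2 = ?q ^ (d + 1) * (cmod (b (d - 1 - n)))\<^sup>2"
    unfolding eq[OF n] power_mult_distrib tau ..
  then have "?q ^ (2 * (d - n)) * (cmod (b n))\<^sup>2 * (?q ^ (2 * n)) = ?q ^ (d + 1) * (cmod (b (d - 1 - n)))\<^sup>2 * ?q ^ (2 * n)"
    by (simp add: power_mult_distrib power_mult[symmetric] mult.commute)
  then have h: "(?q ^ (2 * (d - n)) * ?q ^ (2 * n)) * (cmod (b n))\<^sup>2 = ?q ^ (d + 1) * (?q ^ (2 * n) * (cmod (b (d - 1 - n)))\<^sup>2)"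
    by (simp only: mult_ac)
  have "?q ^ (2 * (d - n)) * ?q ^ (2 * n) = ?q ^ (d + 1) * ?q ^ (d - 1)"
  proof -
    have "2 * (d - n) + 2 * n = (d + 1) + (d - 1)" using n d_pos by simp
    then show ?thesis by (simp only: power_add[symmetric])
  qed
  from h[unfolded this] have "?q ^ (d + 1) * ((cmod (b n))\<^sup>2 * ?q ^ (d - 1)) = ?q ^ (d + 1) * (?q ^ (2 * n) * (cmod (b (d - 1 - n)))\<^sup>2)"
    by (simp only: mult_ac)
  then show ?thesis using q by simp
qed

end

section \<open>Reversal: from sums over monic polynomials to sums modulo a power of X\<close>

definition rv :: "nat \<Rightarrow> 'a::zero poly \<Rightarrow> 'a poly" where
  "rv n A = Poly (map (\<lambda>i. coeff A (n - i)) [0..<Suc n])"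

lemma coeff_rv: "coeff (rv n A) i = (if i \<le> n then coeff A (n - i) else 0)"
  by (auto simp: rv_def nth_default_def simp del: upt_Suc)

lemma degree_rv: "degree (rv n A) \<le> n"
  by (rule degree_le) (simp add: coeff_rv)

lemma rv_rv: "degree A \<le> n \<Longrightarrow> rv n (rv n A) = A"
  by (intro poly_eqI) (auto simp: coeff_rv coeff_eq_0)

lemma at_inf_times_nth:
  "degree F \<le> N \<Longrightarrow> fls_nth (at_inf F * Z) k = (\<Sum>i\<le>N. coeff F i * fls_nth Z (k + int i))"
proof (induction F arbitrary: k N)
  case (pCons a F)
  show ?case
  proof (cases N)
    case 0
    then have "F = 0" using pCons.prems by (auto split: if_splits)
    then show ?thesis using 0 by (simp add: at_inf_pCons)
  next
    case (Suc N')
    have "degree F \<le> N'" using pCons.prems Suc by (auto split: if_splits)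
    then have IH: "fls_nth (at_inf F * Z) (k + 1) = (\<Sum>i\<le>N'. coeff F i * fls_nth Z (k + 1 + int i))"
      by (rule pCons.IH)
    have e: "at_inf (pCons a F) * Z = fls_const a * Z + fls_X_inv * (at_inf F * Z)"
      by (simp add: at_inf_pCons algebra_simps)
    have "fls_nth (at_inf (pCons a F) * Z) k = a * fls_nth Z k + fls_nth (at_inf F * Z) (k + 1)"
      unfolding e by (simp add: fls_X_inv_times_conv_shift(1)[of "at_inf F * Z"])
    also have "\<dots> = (\<Sum>i\<le>N. coeff (pCons a F) i * fls_nth Z (k + int i))"
      unfolding IH Suc sum.atMost_Suc_shift by (simp add: algebra_simps)
    finally show ?thesis .
  qed
qed simp

text \<open>In the variable \<open>X = 1/T\<close> a monic \<open>g\<close> of degree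
  \<open>n\<close> is \<open>X ^ (-n)\<close> times its reversal, and the chain rule gives
  \<open>g'/g = n X - X ^ 2 L\<close>, with \<open>L\<close> the logarithmic derivative of the
  reversal. The term \<open>n X\<close> meets only the constant coefficient of
  \<open>F\<close>.\<close>

lemma lam_mu:
  assumes g: "g \<in> monics n"
  shows "lam F g = of_nat n * coeff F 0 + mu F (rv n g)"
proof -
  have lc: "lead_coeff g = 1" and dg: "degree g = n" using g by (auto dest: monicsD)
  define x where "x = fps_of_poly (rv n g)"
  have x0: "fps_nth x 0 \<noteq> 0" using lc dg by (simp add: x_def coeff_rv)
  define Y where "Y = fps_to_fls x"
  define Y' where "Y' = fps_to_fls (fps_deriv x)"
  define L where "L = fps_to_fls (logd x)"
  have Y0: "Y \<noteq> 0" using x0 by (auto simp: Y_def)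
  have LY: "L * Y = Y'"
  proof -
    have "logd x * x = fps_deriv x" using x0 by (simp add: logd_def mult.assoc inverse_mult_eq_1)
    then show ?thesis by (simp add: L_def Y_def Y'_def fls_times_fps_to_fls[symmetric])
  qed
  have nthY: "fls_nth Y k = (if 0 \<le> k \<and> k \<le> int n then coeff g (nat (int n - k)) else 0)" for k
    by (auto simp: Y_def x_def coeff_rv nat_diff_distrib)
  have e1: "at_inf g = fls_X_inv ^ n * Y"
  proof (rule fls_eqI)
    fix k show "fls_nth (at_inf g) k = fls_nth (fls_X_inv ^ n * Y) k"
    proof (cases "k + int n < 0")
      case True
      then have "nat (- k) > degree g" using dg by auto
      then have "coeff g (nat (- k)) = 0" by (rule coeff_eq_0)
      then show ?thesis using True by (simp add: at_inf_nth fls_X_inv_power_times_conv_shift nthY)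
    next
      case False
      then show ?thesis by (simp add: at_inf_nth fls_X_inv_power_times_conv_shift nthY)
    qed
  qed
  have e2: "at_inf (pderiv g) = fls_X_inv ^ n * (of_nat n * (fls_X * Y) - fls_X ^ 2 * Y')"
  proof (rule fls_eqI)
    fix k :: int
    have nthY': "fls_nth Y' j = of_int (j + 1) * fls_nth Y (j + 1)" for j
    proof (cases "j \<ge> 0")
      case True
      then obtain i where j: "j = int i" using zero_le_imp_eq_int by blast
      have n1: "j + 1 = int (Suc i)" using j by simp
      have "fls_nth Y' j = of_nat (Suc i) * fps_nth x (Suc i)"
        unfolding Y'_def j fps_to_fls_nth by (simp del: of_nat_Suc)
      also have "fps_nth x (Suc i) = fls_nth Y (j + 1)" unfolding Y_def n1 fps_to_fls_nth by (simp del: of_nat_Suc)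
      also have "of_nat (Suc i) = of_int (j + 1)" unfolding n1 by (rule of_int_of_nat_eq[symmetric])
      finally show ?thesis .
    next
      case False
      then show ?thesis by (cases "j = -1") (auto simp: Y_def Y'_def)
    qed
    have "fls_nth (of_nat n * (fls_X * Y) - fls_X ^ 2 * Y') j = of_int (int n - (j - 1)) * fls_nth Y (j - 1)" for j
      by (simp add: fls_of_nat[symmetric] fls_X_power_times_conv_shift fls_X_times_conv_shift nthY' algebra_simps del: fls_of_nat)
    then have "fls_nth (fls_X_inv ^ n * (of_nat n * (fls_X * Y) - fls_X ^ 2 * Y')) k = of_int (1 - k) * fls_nth Y (k + int n - 1)"
      by (simp add: fls_X_inv_power_times_conv_shift)
    also have "\<dots> = fls_nth (at_inf (pderiv g)) k"
    proof (cases "k \<le> 0")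
      case True
      have n1: "nat (1 - k) = Suc (nat (- k))" using True by auto
      have "coeff g (nat (1 - k)) = 0" if "\<not> 0 < k + int n"
        by (rule coeff_eq_0) (use that dg in linarith)
      then have "fls_nth Y (k + int n - 1) = coeff g (nat (1 - k))"
        using True by (auto simp: nthY)
      moreover have "1 - k = int (Suc (nat (- k)))" using True by simp
      then have "(of_int (1 - k) :: 'a) = of_nat (Suc (nat (- k)))" by (metis of_int_of_nat_eq)
      ultimately show ?thesis using True n1 by (simp add: at_inf_nth coeff_pderiv)
    next
      case False
      then show ?thesis by (cases "k = 1") (auto simp: at_inf_nth nthY)
    qed
    finally show "fls_nth (at_inf (pderiv g)) k = fls_nth (fls_X_inv ^ n * (of_nat n * (fls_X * Y) - fls_X ^ 2 * Y')) k" by simp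
  qed
  define Z where "Z = of_nat n * fls_X - fls_X ^ 2 * L"
  have "at_inf F * at_inf (pderiv g) / at_inf g = at_inf F * Z"
  proof -
    have "at_inf (pderiv g) = Z * at_inf g" unfolding e1 e2 Z_def LY[symmetric] by (simp add: algebra_simps)
    moreover have "at_inf g \<noteq> 0" using lc by auto
    ultimately show ?thesis by simp
  qed
  then have "lam F g = (\<Sum>i\<le>degree F. coeff F i * fls_nth Z (1 + int i))"
    unfolding lam_at_inf[OF lc] by (simp add: at_inf_times_nth)
  also have "\<dots> = coeff F 0 * fls_nth Z 1 + (\<Sum>i\<in>{1..degree F}. coeff F i * fls_nth Z (1 + int i))"
    by (subst atMost_atLeast0, subst sum.atLeast_Suc_atMost) auto
  also have "fls_nth Z 1 = of_nat n"
    by (simp add: Z_def L_def fls_of_nat[symmetric] fls_X_power_times_conv_shift del: fls_of_nat)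
  also have "(\<Sum>i\<in>{1..degree F}. coeff F i * fls_nth Z (1 + int i)) = mu F (rv n g)"
  proof -
    have "fls_nth Z (1 + int i) = - fps_nth (logd x) (i - 1)" if "i \<in> {1..degree F}" for i
      using that by (simp add: Z_def L_def fls_of_nat[symmetric] fls_X_power_times_conv_shift nat_diff_distrib del: fls_of_nat)
    then show ?thesis by (simp add: mu_def x_def sum_negf[symmetric])
  qed
  finally show ?thesis by (simp add: mult.commute)
qed

lemma (in fe) asum_b: "asum c F n = psi (c * (of_nat n * coeff F 0)) * b n"
proof -
  have "asum c F n = (\<Sum>g\<in>monics n. psi (c * (of_nat n * coeff F 0)) * dch c F (rv n g))"
    unfolding asum_def
  proof (rule sum.cong[OF refl])
    fix g :: "'g poly" assume g: "g \<in> monics n"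
    then have "coeff (rv n g) 0 = 1" by (auto simp: coeff_rv dest: monicsD)
    then show "chi c F g = psi (c * (of_nat n * coeff F 0)) * dch c F (rv n g)"
      by (simp add: chi_def dch_def lam_mu[OF g] distrib_left psi_add)
  qed
  also have "\<dots> = psi (c * (of_nat n * coeff F 0)) * (\<Sum>g\<in>monics n. dch c F (rv n g))"
    by (rule sum_distrib_left[symmetric])
  also have "(\<Sum>g\<in>monics n. dch c F (rv n g)) = b n" unfolding b_def
  proof (rule sum.reindex_bij_witness[of _ "rv n" "rv n"])
    fix g :: "'g poly" assume g: "g \<in> monics n"
    show "rv n (rv n g) = g" using g by (simp add: rv_rv monicsD)
    show "rv n g \<in> {x. degree x < Suc n \<and> coeff x 0 = 1}"
      using monicsD[OF g] degree_rv[of n g] by (simp add: coeff_rv less_Suc_eq_le)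
  next
    fix x :: "'g poly" assume x: "x \<in> {x. degree x < Suc n \<and> coeff x 0 = 1}"
    show "rv n (rv n x) = x" using x by (simp add: rv_rv)
    have "coeff (rv n x) n = 1" using x by (simp add: coeff_rv)
    then have "degree (rv n x) = n" using degree_rv[of n x] by (metis le_antisym le_degree zero_neq_one)
    then show "rv n x \<in> monics n" using \<open>coeff (rv n x) n = 1\<close> by (simp add: monics_def)
  qed simp
  finally show ?thesis .
qed

lemma (in fe) cmod_asum: "cmod (asum c F n) = cmod (b n)"
  by (simp add: asum_b norm_mult)

lemma (in fe) asum_0: "n \<ge> d \<Longrightarrow> asum c F n = 0"
  by (simp add: asum_b b_large)

text \<open>Lengths above \<open>d / 2\<close> are reflected to \<open>d - 1 - l\<close> by
  \<open>b_fe\<close>, for each \<open>h\<close> separately; this is possible since all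
  \<open>R + h\<close> have the same degree \<open>d\<close>.\<close>

lemma asum_second_moment:
  fixes R :: "'g::{finite_field,field_gcd} poly"
  assumes R: "degree R = d" "R \<noteq> 0" and d: "\<not> CHAR('g) dvd d" and c: "c \<noteq> 0" and l: "l < d"
  shows "(\<Sum>h | degree h < d. (cmod (asum c (R + h) l))\<^sup>2) \<le> real CARD('g) ^ d * (real d * real CARD('g) ^ l)"
proof -
  let ?q = "real CARD('g)"
  have d0: "d > 0" using l by simp
  have short: "(\<Sum>h | degree h < d. (cmod (asum c (R + h) j))\<^sup>2) \<le> ?q ^ d * (real d * ?q ^ j)" if "2 * j \<le> d" "j < d" for j
  proof -
    have "(\<Sum>h | degree h < d. (cmod (asum c (R + h) j))\<^sup>2) \<le> ?q ^ d * ((real j + 1) * ?q ^ j)"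
      by (rule asum_second_moment_short[OF d0 _ c]) (use that in simp)
    also have "\<dots> \<le> ?q ^ d * (real d * ?q ^ j)" using that by (intro mult_left_mono mult_right_mono) auto
    finally show ?thesis .
  qed
  show ?thesis
  proof (cases "2 * l \<le> d")
    case True then show ?thesis using short l by simp
  next
    case False
    define j where "j = d - 1 - l"
    have j: "2 * j \<le> d" "j < d" using False l by (auto simp: j_def)
    have fe: "(cmod (asum c (R + h) l))\<^sup>2 * ?q ^ (d - 1) = ?q ^ (2 * l) * (cmod (asum c (R + h) j))\<^sup>2" if "degree h < d" for h
    proof -
      have dR: "degree (R + h) = d" using that R by (simp add: degree_add_eq_left)
      interpret fe "R + h" c by unfold_locales (use c d dR in auto)
      show ?thesis using b_fe[of l] l unfolding cmod_asum dR j_def by simp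
    qed
    have q0: "?q > 0" using CARD_gt_1[where 'g='g] by simp
    have "(\<Sum>h | degree h < d. (cmod (asum c (R + h) l))\<^sup>2) * ?q ^ (d - 1) = ?q ^ (2 * l) * (\<Sum>h | degree h < d. (cmod (asum c (R + h) j))\<^sup>2)"
      unfolding sum_distrib_left sum_distrib_right by (rule sum.cong) (use fe in auto)
    also have "\<dots> \<le> ?q ^ (2 * l) * (?q ^ d * (real d * ?q ^ j))"
      using short[OF j] by (rule mult_left_mono) simp
    also have "\<dots> = ?q ^ d * (real d * ?q ^ (2 * l + j))" by (simp add: power_add)
    also have "2 * l + j = l + (d - 1)" using l by (simp add: j_def)
    also have "?q ^ d * (real d * ?q ^ (l + (d - 1))) = (?q ^ d * (real d * ?q ^ l)) * ?q ^ (d - 1)"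
      by (simp add: power_add)
    finally show ?thesis using q0 by simp
  qed
qed

text \<open>By positivity the sum over the progression is at most the sum over all \<open>h\<close>.
  The loss, a factor \<open>CARD('g) ^ m\<close> in the mean, stays fixed while \<open>d\<close>
  grows and is absorbed by exponential decay later.\<close>

lemma asum_second_moment_progression:
  fixes R M :: "'g::{finite_field,field_gcd} poly"
  assumes R: "degree R = d" "R \<noteq> 0" and M: "lead_coeff M = 1" "degree M = m" "m + D = d" "D > 0"
    and d: "\<not> CHAR('g) dvd d" and c: "c \<noteq> 0" and l: "l < d"
  shows "(\<Sum>h | degree h < D. (cmod (asum c (R + M * h) l))\<^sup>2) \<le> real CARD('g) ^ d * (real d * real CARD('g) ^ l)"
proof -
  have M0: "M \<noteq> 0" using M by auto
  have "(\<Sum>h | degree h < D. (cmod (asum c (R + M * h) l))\<^sup>2) = (\<Sum>h\<in>(\<lambda>h. M * h) ` {h. degree h < D}. (cmod (asum c (R + h) l))\<^sup>2)"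
    using M0 by (subst sum.reindex) (auto intro: inj_onI)
  also have "\<dots> \<le> (\<Sum>h | degree h < d. (cmod (asum c (R + h) l))\<^sup>2)"
  proof (rule sum_mono2)
    show "(\<lambda>h. M * h) ` {h. degree h < D} \<subseteq> {h. degree h < d}"
    proof clarify
      fix h :: "'g poly" assume "degree h < D"
      then show "degree (M * h) < d" using degree_mult_le[of M h] M by linarith
    qed
  qed (auto intro: finite_degree_less)
  also have "\<dots> \<le> real CARD('g) ^ d * (real d * real CARD('g) ^ l)"
    by (rule asum_second_moment[OF R d c l])
  finally show ?thesis .
qed

subsection \<open>Removing Euler factors and the existence of good polynomials\<close>

text \<open>Coefficients of the L-series without its Euler factors at \<open>S\<close>.\<close>

definition asumS :: "'g::finite_field \<Rightarrow> 'g poly \<Rightarrow> 'g poly set \<Rightarrow> nat \<Rightarrow> complex" where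
  "asumS c F S n = (\<Sum>g | g \<in> monics n \<and> (\<forall>P\<in>S. \<not> P dvd g). chi c F g)"

lemma asumS_empty [simp]: "asumS c F {} n = asum c F n"
  by (simp add: asumS_def asum_def)

lemma monic_irreducible_dvd_eq:
  fixes P Q :: "'a::field poly"
  assumes "P \<in> monic_irreducibles" "Q \<in> monic_irreducibles" "P dvd Q"
  shows "P = Q"
proof -
  obtain A where A: "Q = P * A" using assms(3) by auto
  have "\<not> is_unit P" using assms(1) by (auto simp: monic_irreducibles_def Factorial_Ring.irreducible_def)
  then have "is_unit A" using assms(2) A by (auto simp: monic_irreducibles_def Factorial_Ring.irreducible_def)
  then obtain a where a: "A = [:a:]" by (metis is_unit_poly_iff)
  have "lead_coeff Q = lead_coeff P * lead_coeff A" unfolding A by (rule lead_coeff_mult)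
  then have "lead_coeff A = 1" using assms by (simp add: monic_irreducibles_def)
  then have "a = 1" by (simp add: a)
  then show ?thesis using a A by simp
qed

lemma monic_irreducible_dvd_mult:
  fixes P :: "'a::field_gcd poly"
  assumes "P \<in> monic_irreducibles" "P dvd A * B" shows "P dvd A \<or> P dvd B"
proof -
  have "prime_elem P" using assms(1) by (simp add: monic_irreducibles_def irreducible_imp_prime_elem)
  then show ?thesis using assms(2) by (simp add: prime_elem_dvd_mult_iff)
qed

lemma monic_irreducible_degree_pos: "P \<in> monic_irreducibles \<Longrightarrow> degree (P::'a::field poly) > 0"
  by (auto simp: monic_irreducibles_def Factorial_Ring.irreducible_def is_unit_iff_degree)

text \<open>One sieve step: the multiples of \<open>P\<close> to be removed are the
  \<open>P * h\<close> with \<open>h\<close> again free of \<open>S\<close>, because no member of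
  \<open>S\<close> divides \<open>P\<close>.\<close>

lemma asumS_insert:
  fixes S :: "'g::{finite_field,field_gcd} poly set"
  assumes P: "P \<in> monic_irreducibles" "P \<notin> S" and S: "S \<subseteq> monic_irreducibles"
  shows "asumS c F (insert P S) n = asumS c F S n - (if degree P \<le> n then chi c F P * asumS c F S (n - degree P) else 0)"
proof -
  let ?A = "\<lambda>n. {g. g \<in> monics n \<and> (\<forall>P\<in>S. \<not> P dvd g)}"
  have fin: "finite (?A n)" for n by (rule finite_subset[OF _ finite_monics[of n]]) auto
  have lP: "lead_coeff P = 1" and P0: "P \<noteq> 0" using P by (auto simp: monic_irreducibles_def)
  have "asumS c F S n = (\<Sum>g\<in>?A n \<inter> {g. \<not> P dvd g}. chi c F g) + (\<Sum>g\<in>?A n \<inter> - {g. \<not> P dvd g}. chi c F g)"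
    unfolding asumS_def by (rule sum.Int_Diff[OF fin, of _ _ "{g. \<not> P dvd g}", unfolded Diff_eq])
  also have "?A n \<inter> {g. \<not> P dvd g} = {g. g \<in> monics n \<and> (\<forall>P\<in>insert P S. \<not> P dvd g)}" by auto
  also have "(\<Sum>g\<in>?A n \<inter> - {g. \<not> P dvd g}. chi c F g) = (if degree P \<le> n then chi c F P * asumS c F S (n - degree P) else 0)"
  proof (cases "degree P \<le> n")
    case True
    have eq: "?A n \<inter> - {g. \<not> P dvd g} = (\<lambda>g. P * g) ` ?A (n - degree P)"
    proof (intro equalityI subsetI)
      fix g assume g: "g \<in> ?A n \<inter> - {g. \<not> P dvd g}"
      then obtain h where h: "g = P * h" by auto
      have lg: "lead_coeff g = 1" "degree g = n" using g by (auto dest: monicsD)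
      have "h \<noteq> 0" using h lg by auto
      then have "degree h = n - degree P" using h lg P0 by (simp add: degree_mult_eq)
      moreover have "lead_coeff h = 1" using h lg lP by (metis lead_coeff_mult mult_1)
      ultimately have "h \<in> ?A (n - degree P)" using g h by (auto simp: monics_def)
      then show "g \<in> (\<lambda>g. P * g) ` ?A (n - degree P)" using h by blast
    next
      fix g assume "g \<in> (\<lambda>g. P * g) ` ?A (n - degree P)"
      then obtain h where h: "g = P * h" "h \<in> monics (n - degree P)" "\<forall>Q\<in>S. \<not> Q dvd h" by auto
      have "P \<in> monics (degree P)" using lP by (simp add: monics_def)
      then have "g \<in> monics n" using monics_mult[of P "degree P" h "n - degree P"] h True by simp
      moreover have "\<not> Q dvd g" if "Q \<in> S" for Q
      proof
        assume "Q dvd g"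
        have Q: "Q \<in> monic_irreducibles" using that S by blast
        have "Q dvd P \<or> Q dvd h" using monic_irreducible_dvd_mult[OF Q] \<open>Q dvd g\<close> h(1) by blast
        then have "Q = P" using monic_irreducible_dvd_eq[OF Q P(1)] that h(3) by blast
        then show False using that P(2) by blast
      qed
      moreover have "P dvd g" using h(1) by simp
      ultimately show "g \<in> ?A n \<inter> - {g. \<not> P dvd g}" by blast
    qed
    have "(\<Sum>g\<in>?A n \<inter> - {g. \<not> P dvd g}. chi c F g) = (\<Sum>g\<in>?A (n - degree P). chi c F (P * g))"
      unfolding eq using P0 by (subst sum.reindex) (auto intro: inj_onI)
    also have "\<dots> = (\<Sum>g\<in>?A (n - degree P). chi c F P * chi c F g)"
      by (rule sum.cong) (use lP in \<open>auto simp: chi_mult dest: monicsD\<close>)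
    finally show ?thesis using True by (simp add: asumS_def sum_distrib_left)
  next
    case False
    have "g \<notin> ?A n \<inter> - {g. \<not> P dvd g}" for g
    proof
      assume g: "g \<in> ?A n \<inter> - {g. \<not> P dvd g}"
      then have "g \<noteq> 0" "P dvd g" "degree g = n" by (auto simp: monics_def)
      then show False using False dvd_imp_degree_le by blast
    qed
    then have "?A n \<inter> - {g. \<not> P dvd g} = {}" by blast
    then show ?thesis using False by (simp only: sum.empty) simp
  qed
  finally show ?thesis by (simp add: asumS_def)
qed

lemma asumS_0:
  assumes S: "S \<subseteq> monic_irreducibles" shows "asumS c F S 0 = 1"
proof -
  have "{g. g \<in> monics 0 \<and> (\<forall>P\<in>S. \<not> P dvd g)} = {1 :: 'a poly}"
    using S by (auto simp: monics_def monic_irreducibles_def Factorial_Ring.irreducible_def elim!: degree_eq_zeroE simp: one_pCons)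
  then show ?thesis by (simp add: asumS_def)
qed

lemma sum_shift_degree:
  fixes f :: "nat \<Rightarrow> 'a::comm_semiring_1"
  shows "(\<Sum>n<K + e. (if e \<le> n then f (n - e) else 0) * u ^ n) = u ^ e * (\<Sum>n<K. f n * u ^ n)"
proof -
  have "(\<Sum>n<K + e. (if e \<le> n then f (n - e) else 0) * u ^ n) = (\<Sum>n\<in>{0 + e..<K + e}. f (n - e) * u ^ n)"
    by (rule sum.mono_neutral_cong_right) auto
  also have "\<dots> = (\<Sum>n\<in>{0..<K}. f n * u ^ (n + e))" by (subst sum.shift_bounds_nat_ivl) simp
  finally show ?thesis by (simp add: sum_distrib_left power_add mult_ac atLeast0LessThan)
qed

context fe begin

definition totdeg :: "'g poly set \<Rightarrow> nat" where "totdeg S = (\<Sum>P\<in>S. degree P)"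

lemma asumS_vanish:
  assumes "finite S" "S \<subseteq> monic_irreducibles" "n \<ge> d + totdeg S" shows "asumS c F S n = 0"
  using assms
proof (induction S arbitrary: n rule: finite_induct)
  case empty then show ?case by (simp add: totdeg_def asum_0)
next
  case (insert P S)
  have "totdeg (insert P S) = degree P + totdeg S" using insert by (simp add: totdeg_def)
  then show ?case using insert by (auto simp: asumS_insert)
qed

lemma asumS_generating:
  assumes "finite S" "S \<subseteq> monic_irreducibles"
  shows "(\<Sum>n<d + totdeg S. asumS c F S n * u ^ n) = (\<Sum>n<d. asum c F n * u ^ n) * (\<Prod>P\<in>S. 1 - chi c F P * u ^ degree P)"
  using assms
proof (induction S rule: finite_induct)
  case empty then show ?case by (simp add: totdeg_def)
next
  case (insert P S)
  let ?K = "d + totdeg S" and ?e = "degree P"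
  have td: "d + totdeg (insert P S) = ?K + ?e" using insert by (simp add: totdeg_def)
  have "(\<Sum>n<?K + ?e. asumS c F (insert P S) n * u ^ n) =
    (\<Sum>n<?K + ?e. asumS c F S n * u ^ n) - chi c F P * (\<Sum>n<?K + ?e. (if ?e \<le> n then asumS c F S (n - ?e) else 0) * u ^ n)"
  proof -
    have "asumS c F (insert P S) n * u ^ n = asumS c F S n * u ^ n - chi c F P * ((if ?e \<le> n then asumS c F S (n - ?e) else 0) * u ^ n)" for n
      using insert by (simp add: asumS_insert algebra_simps)
    then show ?thesis by (simp only: sum_subtractf sum_distrib_left)
  qed
  also have "(\<Sum>n<?K + ?e. asumS c F S n * u ^ n) = (\<Sum>n<?K. asumS c F S n * u ^ n)"
    by (rule sum.mono_neutral_right) (use insert asumS_vanish[of S] in auto)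
  also have "(\<Sum>n<?K + ?e. (if ?e \<le> n then asumS c F S (n - ?e) else 0) * u ^ n) = u ^ ?e * (\<Sum>n<?K. asumS c F S n * u ^ n)"
    by (rule sum_shift_degree)
  finally show ?case using insert unfolding td by (simp add: algebra_simps)
qed

text \<open>Removing one Euler factor replaces a coefficient by a difference of two whose indices
  are \<open>degree P\<close> apart. This costs the factor \<open>1 + r ^ degree P\<close> and
  lowers the start of the window by \<open>degree P\<close>.\<close>

lemma asumS_tail:
  fixes r :: real
  assumes "finite S" "S \<subseteq> monic_irreducibles" and r: "r \<ge> 0" and J: "J \<ge> totdeg S"
  shows "(\<Sum>n\<in>{J<..<d + totdeg S}. cmod (asumS c F S n) * r ^ n) \<le>
    (\<Prod>P\<in>S. 1 + r ^ degree P) * (\<Sum>n\<in>{J - totdeg S<..<d}. cmod (asum c F n) * r ^ n)"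
  using assms(1,2) J
proof (induction S arbitrary: J rule: finite_induct)
  case empty then show ?case by (simp add: totdeg_def)
next
  case (insert P S)
  let ?K = "d + totdeg S" and ?e = "degree P"
  let ?a = "\<lambda>n. cmod (asumS c F S n)"
  have td: "totdeg (insert P S) = totdeg S + ?e" using insert by (simp add: totdeg_def)
  have J: "J \<ge> totdeg S + ?e" using insert.prems td by simp
  have "(\<Sum>n\<in>{J<..<?K + ?e}. cmod (asumS c F (insert P S) n) * r ^ n) \<le>
    (\<Sum>n\<in>{J<..<?K + ?e}. ?a n * r ^ n + ?a (n - ?e) * r ^ n)"
  proof (rule sum_mono)
    fix n assume n: "n \<in> {J<..<?K + ?e}"
    then have "asumS c F (insert P S) n = asumS c F S n - chi c F P * asumS c F S (n - ?e)"
      using insert J by (simp add: asumS_insert)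
    then have "cmod (asumS c F (insert P S) n) \<le> ?a n + ?a (n - ?e)"
      using norm_triangle_ineq4[of "asumS c F S n" "chi c F P * asumS c F S (n - ?e)"] by (simp add: norm_mult)
    then show "cmod (asumS c F (insert P S) n) * r ^ n \<le> ?a n * r ^ n + ?a (n - ?e) * r ^ n"
      using r by (metis distrib_right mult_right_mono zero_le_power)
  qed
  also have "\<dots> = (\<Sum>n\<in>{J<..<?K + ?e}. ?a n * r ^ n) + (\<Sum>n\<in>{J<..<?K + ?e}. ?a (n - ?e) * r ^ n)"
    by (rule sum.distrib)
  also have "(\<Sum>n\<in>{J<..<?K + ?e}. ?a n * r ^ n) \<le> (\<Sum>n\<in>{J - ?e<..<?K}. ?a n * r ^ n)"
  proof -
    have "(\<Sum>n\<in>{J<..<?K + ?e}. ?a n * r ^ n) = (\<Sum>n\<in>{J<..<?K}. ?a n * r ^ n)"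
      by (rule sum.mono_neutral_right) (use insert asumS_vanish[of S] in auto)
    also have "\<dots> \<le> (\<Sum>n\<in>{J - ?e<..<?K}. ?a n * r ^ n)"
      by (rule sum_mono2) (use r in auto)
    finally show ?thesis .
  qed
  also have "(\<Sum>n\<in>{J<..<?K + ?e}. ?a (n - ?e) * r ^ n) = r ^ ?e * (\<Sum>n\<in>{J - ?e<..<?K}. ?a n * r ^ n)"
  proof -
    have "(\<Sum>n\<in>{J<..<?K + ?e}. ?a (n - ?e) * r ^ n) = (\<Sum>n\<in>{J - ?e<..<?K}. ?a n * r ^ (n + ?e))"
      by (rule sum.reindex_bij_witness[of _ "\<lambda>n. n + ?e" "\<lambda>n. n - ?e"]) (use J in auto)
    then show ?thesis by (simp add: sum_distrib_left power_add mult_ac)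
  qed
  also have "(\<Sum>n\<in>{J - ?e<..<?K}. ?a n * r ^ n) + r ^ ?e * (\<Sum>n\<in>{J - ?e<..<?K}. ?a n * r ^ n) =
    (1 + r ^ ?e) * (\<Sum>n\<in>{J - ?e<..<?K}. ?a n * r ^ n)" by (simp add: algebra_simps)
  also have "\<dots> \<le> (1 + r ^ ?e) * ((\<Prod>P\<in>S. 1 + r ^ degree P) * (\<Sum>n\<in>{J - ?e - totdeg S<..<d}. cmod (asum c F n) * r ^ n))"
    by (rule mult_left_mono[OF insert.IH]) (use insert r J in auto)
  finally show ?case using insert td by (simp add: mult.assoc add.assoc add.commute[of "totdeg S"])
qed

end

lemma geometric_tail_le:
  fixes \<rho> :: real
  assumes "0 \<le> \<rho>" "\<rho> < 1"
  shows "(\<Sum>n\<in>{k<..J}. \<rho> ^ n) \<le> \<rho> ^ (k + 1) / (1 - \<rho>)"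
proof -
  have s: "summable (\<lambda>n. \<rho> ^ (k + 1) * \<rho> ^ n)" using assms by (intro summable_mult summable_geometric) simp
  have "(\<Sum>n\<in>{k<..J}. \<rho> ^ n) = (\<Sum>n<J - k. \<rho> ^ (k + 1) * \<rho> ^ n)"
    by (rule sum.reindex_bij_witness[of _ "\<lambda>n. n + k + 1" "\<lambda>n. n - (k + 1)"]) (auto simp: power_add[symmetric] simp del: power_Suc)
  also have "\<dots> \<le> suminf (\<lambda>n. \<rho> ^ (k + 1) * \<rho> ^ n)" using assms by (intro sum_le_suminf[OF s]) auto
  also have "\<dots> = \<rho> ^ (k + 1) / (1 - \<rho>)"
    using assms by (subst suminf_mult) (auto simp: suminf_geometric summable_geometric field_simps)
  finally show ?thesis .
qed

text \<open>All contributions to the mean square except \<open>g\<^sub>1 = g\<^sub>2 = 1\<close> come from polynomials of large degree.\<close>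

lemma asumS_mean_square:
  fixes R :: "'g::{finite_field,field_gcd} poly" and u :: complex
  assumes S: "finite S" "S \<subseteq> monic_irreducibles"
    and k: "\<And>g. lead_coeff g = 1 \<Longrightarrow> (\<forall>P\<in>S. \<not> P dvd g) \<Longrightarrow> g = 1 \<or> degree g > k"
    and D: "D > 0" "2 * J \<le> D" and c: "c \<noteq> 0"
    and rho: "\<rho> = sqrt (real CARD('g)) * cmod u" "\<rho> < 1"
  shows "(\<Sum>h | degree h < D. (cmod (\<Sum>n\<in>{1..J}. asumS c (R + \<Prod>S * h) S n * u ^ n))\<^sup>2) \<le>
    real CARD('g) ^ D * ((1 + \<rho> ^ (k + 1) / (1 - \<rho>)) ^ 3 - 1)"
proof -
  let ?q = "real CARD('g)"
  define r where "r = cmod u"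
  define t where "t = \<rho> ^ (k + 1) / (1 - \<rho>)"
  have r0: "r \<ge> 0" by (simp add: r_def)
  have rho0: "\<rho> \<ge> 0" using rho by simp
  have t0: "t \<ge> 0" using rho rho0 by (simp add: t_def)
  define ok where "ok g \<longleftrightarrow> (\<forall>P\<in>S. \<not> P dvd g)" for g :: "'g poly"
  define G where "G = {g :: 'g poly. lead_coeff g = 1 \<and> degree g \<in> {1..J} \<and> ok g}"
  have finG: "finite G" by (rule finite_subset[OF _ finite_degree_less[of "Suc J"]]) (auto simp: G_def)
  have eqG: "(\<Sum>n\<in>{1..J}. asumS c F S n * u ^ n) = (\<Sum>g\<in>G. u ^ degree g * chi c F g)" for F
  proof -
    have "(\<Sum>g\<in>G. u ^ degree g * chi c F g) = (\<Sum>n\<in>{1..J}. \<Sum>g\<in>{g\<in>G. degree g = n}. u ^ degree g * chi c F g)"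
      by (rule sum.group[symmetric]) (use finG in \<open>auto simp: G_def\<close>)
    also have "\<dots> = (\<Sum>n\<in>{1..J}. asumS c F S n * u ^ n)"
    proof (rule sum.cong[OF refl])
      fix n assume "n \<in> {1..J}"
      then have "{g\<in>G. degree g = n} = {g. g \<in> monics n \<and> (\<forall>P\<in>S. \<not> P dvd g)}"
        by (auto simp: G_def monics_def ok_def)
      then show "(\<Sum>g\<in>{g\<in>G. degree g = n}. u ^ degree g * chi c F g) = asumS c F S n * u ^ n"
        by (simp add: asumS_def sum_distrib_left sum_distrib_right mult.commute monics_def)
    qed
    finally show ?thesis by simp
  qed
  have cop: "coprime (\<Prod>S) g" if "ok g" for g
  proof (rule prod_coprime_left)
    fix P assume "P \<in> S"
    then have "prime_elem P" "\<not> P dvd g" using S that by (auto simp: ok_def monic_irreducibles_def irreducible_imp_prime_elem)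
    then show "coprime P g" by (rule prime_elem_imp_coprime)
  qed
  define Pr where "Pr = {(g1, g2). g1 \<in> G \<and> g2 \<in> G \<and> pderiv g1 * g2 = g1 * pderiv g2}"
  have "(\<Sum>h | degree h < D. (cmod (\<Sum>g\<in>G. u ^ degree g * chi c (R + \<Prod>S * h) g))\<^sup>2) \<le>
    ?q ^ D * (\<Sum>(g1, g2) | g1 \<in> G \<and> g2 \<in> G \<and> pderiv g1 * g2 = g1 * pderiv g2. cmod (u ^ degree g1) * cmod (u ^ degree g2))"
  proof (rule second_moment[OF D(1) c finG])
    fix g assume g: "g \<in> G"
    then show "lead_coeff g = 1" "coprime (\<Prod>S) g" using cop by (auto simp: G_def)
    show "2 * degree g \<le> D" using g D by (auto simp: G_def)
  qed
  then have 1: "(\<Sum>h | degree h < D. (cmod (\<Sum>n\<in>{1..J}. asumS c (R + \<Prod>S * h) S n * u ^ n))\<^sup>2) \<le>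
    ?q ^ D * (\<Sum>(g1, g2)\<in>Pr. r ^ degree g1 * r ^ degree g2)"
    unfolding eqG Pr_def r_def norm_power .
  define C where "C = {g :: 'g poly. lead_coeff g = 1 \<and> degree g \<le> J \<and> ok g}"
  define C0 where "C0 = {g \<in> C. pderiv g = 0}"
  have finC: "finite C" by (rule finite_subset[OF _ finite_degree_less[of "Suc J"]]) (auto simp: C_def)
  have finC0: "finite C0" using finC by (simp add: C0_def)
  have one: "1 \<in> C" "1 \<in> C0" using S by (auto simp: C_def C0_def ok_def monic_irreducibles_def Factorial_Ring.irreducible_def)
  have C_cases: "g = 1 \<or> degree g \<in> {k<..J}" if "g \<in> C" for g
    using that k[of g] by (auto simp: C_def ok_def)
  \<comment> \<open>The triple of ones comes from no pair, since members of \<open>G\<close> have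
    positive degree. Its removal is the \<open>- 1\<close> in the bound.\<close>
  define T where "T = C \<times> C0 \<times> C0 - {(1, 1, 1)}"
  have "(\<Sum>(g1, g2)\<in>Pr. r ^ degree g1 * r ^ degree g2) \<le> (\<Sum>(c, A, B)\<in>T. r ^ (2 * degree c) * (r ^ degree A * r ^ degree B))"
  proof (rule proportional_pairs_sum_le[OF _ r0])
    show "finite T" using finC finC0 by (simp add: T_def)
    fix g1 g2 c A B :: "'g poly"
    assume a: "(g1, g2) \<in> Pr" "g1 = c * A" "g2 = c * B" "lead_coeff c = 1" "lead_coeff A = 1"
      "lead_coeff B = 1" "pderiv A = 0" "pderiv B = 0"
    then have nz: "c \<noteq> 0" "A \<noteq> 0" "B \<noteq> 0" by auto
    have g: "g1 \<in> G" "g2 \<in> G" using a by (auto simp: Pr_def)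
    have "degree c + degree A \<le> J" "degree c + degree B \<le> J" "degree c + degree A > 0"
      using g a nz by (auto simp: G_def degree_mult_eq)
    moreover have "ok c" "ok A" "ok B" using g a unfolding G_def ok_def by (auto intro: dvd_mult dvd_mult2)
    moreover have "(c, A, B) \<noteq> (1, 1, 1)" using \<open>degree c + degree A > 0\<close> by auto
    ultimately show "(c, A, B) \<in> T" using a by (auto simp: T_def C_def C0_def)
  qed (auto simp: Pr_def T_def G_def C_def C0_def)
  also have "\<dots> = (\<Sum>(c, A, B)\<in>C \<times> C0 \<times> C0. r ^ (2 * degree c) * (r ^ degree A * r ^ degree B)) - 1"
    unfolding T_def using finC finC0 one by (subst sum_diff1) auto
  also have "(\<Sum>(c, A, B)\<in>C \<times> C0 \<times> C0. r ^ (2 * degree c) * (r ^ degree A * r ^ degree B)) =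
    (\<Sum>c\<in>C. r ^ (2 * degree c)) * ((\<Sum>A\<in>C0. r ^ degree A) * (\<Sum>B\<in>C0. r ^ degree B))"
    by (simp only: sum.cartesian_product[symmetric] sum_product) (simp only: sum_distrib_left)
  \<comment> \<open>Apart from \<open>1\<close>, all degrees exceed \<open>k\<close>. In degree
    \<open>n\<close> there are at most \<open>?q ^ n\<close> members of \<open>C\<close>, weighted
    by \<open>r ^ (2 * n)\<close>, and at most \<open>sqrt ?q ^ n\<close> members of
    \<open>C0\<close>, weighted by \<open>r ^ n\<close>; either total is at most
    \<open>\<rho> ^ n\<close>.\<close>
  also have "\<dots> \<le> (1 + t) * ((1 + t) * (1 + t))"
  proof -
    have "(\<Sum>c\<in>C. r ^ (2 * degree c)) \<le> (\<Sum>c\<in>insert 1 (\<Union>n\<in>{k<..J}. (monics n :: 'g poly set)). r ^ (2 * degree c))"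
    proof (rule sum_mono2)
      show "C \<subseteq> insert 1 (\<Union>n\<in>{k<..J}. (monics n :: 'g poly set))"
      proof
        fix g assume g: "g \<in> C"
        then show "g \<in> insert 1 (\<Union>n\<in>{k<..J}. (monics n :: 'g poly set))"
          using C_cases[OF g] by (auto simp: C_def monics_def)
      qed
    qed (use r0 in auto)
    also have "\<dots> \<le> 1 + (\<Sum>c\<in>(\<Union>n\<in>{k<..J}. (monics n :: 'g poly set)). r ^ (2 * degree c))"
      by (subst sum.insert_if) (use r0 in \<open>auto intro: finite_monics\<close>)
    also have "(\<Sum>c\<in>(\<Union>n\<in>{k<..J}. (monics n :: 'g poly set)). r ^ (2 * degree (c :: 'g poly))) = (\<Sum>n\<in>{k<..J}. \<Sum>c\<in>(monics n :: 'g poly set). r ^ (2 * degree c))"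
      by (rule sum.UNION_disjoint) (auto intro: finite_monics dest: monicsD)
    also have "\<dots> = (\<Sum>n\<in>{k<..J}. \<Sum>c\<in>(monics n :: 'g poly set). r ^ (2 * n))"
      by (intro sum.cong refl) (auto dest: monicsD)
    also have "\<dots> = (\<Sum>n\<in>{k<..J}. \<rho> ^ n * \<rho> ^ n)"
    proof (rule sum.cong[OF refl])
      fix n
      have "\<rho> ^ n * \<rho> ^ n = (\<rho> * \<rho>) ^ n" by (simp add: power_mult_distrib)
      also have "\<rho> * \<rho> = ?q * r\<^sup>2" unfolding rho r_def by (simp add: power2_eq_square algebra_simps)
      finally show "(\<Sum>c\<in>(monics n :: 'g poly set). r ^ (2 * n)) = \<rho> ^ n * \<rho> ^ n"
        by (simp add: card_monics power_mult_distrib power_mult[symmetric])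
    qed
    also have "\<dots> \<le> (\<Sum>n\<in>{k<..J}. \<rho> ^ n * 1)"
      using rho0 rho by (intro sum_mono mult_left_mono power_le_one) auto
    also have "\<dots> \<le> t" using geometric_tail_le[OF rho0 rho(2)] by (simp add: t_def)
    finally have c1: "(\<Sum>c\<in>C. r ^ (2 * degree c)) \<le> 1 + t" by simp
    have fin0: "finite (monics0 j :: 'g poly set)" for j by (rule finite_subset[OF _ finite_monics[of j]]) (auto simp: monics0_def)
    have "(\<Sum>c\<in>C0. r ^ degree c) \<le> (\<Sum>c\<in>insert 1 (\<Union>n\<in>{k<..J}. (monics0 n :: 'g poly set)). r ^ degree c)"
    proof (rule sum_mono2)
      show "C0 \<subseteq> insert 1 (\<Union>n\<in>{k<..J}. (monics0 n :: 'g poly set))"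
      proof
        fix g assume g: "g \<in> C0"
        then have "g \<in> C" by (simp add: C0_def)
        then show "g \<in> insert 1 (\<Union>n\<in>{k<..J}. (monics0 n :: 'g poly set))"
          using C_cases[of g] g by (auto simp: C0_def C_def monics0_def monics_def)
      qed
    qed (use fin0 r0 in auto)
    also have "\<dots> \<le> 1 + (\<Sum>c\<in>(\<Union>n\<in>{k<..J}. (monics0 n :: 'g poly set)). r ^ degree c)"
      by (subst sum.insert_if) (use r0 in \<open>auto intro: fin0\<close>)
    also have "(\<Sum>c\<in>(\<Union>n\<in>{k<..J}. (monics0 n :: 'g poly set)). r ^ degree (c :: 'g poly)) = (\<Sum>n\<in>{k<..J}. \<Sum>c\<in>(monics0 n :: 'g poly set). r ^ degree c)"
      by (rule sum.UNION_disjoint) (auto intro: fin0 simp: monics0_def dest: monicsD)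
    also have "\<dots> = (\<Sum>n\<in>{k<..J}. \<Sum>c\<in>(monics0 n :: 'g poly set). r ^ n)"
      by (intro sum.cong refl) (auto simp: monics0_def dest: monicsD)
    also have "\<dots> \<le> (\<Sum>n\<in>{k<..J}. \<rho> ^ n)"
    proof (rule sum_mono)
      fix n
      have "(\<Sum>c\<in>(monics0 n :: 'g poly set). r ^ n) \<le> sqrt ?q ^ n * r ^ n"
        using card_monics0[of n, where 'g='g] r0 by (simp add: mult_right_mono)
      then show "(\<Sum>c\<in>(monics0 n :: 'g poly set). r ^ n) \<le> \<rho> ^ n" by (simp add: rho r_def power_mult_distrib)
    qed
    also have "\<dots> \<le> t" using geometric_tail_le[OF rho0 rho(2)] by (simp add: t_def)
    finally have c2: "(\<Sum>c\<in>C0. r ^ degree c) \<le> 1 + t" by simp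
    show ?thesis
      by (intro mult_mono c1 c2) (use t0 r0 in \<open>auto intro!: sum_nonneg mult_nonneg_nonneg\<close>)
  qed
  finally have "(\<Sum>(g1, g2)\<in>Pr. r ^ degree g1 * r ^ degree g2) \<le> (1 + t) ^ 3 - 1"
    by (simp add: power3_eq_cube mult.assoc)
  then have "?q ^ D * (\<Sum>(g1, g2)\<in>Pr. r ^ degree g1 * r ^ degree g2) \<le> ?q ^ D * ((1 + t) ^ 3 - 1)"
    by (rule mult_left_mono) simp
  from order_trans[OF 1 this] show ?thesis unfolding t_def .
qed

section \<open>Averaging over a residue class\<close>

lemma of_nat_neq_0_less_CHAR: "a \<in> {1..<CHAR('g::finite_field)} \<Longrightarrow> (of_nat a :: 'g) \<noteq> 0"
  by (auto simp: of_nat_eq_0_iff_char_dvd dest: dvd_imp_le)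

text \<open>Cauchy--Schwarz passes from the second moment of each coefficient to its first moment,
  which is of size \<open>sqrt ?q ^ n\<close>; together with \<open>cmod u ^ n\<close> this makes
  \<open>\<rho> ^ n\<close>. The reduction \<open>asumS_tail\<close> to full coefficients is applied
  first, since only these have a functional equation.\<close>

lemma tail_mean_bound:
  fixes R :: "'g::{finite_field,field_gcd} poly" and u :: complex
  assumes S: "finite S" "S \<subseteq> monic_irreducibles"
    and R: "lead_coeff R = 1" "degree R = d" and d: "\<not> CHAR('g) dvd d"
    and m: "m = (\<Sum>P\<in>S. degree P)" and D: "m + D = d" "D > 0" "J \<ge> m" and c: "c \<noteq> 0"
    and rho: "\<rho> = sqrt (real CARD('g)) * cmod u" "\<rho> < 1"
  shows "(\<Sum>h | degree h < D. \<Sum>n\<in>{J<..<d + m}. cmod (asumS c (R + \<Prod>S * h) S n) * cmod u ^ n) \<le>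
    real CARD('g) ^ D * ((\<Prod>P\<in>S. 1 + cmod u ^ degree P) * (sqrt (real CARD('g) ^ m * real d) * (\<rho> ^ (J - m + 1) / (1 - \<rho>))))"
proof -
  let ?q = "real CARD('g)"
  define r where "r = cmod u"
  define H where "H = {h :: 'g poly. degree h < D}"
  define M where "M = \<Prod>S"
  have rho0: "\<rho> \<ge> 0" using rho by simp
  have lM: "lead_coeff M = 1" unfolding M_def unfolding lead_coeff_prod by (rule prod.neutral) (use S in \<open>auto simp: monic_irreducibles_def\<close>)
  have dM: "degree M = m" unfolding M_def m using S by (subst degree_prod_sum_eq) (auto simp: monic_irreducibles_def)
  have deg: "degree (R + M * h) = d" if "h \<in> H" for h
  proof -
    have "degree (M * h) < degree R" using degree_mult_le[of M h] that dM D R by (auto simp: H_def)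
    then show ?thesis using R by (simp add: degree_add_eq_left)
  qed
  define E where "E = (\<Prod>P\<in>S. 1 + r ^ degree P)"
  have E0: "E \<ge> 0" unfolding E_def by (intro prod_nonneg) (simp add: r_def)
  have t: "(\<Sum>n\<in>{J<..<d + m}. cmod (asumS c (R + M * h) S n) * r ^ n) \<le> E * (\<Sum>n\<in>{J - m<..<d}. cmod (asum c (R + M * h) n) * r ^ n)"
    if h: "h \<in> H" for h
  proof -
    interpret fe "R + M * h" c by unfold_locales (use c d deg[OF h] in auto)
    show ?thesis using asumS_tail[OF S, of r J] D(3) unfolding totdeg_def deg[OF h] E_def m[symmetric] by (simp add: r_def)
  qed
  have one: "(\<Sum>h\<in>H. cmod (asum c (R + M * h) n)) \<le> ?q ^ D * (sqrt (?q ^ m * real d) * sqrt ?q ^ n)" if n: "n < d" for n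
  proof -
    have cH: "card H = CARD('g) ^ D" using card_degree_less[OF D(2), where 'a='g] by (simp add: H_def)
    have "(\<Sum>h\<in>H. cmod (asum c (R + M * h) n))\<^sup>2 \<le> (\<Sum>h\<in>H. (cmod (asum c (R + M * h) n))\<^sup>2) * real (card H)"
      by (rule sum_squared_le_sum_of_squares)
    also have "\<dots> \<le> ?q ^ d * (real d * ?q ^ n) * real (card H)"
    proof (rule mult_right_mono)
      show "(\<Sum>h\<in>H. (cmod (asum c (R + M * h) n))\<^sup>2) \<le> ?q ^ d * (real d * ?q ^ n)"
        unfolding H_def by (rule asum_second_moment_progression[where m=m]) (use R lM dM D d c n in auto)
    qed simp
    also have "?q ^ d * (real d * ?q ^ n) * real (card H) = (?q ^ D * (sqrt (?q ^ m * real d) * sqrt ?q ^ n))\<^sup>2"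
    proof -
      have "?q ^ d = ?q ^ m * ?q ^ D" using D by (simp add: power_add[symmetric])
      moreover have "(sqrt ?q ^ n)\<^sup>2 = ?q ^ n" by (simp add: power_mult[symmetric] mult.commute[of n] power_mult)
      ultimately show ?thesis by (simp add: cH power_mult_distrib) (simp add: power2_eq_square)
    qed
    finally show ?thesis by (rule power2_le_imp_le) simp
  qed
  have "(\<Sum>h\<in>H. \<Sum>n\<in>{J<..<d + m}. cmod (asumS c (R + M * h) S n) * r ^ n) \<le>
    (\<Sum>h\<in>H. E * (\<Sum>n\<in>{J - m<..<d}. cmod (asum c (R + M * h) n) * r ^ n))"
    using t by (rule sum_mono)
  also have "\<dots> = E * (\<Sum>n\<in>{J - m<..<d}. (\<Sum>h\<in>H. cmod (asum c (R + M * h) n)) * r ^ n)"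
    by (subst sum_distrib_left[symmetric], subst sum.swap) (simp add: sum_distrib_right)
  also have "\<dots> \<le> E * (\<Sum>n\<in>{J - m<..<d}. (?q ^ D * (sqrt (?q ^ m * real d) * sqrt ?q ^ n)) * r ^ n)"
    using one E0 by (intro mult_left_mono sum_mono mult_right_mono) (auto simp: r_def)
  also have "\<dots> = E * (?q ^ D * (sqrt (?q ^ m * real d) * (\<Sum>n\<in>{J - m<..<d}. \<rho> ^ n)))"
    by (simp add: rho r_def power_mult_distrib sum_distrib_left mult_ac)
  also have "\<dots> \<le> E * (?q ^ D * (sqrt (?q ^ m * real d) * (\<rho> ^ (J - m + 1) / (1 - \<rho>))))"
  proof -
    have "(\<Sum>n\<in>{J - m<..<d}. \<rho> ^ n) \<le> (\<Sum>n\<in>{J - m<..d}. \<rho> ^ n)" using rho0 by (intro sum_mono2) auto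
    also have "\<dots> \<le> \<rho> ^ (J - m + 1) / (1 - \<rho>)" by (rule geometric_tail_le[OF rho0 rho(2)])
    finally show ?thesis using E0 by (intro mult_left_mono) auto
  qed
  finally show ?thesis unfolding H_def M_def E_def r_def by (simp only: mult_ac)
qed

text \<open>If every \<open>h\<close> failed for some \<open>a\<close>, the sum of
  \<open>16 * (cmod (UU a h))\<^sup>2 + 4 * W a h\<close> over all \<open>h\<close> and
  \<open>a\<close> would be at least \<open>?q ^ D\<close>, while the two mean bounds leave less
  than three quarters of that. The low part \<open>UU\<close> is small by the choice of
  \<open>k\<close>, the tail \<open>W\<close> by a large degree \<open>d\<close>.\<close>

lemma exists_L_near_1:
  fixes R0 :: "'g::{finite_field,field_gcd} poly" and u :: complex
  assumes S: "finite S" "S \<subseteq> monic_irreducibles"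
    and k: "\<And>g. lead_coeff g = 1 \<Longrightarrow> (\<forall>P\<in>S. \<not> P dvd g) \<Longrightarrow> g = 1 \<or> degree g > k"
    and rho: "\<rho> = sqrt (real CARD('g)) * cmod u" "\<rho> < 1" "u \<noteq> 0"
    and t: "64 * real CHAR('g) * ((1 + \<rho> ^ (k + 1) / (1 - \<rho>)) ^ 3 - 1) \<le> 1"
  shows "\<exists>f. lead_coeff f = 1 \<and> \<not> CHAR('g) dvd degree f \<and> (\<forall>P\<in>S. P dvd f - R0) \<and>
    (\<forall>a\<in>{1..<CHAR('g)}. cmod ((\<Sum>n<degree f. asum (of_nat a) f n * u ^ n) *
       (\<Prod>P\<in>S. 1 - chi (of_nat a) f P * u ^ degree P) - 1) \<le> 1 / 2)"
proof -
  let ?q = "real CARD('g)" and ?p = "CHAR('g)"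
  define M where "M = \<Prod>S"
  define m where "m = (\<Sum>P\<in>S. degree P)"
  define E where "E = (\<Prod>P\<in>S. 1 + cmod u ^ degree P)"
  have q1: "?q > 1" using CARD_gt_1[where 'g='g] by simp
  have p1: "?p > 1" using prime_gt_1_nat by simp
  have rho0: "\<rho> > 0" using rho q1 by simp
  have E0: "E \<ge> 0" unfolding E_def by (intro prod_nonneg) simp
  have lM: "lead_coeff M = 1" unfolding M_def unfolding lead_coeff_prod by (rule prod.neutral) (use S in \<open>auto simp: monic_irreducibles_def\<close>)
  have dM: "degree M = m" unfolding M_def m_def using S by (subst degree_prod_sum_eq) (auto simp: monic_irreducibles_def)
  have M0: "M \<noteq> 0" using lM by auto
  \<comment> \<open>The square of \<open>8 * real ?p\<close> times the bound of
    \<open>tail_mean_bound\<close> is at most \<open>K * (real d * \<rho> ^ d)\<close>; the division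
    by \<open>\<rho> ^ (3 * m)\<close> pays for
    \<open>d \<le> 3 * m + 2 * (J - m + 1)\<close>.\<close>
  define K where "K = (8 * real ?p * (E * sqrt (?q ^ m) / (1 - \<rho>)))\<^sup>2 / \<rho> ^ (3 * m)"
  have K0: "K \<ge> 0" using rho0 by (simp add: K_def)
  have "(\<lambda>n. K * (of_nat n * \<rho> ^ n)) \<longlonglongrightarrow> K * 0"
    by (intro tendsto_mult tendsto_const powser_times_n_limit_0) (use rho0 rho in auto)
  then have "\<forall>\<^sub>F n in sequentially. K * (of_nat n * \<rho> ^ n) < 1" by (rule order_tendstoD) simp
  then obtain N where N: "\<And>n. n \<ge> N \<Longrightarrow> K * (of_nat n * \<rho> ^ n) < 1" by (auto simp: eventually_sequentially)
  \<comment> \<open>\<open>N\<close> makes the tail small and \<open>3 * m\<close> ensures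
    \<open>m \<le> J\<close>; of \<open>d0\<close> and its successor at least one is prime to
    \<open>?p\<close>.\<close>
  define d0 where "d0 = N + 3 * m + degree R0 + 2"
  define d where "d = (if ?p dvd d0 then d0 + 1 else d0)"
  have d: "\<not> ?p dvd d" 
  proof -
    have "\<not> ?p dvd d0 + 1" if "?p dvd d0"
      using dvd_diff_nat[OF _ that, of "d0 + 1"] p1 by auto
    then show ?thesis unfolding d_def by simp
  qed
  have d_ge: "d \<ge> N + 3 * m + degree R0 + 2" by (simp add: d_def d0_def)
  define D where "D = d - m"
  define J where "J = D div 2"
  have D: "m + D = d" "D > 0" "J \<ge> m" "2 * J \<le> D" using d_ge by (auto simp: D_def J_def)
  \<comment> \<open>A monic representative of degree \<open>d\<close> of the class of
    \<open>R0\<close>; adding \<open>M * h\<close> with \<open>degree h < D\<close> changes neither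
    the class nor the leading term.\<close>
  define R where "R = (R0 mod M) + M * Polynomial.monom 1 D"
  have dmod: "degree (R0 mod M) < d"
  proof (cases "R0 mod M = 0")
    case False
    then show ?thesis using degree_mod_less'[OF M0 False] dM D by simp
  qed (use d_ge in simp)
  have dMT: "degree (M * Polynomial.monom 1 D) = d" using M0 D dM by (simp add: degree_mult_eq degree_monom_eq)
  then have dR: "degree R = d" unfolding R_def using dmod by (subst degree_add_eq_right) auto
  have lR: "lead_coeff R = 1"
  proof -
    have "lead_coeff (M * Polynomial.monom 1 D) = 1" using lM by (simp add: lead_coeff_mult degree_monom_eq)
    then show ?thesis unfolding dR unfolding R_def using dmod dMT by (simp add: coeff_eq_0)
  qed
  define H where "H = {h :: 'g poly. degree h < D}"
  have finH: "finite H" and cH: "card H = CARD('g) ^ D"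
    using finite_degree_less card_degree_less[OF D(2)] by (auto simp: H_def)
  have dRh: "degree (R + M * h) = d" and lRh: "lead_coeff (R + M * h) = 1" if "h \<in> H" for h
  proof -
    have *: "degree (M * h) < d" using degree_mult_le[of M h] that dM D by (auto simp: H_def)
    then show "degree (R + M * h) = d" using dR by (simp add: degree_add_eq_left)
    then show "lead_coeff (R + M * h) = 1" using * lR dR by (simp add: coeff_eq_0)
  qed
  have res: "P dvd (R + M * h) - R0" if "P \<in> S" for P h
  proof -
    have "P dvd M" unfolding M_def using S that by (simp add: dvd_prod_eqI)
    moreover have "(R + M * h) - R0 = M * (Polynomial.monom 1 D + h - R0 div M)"
      unfolding R_def by (simp add: algebra_simps minus_mult_div_eq_mod[symmetric])
    ultimately show ?thesis by simp
  qed
  define UU where "UU a h = (\<Sum>n\<in>{1..J}. asumS (of_nat a) (R + M * h) S n * u ^ n)" for a h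
  define W where "W a h = (\<Sum>n\<in>{J<..<d + m}. cmod (asumS (of_nat a) (R + M * h) S n) * cmod u ^ n)" for a h
  have near: "cmod ((\<Sum>n<d. asum (of_nat a) (R + M * h) n * u ^ n) *
       (\<Prod>P\<in>S. 1 - chi (of_nat a) (R + M * h) P * u ^ degree P) - 1) \<le> cmod (UU a h) + W a h"
    if a: "a \<in> {1..<?p}" and h: "h \<in> H" for a h
  proof -
    interpret fe "R + M * h" "of_nat a" by unfold_locales (use a d dRh[OF h] of_nat_neq_0_less_CHAR in auto)
    have "(\<Sum>n<d. asum (of_nat a) (R + M * h) n * u ^ n) * (\<Prod>P\<in>S. 1 - chi (of_nat a) (R + M * h) P * u ^ degree P) =
      (\<Sum>n<d + m. asumS (of_nat a) (R + M * h) S n * u ^ n)"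
      using asumS_generating[OF S, of u] unfolding totdeg_def m_def[symmetric] dRh[OF h] by simp
    also have "{..<d + m} = insert 0 ({1..J} \<union> {J<..<d + m})" using D by auto
    also have "(\<Sum>n\<in>insert 0 ({1..J} \<union> {J<..<d + m}). asumS (of_nat a) (R + M * h) S n * u ^ n) =
      1 + (UU a h + (\<Sum>n\<in>{J<..<d + m}. asumS (of_nat a) (R + M * h) S n * u ^ n))"
      by (subst sum.insert) (auto simp: asumS_0[OF S(2)] UU_def sum.union_disjoint ivl_disj_int)
    finally have "cmod ((\<Sum>n<d. asum (of_nat a) (R + M * h) n * u ^ n) *
       (\<Prod>P\<in>S. 1 - chi (of_nat a) (R + M * h) P * u ^ degree P) - 1) =
      cmod (UU a h + (\<Sum>n\<in>{J<..<d + m}. asumS (of_nat a) (R + M * h) S n * u ^ n))" by simp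
    also have "\<dots> \<le> cmod (UU a h) + cmod (\<Sum>n\<in>{J<..<d + m}. asumS (of_nat a) (R + M * h) S n * u ^ n)"
      by (rule norm_triangle_ineq)
    also have "cmod (\<Sum>n\<in>{J<..<d + m}. asumS (of_nat a) (R + M * h) S n * u ^ n) \<le> W a h"
      unfolding W_def by (rule order_trans[OF norm_sum]) (simp add: norm_mult norm_power)
    finally show ?thesis by simp
  qed
  have sumU: "(\<Sum>h\<in>H. 16 * (cmod (UU a h))\<^sup>2) \<le> ?q ^ D / (4 * real ?p)" if a: "a \<in> {1..<?p}" for a
  proof -
    have "(\<Sum>h\<in>H. (cmod (UU a h))\<^sup>2) \<le> ?q ^ D * ((1 + \<rho> ^ (k + 1) / (1 - \<rho>)) ^ 3 - 1)"
      unfolding H_def UU_def M_def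
      by (rule asumS_mean_square[OF S k D(2) D(4) _ rho(1,2)]) (use a of_nat_neq_0_less_CHAR in auto)
    also have "\<dots> \<le> ?q ^ D * (1 / (64 * real ?p))"
      using t p1 by (intro mult_left_mono) (auto simp: field_simps)
    finally show ?thesis by (simp add: sum_distrib_left[symmetric])
  qed
  have sumW: "(\<Sum>h\<in>H. 4 * W a h) < ?q ^ D / (2 * real ?p)" if a: "a \<in> {1..<?p}" for a
  proof -
    have "(\<Sum>h\<in>H. W a h) \<le> ?q ^ D * (E * (sqrt (?q ^ m * real d) * (\<rho> ^ (J - m + 1) / (1 - \<rho>))))"
      unfolding H_def W_def M_def E_def
      by (rule tail_mean_bound[OF S lR dR d m_def D(1-3) _ rho(1,2)]) (use a of_nat_neq_0_less_CHAR in auto)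
    moreover have "8 * real ?p * (E * (sqrt (?q ^ m * real d) * (\<rho> ^ (J - m + 1) / (1 - \<rho>)))) < 1"
    proof -
      let ?x = "8 * real ?p * (E * (sqrt (?q ^ m * real d) * (\<rho> ^ (J - m + 1) / (1 - \<rho>))))"
      have "?x = (8 * real ?p * (E * sqrt (?q ^ m) / (1 - \<rho>))) * (sqrt (real d) * \<rho> ^ (J - m + 1))"
        by (simp add: real_sqrt_mult)
      then have "?x\<^sup>2 = (8 * real ?p * (E * sqrt (?q ^ m) / (1 - \<rho>)))\<^sup>2 * (real d * \<rho> ^ (2 * (J - m + 1)))"
        by (simp only: power_mult_distrib power_mult[symmetric] real_sqrt_pow2[OF of_nat_0_le_iff] mult.commute[of "_ + 1" 2])
      also have "\<dots> = K * (real d * (\<rho> ^ (3 * m) * \<rho> ^ (2 * (J - m + 1))))"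
        using rho0 by (simp add: K_def)
      also have "\<rho> ^ (3 * m) * \<rho> ^ (2 * (J - m + 1)) = \<rho> ^ (3 * m + 2 * (J - m + 1))"
        by (simp only: power_add)
      also have "\<rho> ^ (3 * m + 2 * (J - m + 1)) \<le> \<rho> ^ d"
      proof (rule power_decreasing)
        show "d \<le> 3 * m + 2 * (J - m + 1)" using D by (simp add: J_def)
      qed (use rho0 rho in auto)
      finally have "?x\<^sup>2 \<le> K * (real d * \<rho> ^ d)" using K0 by (simp add: mult_left_mono)
      also have "\<dots> < 1" using N[of d] d_ge by simp
      finally have "?x\<^sup>2 < 1\<^sup>2" by simp
      then show ?thesis by (rule power2_less_imp_less) simp
    qed
    then have "?q ^ D * (8 * real ?p * (E * (sqrt (?q ^ m * real d) * (\<rho> ^ (J - m + 1) / (1 - \<rho>))))) < ?q ^ D * 1"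
      using q1 by (intro mult_strict_left_mono) auto
    ultimately have "8 * real ?p * (\<Sum>h\<in>H. W a h) < ?q ^ D"
    proof -
      assume *: "(\<Sum>h\<in>H. W a h) \<le> ?q ^ D * (E * (sqrt (?q ^ m * real d) * (\<rho> ^ (J - m + 1) / (1 - \<rho>))))"
      assume **: "?q ^ D * (8 * real ?p * (E * (sqrt (?q ^ m * real d) * (\<rho> ^ (J - m + 1) / (1 - \<rho>))))) < ?q ^ D * 1"
      have "8 * real ?p * (\<Sum>h\<in>H. W a h) \<le> 8 * real ?p * (?q ^ D * (E * (sqrt (?q ^ m * real d) * (\<rho> ^ (J - m + 1) / (1 - \<rho>)))))"
        using * by (intro mult_left_mono) auto
      also have "\<dots> = ?q ^ D * (8 * real ?p * (E * (sqrt (?q ^ m * real d) * (\<rho> ^ (J - m + 1) / (1 - \<rho>)))))"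
        by (simp only: mult_ac)
      finally show ?thesis using ** by linarith
    qed
    moreover have "(\<Sum>h\<in>H. 4 * W a h) = 4 * (\<Sum>h\<in>H. W a h)" by (rule sum_distrib_left[symmetric])
    ultimately show ?thesis using p1 by (simp add: field_simps)
  qed
  have "\<exists>h\<in>H. \<forall>a\<in>{1..<?p}. cmod (UU a h) + W a h \<le> 1 / 2"
  proof (rule ccontr)
    assume "\<not> ?thesis"
    then have bad: "\<exists>a\<in>{1..<?p}. cmod (UU a h) + W a h > 1 / 2" if "h \<in> H" for h using that by (force simp: not_le)
    have W0: "W a h \<ge> 0" for a h unfolding W_def by (intro sum_nonneg) simp
    have "?q ^ D = (\<Sum>h\<in>H. 1)" by (simp add: cH)
    also have "\<dots> \<le> (\<Sum>h\<in>H. \<Sum>a\<in>{1..<?p}. 16 * (cmod (UU a h))\<^sup>2 + 4 * W a h)"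
    proof (rule sum_mono)
      fix h assume "h \<in> H"
      then obtain a where a: "a \<in> {1..<?p}" "cmod (UU a h) + W a h > 1 / 2" using bad by blast
      \<comment> \<open>One of the two summands of the error is at least \<open>1 / 4\<close>; the
        weights \<open>16\<close> and \<open>4\<close> turn that into \<open>1\<close>.\<close>
      have "1 \<le> 16 * (cmod (UU a h))\<^sup>2 + 4 * W a h"
      proof (cases "W a h \<ge> 1 / 4")
        case True
        moreover have "0 \<le> 16 * (cmod (UU a h))\<^sup>2" by simp
        ultimately show ?thesis by linarith
      next
        case False
        then have "cmod (UU a h) \<ge> 1 / 4" using a by linarith
        then have "(cmod (UU a h))\<^sup>2 \<ge> (1 / 4)\<^sup>2" by (rule power_mono) simp
        then show ?thesis using W0[of a h] by (simp add: power2_eq_square)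
      qed
      also have "\<dots> \<le> (\<Sum>a\<in>{1..<?p}. 16 * (cmod (UU a h))\<^sup>2 + 4 * W a h)"
        using W0 a by (intro member_le_sum) auto
      finally show "1 \<le> (\<Sum>a\<in>{1..<?p}. 16 * (cmod (UU a h))\<^sup>2 + 4 * W a h)" .
    qed
    also have "\<dots> = (\<Sum>a\<in>{1..<?p}. (\<Sum>h\<in>H. 16 * (cmod (UU a h))\<^sup>2) + (\<Sum>h\<in>H. 4 * W a h))"
      by (subst sum.swap) (simp only: sum.distrib)
    also have "\<dots> \<le> (\<Sum>a\<in>{1..<?p}. ?q ^ D / (4 * real ?p) + ?q ^ D / (2 * real ?p))"
      using sumU sumW by (intro sum_mono add_mono) (auto intro: less_imp_le)
    also have "\<dots> = real (?p - 1) * (3 / 4 * (?q ^ D / real ?p))" by simp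
    also have "\<dots> < real ?p * (?q ^ D / real ?p)"
    proof -
      have X: "?q ^ D / real ?p > 0" using p1 q1 by simp
      define Y where "Y = ?q ^ D / real ?p"
      have "real (?p - 1) * (3 / 4 * Y) \<le> real (?p - 1) * Y"
        using X by (intro mult_left_mono) (auto simp: Y_def[symmetric])
      then have "real (?p - 1) * (3 / 4 * (?q ^ D / real ?p)) \<le> real (?p - 1) * (?q ^ D / real ?p)"
        by (simp only: Y_def)
      also have "\<dots> < real ?p * (?q ^ D / real ?p)" using X p1 by (intro mult_strict_right_mono) auto
      finally show ?thesis .
    qed
    also have "\<dots> = ?q ^ D" using p1 by simp
    finally show False by simp
  qed
  then obtain h where h: "h \<in> H" "\<And>a. a \<in> {1..<?p} \<Longrightarrow> cmod (UU a h) + W a h \<le> 1 / 2" by blast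
  show ?thesis
  proof (intro exI[of _ "R + M * h"] conjI ballI)
    show "lead_coeff (R + M * h) = 1" by (rule lRh[OF h(1)])
    show "\<not> ?p dvd degree (R + M * h)" using d dRh[OF h(1)] by simp
    show "P dvd (R + M * h) - R0" if "P \<in> S" for P by (rule res[OF that])
    show "cmod ((\<Sum>n<degree (R + M * h). asum (of_nat a) (R + M * h) n * u ^ n) *
       (\<Prod>P\<in>S. 1 - chi (of_nat a) (R + M * h) P * u ^ degree P) - 1) \<le> 1 / 2" if "a \<in> {1..<?p}" for a
      unfolding dRh[OF h(1)] using near[OF that h(1)] h(2)[OF that] by linarith
  qed
qed

 

section \<open>Prescribed behaviour at finitely many primes and the gain at inert ones\<close>

lemma polynomial_crt:
  fixes t :: "'a::field_gcd poly \<Rightarrow> 'a poly"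
  assumes "finite S" "S \<subseteq> monic_irreducibles"
  shows "\<exists>R. \<forall>P\<in>S. P dvd R - t P"
  using assms
proof (induction S rule: finite_induct)
  case (insert P S)
  then obtain R where R: "\<forall>Q\<in>S. Q dvd R - t Q" by auto
  have P: "P \<in> monic_irreducibles" using insert by simp
  have "\<not> P dvd \<Prod>S"
  proof
    assume "P dvd \<Prod>S"
    moreover have "coprime P (\<Prod>S)"
    proof (rule prod_coprime_right)
      fix Q assume "Q \<in> S"
      then have "\<not> P dvd Q" using monic_irreducible_dvd_eq[of P Q] P insert by auto
      moreover have "prime_elem P" using P by (simp add: monic_irreducibles_def irreducible_imp_prime_elem)
      ultimately show "coprime P Q" by (simp add: prime_elem_imp_coprime)
    qed
    ultimately have "is_unit P" by (metis coprime_common_divisor dvd_refl)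
    then show False using P by (auto simp: monic_irreducibles_def Factorial_Ring.irreducible_def)
  qed
  then obtain U V where UV: "U * P + V * \<Prod>S = 1"
    using monic_irreducible_bezout[of P "\<Prod>S"] P by (auto simp: monic_irreducibles_def)
  define R' where "R' = R + V * \<Prod>S * (t P - R)"
  have "R' - t P = (R - t P) * (1 - V * \<Prod>S)" by (simp add: R'_def algebra_simps)
  also have "1 - V * \<Prod>S = U * P" using UV by (simp add: algebra_simps)
  finally have "P dvd R' - t P" by simp
  moreover have "Q dvd R' - t Q" if "Q \<in> S" for Q
  proof -
    have "Q dvd \<Prod>S" using that insert.hyps by (simp add: dvd_prod_eqI)
    then have "Q dvd V * \<Prod>S * (t P - R)" by simp
    moreover have "R' - t Q = (R - t Q) + V * \<Prod>S * (t P - R)" by (simp add: R'_def)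
    moreover have "Q dvd R - t Q" using R that by blast
    ultimately show ?thesis by (simp only: dvd_add)
  qed
  ultimately show ?case by (intro exI[of _ R']) auto
qed simp

text \<open>Since \<open>pderiv P\<close> is invertible modulo \<open>P\<close>, the product
  \<open>f * pderiv P\<close> can be given any residue, in particular \<open>c T ^ (m - 1)\<close>,
  whose only coefficient is the one that \<open>lam\<close> reads.\<close>

lemma (in irr_root) exists_psi_lam_neq_1: "\<exists>f. psi (lam f P) \<noteq> 1"
proof -
  have "\<not> P dvd pderiv P" using pderiv_root_nz eval_0_iff by blast
  then obtain U V where UV: "U * P + V * pderiv P = 1" using monic_irreducible_bezout[OF irr] by blast
  obtain c :: 'g where c: "psi c \<noteq> 1" using psi_nontrivial by blast
  define N where "N = Polynomial.monom c (m - 1)"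
  define f where "f = V * N"
  have "f * pderiv P - N = - (U * N) * P"
  proof -
    have "V * pderiv P = 1 - U * P" using UV by (simp add: algebra_simps)
    moreover have "f * pderiv P = (V * pderiv P) * N" by (simp add: f_def mult_ac)
    ultimately have "f * pderiv P = (1 - U * P) * N" by simp
    then show ?thesis by (simp add: algebra_simps)
  qed
  then have "P dvd f * pderiv P - N" by simp
  then have "(f * pderiv P) mod P = N mod P" by (simp add: mod_eq_dvd_iff)
  also have "N mod P = N"
  proof (rule mod_poly_less)
    have "degree N \<le> m - 1" by (simp add: N_def degree_monom_le)
    then show "degree N < m" using m_pos by linarith
  qed
  finally have "lam f P = c" by (simp add: lam_def N_def)
  then show ?thesis using c by blast
qed

lemma monic_irreducible_factor_exists:
  fixes g :: "'g::{finite_field,field_gcd} poly"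
  assumes "degree g > 0" obtains P where "P \<in> monic_irreducibles" "P dvd g"
proof -
  obtain z where z: "poly (ac g) z = 0" using alg_closed_imp_poly_has_root[of "ac g"] assms by auto
  have "g \<noteq> 0" using assms by auto
  then obtain P where P: "P \<in> monic_irreducibles" "poly (ac P) z = 0" using minimal_polynomial_exists z by blast
  interpret irr_root P z by unfold_locales (use P in auto)
  show thesis using that[OF P(1)] eval_0_iff z by blast
qed

text \<open>With the factor for \<open>a = 0\<close> included, both sides are polynomials of degree
  at most \<open>p\<close> in \<open>x\<close>, and they agree at \<open>0\<close> and at the
  \<open>p\<close> inverse powers of \<open>\<omega>\<close>, one point more than their degree
  allows.\<close>

lemma prod_roots_of_unity:
  fixes \<omega> x :: complex
  assumes p: "prime p" and w: "\<omega> ^ p = 1" "\<omega> \<noteq> 1"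
  shows "(\<Prod>a\<in>{1..<p}. 1 - \<omega> ^ a * x) * (1 - x) = 1 - x ^ p"
proof -
  have p1: "p > 1" using p prime_gt_1_nat by blast
  have w0: "\<omega> \<noteq> 0" using w p1 by (auto simp: power_0_left)
  have inj: "inj_on (\<lambda>a. \<omega> ^ a) {..<p}"
  proof (rule inj_onI)
    have aux: "a = b" if "a \<le> b" "b < p" "\<omega> ^ a = \<omega> ^ b" for a b
    proof (rule ccontr)
      assume "a \<noteq> b"
      have "\<omega> ^ a * \<omega> ^ (b - a) = \<omega> ^ b" using that(1) by (metis le_add_diff_inverse power_add)
      then have "\<omega> ^ a * \<omega> ^ (b - a) = \<omega> ^ a * 1" using that by simp
      then have 1: "\<omega> ^ (b - a) = 1" using w0 by simp
      have "coprime (b - a) p" using that \<open>a \<noteq> b\<close> p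
        by (metis coprime_commute dvd_imp_le leD less_imp_diff_less prime_imp_coprime zero_less_diff le_neq_implies_less)
      then obtain c where c: "[(b - a) * c = 1] (mod p)" using cong_solve_coprime_nat by (metis One_nat_def)
      then have "((b - a) * c) mod p = 1" using p1 by (simp add: cong_def)
      then have e: "(b - a) * c = p * ((b - a) * c div p) + 1" by (metis mult_div_mod_eq)
      have "\<omega> = \<omega> ^ (p * ((b - a) * c div p) + 1)" by (simp add: power_mult w)
      also have "\<dots> = \<omega> ^ ((b - a) * c)" using e by simp
      also have "\<dots> = 1" by (simp add: power_mult 1)
      finally show False using w by simp
    qed
    fix a b assume "a \<in> {..<p}" "b \<in> {..<p}" "\<omega> ^ a = \<omega> ^ b"
    then show "a = b" using aux[of a b] aux[of b a] by (cases "a \<le> b") auto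
  qed
  define f where "f = (\<Prod>a<p. [:1, - (\<omega> ^ a):]) - (1 - Polynomial.monom 1 p)"
  have f: "poly f x = (\<Prod>a<p. 1 - \<omega> ^ a * x) - (1 - x ^ p)" for x
    by (simp add: f_def poly_prod poly_monom mult.commute)
  have "f = 0"
  proof (rule ccontr)
    assume f0: "f \<noteq> 0"
    let ?Z = "insert 0 ((\<lambda>a. inverse (\<omega> ^ a)) ` {..<p})"
    have "?Z \<subseteq> {x. poly f x = 0}"
    proof
      fix z assume "z \<in> ?Z"
      then consider "z = 0" | b where "b < p" "z = inverse (\<omega> ^ b)" by auto
      then show "z \<in> {x. poly f x = 0}"
      proof cases
        case 1 then show ?thesis using p1 by (simp add: f power_0_left)
      next
        case 2
        have "(\<Prod>a<p. 1 - \<omega> ^ a * z) = 0" using 2 w0 by (intro prod_zero) (auto intro!: bexI[of _ b])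
        moreover have "(\<omega> ^ b) ^ p = 1" by (metis mult.commute power_mult power_one w(1))
        then have "z ^ p = 1" using 2 by (simp add: power_inverse)
        ultimately show ?thesis by (simp add: f)
      qed
    qed
    then have "card ?Z \<le> degree f"
      using card_mono[OF poly_roots_finite[OF f0]] card_poly_roots_bound[OF f0] order_trans by blast
    moreover have "card ?Z = Suc p"
    proof -
      have "inj_on (\<lambda>a. inverse (\<omega> ^ a)) {..<p}" using inj by (simp add: inj_on_def)
      then have "card ((\<lambda>a. inverse (\<omega> ^ a)) ` {..<p}) = p" by (simp add: card_image)
      moreover have "0 \<notin> (\<lambda>a. inverse (\<omega> ^ a)) ` {..<p}" using w0 by auto
      ultimately show ?thesis by simp
    qed
    moreover have "degree f \<le> p"
    proof -
      have "degree (\<Prod>a<p. [:1, - (\<omega> ^ a):]) \<le> (\<Sum>a<p. degree [:1, - (\<omega> ^ a):])"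
        using degree_prod_sum_le[of "{..<p}" "\<lambda>a. [:1, - (\<omega> ^ a):]"] by (simp add: o_def)
      also have "\<dots> \<le> (\<Sum>a<p. 1)" by (intro sum_mono) simp
      finally have "degree (\<Prod>a<p. [:1, - (\<omega> ^ a):]) \<le> p" by simp
      moreover have "degree (1 - Polynomial.monom (1::complex) p) \<le> p"
        by (rule degree_diff_le) (auto simp: degree_monom_le)
      ultimately show ?thesis unfolding f_def by (rule degree_diff_le)
    qed
    ultimately show False by simp
  qed
  then have "(\<Prod>a<p. 1 - \<omega> ^ a * x) = 1 - x ^ p" using f[of x] by simp
  moreover have "{..<p} = insert 0 {1..<p}" using p1 by auto
  ultimately show ?thesis by (simp add: mult.commute)
qed

text \<open>Dirichlet approximation with bound \<open>6\<close> brings the angle within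
  \<open>pi / 3\<close> of a full turn, where the cosine is at least \<open>1 / 2\<close>. It is
  applied to the angle of \<open>u ^ L'\<close> rather than \<open>u\<close>, so that the exponent
  found is a multiple of \<open>L'\<close>.\<close>

lemma arbitrarily_large_power_near_positive_axis:
  fixes u :: complex
  shows "\<exists>n\<ge>L. n > 0 \<and> Re (u ^ n) \<ge> cmod u ^ n / 2"
proof -
  define \<theta> where "\<theta> = Arg u / (2 * pi)"
  have u: "u = rcis (cmod u) (2 * pi * \<theta>)" by (simp add: \<theta>_def rcis_cmod_Arg)
  define L' where "L' = Suc L"
  have "(6::nat) > 0" by simp
  from Dirichlet_approx[OF this, of "real L' * \<theta>"]
  obtain h k where hk: "0 < k" "k \<le> int 6" "\<bar>of_int k * (real L' * \<theta>) - of_int h\<bar> < 1 / real 6"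
    by blast
  define n where "n = nat k * L'"
  define \<delta> where "\<delta> = of_int k * (real L' * \<theta>) - of_int h"
  have nth: "real n * \<theta> = of_int h + \<delta>" using hk(1) by (simp add: n_def \<delta>_def)
  have "u ^ n = rcis (cmod u ^ n) (real n * (2 * pi * \<theta>))" by (subst u) (simp add: DeMoivre2)
  then have "Re (u ^ n) = cmod u ^ n * cos (real n * (2 * pi * \<theta>))" by simp
  also have "real n * (2 * pi * \<theta>) = 2 * pi * (real n * \<theta>)" by simp
  also have "\<dots> = 2 * pi * \<delta> + 2 * pi * of_int h" unfolding nth by (simp add: algebra_simps)
  also have "cos \<dots> = cos (2 * pi * \<delta>)" by (simp add: cos_add)
  also have "cos (2 * pi * \<delta>) = cos (2 * pi * \<bar>\<delta>\<bar>)" by (cases "\<delta> \<ge> 0") (auto simp: abs_if)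
  also have "cos (2 * pi * \<bar>\<delta>\<bar>) \<ge> cos (pi / 3)"
  proof (rule cos_monotone_0_pi_le)
    have "\<bar>\<delta>\<bar> \<le> 1 / 6" using hk(3) by (simp add: \<delta>_def)
    then have "pi * \<bar>\<delta>\<bar> \<le> pi * (1 / 6)" by (intro mult_left_mono) auto
    then show "2 * pi * \<bar>\<delta>\<bar> \<le> pi / 3" by simp
  qed auto
  then have "cmod u ^ n * cos (2 * pi * \<bar>\<delta>\<bar>) \<ge> cmod u ^ n * (1 / 2)"
    by (intro mult_left_mono) (auto simp: cos_60)
  finally have "Re (u ^ n) \<ge> cmod u ^ n / 2" by simp
  moreover have "n \<ge> L'"
  proof -
    have "1 \<le> nat k" using hk(1) by simp
    then show ?thesis unfolding n_def by simp
  qed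
  ultimately show ?thesis by (intro exI[of _ n]) (auto simp: L'_def)
qed

text \<open>\<open>(1 - x) / (1 - x ^ p)\<close> is the local factor of \<open>Lprod\<close> at an
  inert prime. The linear term \<open>- Re x\<close> dominates all the others; the bound
  \<open>1 / 6\<close> ensures \<open>1 / 2 - 3 * y + y\<^sup>2 \<ge> 0\<close>, the inequality to
  which the estimate reduces.\<close>

lemma inert_factor_bound:
  fixes x :: complex
  assumes re: "Re x \<ge> cmod x / 2" and small: "cmod x \<le> 1 / 6" and p: "p \<ge> 2"
  shows "cmod ((1 - x) / (1 - x ^ p)) \<le> exp (- cmod x / 4)"
proof -
  define y where "y = cmod x"
  have y: "0 \<le> y" "y \<le> 1 / 6" using small by (auto simp: y_def)
  have n1: "(cmod (1 - x))\<^sup>2 \<le> 1 - y + y\<^sup>2"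
  proof -
    have "(cmod (1 - x))\<^sup>2 = 1 - 2 * Re x + y\<^sup>2"
      by (simp add: cmod_power2 y_def) (simp add: power2_eq_square algebra_simps)
    then show ?thesis using re by (simp add: y_def)
  qed
  have "y ^ p \<le> y ^ 2" using y p by (intro power_decreasing) auto
  then have n2: "cmod (1 - x ^ p) \<ge> 1 - y\<^sup>2"
    using norm_triangle_ineq2[of 1 "x ^ p"] by (simp add: norm_power y_def)
  have y2: "y\<^sup>2 \<le> 1 / 36" using power_mono[OF y(2) y(1), of 2] by (simp add: power2_eq_square)
  have "1 - 2 * y\<^sup>2 \<le> (1 - y\<^sup>2)\<^sup>2"
    using zero_le_power2[of "y\<^sup>2"] by (simp add: power2_eq_square algebra_simps)
  also have "\<dots> \<le> (cmod (1 - x ^ p))\<^sup>2" using n2 y2 by (intro power_mono) auto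
  finally have n3: "1 - 2 * y\<^sup>2 \<le> (cmod (1 - x ^ p))\<^sup>2" .
  have pos: "1 - 2 * y\<^sup>2 > 0" using y2 by simp
  have "(cmod ((1 - x) / (1 - x ^ p)))\<^sup>2 = (cmod (1 - x))\<^sup>2 / (cmod (1 - x ^ p))\<^sup>2"
    by (simp add: norm_divide power_divide)
  also have "\<dots> \<le> (1 - y + y\<^sup>2) / (1 - 2 * y\<^sup>2)"
    using n1 n3 pos y by (intro frac_le) auto
  also have "\<dots> \<le> 1 - y / 2"
  proof -
    have "1 - y + y\<^sup>2 \<le> (1 - y / 2) * (1 - 2 * y\<^sup>2)"
    proof -
      have "0 \<le> y * (1 / 2 - 3 * y + y\<^sup>2)" using y by (intro mult_nonneg_nonneg) auto
      then show ?thesis by (simp add: power2_eq_square algebra_simps)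
    qed
    then show ?thesis using pos by (simp add: divide_le_eq)
  qed
  also have "\<dots> \<le> exp (- y / 2)" using exp_ge_add_one_self[of "- y / 2"] by simp
  also have "\<dots> = (exp (- y / 4))\<^sup>2" by (simp add: power2_eq_square exp_add[symmetric])
  finally show ?thesis unfolding y_def[symmetric] by (rule power2_le_imp_le) simp
qed

lemma card_monic_irreducibles_ge':
  assumes n: "n \<ge> 4"
  shows "real (card {P :: 'g::{finite_field,field_gcd} poly. P \<in> monic_irreducibles \<and> degree P = n})
    \<ge> real CARD('g) ^ n / (2 * real n)"
proof -
  let ?q = "real CARD('g)" and ?I = "{P :: 'g poly. P \<in> monic_irreducibles \<and> degree P = n}"
  have q2: "?q \<ge> 2" using CARD_gt_1[where 'g='g] by linarith
  have geo: "(\<Sum>j\<in>{1..m}. ?q ^ j) \<le> 2 * ?q ^ m - 2" for m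
  proof (induction m)
    case (Suc m)
    have "2 * ?q ^ m \<le> ?q ^ Suc m" using q2 by simp
    moreover have "(\<Sum>j\<in>{1..Suc m}. ?q ^ j) = (\<Sum>j\<in>{1..m}. ?q ^ j) + ?q ^ Suc m" by simp
    ultimately show ?case using Suc by linarith
  qed simp
  have "2 * ?q ^ (n div 2) \<le> ?q ^ n / 2"
  proof -
    have "4 * ?q ^ (n div 2) \<le> ?q ^ 2 * ?q ^ (n div 2)"
      using power_mono[OF q2, of 2] by (intro mult_right_mono) auto
    also have "\<dots> = ?q ^ (2 + n div 2)" by (simp only: power_add)
    also have "\<dots> \<le> ?q ^ n" using q2 n by (intro power_increasing) auto
    finally show ?thesis by simp
  qed
  then have "?q ^ n / 2 \<le> real n * real (card ?I)"
    using card_monic_irreducibles_ge[of n, where 'g='g] geo[of "n div 2"] n by simp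
  then show ?thesis using n by (simp add: field_simps)
qed

text \<open>The L-polynomials of the nontrivial characters; \<open>a = 0\<close> would give the zeta
  function of the polynomial ring.\<close>

definition Lprod :: "'g::finite_field poly \<Rightarrow> complex \<Rightarrow> complex" where
  "Lprod f u = (\<Prod>a\<in>{1..<CHAR('g)}. \<Sum>n<degree f. asum (of_nat a) f n * u ^ n)"

lemma chi_of_nat: "chi (of_nat a) f P = psi (lam f P) ^ a"
proof -
  have "psi (of_nat a * x) = psi x ^ a" for x :: 'a
    by (induction a) (auto simp: psi_add algebra_simps)
  then show ?thesis by (simp add: chi_def)
qed

text \<open>The order of choices matters: first \<open>k\<close>, then \<open>S0\<close>,
  \<open>c0\<close> and \<open>B\<close>, and only then \<open>n\<close>, the degree of the primes
  made inert. There are at least \<open>?q ^ n / (2 * real n)\<close> of these and each gains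
  \<open>exp (- (r ^ n) / 4)\<close>; since \<open>?q * r > 1\<close> the total gain outweighs the
  fixed \<open>B\<close>. The primes in \<open>S0\<close> are put into \<open>S\<close> so that the
  sifted sums start beyond degree \<open>k\<close>.\<close>

theorem small_Lprod:
  fixes u :: complex
  assumes u: "1 / real CARD('g::{finite_field,field_gcd}) < cmod u" "sqrt (real CARD('g)) * cmod u < 1" and eps: "\<epsilon> > 0"
  shows "\<exists>f :: 'g poly. lead_coeff f = 1 \<and> \<not> CHAR('g) dvd degree f \<and> coeff f 0 = 0 \<and>
    Lprod f u \<noteq> 0 \<and> cmod (Lprod f u) < \<epsilon>"
proof -
  let ?q = "real CARD('g)" and ?p = "CHAR('g)"
  define r where "r = cmod u"
  define \<rho> where "\<rho> = sqrt ?q * r"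
  have q1: "?q > 1" using CARD_gt_1[where 'g='g] by simp
  have p2: "?p \<ge> 2" using prime_ge_2_nat by simp
  have r0: "r > 0" using u(1) q1 unfolding r_def by (meson divide_pos_pos less_trans zero_less_one)
  have r1: "r < 1"
  proof -
    have "1 * r \<le> sqrt ?q * r" using q1 r0 by (intro mult_right_mono) auto
    then show ?thesis using u(2) by (simp add: r_def)
  qed
  have rho: "0 < \<rho>" "\<rho> < 1" using u q1 r0 by (auto simp: \<rho>_def r_def)
  have qr: "?q * r > 1" using u(1) q1 by (simp add: r_def field_simps)
  obtain k where k1: "k \<ge> 1" and k: "64 * real ?p * ((1 + \<rho> ^ (k + 1) / (1 - \<rho>)) ^ 3 - 1) \<le> 1"
  proof -
    have "(\<lambda>k. 64 * real ?p * ((1 + \<rho> ^ (k + 1) / (1 - \<rho>)) ^ 3 - 1)) \<longlonglongrightarrow> 64 * real ?p * ((1 + 0 / (1 - \<rho>)) ^ 3 - 1)"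
    proof -
      have "(\<lambda>k. \<rho> ^ (k + 1)) \<longlonglongrightarrow> 0"
        using LIMSEQ_Suc[OF LIMSEQ_power_zero[of \<rho>]] rho by simp
      then show ?thesis by (intro tendsto_intros) (use rho in auto)
    qed
    then have "\<forall>\<^sub>F k in sequentially. 64 * real ?p * ((1 + \<rho> ^ (k + 1) / (1 - \<rho>)) ^ 3 - 1) < 1"
      by (rule order_tendstoD) simp
    then obtain k0 where "\<And>k. k \<ge> k0 \<Longrightarrow> 64 * real ?p * ((1 + \<rho> ^ (k + 1) / (1 - \<rho>)) ^ 3 - 1) < 1"
      by (auto simp: eventually_sequentially)
    from this[of "Suc k0"] show thesis using that[of "Suc k0"] by simp
  qed
  define S0 where "S0 = {P :: 'g poly. P \<in> monic_irreducibles \<and> degree P \<le> k}"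
  have finS0: "finite S0" by (rule finite_subset[OF _ finite_degree_less[of "Suc k"]]) (auto simp: S0_def)
  define c0 where "c0 = (\<Prod>P\<in>S0. cmod (1 - u ^ degree P)) ^ (?p - 1)"
  have small: "cmod (u ^ j) < 1" if "j > 0" for j using r0 r1 that by (simp add: norm_power r_def power_less_one_iff)
  have nz1: "1 - u ^ j \<noteq> 0" if "j > 0" for j using small[OF that] by (metis eq_iff_diff_eq_0 less_irrefl norm_one)
  have c0: "c0 > 0" unfolding c0_def
  proof (intro zero_less_power prod_pos ballI)
    fix P assume "P \<in> S0"
    then have "degree P > 0" by (auto simp: S0_def intro: monic_irreducible_degree_pos)
    from nz1[OF this] show "cmod (1 - u ^ degree P) > 0" by (simp only: zero_less_norm_iff) simp
  qed
  \<comment> \<open>The bound for \<open>Lprod\<close> before inert primes enter: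
    \<open>3 / 2\<close> for each sifted L-polynomial, and \<open>c0\<close> for the factors at
    \<open>S0\<close>, whose value is known as these primes will split.\<close>
  define B where "B = (3 / 2) ^ (?p - 1) / c0"
  have B0: "B > 0" using c0 by (simp add: B_def)
  obtain n where n: "n > k" "n \<ge> 4" "Re (u ^ n) \<ge> cmod u ^ n / 2" "r ^ n \<le> 1 / 6" "B * exp (- ((?q * r) ^ n / (8 * real n))) < \<epsilon>"
  proof -
    have l1: "(\<lambda>n. r ^ n) \<longlonglongrightarrow> 0" using r0 r1 by (intro LIMSEQ_power_zero) simp
    then have e1: "\<forall>\<^sub>F n in sequentially. r ^ n < 1 / 6" by (rule order_tendstoD) simp
    \<comment> \<open>It will be arranged that \<open>T * real n < (?q * r) ^ n\<close>, so
      \<open>T / 8\<close> bounds the exponent gained from below; hence the factor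
      \<open>8\<close>.\<close>
    define T where "T = max 1 (8 * (ln B - ln \<epsilon> + 1))"
    have T: "T > 0" "T / 8 \<ge> ln B - ln \<epsilon> + 1" by (auto simp: T_def)
    have "(\<lambda>n. T * (of_nat n * (1 / (?q * r)) ^ n)) \<longlonglongrightarrow> T * 0"
      by (intro tendsto_mult tendsto_const powser_times_n_limit_0) (use qr in auto)
    then have e2: "\<forall>\<^sub>F n in sequentially. T * (of_nat n * (1 / (?q * r)) ^ n) < 1" by (rule order_tendstoD) simp
    obtain N where N: "\<And>n. n \<ge> N \<Longrightarrow> r ^ n < 1 / 6 \<and> T * (of_nat n * (1 / (?q * r)) ^ n) < 1"
      using eventually_conj[OF e1 e2] by (auto simp: eventually_sequentially)
    obtain n where n: "n \<ge> N + k + 5" "Re (u ^ n) \<ge> cmod u ^ n / 2"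
      using arbitrarily_large_power_near_positive_axis[of "N + k + 5" u] by blast
    have n0: "real n > 0" using n by simp
    have "T * real n < (?q * r) ^ n"
    proof -
      have pos: "(?q * r) ^ n > 0" using qr by simp
      have "T * (real n * (1 / (?q * r)) ^ n) < 1" using N[of n] n by simp
      then have "T * real n / (?q * r) ^ n < 1" unfolding power_one_over by simp
      then show ?thesis using pos by (simp add: divide_less_eq_1_pos)
    qed
    then have "T / 8 < (?q * r) ^ n / (8 * real n)" using n0 by (simp add: field_simps)
    then have "ln B - ln \<epsilon> < (?q * r) ^ n / (8 * real n)" using T by linarith
    then have "exp (ln B - (?q * r) ^ n / (8 * real n)) < exp (ln \<epsilon>)" by simp
    then have "B * exp (- ((?q * r) ^ n / (8 * real n))) < \<epsilon>" using B0 eps by (simp add: exp_diff exp_minus field_simps)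
    then show thesis using that[of n] n N[of n] by (simp add: less_imp_le)
  qed
  define I where "I = {P :: 'g poly. P \<in> monic_irreducibles \<and> degree P = n}"
  have finI: "finite I" by (rule finite_subset[OF _ finite_degree_less[of "Suc n"]]) (auto simp: I_def)
  define S where "S = S0 \<union> I"
  have S: "finite S" "S \<subseteq> monic_irreducibles" using finS0 finI by (auto simp: S_def S0_def I_def)
  have disj: "S0 \<inter> I = {}" using n by (auto simp: S0_def I_def)
  have cover: "g = 1 \<or> degree g > k" if g: "lead_coeff g = 1" "\<forall>P\<in>S. \<not> P dvd g" for g :: "'g poly"
  proof (cases "degree g = 0")
    case True then show ?thesis using g by (auto elim!: degree_eq_zeroE simp: one_pCons)
  next
    case False
    then obtain P where P: "P \<in> monic_irreducibles" "P dvd g" using monic_irreducible_factor_exists by blast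
    have "g \<noteq> 0" using False by auto
    then have "degree P \<le> degree g" using P(2) by (rule dvd_imp_degree_le[rotated])
    moreover have "degree P > k" using P g by (auto simp: S_def S0_def not_le)
    ultimately show ?thesis by simp
  qed
  have inert: "\<exists>f. psi (lam f P) \<noteq> 1" if P: "P \<in> monic_irreducibles" for P :: "'g poly"
  proof -
    obtain \<theta> where "poly (ac P) \<theta> = 0" using monic_irreducible_ac_root[OF P] by blast
    then interpret irr_root P \<theta> by unfold_locales (use P in auto)
    show ?thesis by (rule exists_psi_lam_neq_1)
  qed
  \<comment> \<open>Residue \<open>0\<close> makes the small primes split, and the chosen residues
    make all primes of degree \<open>n\<close> inert.\<close>
  define t where "t P = (if P \<in> I then SOME f. psi (lam f P) \<noteq> 1 else 0)" for P
  have tI: "psi (lam (t P) P) \<noteq> 1" if "P \<in> I" for P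
    using that someI_ex[OF inert, of P] by (simp add: t_def I_def)
  obtain R0 where R0: "\<forall>P\<in>S. P dvd R0 - t P" using polynomial_crt[OF S] by blast
  have "u \<noteq> 0" using r0 by (auto simp: r_def)
  obtain f where f: "lead_coeff f = 1" "\<not> ?p dvd degree f" "\<forall>P\<in>S. P dvd f - R0"
    "\<And>a. a \<in> {1..<?p} \<Longrightarrow> cmod ((\<Sum>n<degree f. asum (of_nat a) f n * u ^ n) *
       (\<Prod>P\<in>S. 1 - chi (of_nat a) f P * u ^ degree P) - 1) \<le> 1 / 2"
    using exists_L_near_1[OF S cover, of \<rho> u R0] k rho \<open>u \<noteq> 0\<close> by (auto simp: \<rho>_def r_def)
  have ft: "P dvd f - t P" if "P \<in> S" for P
    using dvd_add[of P "f - R0" "R0 - t P"] f(3) R0 that by simp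
  have lamS: "lam f P = lam (t P) P" if "P \<in> S" for P using ft[OF that] by (rule lam_cong_mod)
  have T: "[:0, 1:] \<in> S0"
    using k1 by (auto simp: S0_def monic_irreducibles_def intro!: irreducible_linear_field_poly)
  then have "[:0, 1:] dvd f - t [:0, 1:]" using ft by (simp add: S_def)
  moreover have "[:0, 1:] \<notin> I" using T disj by blast
  then have "t [:0, 1:] = 0" unfolding t_def by (rule if_not_P)
  ultimately have f0: "coeff f 0 = 0" using poly_eq_0_iff_dvd[of f 0] by (simp add: poly_0_coeff_0)
  define La where "La a = (\<Sum>n<degree f. asum (of_nat a) f n * u ^ n)" for a
  define Ea where "Ea a = (\<Prod>P\<in>S. 1 - chi (of_nat a) f P * u ^ degree P)" for a
  have near: "cmod (La a * Ea a - 1) \<le> 1 / 2" if "a \<in> {1..<?p}" for a using f(4)[OF that] by (simp add: La_def Ea_def)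
  have La0: "La a \<noteq> 0" if "a \<in> {1..<?p}" for a using near[OF that] by auto
  have Lf: "Lprod f u = (\<Prod>a\<in>{1..<?p}. La a)" by (simp add: Lprod_def La_def)
  have L0: "Lprod f u \<noteq> 0" using La0 by (simp add: Lf)
  have "(\<Prod>a\<in>{1..<?p}. cmod (La a * Ea a)) \<le> (\<Prod>a\<in>{1..<?p}. 3 / 2)"
  proof (rule prod_mono)
    fix a assume a: "a \<in> {1..<?p}"
    have "cmod (La a * Ea a) \<le> cmod (La a * Ea a - 1) + cmod 1"
      using norm_triangle_ineq[of "La a * Ea a - 1" 1] by simp
    then show "0 \<le> cmod (La a * Ea a) \<and> cmod (La a * Ea a) \<le> 3 / 2" using near[OF a] by simp
  qed
  then have LE: "cmod (Lprod f u) * (\<Prod>a\<in>{1..<?p}. cmod (Ea a)) \<le> (3 / 2) ^ (?p - 1)"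
    by (simp add: Lf norm_mult prod.distrib prod_norm)
  define x where "x = u ^ n"
  have xs: "cmod x < 1" "x \<noteq> 1" using small[of n] nz1[of n] n by (auto simp: x_def)
  have xp: "1 - x ^ ?p \<noteq> 0" using nz1[of "n * ?p"] n p2 by (simp add: x_def power_mult)
  have "(\<Prod>a\<in>{1..<?p}. Ea a) = (\<Prod>P\<in>S. \<Prod>a\<in>{1..<?p}. 1 - psi (lam f P) ^ a * u ^ degree P)"
    unfolding Ea_def chi_of_nat by (rule prod.swap)
  also have "\<dots> = (\<Prod>P\<in>S0. \<Prod>a\<in>{1..<?p}. 1 - psi (lam f P) ^ a * u ^ degree P) * (\<Prod>P\<in>I. \<Prod>a\<in>{1..<?p}. 1 - psi (lam f P) ^ a * u ^ degree P)"
    unfolding S_def by (rule prod.union_disjoint[OF finS0 finI disj])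
  also have "(\<Prod>P\<in>S0. \<Prod>a\<in>{1..<?p}. 1 - psi (lam f P) ^ a * u ^ degree P) = (\<Prod>P\<in>S0. (1 - u ^ degree P) ^ (?p - 1))"
  proof (rule prod.cong[OF refl])
    fix P assume P: "P \<in> S0"
    then have "P \<notin> I" using disj by blast
    then have "lam f P = 0" using lamS[of P] P by (simp add: S_def t_def)
    then show "(\<Prod>a\<in>{1..<?p}. 1 - psi (lam f P) ^ a * u ^ degree P) = (1 - u ^ degree P) ^ (?p - 1)" by simp
  qed
  also have "(\<Prod>P\<in>I. \<Prod>a\<in>{1..<?p}. 1 - psi (lam f P) ^ a * u ^ degree P) = (\<Prod>P\<in>I. (1 - x ^ ?p) / (1 - x))"
  proof (rule prod.cong[OF refl])
    fix P assume P: "P \<in> I"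
    then have "psi (lam f P) \<noteq> 1" using lamS[of P] tI by (simp add: S_def)
    then have "(\<Prod>a\<in>{1..<?p}. 1 - psi (lam f P) ^ a * x) * (1 - x) = 1 - x ^ ?p"
      by (intro prod_roots_of_unity) (auto simp: psi_power_CHAR)
    then show "(\<Prod>a\<in>{1..<?p}. 1 - psi (lam f P) ^ a * u ^ degree P) = (1 - x ^ ?p) / (1 - x)"
      using P xs by (simp add: I_def x_def[symmetric] eq_divide_eq)
  qed
  finally have "cmod (\<Prod>a\<in>{1..<?p}. Ea a) = c0 * cmod ((1 - x ^ ?p) / (1 - x)) ^ card I"
    by (simp add: norm_mult c0_def prod_power_distrib[symmetric] prod_norm norm_power)
  then have Ev: "(\<Prod>a\<in>{1..<?p}. cmod (Ea a)) = c0 * cmod ((1 - x ^ ?p) / (1 - x)) ^ card I" by (simp add: prod_norm)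
  let ?y = "cmod ((1 - x ^ ?p) / (1 - x))" and ?z = "cmod ((1 - x) / (1 - x ^ ?p))"
  have yz: "?y * ?z = 1" using xs xp by (simp add: norm_mult[symmetric])
  have z: "?z \<le> exp (- cmod x / 4)"
    using n p2 by (intro inert_factor_bound) (auto simp: x_def r_def norm_power)
  have "cmod (Lprod f u) * c0 = cmod (Lprod f u) * (c0 * ?y ^ card I) * ?z ^ card I"
    using yz by (simp add: mult.assoc power_mult_distrib[symmetric])
  also have "\<dots> \<le> (3 / 2) ^ (?p - 1) * ?z ^ card I"
    using LE unfolding Ev by (intro mult_right_mono) auto
  also have "\<dots> \<le> (3 / 2) ^ (?p - 1) * exp (- cmod x / 4) ^ card I"
    using z by (intro mult_left_mono power_mono) auto
  finally have "cmod (Lprod f u) \<le> B * exp (- cmod x / 4) ^ card I"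
    using c0 by (simp add: B_def field_simps)
  also have "exp (- cmod x / 4) ^ card I = exp (- (r ^ n * real (card I) / 4))"
    by (simp add: exp_of_nat_mult[symmetric] x_def norm_power r_def)
  also have "\<dots> \<le> exp (- ((?q * r) ^ n / (8 * real n)))"
  proof -
    have "r ^ n * real (card I) \<ge> r ^ n * (?q ^ n / (2 * real n))"
      using card_monic_irreducibles_ge'[OF n(2), where 'g='g] r0 by (intro mult_left_mono) (auto simp: I_def)
    then show ?thesis by (simp add: power_mult_distrib mult.commute)
  qed
  then have "B * exp (- (r ^ n * real (card I) / 4)) \<le> B * exp (- ((?q * r) ^ n / (8 * real n)))"
    using B0 by (intro mult_left_mono) auto
  finally have "cmod (Lprod f u) < \<epsilon>" using n(5) by linarith
  then show ?thesis using f f0 L0 by blast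
qed

 

subsection \<open>Euler products\<close>

lemma cmod_asumS_le:
  fixes F :: "'g::finite_field poly"
  shows "cmod (asumS c F S n) \<le> real CARD('g) ^ n"
proof -
  have "cmod (asumS c F S n) \<le> (\<Sum>g | g \<in> monics n \<and> (\<forall>P\<in>S. \<not> P dvd g). cmod (chi c F g))"
    unfolding asumS_def by (rule norm_sum)
  also have "\<dots> = real (card {g. g \<in> monics n \<and> (\<forall>P\<in>S. \<not> P dvd g)})" by simp
  also have "\<dots> \<le> real (card (monics n :: 'g poly set))"
    by (intro of_nat_mono card_mono) (auto intro: finite_monics)
  finally show ?thesis by (simp add: card_monics)
qed

lemma summable_asumS:
  fixes F :: "'g::finite_field poly" and u :: complex
  assumes u: "real CARD('g) * cmod u < 1"
  shows "summable (\<lambda>n. asumS c F S n * u ^ n)" "summable (\<lambda>n. cmod (asumS c F S n * u ^ n))"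
proof -
  have g: "summable (\<lambda>n. (real CARD('g) * cmod u) ^ n)" using u by (intro summable_geometric) simp
  have le: "cmod (asumS c F S n * u ^ n) \<le> (real CARD('g) * cmod u) ^ n" for n
    using cmod_asumS_le[of c F S n] by (simp add: norm_mult norm_power power_mult_distrib mult_right_mono)
  show "summable (\<lambda>n. cmod (asumS c F S n * u ^ n))"
    by (rule summable_comparison_test'[OF g, of 0]) (use le in simp)
  then show "summable (\<lambda>n. asumS c F S n * u ^ n)" by (rule summable_norm_cancel)
qed

lemma suminf_asumS:
  fixes F :: "'g::{finite_field,field_gcd} poly" and u :: complex
  assumes u: "real CARD('g) * cmod u < 1" and S: "finite S" "S \<subseteq> monic_irreducibles"
  shows "suminf (\<lambda>n. asumS c F S n * u ^ n) = suminf (\<lambda>n. asum c F n * u ^ n) * (\<Prod>P\<in>S. 1 - chi c F P * u ^ degree P)"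
  using S
proof (induction S rule: finite_induct)
  case (insert P S)
  let ?e = "degree P"
  let ?f = "\<lambda>n. asumS c F S n"
  define g where "g n = (if ?e \<le> n then ?f (n - ?e) else 0) * u ^ n" for n
  have sf: "(\<lambda>n. ?f n * u ^ n) sums suminf (\<lambda>n. ?f n * u ^ n)" by (rule summable_sums[OF summable_asumS(1)[OF u]])
  have "(\<lambda>n. u ^ ?e * (?f n * u ^ n)) sums (u ^ ?e * suminf (\<lambda>n. ?f n * u ^ n))" by (rule sums_mult[OF sf])
  then have "(\<lambda>n. g (n + ?e)) sums (u ^ ?e * suminf (\<lambda>n. ?f n * u ^ n))" by (simp add: g_def power_add mult_ac)
  then have "g sums (u ^ ?e * suminf (\<lambda>n. ?f n * u ^ n) + (\<Sum>i<?e. g i))" by (simp only: sums_iff_shift)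
  also have "(\<Sum>i<?e. g i) = 0" by (simp add: g_def)
  finally have sg: "g sums (u ^ ?e * suminf (\<lambda>n. ?f n * u ^ n))" by simp
  have "asumS c F (insert P S) n * u ^ n = ?f n * u ^ n - chi c F P * g n" for n
    using insert by (simp add: asumS_insert g_def algebra_simps)
  then have "(\<lambda>n. asumS c F (insert P S) n * u ^ n) sums (suminf (\<lambda>n. ?f n * u ^ n) - chi c F P * (u ^ ?e * suminf (\<lambda>n. ?f n * u ^ n)))"
    using sums_diff[OF sf sums_mult[OF sg]] by simp
  then have "suminf (\<lambda>n. asumS c F (insert P S) n * u ^ n) = suminf (\<lambda>n. ?f n * u ^ n) * (1 - chi c F P * u ^ ?e)"
    by (simp add: sums_iff algebra_simps)
  then show ?case using insert by (simp add: mult_ac)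
qed simp

lemma finite_small_irreducibles: "finite {P :: 'g::{finite,field} poly. P \<in> monic_irreducibles \<and> degree P \<le> k}"
  by (rule finite_subset[OF _ finite_degree_less[of "Suc k"]]) auto

text \<open>Once \<open>S\<close> contains all primes of degree at most \<open>k0\<close>, the
  sifted series is \<open>1\<close> plus terms of degree above \<open>k0\<close>. The multiplicative
  form of the claim presupposes nothing about zeros of the L-series; nonvanishing is deduced from it
  afterwards.\<close>

lemma euler_tendsto:
  fixes F :: "'g::{finite_field,field_gcd} poly" and u :: complex
  assumes u: "real CARD('g) * cmod u < 1"
  shows "((\<lambda>S. suminf (\<lambda>n. asum c F n * u ^ n) * (\<Prod>P\<in>S. 1 - chi c F P * u ^ degree P)) \<longlongrightarrow> 1)
    (finite_subsets_at_top monic_irreducibles)"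
proof (rule tendstoI)
  fix e :: real assume e: "e > 0"
  let ?x = "real CARD('g) * cmod u"
  have x0: "?x \<ge> 0" by simp
  have "(\<lambda>k. ?x ^ k / (1 - ?x)) \<longlonglongrightarrow> 0 / (1 - ?x)"
    by (intro tendsto_divide tendsto_const LIMSEQ_power_zero) (use u in auto)
  then have "\<forall>\<^sub>F k in sequentially. ?x ^ k / (1 - ?x) < e" by (rule order_tendstoD) (use e in simp)
  then obtain k0 where k0: "\<And>k. k \<ge> k0 \<Longrightarrow> ?x ^ k / (1 - ?x) < e" by (auto simp: eventually_sequentially)
  define S0 where "S0 = {P :: 'g poly. P \<in> monic_irreducibles \<and> degree P \<le> k0}"
  have fin0: "finite S0" unfolding S0_def by (rule finite_small_irreducibles)
  have "dist (suminf (\<lambda>n. asum c F n * u ^ n) * (\<Prod>P\<in>S. 1 - chi c F P * u ^ degree P)) 1 < e"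
    if S: "finite S" "S0 \<subseteq> S" "S \<subseteq> monic_irreducibles" for S
  proof -
    have van: "asumS c F S n = 0" if n: "n \<in> {1..k0}" for n
    proof -
      have "\<not> (g \<in> monics n \<and> (\<forall>P\<in>S. \<not> P dvd g))" for g
      proof
        assume g: "g \<in> monics n \<and> (\<forall>P\<in>S. \<not> P dvd g)"
        then have dg: "degree g = n" by (auto dest: monicsD)
        then have "degree g > 0" using n by simp
        then obtain P where P: "P \<in> monic_irreducibles" "P dvd g" using monic_irreducible_factor_exists by blast
        have "g \<noteq> 0" using dg n by auto
        then have "degree P \<le> n" using dvd_imp_degree_le[OF P(2)] dg by simp
        then have "P \<in> S" using P n S by (auto simp: S0_def)
        then show False using g P by blast
      qed
      then have "{g. g \<in> monics n \<and> (\<forall>P\<in>S. \<not> P dvd g)} = {}" by blast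
      then show ?thesis unfolding asumS_def by (simp only: sum.empty)
    qed
    have "suminf (\<lambda>n. asumS c F S n * u ^ n) = suminf (\<lambda>n. asumS c F S (n + Suc k0) * u ^ (n + Suc k0)) + (\<Sum>n<Suc k0. asumS c F S n * u ^ n)"
      by (rule suminf_split_initial_segment[OF summable_asumS(1)[OF u]])
    also have "(\<Sum>n<Suc k0. asumS c F S n * u ^ n) = (\<Sum>n\<in>{0}. asumS c F S n * u ^ n)"
      by (rule sum.mono_neutral_right) (auto intro!: van)
    also have "\<dots> = 1" using asumS_0[OF S(3)] by simp
    finally have "dist (suminf (\<lambda>n. asumS c F S n * u ^ n)) 1 = cmod (suminf (\<lambda>n. asumS c F S (n + Suc k0) * u ^ (n + Suc k0)))"
      by (simp add: dist_norm)
    also have "\<dots> \<le> suminf (\<lambda>n. cmod (asumS c F S (n + Suc k0) * u ^ (n + Suc k0)))"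
      by (rule summable_norm) (use summable_ignore_initial_segment[OF summable_asumS(2)[OF u], of c F S "Suc k0"] in simp)
    also have "\<dots> \<le> suminf (\<lambda>n. ?x ^ Suc k0 * ?x ^ n)"
    proof (rule suminf_le)
      show "summable (\<lambda>n. cmod (asumS c F S (n + Suc k0) * u ^ (n + Suc k0)))"
        by (rule summable_ignore_initial_segment[OF summable_asumS(2)[OF u]])
      show "summable (\<lambda>n. ?x ^ Suc k0 * ?x ^ n)" using u by (intro summable_mult summable_geometric) simp
      show "cmod (asumS c F S (n + Suc k0) * u ^ (n + Suc k0)) \<le> ?x ^ Suc k0 * ?x ^ n" for n
      proof -
        have "cmod (asumS c F S (n + Suc k0) * u ^ (n + Suc k0)) \<le> real CARD('g) ^ (n + Suc k0) * cmod u ^ (n + Suc k0)"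
          using cmod_asumS_le[of c F S "n + Suc k0"] by (simp only: norm_mult norm_power) (intro mult_right_mono, auto)
        also have "\<dots> = ?x ^ Suc k0 * ?x ^ n" by (simp only: power_mult_distrib power_add) (simp only: mult_ac)
        finally show ?thesis .
      qed
    qed
    also have "\<dots> = ?x ^ Suc k0 / (1 - ?x)" using u
      by (subst suminf_mult) (auto intro!: summable_geometric simp: suminf_geometric)
    also have "\<dots> < e" by (rule k0) simp
    finally show ?thesis using suminf_asumS[OF u S(1) S(3), of c F] by simp
  qed
  moreover have "S0 \<subseteq> monic_irreducibles" by (auto simp: S0_def)
  ultimately show "\<forall>\<^sub>F S in finite_subsets_at_top monic_irreducibles. dist (suminf (\<lambda>n. asum c F n * u ^ n) * (\<Prod>P\<in>S. 1 - chi c F P * u ^ degree P)) 1 < e"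
    unfolding eventually_finite_subsets_at_top using fin0 by blast
qed

text \<open>The joint Euler factor of the places over \<open>P\<close>: there are
  \<open>CHAR('g)\<close> places of degree \<open>degree P\<close> if the character is trivial, and
  otherwise a single one of \<open>CHAR('g)\<close> times that degree.\<close>

definition eulerfac :: "'g::finite_field poly \<Rightarrow> complex \<Rightarrow> 'g poly \<Rightarrow> complex" where
  "eulerfac f u P = inverse (if psi (lam f P) = 1 then (1 - u ^ degree P) ^ CHAR('g) else 1 - u ^ (CHAR('g) * degree P))"

text \<open>The product over all \<open>a < ?p\<close> of the local factors is evaluated by
  \<open>prod_roots_of_unity\<close>. The trivial character \<open>a = 0\<close> accounts for the
  denominator.\<close>

lemma eulerfac_tendsto:
  fixes f :: "'g::{finite_field,field_gcd} poly" and u :: complex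
  assumes u: "real CARD('g) * cmod u < 1" and f: "\<not> CHAR('g) dvd degree f"
  shows "((\<lambda>S. \<Prod>P\<in>S. eulerfac f u P) \<longlongrightarrow> Lprod f u / (1 - of_nat CARD('g) * u)) (finite_subsets_at_top monic_irreducibles)"
proof -
  let ?p = "CHAR('g)"
  have p: "prime ?p" "?p > 1" using prime_gt_1_nat by auto
  define L where "L a = suminf (\<lambda>n. asum (of_nat a) f n * u ^ n)" for a
  define E where "E P = (\<Prod>a<?p. 1 - chi (of_nat a) f P * u ^ degree P)" for P
  have u1: "cmod u < 1"
  proof -
    have "1 * cmod u \<le> real CARD('g) * cmod u" using CARD_gt_1[where 'g='g] by (intro mult_right_mono) auto
    then show ?thesis using u by simp
  qed
  have E: "eulerfac f u P = inverse (E P)" if "P \<in> monic_irreducibles" for P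
  proof -
    have un: "1 - u ^ degree P \<noteq> 0"
    proof -
      have "cmod (u ^ degree P) < 1" using u1 monic_irreducible_degree_pos[OF that]
        by (simp add: norm_power power_less_one_iff)
      then show ?thesis by (metis eq_iff_diff_eq_0 less_irrefl norm_one)
    qed
    have "{..<?p} = insert 0 {1..<?p}" using p by auto
    then have "E P = (1 - u ^ degree P) * (\<Prod>a\<in>{1..<?p}. 1 - psi (lam f P) ^ a * u ^ degree P)"
      unfolding E_def chi_of_nat by simp
    also have "\<dots> = (if psi (lam f P) = 1 then (1 - u ^ degree P) ^ ?p else 1 - u ^ (?p * degree P))"
    proof (cases "psi (lam f P) = 1")
      case True
      have "?p > 0" using p by simp
      then have "(1 - u ^ degree P) ^ ?p = (1 - u ^ degree P) * (1 - u ^ degree P) ^ (?p - 1)"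
        by (metis power_minus_mult mult.commute)
      then show ?thesis using True by simp
    next
      case False
      then show ?thesis using prod_roots_of_unity[OF p(1) psi_power_CHAR[of "lam f P"] False, of "u ^ degree P"]
        by (simp add: mult.commute power_mult[symmetric])
    qed
    finally show ?thesis by (simp add: eulerfac_def)
  qed
  have "((\<lambda>S. \<Prod>a<?p. L a * (\<Prod>P\<in>S. 1 - chi (of_nat a) f P * u ^ degree P)) \<longlongrightarrow> (\<Prod>a<?p. 1)) (finite_subsets_at_top monic_irreducibles)"
    unfolding L_def by (intro tendsto_prod euler_tendsto u)
  then have lim: "((\<lambda>S. (\<Prod>a<?p. L a) * (\<Prod>P\<in>S. E P)) \<longlongrightarrow> 1) (finite_subsets_at_top monic_irreducibles)"
  proof -
    have "(\<Prod>a<?p. L a * (\<Prod>P\<in>S. 1 - chi (of_nat a) f P * u ^ degree P)) = (\<Prod>a<?p. L a) * (\<Prod>P\<in>S. E P)" for S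
      unfolding prod.distrib E_def by (subst prod.swap) (rule refl)
    moreover assume "((\<lambda>S. \<Prod>a<?p. L a * (\<Prod>P\<in>S. 1 - chi (of_nat a) f P * u ^ degree P)) \<longlongrightarrow> (\<Prod>a<?p. 1)) (finite_subsets_at_top monic_irreducibles)"
    ultimately show ?thesis by simp
  qed
  have "((\<lambda>S. (\<Prod>a<?p. L a) / ((\<Prod>a<?p. L a) * (\<Prod>P\<in>S. E P))) \<longlongrightarrow> (\<Prod>a<?p. L a) / 1) (finite_subsets_at_top monic_irreducibles)"
    by (intro tendsto_divide tendsto_const lim) simp
  \<comment> \<open>A zero factor would make the net constantly \<open>0\<close>, against its limit
    \<open>1\<close>.\<close>
  moreover have nz: "(\<Prod>a<?p. L a) \<noteq> 0"
  proof
    assume z: "(\<Prod>a<?p. L a) = 0"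
    have "((\<lambda>S :: 'g poly set. 0 :: complex) \<longlongrightarrow> 1) (finite_subsets_at_top monic_irreducibles)"
      using lim unfolding z mult_zero_left .
    from tendsto_unique[OF finite_subsets_at_top_neq_bot this tendsto_const] show False by simp
  qed
  ultimately have "((\<lambda>S. inverse (\<Prod>P\<in>S. E P)) \<longlongrightarrow> (\<Prod>a<?p. L a)) (finite_subsets_at_top monic_irreducibles)"
    unfolding nonzero_divide_mult_cancel_left[OF nz] inverse_eq_divide div_by_1 by blast
  then have "((\<lambda>S. \<Prod>P\<in>S. eulerfac f u P) \<longlongrightarrow> (\<Prod>a<?p. L a)) (finite_subsets_at_top monic_irreducibles)"
  proof (rule Lim_transform_eventually)
    show "\<forall>\<^sub>F S in finite_subsets_at_top monic_irreducibles. inverse (\<Prod>P\<in>S. E P) = (\<Prod>P\<in>S. eulerfac f u P)"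
      unfolding eventually_finite_subsets_at_top
      by (intro exI[of _ "{}"]) (auto simp: prod_inversef[symmetric] o_def intro!: prod.cong E[symmetric])
  qed
  also have "(\<Prod>a<?p. L a) = L 0 * (\<Prod>a\<in>{1..<?p}. L a)"
  proof -
    have "{..<?p} = insert 0 {1..<?p}" using p by auto
    then show ?thesis by simp
  qed
  also have "L 0 = 1 / (1 - of_nat CARD('g) * u)"
  proof -
    have "L 0 = suminf (\<lambda>n. (of_nat CARD('g) * u) ^ n)"
      by (simp add: L_def asum_def chi_def card_monics power_mult_distrib)
    also have "\<dots> = 1 / (1 - of_nat CARD('g) * u)"
      by (rule suminf_geometric) (use u in \<open>simp add: norm_mult\<close>)
    finally show ?thesis .
  qed
  also have "(\<Prod>a\<in>{1..<?p}. L a) = Lprod f u" unfolding Lprod_def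
  proof (rule prod.cong[OF refl])
    fix a assume a: "a \<in> {1..<?p}"
    interpret fe f "of_nat a" by unfold_locales (use a f of_nat_neq_0_less_CHAR in auto)
    show "L a = (\<Sum>n<degree f. asum (of_nat a) f n * u ^ n)"
      unfolding L_def by (rule suminf_finite) (auto simp: asum_0 not_less)
  qed
  finally show ?thesis by simp
qed

subsection \<open>Unordered products over fibers\<close>

text \<open>Convergence over all finite subsets has to be known before the limit may be computed
  fibre by fibre. It comes from absolute summability of logarithms, the bound \<open>1 / 2\<close>
  being what gives \<open>cmod (g v) \<le> 2 * cmod (x v)\<close>.\<close>

lemma prod_tendsto_fibers:
  fixes x :: "'v \<Rightarrow> complex" and Fib :: "'i \<Rightarrow> 'v set"
  assumes A: "A = insert w (\<Union>i\<in>I. Fib i)" and w: "w \<notin> (\<Union>i\<in>I. Fib i)"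
    and disj: "disjoint_family_on Fib I" and fin: "\<And>i. i \<in> I \<Longrightarrow> finite (Fib i)"
    and x: "\<And>v. v \<in> A \<Longrightarrow> cmod (x v) < 1 / 2" and sum: "(\<lambda>v. cmod (x v)) summable_on A"
    and lim: "((\<lambda>S. \<Prod>i\<in>S. \<Prod>v\<in>Fib i. inverse (1 - x v)) \<longlongrightarrow> l) (finite_subsets_at_top I)"
  shows "infprod (\<lambda>v. inverse (1 - x v)) A = inverse (1 - x w) * l"
proof -
  let ?f = "\<lambda>v. inverse (1 - x v)"
  have nz: "1 - x v \<noteq> 0" if "v \<in> A" for v
    using x[OF that] by auto
  define g where "g v = - Ln (1 - x v)" for v
  have eg: "exp (g v) = ?f v" if "v \<in> A" for v using nz[OF that] by (simp add: g_def exp_minus)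
  have gb: "cmod (g v) \<le> 2 * cmod (x v)" if "v \<in> A" for v
    using norm_Ln_le[of "- x v"] x[OF that] by (simp add: g_def)
  have "(\<lambda>v. 2 * cmod (x v)) summable_on A" using sum by (rule summable_on_cmult_right)
  then have "(\<lambda>v. norm (g v)) summable_on A"
    by (rule summable_on_comparison_test) (use gb in auto)
  then have "g summable_on A" by (rule abs_summable_summable)
  then obtain \<sigma> where "(g has_sum \<sigma>) A" by (auto simp: summable_on_def)
  then have "(sum g \<longlongrightarrow> \<sigma>) (finite_subsets_at_top A)" by (simp add: has_sum_def)
  then have "((\<lambda>F. exp (sum g F)) \<longlongrightarrow> exp \<sigma>) (finite_subsets_at_top A)" by (rule tendsto_exp)
  then have P: "(prod ?f \<longlongrightarrow> exp \<sigma>) (finite_subsets_at_top A)"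
  proof (rule Lim_transform_eventually)
    show "\<forall>\<^sub>F F in finite_subsets_at_top A. exp (sum g F) = prod ?f F"
      unfolding eventually_finite_subsets_at_top
      by (intro exI[of _ "{}"]) (auto simp: exp_sum intro!: prod.cong eg)
  qed
  \<comment> \<open>Unions of finitely many whole fibres together with \<open>w\<close> are cofinal
    among the finite subsets of \<open>A\<close>.\<close>
  define \<Phi> where "\<Phi> S = insert w (\<Union>i\<in>S. Fib i)" for S
  have "filterlim \<Phi> (finite_subsets_at_top A) (finite_subsets_at_top I)"
    unfolding filterlim_finite_subsets_at_top eventually_finite_subsets_at_top
  proof (intro allI impI)
    fix Z assume Z: "finite Z \<and> Z \<subseteq> A"
    have "\<forall>v\<in>Z - {w}. \<exists>i. i \<in> I \<and> v \<in> Fib i" using Z A by auto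
    then obtain h where h: "\<And>v. v \<in> Z - {w} \<Longrightarrow> h v \<in> I \<and> v \<in> Fib (h v)" by metis
    show "\<exists>S0. finite S0 \<and> S0 \<subseteq> I \<and> (\<forall>S. finite S \<and> S0 \<subseteq> S \<and> S \<subseteq> I \<longrightarrow> finite (\<Phi> S) \<and> Z \<subseteq> \<Phi> S \<and> \<Phi> S \<subseteq> A)"
    proof (intro exI[of _ "h ` (Z - {w})"] conjI allI impI)
      fix S assume S: "finite S \<and> h ` (Z - {w}) \<subseteq> S \<and> S \<subseteq> I"
      show "finite (\<Phi> S)" using S fin by (auto simp: \<Phi>_def)
      show "Z \<subseteq> \<Phi> S" using S h by (auto simp: \<Phi>_def)
      show "\<Phi> S \<subseteq> A" using S by (auto simp: \<Phi>_def A)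
    qed (use Z h in auto)
  qed
  then have "((\<lambda>S. prod ?f (\<Phi> S)) \<longlongrightarrow> exp \<sigma>) (finite_subsets_at_top I)"
    using P by (rule filterlim_compose[rotated])
  moreover have "((\<lambda>S. prod ?f (\<Phi> S)) \<longlongrightarrow> inverse (1 - x w) * l) (finite_subsets_at_top I)"
  proof (rule Lim_transform_eventually[OF tendsto_mult[OF tendsto_const lim]])
    show "\<forall>\<^sub>F S in finite_subsets_at_top I. inverse (1 - x w) * (\<Prod>i\<in>S. \<Prod>v\<in>Fib i. inverse (1 - x v)) = prod ?f (\<Phi> S)"
      unfolding eventually_finite_subsets_at_top
    proof (intro exI[of _ "{}"] conjI allI impI)
      fix S assume S: "finite S \<and> {} \<subseteq> S \<and> S \<subseteq> I"
      have "(\<Prod>v\<in>(\<Union>i\<in>S. Fib i). ?f v) = (\<Prod>i\<in>S. \<Prod>v\<in>Fib i. ?f v)"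
        by (rule prod.UNION_disjoint) (use S fin disj in \<open>auto simp: disjoint_family_on_def subset_iff\<close>)
      moreover have "finite (\<Union>i\<in>S. Fib i)" "w \<notin> (\<Union>i\<in>S. Fib i)" using S fin w by auto
      ultimately show "inverse (1 - x w) * (\<Prod>i\<in>S. \<Prod>v\<in>Fib i. inverse (1 - x v)) = prod ?f (\<Phi> S)"
        by (simp add: \<Phi>_def)
    qed auto
  qed
  ultimately have "exp \<sigma> = inverse (1 - x w) * l"
    by (intro tendsto_unique[OF finite_subsets_at_top_neq_bot])
  then show ?thesis using infprod_eqI[OF P] by simp
qed

 

subsection \<open>Valuation rings\<close>

definition ring_closed :: "'a::field set \<Rightarrow> bool" where
  "ring_closed A \<longleftrightarrow> 1 \<in> A \<and> (\<forall>x\<in>A. \<forall>y\<in>A. x - y \<in> A \<and> x * y \<in> A)"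

lemma ring_closedD:
  assumes "ring_closed A"
  shows "1 \<in> A" "0 \<in> A" "x \<in> A \<Longrightarrow> y \<in> A \<Longrightarrow> x - y \<in> A" "x \<in> A \<Longrightarrow> y \<in> A \<Longrightarrow> x * y \<in> A"
    "x \<in> A \<Longrightarrow> - x \<in> A" "x \<in> A \<Longrightarrow> y \<in> A \<Longrightarrow> x + y \<in> A"
proof -
  show 1: "1 \<in> A" and d: "\<And>x y. x \<in> A \<Longrightarrow> y \<in> A \<Longrightarrow> x - y \<in> A" and "x \<in> A \<Longrightarrow> y \<in> A \<Longrightarrow> x * y \<in> A"
    using assms by (auto simp: ring_closed_def)
  show 0: "0 \<in> A" using d[OF 1 1] by simp
  show m: "- x \<in> A" if "x \<in> A" for x using d[OF 0 that] by simp
  show "x + y \<in> A" if "x \<in> A" "y \<in> A" using d[OF that(1) m[OF that(2)]] by simp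
qed

lemma ring_closed_power: "ring_closed A \<Longrightarrow> x \<in> A \<Longrightarrow> x ^ n \<in> A"
  by (induction n) (auto intro: ring_closedD)

lemma ring_closed_sum: "ring_closed A \<Longrightarrow> (\<And>i. i \<in> S \<Longrightarrow> h i \<in> A) \<Longrightarrow> sum h S \<in> A"
  by (induction S rule: infinite_finite_induct) (auto intro: ring_closedD)

lemma ring_closed_prod: "ring_closed A \<Longrightarrow> (\<And>i. i \<in> S \<Longrightarrow> h i \<in> A) \<Longrightarrow> prod h S \<in> A"
  by (induction S rule: infinite_finite_induct) (auto intro: ring_closedD)

definition coeffs_in :: "'a::field set \<Rightarrow> 'a poly \<Rightarrow> bool" where "coeffs_in V p \<longleftrightarrow> (\<forall>i. coeff p i \<in> V)"

lemma ring_closed_adjoin: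
  assumes V: "ring_closed V"
  shows "ring_closed {poly p z | p. coeffs_in V p}"
  unfolding ring_closed_def
proof (intro conjI ballI)
  show "1 \<in> {poly p z | p. coeffs_in V p}"
    by (rule CollectI, rule exI[of _ 1]) (use ring_closedD[OF V] in \<open>auto simp: coeffs_in_def coeff_1\<close>)
  fix x y assume "x \<in> {poly p z | p. coeffs_in V p}" "y \<in> {poly p z | p. coeffs_in V p}"
  then obtain p q where pq: "x = poly p z" "y = poly q z" "coeffs_in V p" "coeffs_in V q" by auto
  show "x - y \<in> {poly p z | p. coeffs_in V p}"
    by (rule CollectI, rule exI[of _ "p - q"]) (use ring_closedD[OF V] pq in \<open>auto simp: coeffs_in_def\<close>)
  show "x * y \<in> {poly p z | p. coeffs_in V p}"
    by (rule CollectI, rule exI[of _ "p * q"])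
      (use ring_closedD[OF V] pq in \<open>auto simp: coeffs_in_def coeff_mult intro!: ring_closed_sum[OF V]\<close>)
qed

text \<open>The descent step of Chevalley's extension theorem.\<close>

lemma shorten_relation:
  fixes V :: "'a::field set"
  assumes V: "ring_closed V" and x: "x \<in> V" "x \<noteq> 0" and z: "z \<noteq> 0"
    and p: "coeffs_in V p" "poly p z = inverse x" "degree p > 0"
    and p': "coeffs_in V p'" "poly p' (inverse z) = inverse x" "degree p' \<le> degree p"
    and u: "1 - x * coeff p' 0 \<noteq> 0" "inverse (1 - x * coeff p' 0) \<in> V"
  shows "\<exists>p2. coeffs_in V p2 \<and> poly p2 z = inverse x \<and> degree p2 < degree p"
proof -
  define n where "n = degree p"
  define k where "k = degree p'"
  define e where "e = inverse (1 - x * coeff p' 0)"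
  define a where "a = coeff p n * x * e"
  \<comment> \<open>The relation for \<open>inverse z\<close>, multiplied by \<open>z ^ n\<close>,
    expresses \<open>z ^ n\<close> as \<open>x * e\<close> times a polynomial in \<open>z\<close> of
    degree below \<open>n\<close>; this is substituted for the leading term of
    \<open>p\<close>.\<close>
  define r where "r = (\<Sum>i\<in>{1..k}. Polynomial.monom (coeff p' i) (n - i))"
  define p2 where "p2 = (p - Polynomial.monom (coeff p n) n) + Polynomial.smult a r"
  have kn: "k \<le> n" using p' by (simp add: k_def n_def)
  have "inverse x = (\<Sum>i\<le>k. coeff p' i * inverse z ^ i)" using p'(2) by (simp add: poly_altdef k_def)
  also have "{..k} = insert 0 {1..k}" by auto
  finally have "inverse x = coeff p' 0 + (\<Sum>i\<in>{1..k}. coeff p' i * inverse z ^ i)" by simp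
  then have "x * inverse x = x * coeff p' 0 + x * (\<Sum>i\<in>{1..k}. coeff p' i * inverse z ^ i)"
    by (simp add: distrib_left)
  then have "1 - x * coeff p' 0 = x * (\<Sum>i\<in>{1..k}. coeff p' i * inverse z ^ i)"
    using x by (metis add_diff_cancel_left' right_inverse)
  then have "1 = x * e * (\<Sum>i\<in>{1..k}. coeff p' i * inverse z ^ i)" using u by (simp add: e_def field_simps)
  then have "z ^ n = x * e * ((\<Sum>i\<in>{1..k}. coeff p' i * inverse z ^ i) * z ^ n)"
    by (simp add: mult.assoc[symmetric])
  also have "(\<Sum>i\<in>{1..k}. coeff p' i * inverse z ^ i) * z ^ n = poly r z"
    unfolding r_def poly_sum poly_monom sum_distrib_right
  proof (rule sum.cong[OF refl])
    fix i assume "i \<in> {1..k}"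
    then have "z ^ n = z ^ i * z ^ (n - i)" using kn by (simp add: power_add[symmetric])
    then show "coeff p' i * inverse z ^ i * z ^ n = coeff p' i * z ^ (n - i)"
      using z by (simp add: power_inverse)
  qed
  finally have zn: "z ^ n = x * e * poly r z" .
  have "poly p2 z = inverse x - coeff p n * z ^ n + a * poly r z"
    by (simp add: p2_def poly_monom p(2))
  also have "\<dots> = inverse x" unfolding zn a_def by simp
  finally have 1: "poly p2 z = inverse x" .
  have cr: "coeff r j \<in> V" for j unfolding r_def coeff_sum
    using p'(1) ring_closedD[OF V] by (intro ring_closed_sum[OF V]) (auto simp: coeffs_in_def)
  have aV: "a \<in> V" unfolding a_def e_def using ring_closedD[OF V] p x u by (auto simp: coeffs_in_def)
  have 2: "coeffs_in V p2"
    using ring_closedD[OF V] p(1) cr aV by (auto simp: coeffs_in_def p2_def)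
  have "degree p2 < n"
  proof (rule degree_lessI)
    show "p2 \<noteq> 0 \<or> n > 0" using p n_def by simp
    show "\<forall>j\<ge>n. coeff p2 j = 0"
    proof (intro allI impI)
      fix j assume j: "j \<ge> n"
      have "coeff r j = 0" unfolding r_def coeff_sum
        by (rule sum.neutral) (use j kn in auto)
      moreover have "coeff p j - coeff (Polynomial.monom (coeff p n) n) j = 0"
        using j by (cases "j = n") (auto simp: n_def coeff_eq_0)
      ultimately show "coeff p2 j = 0" by (simp add: p2_def)
    qed
  qed
  then show ?thesis using 1 2 n_def by blast
qed

text \<open>Zorn's lemma yields a ring \<open>V\<close> that is maximal subject to
  \<open>inverse x \<notin> V\<close>. For \<open>z\<close> outside \<open>V\<close> the ring
  \<open>V[z]\<close> must then contain \<open>inverse x\<close>. If neither \<open>z\<close> nor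
  \<open>inverse z\<close> belonged to \<open>V\<close>, both would give such relations, and the
  longer of two relations of minimal degree could be shortened.\<close>

lemma chevalley:
  fixes A :: "'a::field set"
  assumes A: "ring_closed A" and x: "x \<in> A" "inverse x \<notin> A"
  obtains V where "ring_closed V" "A \<subseteq> V" "\<And>z. z \<in> V \<or> inverse z \<in> V" "inverse x \<notin> V"
proof -
  have x0: "x \<noteq> 0" using x ring_closedD(2)[OF A] by auto
  define \<A> where "\<A> = {B. ring_closed B \<and> A \<subseteq> B \<and> inverse x \<notin> B}"
  have "A \<in> \<A>" using assms by (simp add: \<A>_def)
  have "\<exists>M\<in>\<A>. \<forall>Z\<in>\<A>. M \<subseteq> Z \<longrightarrow> Z = M"
  proof (rule subset_Zorn_nonempty)
    show "\<A> \<noteq> {}" using \<open>A \<in> \<A>\<close> by blast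
    fix C assume C: "C \<noteq> {}" "subset.chain \<A> C"
    then have CA: "C \<subseteq> \<A>" and lin: "\<And>Z Y. Z \<in> C \<Longrightarrow> Y \<in> C \<Longrightarrow> Z \<subseteq> Y \<or> Y \<subseteq> Z"
      by (auto simp: subset_chain_def)
    have "ring_closed (\<Union>C)" unfolding ring_closed_def
    proof (intro conjI ballI)
      show "1 \<in> \<Union>C" using C(1) CA by (auto simp: \<A>_def ring_closed_def)
      fix u v assume "u \<in> \<Union>C" "v \<in> \<Union>C"
      then obtain B B' where "B \<in> C" "u \<in> B" "B' \<in> C" "v \<in> B'" by auto
      then obtain B where B: "B \<in> C" "u \<in> B" "v \<in> B" using lin[of B B'] by blast
      then have "ring_closed B" using CA by (auto simp: \<A>_def)
      then have "u - v \<in> B" "u * v \<in> B" using B by (simp_all add: ring_closedD)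
      then show "u - v \<in> \<Union>C" "u * v \<in> \<Union>C" using B by blast+
    qed
    moreover have "A \<subseteq> \<Union>C" using C(1) CA by (auto simp: \<A>_def)
    moreover have "inverse x \<notin> \<Union>C" using CA by (auto simp: \<A>_def)
    ultimately show "\<Union>C \<in> \<A>" by (simp add: \<A>_def)
  qed
  then obtain V where V: "V \<in> \<A>" and max: "\<And>Z. Z \<in> \<A> \<Longrightarrow> V \<subseteq> Z \<Longrightarrow> Z = V" by blast
  have rc: "ring_closed V" and AV: "A \<subseteq> V" and nx: "inverse x \<notin> V" using V by (auto simp: \<A>_def)
  note R = ring_closedD[OF rc]
  have xV: "x \<in> V" using x AV by blast
  have adj: "\<exists>p. coeffs_in V p \<and> poly p z = inverse x" if z: "z \<notin> V" for z
  proof (rule ccontr)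
    assume no: "\<not> ?thesis"
    define Z where "Z = {poly p z | p. coeffs_in V p}"
    have "V \<subseteq> Z"
    proof
      fix v assume "v \<in> V"
      then have "coeffs_in V [:v:]" using R(2) by (auto simp: coeffs_in_def coeff_pCons split: nat.splits)
      then show "v \<in> Z" unfolding Z_def by (intro CollectI exI[of _ "[:v:]"]) simp
    qed
    moreover have "Z \<in> \<A>" using no ring_closed_adjoin[OF rc, of z] \<open>V \<subseteq> Z\<close> AV by (auto simp: \<A>_def Z_def)
    ultimately have "Z = V" using max by blast
    moreover have "z \<in> Z" unfolding Z_def using R
      by (intro CollectI exI[of _ "[:0,1:]"]) (auto simp: coeffs_in_def coeff_pCons split: nat.splits)
    ultimately show False using z by simp
  qed
  \<comment> \<open>Put \<open>s = 1 - x * v\<close>. A relation for \<open>inverse s\<close>,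
    cleared by \<open>s ^ n\<close>, puts \<open>inverse x * s ^ n\<close> into \<open>V\<close>; as
    \<open>s ^ n\<close> is \<open>1\<close> modulo \<open>x\<close>, this would put
    \<open>inverse x\<close> there too.\<close>
  have unit: "1 - x * v \<noteq> 0 \<and> inverse (1 - x * v) \<in> V" if v: "v \<in> V" for v
  proof
    show nz: "1 - x * v \<noteq> 0"
    proof
      assume "1 - x * v = 0"
      then have "v = inverse x" using x0 by (simp add: field_simps)
      then show False using v nx by simp
    qed
    show "inverse (1 - x * v) \<in> V"
    proof (rule ccontr)
      let ?s = "1 - x * v"
      assume "inverse ?s \<notin> V"
      then obtain p where p: "coeffs_in V p" "poly p (inverse ?s) = inverse x" using adj by blast
      have sV: "?s \<in> V" using R v xV by auto
      let ?n = "degree p"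
      have "inverse x * ?s ^ ?n = (\<Sum>i\<le>?n. coeff p i * (inverse ?s ^ i * ?s ^ ?n))"
        unfolding p(2)[symmetric] poly_altdef by (simp add: sum_distrib_right mult.assoc)
      also have "\<dots> = (\<Sum>i\<le>?n. coeff p i * ?s ^ (?n - i))"
      proof (rule sum.cong[OF refl])
        fix i assume "i \<in> {..?n}"
        then have "?s ^ ?n = ?s ^ i * ?s ^ (?n - i)" by (simp add: power_add[symmetric])
        then show "coeff p i * (inverse ?s ^ i * ?s ^ ?n) = coeff p i * ?s ^ (?n - i)"
          using nz by (simp add: power_inverse)
      qed
      also have "\<dots> \<in> V" using p(1) sV R ring_closed_power[OF rc] by (intro ring_closed_sum[OF rc]) (auto simp: coeffs_in_def)
      finally have 1: "inverse x * ?s ^ ?n \<in> V" .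
      have "\<exists>w\<in>V. ?s ^ n = 1 + x * w" for n
      proof (induction n)
        case 0 then show ?case using R(2) by (intro bexI[of _ 0]) auto
      next
        case (Suc n)
        then obtain w where w: "w \<in> V" "?s ^ n = 1 + x * w" by blast
        have "?s ^ Suc n = 1 + x * (w - v - v * x * w)" using w(2) by (simp add: algebra_simps)
        moreover have "w - v - v * x * w \<in> V" using w v xV R by auto
        ultimately show ?case by blast
      qed
      then obtain w where w: "w \<in> V" "?s ^ ?n = 1 + x * w" by blast
      have "inverse x = inverse x * ?s ^ ?n - w" unfolding w(2) using x0 by (simp add: field_simps)
      also have "\<dots> \<in> V" using 1 w R by auto
      finally show False using nx by simp
    qed
  qed
  have "z \<in> V \<or> inverse z \<in> V" for z
  proof (rule ccontr)
    assume no: "\<not> ?thesis"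
    then have z0: "z \<noteq> 0" using R by auto
    define Q where "Q w p \<longleftrightarrow> coeffs_in V p \<and> poly p w = inverse x" for w p
    have min: "\<exists>p. Q w p \<and> (\<forall>p'. Q w p' \<longrightarrow> degree p \<le> degree p')" if wV: "w \<notin> V" for w
    proof -
      obtain p0 where "Q w p0" using adj[OF wV] by (auto simp: Q_def)
      then show ?thesis using ex_has_least_nat[of "Q w" p0 degree] by blast
    qed
    obtain p where p: "Q z p" "\<And>p'. Q z p' \<Longrightarrow> degree p \<le> degree p'" using min[of z] no by blast
    obtain p' where p': "Q (inverse z) p'" "\<And>p''. Q (inverse z) p'' \<Longrightarrow> degree p' \<le> degree p''" using min[of "inverse z"] no by blast
    have pos: "degree r > 0" if "Q w r" for w r
    proof (rule ccontr)
      assume "\<not> degree r > 0"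
      then obtain c where "r = [:c:]" by (auto elim: degree_eq_zeroE)
      then have "inverse x = coeff r 0" using that by (simp add: Q_def)
      then show False using that nx unfolding Q_def coeffs_in_def by metis
    qed
    have c0: "1 - x * coeff r 0 \<noteq> 0 \<and> inverse (1 - x * coeff r 0) \<in> V" if "Q w r" for w r
      using unit that by (simp add: Q_def coeffs_in_def)
    show False
    proof (cases "degree p' \<le> degree p")
      case True
      have "\<exists>p2. coeffs_in V p2 \<and> poly p2 z = inverse x \<and> degree p2 < degree p"
        by (rule shorten_relation[OF rc xV x0 z0 _ _ pos[OF p(1)] _ _ True])
           (use p(1) p'(1) c0[OF p'(1)] in \<open>auto simp: Q_def\<close>)
      then show False using p(2) by (auto simp: Q_def not_less[symmetric])
    next
      case False
      have "\<exists>p2. coeffs_in V p2 \<and> poly p2 (inverse z) = inverse x \<and> degree p2 < degree p'"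
        by (rule shorten_relation[OF rc xV x0 _ _ _ pos[OF p'(1)], where p' = p])
           (use z0 p(1) p'(1) False c0[OF p(1)] in \<open>auto simp: Q_def\<close>)
      then show False using p'(2) by (auto simp: Q_def not_less[symmetric])
    qed
  qed
  then show thesis using that[OF rc AV _ nx] by blast
qed

text \<open>No value group is introduced: \<open>maxi\<close> and \<open>units\<close> suffice, and
  fractional orders are compared after raising to a power, by \<open>power_in_V\<close> and
  \<open>power_in_maxi\<close>.\<close>

locale vr =
  fixes L V :: "'a::field set"
  assumes L: "ring_closed L" "\<And>z. z \<in> L \<Longrightarrow> inverse z \<in> L"
    and V: "ring_closed V" "V \<subseteq> L" and val: "\<And>z. z \<in> L \<Longrightarrow> z \<in> V \<or> inverse z \<in> V"
begin

lemmas VR = ring_closedD[OF V(1)]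
lemmas LR = ring_closedD[OF L(1)]

definition maxi :: "'a set" where "maxi = {z\<in>V. z = 0 \<or> inverse z \<notin> V}"

lemma maxi_V: "z \<in> maxi \<Longrightarrow> z \<in> V" by (simp add: maxi_def)

lemma maxi_0 [simp]: "0 \<in> maxi" using VR by (simp add: maxi_def)

lemma one_notin_maxi [simp]: "1 \<notin> maxi" using VR by (simp add: maxi_def)

lemma unitD: "z \<in> V \<Longrightarrow> z \<notin> maxi \<Longrightarrow> z \<noteq> 0 \<and> inverse z \<in> V \<and> inverse z \<notin> maxi"
  by (auto simp: maxi_def)

lemma maxi_mult: "z \<in> maxi \<Longrightarrow> v \<in> V \<Longrightarrow> z * v \<in> maxi"
proof -
  assume z: "z \<in> maxi" and v: "v \<in> V"
  have "z * v \<in> V" by (rule VR(4)[OF maxi_V[OF z] v])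
  moreover have "inverse z \<in> V" if "inverse (z * v) \<in> V" "z * v \<noteq> 0"
  proof -
    have "inverse z = v * inverse (z * v)" using that by simp
    then show ?thesis using VR v that by metis
  qed
  ultimately show ?thesis using z by (auto simp: maxi_def)
qed

lemma maxi_add: "a \<in> maxi \<Longrightarrow> b \<in> maxi \<Longrightarrow> a + b \<in> maxi"
proof -
  have aux: "a + b \<in> maxi" if "a \<in> maxi" "b \<in> maxi" "a \<noteq> 0" "b / a \<in> V" for a b
  proof -
    have "a + b = a * (1 + b / a)" using that by (simp add: field_simps)
    then show ?thesis using maxi_mult[OF that(1), of "1 + b / a"] VR that by simp
  qed
  assume a: "a \<in> maxi" and b: "b \<in> maxi"
  show ?thesis
  proof (cases "a = 0 \<or> b = 0")
    case True then show ?thesis using a b by auto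
  next
    case False
    have "a \<in> L" "b \<in> L" using a b maxi_V V(2) by blast+
    then have "b / a \<in> L" unfolding divide_inverse by (intro LR L(2))
    then have "b / a \<in> V \<or> a / b \<in> V" using val[of "b / a"] by (simp add: inverse_divide)
    then show ?thesis using aux[of a b] aux[of b a] a b False by (auto simp: add.commute)
  qed
qed

lemma maxi_uminus: "a \<in> maxi \<Longrightarrow> - a \<in> maxi"
  using maxi_mult[of a "- 1"] VR by simp

lemma maxi_diff: "a \<in> maxi \<Longrightarrow> b \<in> maxi \<Longrightarrow> a - b \<in> maxi"
  using maxi_add[of a "- b"] maxi_uminus by simp

lemma maxi_sum: "(\<And>i. i \<in> S \<Longrightarrow> h i \<in> maxi) \<Longrightarrow> sum h S \<in> maxi"
  by (induction S rule: infinite_finite_induct) (auto intro: maxi_add)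

lemma maxi_prime: "a \<in> V \<Longrightarrow> b \<in> V \<Longrightarrow> a * b \<in> maxi \<Longrightarrow> a \<in> maxi \<or> b \<in> maxi"
proof (rule ccontr)
  assume a: "a \<in> V" "b \<in> V" "a * b \<in> maxi" "\<not> (a \<in> maxi \<or> b \<in> maxi)"
  then have "a \<noteq> 0" "inverse a \<in> V" "b \<noteq> 0" "inverse b \<in> V" using unitD by blast+
  then have "inverse (a * b) \<in> V" "a * b \<noteq> 0" using VR by auto
  then show False using a by (auto simp: maxi_def)
qed

lemma maxi_prod_prime: "finite S \<Longrightarrow> (\<And>i. i \<in> S \<Longrightarrow> h i \<in> V) \<Longrightarrow> prod h S \<in> maxi \<Longrightarrow> \<exists>i\<in>S. h i \<in> maxi"
proof (induction S rule: finite_induct)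
  case (insert i S)
  have "prod h S \<in> V" using insert by (intro ring_closed_prod[OF V(1)]) auto
  then show ?case using insert maxi_prime[of "h i" "prod h S"] by auto
qed simp

lemma not_V_inverse_maxi: "z \<in> L \<Longrightarrow> z \<notin> V \<Longrightarrow> inverse z \<in> maxi"
proof -
  assume z: "z \<in> L" "z \<notin> V"
  then have "inverse z \<in> V" using val by blast
  then show ?thesis using z by (simp add: maxi_def)
qed

lemma maxi_inverse_not_V: "z \<in> maxi \<Longrightarrow> z \<noteq> 0 \<Longrightarrow> inverse z \<notin> V" by (auto simp: maxi_def)

definition units :: "'a set" where "units = {z\<in>V. z \<notin> maxi}"

lemma units_D: "z \<in> units \<Longrightarrow> z \<in> V" "z \<in> units \<Longrightarrow> z \<noteq> 0" by (auto simp: units_def)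

lemma units_inverse: "z \<in> units \<Longrightarrow> inverse z \<in> units" using unitD by (auto simp: units_def)

lemma units_mult: "a \<in> units \<Longrightarrow> b \<in> units \<Longrightarrow> a * b \<in> units"
  using maxi_prime VR by (auto simp: units_def)

lemma units_one: "1 \<in> units" using VR by (simp add: units_def)

lemma units_power: "a \<in> units \<Longrightarrow> a ^ n \<in> units"
  by (induction n) (auto intro: units_mult units_one)

lemma units_add_maxi: "a \<in> units \<Longrightarrow> b \<in> maxi \<Longrightarrow> a + b \<in> units"
proof -
  assume a: "a \<in> units" and b: "b \<in> maxi"
  have "a + b \<in> V" by (rule VR(6)[OF units_D(1)[OF a] maxi_V[OF b]])
  moreover have "a + b \<notin> maxi"
  proof
    assume "a + b \<in> maxi"
    then have "(a + b) - b \<in> maxi" using b by (rule maxi_diff)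
    then show False using a by (simp add: units_def)
  qed
  ultimately show ?thesis by (simp add: units_def)
qed

lemma power_maxi: "a \<in> maxi \<Longrightarrow> n > 0 \<Longrightarrow> a ^ n \<in> maxi"
proof -
  assume a: "a \<in> maxi" and n: "n > 0"
  have "a * a ^ (n - 1) \<in> maxi" by (rule maxi_mult[OF a ring_closed_power[OF V(1) maxi_V[OF a]]])
  then show ?thesis using n by (metis power_minus_mult mult.commute)
qed

lemma power_in_V: "z \<in> L \<Longrightarrow> n > 0 \<Longrightarrow> z ^ n \<in> V \<Longrightarrow> z \<in> V"
proof (rule ccontr)
  assume a: "z \<in> L" "n > 0" "z ^ n \<in> V" "z \<notin> V"
  then have "inverse z \<in> maxi" by (intro not_V_inverse_maxi)
  then have "inverse z ^ n \<in> maxi" using a by (intro power_maxi)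
  then have "inverse z ^ n * z ^ n \<in> maxi" using a by (intro maxi_mult)
  moreover have "z \<noteq> 0" using a VR by auto
  ultimately show False by (simp add: power_mult_distrib[symmetric])
qed

lemma power_in_maxi: "z \<in> L \<Longrightarrow> n > 0 \<Longrightarrow> z ^ n \<in> maxi \<Longrightarrow> z \<in> maxi"
proof -
  assume a: "z \<in> L" "n > 0" "z ^ n \<in> maxi"
  then have zV: "z \<in> V" using power_in_V maxi_V by blast
  show ?thesis
  proof (rule ccontr)
    assume "z \<notin> maxi"
    then have "z \<in> units" using zV by (simp add: units_def)
    then have "z ^ n \<in> units" by (rule units_power)
    then show False using a by (simp add: units_def)
  qed
qed

end

 

subsection \<open>Artin--Schreier extensions of the rational function field\<close>

definition emb :: "'g::field_gcd poly \<Rightarrow> 'g poly fract alg_closure" where "emb h = to_ac (to_fract h)"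

lemma emb_simps [simp]:
  "emb 0 = 0" "emb 1 = 1" "emb (a + b) = emb a + emb b" "emb (a * b) = emb a * emb b"
  "emb (a - b) = emb a - emb b" "emb a = 0 \<longleftrightarrow> a = 0" "emb a = emb b \<longleftrightarrow> a = b"
  by (simp_all add: emb_def)

lemma emb_power [simp]: "emb (a ^ n) = emb a ^ n" by (induction n) simp_all

lemma emb_sum: "emb (sum h S) = (\<Sum>i\<in>S. emb (h i))"
  by (induction S rule: infinite_finite_induct) simp_all

definition rhom :: "('a::comm_ring_1 \<Rightarrow> 'b::comm_ring_1) \<Rightarrow> bool" where
  "rhom h \<longleftrightarrow> h 0 = 0 \<and> h 1 = 1 \<and> (\<forall>a b. h (a + b) = h a + h b \<and> h (a * b) = h a * h b)"

text \<open>Serves both as evaluation \<open>ev\<close> at \<open>y\<close> in the extension and as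
  its reductions \<open>phi\<close> modulo a prime.\<close>

definition hev :: "('a::comm_ring_1 \<Rightarrow> 'b::comm_ring_1) \<Rightarrow> 'b \<Rightarrow> 'a poly \<Rightarrow> 'b" where
  "hev h z A = poly (map_poly h A) z"

context
  fixes h :: "'a::comm_ring_1 \<Rightarrow> 'b::comm_ring_1" and z :: 'b
  assumes h: "rhom h"
begin

lemma rhomD: "h 0 = 0" "h 1 = 1" "h (a + b) = h a + h b" "h (a * b) = h a * h b"
  using h by (auto simp: rhom_def)

lemma hev_0: "hev h z 0 = 0" by (simp add: hev_def)

lemma hev_pCons: "hev h z (pCons a A) = h a + z * hev h z A"
  by (simp add: hev_def map_poly_pCons rhomD)

lemma hev_const: "hev h z [:a:] = h a" by (simp add: hev_pCons hev_0)

lemma hev_1: "hev h z 1 = 1" using hev_const[of 1] by (simp add: rhomD one_pCons)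

lemma hev_add: "hev h z (A + B) = hev h z A + hev h z B"
  by (induction A B rule: poly_induct2) (simp_all add: hev_0 hev_pCons rhomD algebra_simps)

lemma hev_smult: "hev h z (Polynomial.smult a B) = h a * hev h z B"
  by (induction B) (simp_all add: hev_0 hev_pCons rhomD algebra_simps)

lemma hev_mult: "hev h z (A * B) = hev h z A * hev h z B"
  by (induction A) (simp_all add: hev_0 hev_pCons rhomD hev_add hev_smult algebra_simps)

lemma hev_diff: "hev h z (A - B) = hev h z A - hev h z B"
  using hev_add[of "A - B" B] by simp

lemma hev_power: "hev h z (A ^ n) = hev h z A ^ n"
  by (induction n) (simp_all add: hev_1 hev_mult)

lemma hev_prod: "hev h z (\<Prod>i\<in>S. A i) = (\<Prod>i\<in>S. hev h z (A i))"
  by (induction S rule: infinite_finite_induct) (simp_all add: hev_1 hev_mult)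

lemma hev_monom: "hev h z (Polynomial.monom 1 n) = z ^ n"
  by (simp add: hev_def map_poly_monom rhomD poly_monom)

lemma hev_sum: "degree A < n \<Longrightarrow> hev h z A = (\<Sum>j<n. h (coeff A j) * z ^ j)"
proof -
  assume "degree A < n"
  then have "degree (map_poly h A) < n" 
    using degree_le[of "degree A" "map_poly h A"] by (simp add: coeff_map_poly rhomD coeff_eq_0)
  then have "hev h z A = (\<Sum>j<n. coeff (map_poly h A) j * z ^ j)"
    unfolding hev_def poly_altdef by (intro sum.mono_neutral_left) (auto simp: coeff_eq_0)
  then show ?thesis by (simp add: coeff_map_poly rhomD)
qed

end

lemma rhom_emb: "rhom emb" by (simp add: rhom_def)

definition nrm :: "'a::field set \<Rightarrow> nat" where
  "nrm V = card ((\<lambda>z. {w\<in>V. w - z \<in> vr.maxi V}) ` V)"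

lemma (in vr) nrm_eq:
  assumes "\<And>z w. z \<in> V \<Longrightarrow> w \<in> V \<Longrightarrow> \<rho> z = \<rho> w \<longleftrightarrow> w - z \<in> maxi"
  shows "nrm V = card (\<rho> ` V)"
proof -
  have "(\<lambda>z. {w\<in>V. w - z \<in> maxi}) ` V = (\<lambda>r. {w\<in>V. \<rho> w = r}) ` (\<rho> ` V)"
    unfolding image_image by (intro image_cong refl Collect_cong) (auto simp: assms[symmetric])
  moreover have "inj_on (\<lambda>r. {w\<in>V. \<rho> w = r}) (\<rho> ` V)"
    by (rule inj_onI) blast
  ultimately show ?thesis unfolding nrm_def by (simp add: card_image)
qed

locale as_field =
  fixes f :: "'g::{finite_field,field_gcd} poly" and y :: "'g poly fract alg_closure" and p :: nat
  assumes p_eq: "p = CHAR('g)" and f: "\<not> p dvd degree f" and y: "y ^ p - y = emb f"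
begin

abbreviation "ev \<equiv> hev emb y"
abbreviation "T \<equiv> emb ([:0, 1:] :: 'g poly)"

lemma p: "prime p" "p > 1" "p > 0"
proof -
  show "prime p" by (simp add: p_eq)
  then show "p > 1" "p > 0" using prime_gt_1_nat prime_gt_0_nat by blast+
qed

lemma f_deg: "degree f > 0"
proof (rule ccontr)
  assume "\<not> degree f > 0"
  then show False using f by simp
qed

lemmas ev_simps = hev_0[OF rhom_emb] hev_1[OF rhom_emb] hev_pCons[OF rhom_emb] hev_const[OF rhom_emb]
  hev_add[OF rhom_emb] hev_smult[OF rhom_emb] hev_mult[OF rhom_emb] hev_diff[OF rhom_emb]
  hev_power[OF rhom_emb] hev_monom[OF rhom_emb] hev_prod[OF rhom_emb]

definition m0 :: "'g poly poly" where "m0 = Polynomial.monom 1 p - Polynomial.monom 1 1 - [:f:]"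

lemma ev_m0: "ev m0 = 0"
  using y by (simp add: m0_def ev_simps del: One_nat_def)

lemma degree_m0: "degree m0 = p" and lead_coeff_m0: "coeff m0 p = 1"
proof -
  have "degree (Polynomial.monom 1 1 + [:f:] :: 'g poly poly) \<le> 1"
    by (intro degree_add_le degree_monom_le) simp
  then have "degree (Polynomial.monom 1 1 + [:f:] :: 'g poly poly) < degree (Polynomial.monom 1 p :: 'g poly poly)"
    using p by (simp add: degree_monom_eq)
  then have "degree (Polynomial.monom 1 p - (Polynomial.monom 1 1 + [:f:]) :: 'g poly poly) = degree (Polynomial.monom 1 p :: 'g poly poly)"
    by (metis add_uminus_conv_diff degree_add_eq_left degree_minus)
  then show "degree m0 = p" by (simp add: m0_def degree_monom_eq diff_diff_add)
  show "coeff m0 p = 1" using p by (simp add: m0_def coeff_pCons split: nat.splits)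
qed

text \<open>Pseudo-division multiplies by a power of the leading coefficient of \<open>m0\<close>,
  which is \<open>1\<close>, so it is an honest division although the coefficients form only a
  ring.\<close>

lemma reduce: obtains B C where "A = m0 * B + C" "degree C < p"
proof -
  have nz: "m0 \<noteq> 0" using lead_coeff_m0 by auto
  obtain B C where BC: "pseudo_divmod A m0 = (B, C)" by force
  have "A = m0 * B + C" "C = 0 \<or> degree C < degree m0"
    using pseudo_divmod[OF nz BC] by (simp_all add: degree_m0 lead_coeff_m0)
  then show thesis using that[of B C] p degree_m0 by auto
qed

text \<open>Denominators come from the polynomial ring alone, so that numerators can be reduced
  modulo \<open>m0\<close>; \<open>K_inverse\<close> shows that this already gives a field.\<close>

definition K :: "'g poly fract alg_closure set" where "K = {ev A / emb h | A h. h \<noteq> 0}"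

lemma K_I: "h \<noteq> 0 \<Longrightarrow> ev A / emb h \<in> K" by (auto simp: K_def)

lemma K_ev: "ev A \<in> K" using K_I[of 1 A] by simp

lemma K_emb: "emb h \<in> K" using K_ev[of "[:h:]"] by (simp add: ev_simps)

lemma K_y: "y \<in> K" using K_ev[of "[:0,1:]"] by (simp add: ev_simps)

lemma K_ring: "ring_closed K"
  unfolding ring_closed_def
proof (intro conjI ballI)
  show "1 \<in> K" using K_ev[of 1] by (simp add: ev_simps)
  fix u v assume "u \<in> K" "v \<in> K"
  then obtain A h B k where uv: "u = ev A / emb h" "v = ev B / emb k" "h \<noteq> 0" "k \<noteq> 0" by (auto simp: K_def)
  have "u - v = ev (Polynomial.smult k A - Polynomial.smult h B) / emb (h * k)"
    unfolding uv(1,2) using uv(3,4) by (simp add: ev_simps field_simps)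
  then show "u - v \<in> K" using K_I[of "h * k"] uv by simp
  have "u * v = ev (A * B) / emb (h * k)" using uv by (simp add: ev_simps)
  then show "u * v \<in> K" using K_I[of "h * k"] uv by simp
qed

text \<open>A Bezout relation between the numerator and the minimal polynomial of \<open>y\<close>
  over the rational function field inverts \<open>ev A\<close>. Clearing the denominators of its
  coefficients restores the shape required by \<open>K\<close>.\<close>

lemma K_inverse:
  assumes "z \<in> K" shows "inverse z \<in> K"
proof (cases "z = 0")
  case True then show ?thesis using assms by simp
next
  case False
  obtain A h where z: "z = ev A / emb h" "h \<noteq> 0" using assms by (auto simp: K_def)
  have nz: "ev A \<noteq> 0" using False z by auto
  have emb_eq: "to_ac \<circ> to_fract = (emb :: 'g poly \<Rightarrow> _)" by (auto simp: emb_def)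
  have ac: "poly (ac (map_poly to_fract B)) y = ev B" for B
    by (simp add: hev_def map_poly_map_poly emb_eq)
  have m0_nz: "map_poly to_fract m0 \<noteq> (0 :: 'g poly fract poly)"
  proof
    assume "map_poly to_fract m0 = (0 :: 'g poly fract poly)"
    then have "coeff (map_poly to_fract m0) p = (0 :: 'g poly fract)" by simp
    then show False by (simp add: coeff_map_poly lead_coeff_m0)
  qed
  obtain P where P: "P \<in> monic_irreducibles" "poly (ac P) y = 0"
    using minimal_polynomial_exists[OF m0_nz] ac[of m0] ev_m0 by metis
  have "\<not> P dvd map_poly to_fract A"
  proof
    assume "P dvd map_poly to_fract A"
    then obtain Q where "map_poly to_fract A = P * Q" by (elim dvdE)
    then have "poly (ac (map_poly to_fract A)) y = 0" using P by (simp add: ac_mult)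
    then show False using nz ac by simp
  qed
  then obtain U V where UV: "U * P + V * map_poly to_fract A = 1"
    using monic_irreducible_bezout[of P] P by (auto simp: monic_irreducibles_def)
  have "poly (ac (U * P + V * map_poly to_fract A)) y = 1" unfolding UV by simp
  then have 1: "poly (ac V) y * ev A = 1" using P by (simp add: ac_add ac_mult ac)
  obtain c V' where V: "V = Polynomial.smult c (map_poly to_fract V')" using content_decompose_fract[of V] by metis
  obtain n d where c: "c = Fract n d" "d \<noteq> 0" by (cases c)
  then have "c * to_fract d = to_fract n" by (simp add: to_fract_def eq_fract)
  then have "to_ac c * emb d = emb n" unfolding emb_def by (metis to_ac_mult)
  then have "to_ac c = emb n / emb d" using c by (simp add: field_simps)
  then have "poly (ac V) y = ev (Polynomial.smult n V') / emb d" unfolding V by (simp add: ac_smult ac ev_simps)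
  moreover have "inverse (ev A) = poly (ac V) y" using 1 nz by (simp add: field_simps)
  moreover have "inverse z = emb h * inverse (ev A)" using z by (simp add: divide_inverse)
  ultimately have "inverse z = ev (Polynomial.smult (h * n) V') / emb d"
    by (simp add: ev_simps)
  then show ?thesis using K_I c by simp
qed

section \<open>Constants and places of the extension\<close>

definition cst :: "'g poly fract alg_closure set" where "cst = range (\<lambda>c. emb [:c:])"

definition isplace :: "'g poly fract alg_closure set \<Rightarrow> bool" where
  "isplace V \<longleftrightarrow> vr K V \<and> cst \<subseteq> V \<and> V \<noteq> K"

lemma emb_const_mult: "emb [:a:] * emb [:b:] = emb [:a * b:]"
  unfolding emb_simps(4)[symmetric] by simp

lemma emb_const_diff: "emb [:a:] - emb [:b:] = emb [:a - b:]"
  unfolding emb_simps(5)[symmetric] by simp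

lemma inverse_emb_const: "inverse (emb [:c:]) = emb [:inverse c:]"
proof (cases "c = 0")
  case False
  then have "emb [:c:] * emb [:inverse c:] = 1"
    unfolding emb_const_mult by (simp add: one_pCons[symmetric])
  then show ?thesis by (rule inverse_unique)
qed simp

lemma emb_pCons: "emb (pCons a g) = emb [:a:] + T * emb g"
  unfolding emb_simps(3,4)[symmetric] by simp

lemma cst_closed: "ring_closed cst"
  unfolding ring_closed_def cst_def
  by (auto simp: emb_const_mult emb_const_diff image_iff intro!: exI[of _ 1] simp: one_pCons[symmetric])

lemma vr_restrict:
  assumes V: "ring_closed V" "\<And>z. z \<in> V \<or> inverse z \<in> V"
  shows "vr K (V \<inter> K)"
proof
  show "ring_closed K" by (rule K_ring)
  show "\<And>z. z \<in> K \<Longrightarrow> inverse z \<in> K" by (rule K_inverse)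
  show "ring_closed (V \<inter> K)" using V(1) K_ring by (auto simp: ring_closed_def)
  show "V \<inter> K \<subseteq> K" by blast
  show "\<And>z. z \<in> K \<Longrightarrow> z \<in> V \<inter> K \<or> inverse z \<in> V \<inter> K" using V(2) K_inverse by blast
qed

text \<open>As \<open>p\<close> does not divide \<open>degree f\<close>, the terms of \<open>ev A\<close> have pairwise different pole orders
  at infinity, and so no cancellation takes place.\<close>

lemma top_exists:
  assumes "A \<noteq> 0" "degree A < p"
  obtains j where "coeff A j \<noteq> 0" "j < p"
    "\<And>i. coeff A i \<noteq> 0 \<Longrightarrow> i \<noteq> j \<Longrightarrow> p * degree (coeff A i) + degree f * i < p * degree (coeff A j) + degree f * j"
proof -
  define w where "w i = p * degree (coeff A i) + degree f * i" for i
  define J where "J = {i. coeff A i \<noteq> 0}"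
  have Jp: "i < p" if "i \<in> J" for i using that assms le_degree[of A i] by (auto simp: J_def)
  then have fin: "finite J" by (meson finite_nat_iff_bounded lessThan_iff subsetI)
  have "degree A \<in> J" using assms by (simp add: J_def)
  then have "Max (w ` J) \<in> w ` J" using fin by (intro Max_in) auto
  then obtain j where j: "j \<in> J" "w j = Max (w ` J)" by auto
  have le: "w i \<le> w j" if "i \<in> J" for i using fin that by (simp add: j(2))
  have ne: "w i \<noteq> w j" if i: "i \<in> J" "i \<noteq> j" for i
  proof
    assume eq: "w i = w j"
    have "(degree f * i) mod p = w i mod p" by (simp add: w_def)
    also have "\<dots> = (degree f * j) mod p" unfolding eq by (simp add: w_def)
    finally have "[degree f * i = degree f * j] (mod p)" by (simp add: Cong.cong_def)
    moreover have "coprime (degree f) p" using prime_imp_coprime[OF p(1) f] by (simp add: coprime_commute)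
    ultimately have "[i = j] (mod p)" using cong_mult_lcancel_nat by blast
    then show False using i j Jp by (metis cong_less_modulus_unique_nat)
  qed
  show thesis
  proof (rule that[of j])
    show "coeff A j \<noteq> 0" using j by (simp add: J_def)
    show "j < p" using j Jp by blast
    show "p * degree (coeff A i) + degree f * i < p * degree (coeff A j) + degree f * j" if "coeff A i \<noteq> 0" "i \<noteq> j" for i
      using le[of i] ne[of i] that by (simp add: J_def w_def)
  qed
qed

end

section \<open>The place at infinity\<close>

locale as_inf = as_field f y p for f :: "'g::{finite_field,field_gcd} poly" and y p +
  fixes V assumes Vp: "vr K V" "cst \<subseteq> V" "T \<notin> V"
begin

sublocale vr K V by (fact Vp(1))

lemma T_inv: "inverse T \<in> maxi" by (rule not_V_inverse_maxi[OF K_emb Vp(3)])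

lemma T_nz: "T \<noteq> 0" by simp

lemma const_V: "emb [:c:] \<in> V" using Vp by (auto simp: cst_def)

lemma const_units: "c \<noteq> 0 \<Longrightarrow> emb [:c:] \<in> units"
  using const_V[of c] const_V[of "inverse c"] by (simp add: units_def maxi_def inverse_emb_const)

lemma inf_emb: "g \<noteq> 0 \<Longrightarrow> \<exists>\<mu>\<in>maxi. emb g = T ^ degree g * (emb [:lead_coeff g:] + \<mu>)"
proof (induction g rule: pCons_induct)
  case (pCons a g)
  show ?case
  proof (cases "g = 0")
    case True then show ?thesis by (intro bexI[of _ 0]) (use maxi_0 in auto)
  next
    case False
    then obtain \<mu> where \<mu>: "\<mu> \<in> maxi" "emb g = T ^ degree g * (emb [:lead_coeff g:] + \<mu>)" using pCons by blast
    have T1: "T ^ Suc n * inverse T ^ Suc n = 1" for n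
    proof -
      have "T * inverse T = 1" using T_nz by (rule right_inverse)
      then show ?thesis by (metis power_mult_distrib power_one)
    qed
    let ?\<nu> = "\<mu> + inverse T ^ Suc (degree g) * emb [:a:]"
    have "emb (pCons a g) = T ^ Suc (degree g) * (emb [:lead_coeff g:] + \<mu>) + (T ^ Suc (degree g) * inverse T ^ Suc (degree g)) * emb [:a:]"
      unfolding T1 emb_pCons[of a g] \<mu>(2) by simp
    also have "\<dots> = T ^ Suc (degree g) * (emb [:lead_coeff g:] + ?\<nu>)" by (simp only: algebra_simps)
    finally have "emb (pCons a g) = T ^ degree (pCons a g) * (emb [:lead_coeff (pCons a g):] + ?\<nu>)"
      using False by simp
    moreover have "?\<nu> \<in> maxi"
      by (intro maxi_add \<mu> maxi_mult power_maxi T_inv const_V) simp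
    ultimately show ?thesis by blast
  qed
qed simp

lemma inf_emb_unit: "g \<noteq> 0 \<Longrightarrow> \<exists>u\<in>units. emb g = T ^ degree g * u"
proof -
  assume g: "g \<noteq> 0"
  obtain \<mu> where "\<mu> \<in> maxi" "emb g = T ^ degree g * (emb [:lead_coeff g:] + \<mu>)" using inf_emb[OF g] by blast
  moreover then have "emb [:lead_coeff g:] + \<mu> \<in> units" using g by (intro units_add_maxi const_units) auto
  ultimately show ?thesis by blast
qed

text \<open>Since \<open>emb f\<close> has a pole, so has \<open>y\<close>; then \<open>y\<close> is
  negligible against \<open>y ^ p\<close>, which therefore agrees with \<open>emb f\<close> up to a
  unit.\<close>

lemma inf_y: "\<exists>u\<in>units. y ^ p = T ^ degree f * u"
proof -
  have f0: "f \<noteq> 0" using f_deg by auto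
  obtain u where u: "u \<in> units" "emb f = T ^ degree f * u" using inf_emb_unit[OF f0] by blast
  have "y \<notin> V"
  proof
    assume "y \<in> V"
    then have "emb f \<in> V" unfolding y[symmetric] by (intro VR ring_closed_power[OF V(1)])
    then have "emb f * inverse u \<in> V" using VR(4) u units_inverse units_D by blast
    then have "T ^ degree f \<in> V" using u units_D(2)[OF u(1)] by (simp add: mult.assoc)
    then show False using power_in_V[OF K_emb f_deg] Vp(3) by blast
  qed
  then have iy: "inverse y \<in> maxi" and y0: "y \<noteq> 0" using not_V_inverse_maxi[OF K_y] VR(2) by auto
  define e where "e = 1 + - (inverse y ^ (p - 1))"
  have e: "e \<in> units" unfolding e_def using p by (intro units_add_maxi units_one maxi_uminus power_maxi iy) simp
  have "y ^ p * inverse y ^ (p - 1) = y * (y ^ (p - 1) * inverse y ^ (p - 1))"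
  proof -
    have "y ^ p = y * y ^ (p - 1)" using p by (simp add: power_eq_if)
    then show ?thesis by (simp only: mult.assoc)
  qed
  also have "\<dots> = y" using y0 by (simp add: power_mult_distrib[symmetric])
  finally have "y ^ p * e = y ^ p - y" by (simp add: e_def algebra_simps)
  also have "\<dots> = T ^ degree f * u" using y u by simp
  finally have "y ^ p = T ^ degree f * (u * inverse e)" using units_D(2)[OF e] by (simp add: field_simps)
  moreover have "u * inverse e \<in> units" using u e by (intro units_mult units_inverse)
  ultimately show ?thesis by blast
qed

lemma y_nz: "y \<noteq> 0"
proof
  assume "y = 0"
  moreover obtain u where "u \<in> units" "y ^ p = T ^ degree f * u" using inf_y by blast
  ultimately show False using p units_D(2) by (auto simp: power_0_left)
qed

text \<open>Orders are read off p-th powers, where \<open>y\<close> too becomes a power of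
  \<open>T\<close> up to a unit and all exponents are integers.\<close>

lemma inf_term: "c \<noteq> 0 \<Longrightarrow> \<exists>u\<in>units. (emb c * y ^ i) ^ p = T ^ (p * degree c + degree f * i) * u"
proof -
  assume "c \<noteq> 0"
  then obtain u where u: "u \<in> units" "emb c = T ^ degree c * u" using inf_emb_unit by blast
  obtain v where v: "v \<in> units" "y ^ p = T ^ degree f * v" using inf_y by blast
  have "(emb c * y ^ i) ^ p = emb c ^ p * (y ^ p) ^ i"
    by (simp add: power_mult_distrib power_mult[symmetric] mult.commute)
  also have "\<dots> = T ^ (p * degree c + degree f * i) * (u ^ p * v ^ i)"
    unfolding u(2) v(2) by (simp add: power_mult_distrib power_add power_mult[symmetric] mult_ac)
  finally show ?thesis using u v by (intro bexI[of _ "u ^ p * v ^ i"] units_mult units_power)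
qed

lemma quotient_maxi:
  assumes t: "t \<in> K" "t' \<in> K" "t ^ p = T ^ a * u" "t' ^ p = T ^ b * u'" "u \<in> units" "u' \<in> units" "a < b"
  shows "t / t' \<in> maxi"
proof (rule power_in_maxi[OF _ p(3)])
  show "t / t' \<in> K" unfolding divide_inverse by (intro LR L(2) t)
  have "(t / t') ^ p = inverse T ^ (b - a) * (u * inverse u')"
    using t(7) units_D(2)[OF t(6)] by (simp add: power_divide t(3,4) field_simps power_add[symmetric])
  also have "\<dots> \<in> maxi"
    using t by (intro maxi_mult power_maxi T_inv units_D(1) units_mult units_inverse) auto
  finally show "(t / t') ^ p \<in> maxi" .
qed

lemma inf_ev:
  assumes A: "degree A < p" "coeff A j \<noteq> 0" "j < p"
    "\<And>i. coeff A i \<noteq> 0 \<Longrightarrow> i \<noteq> j \<Longrightarrow> p * degree (coeff A i) + degree f * i < p * degree (coeff A j) + degree f * j"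
  shows "\<exists>\<mu>\<in>maxi. ev A = emb (coeff A j) * y ^ j * (1 + \<mu>)"
proof -
  define t where "t i = emb (coeff A i) * y ^ i" for i
  have tj: "t j \<noteq> 0" using A y_nz by (simp add: t_def)
  have tK: "t i \<in> K" for i unfolding t_def by (intro LR K_emb ring_closed_power[OF L(1)] K_y)
  have "ev A = (\<Sum>i<p. t i)" unfolding t_def by (rule hev_sum[OF rhom_emb A(1)])
  also have "\<dots> = t j + (\<Sum>i\<in>{..<p} - {j}. t i)" using A by (intro sum.remove) auto
  also have "\<dots> = t j * (1 + (\<Sum>i\<in>{..<p} - {j}. t i / t j))"
    using tj by (simp add: distrib_left sum_divide_distrib[symmetric])
  finally have "ev A = t j * (1 + (\<Sum>i\<in>{..<p} - {j}. t i / t j))" .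
  moreover have "(\<Sum>i\<in>{..<p} - {j}. t i / t j) \<in> maxi"
  proof (rule maxi_sum)
    fix i assume i: "i \<in> {..<p} - {j}"
    show "t i / t j \<in> maxi"
    proof (cases "coeff A i = 0")
      case True then show ?thesis by (simp add: t_def)
    next
      case False
      obtain u where u: "u \<in> units" "t i ^ p = T ^ (p * degree (coeff A i) + degree f * i) * u"
        using inf_term[OF False] unfolding t_def by blast
      obtain v where v: "v \<in> units" "t j ^ p = T ^ (p * degree (coeff A j) + degree f * j) * v"
        using inf_term[OF A(2)] unfolding t_def by blast
      show ?thesis using A(4)[OF False] i by (intro quotient_maxi[OF tK tK u(2) v(2) u(1) v(1)]) auto
    qed
  qed
  ultimately show ?thesis by (auto simp: t_def)
qed

lemma one_plus_maxi: "\<mu> \<in> maxi \<Longrightarrow> 1 + \<mu> \<in> units"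
  by (intro units_add_maxi units_one)

lemma ev_nonzero:
  assumes "degree A < p" "A \<noteq> 0" shows "ev A \<noteq> 0"
proof -
  obtain j where j: "coeff A j \<noteq> 0" "j < p"
    "\<And>i. coeff A i \<noteq> 0 \<Longrightarrow> i \<noteq> j \<Longrightarrow> p * degree (coeff A i) + degree f * i < p * degree (coeff A j) + degree f * j"
    using top_exists[OF assms(2,1)] by blast
  obtain \<mu> where "\<mu> \<in> maxi" "ev A = emb (coeff A j) * y ^ j * (1 + \<mu>)" using inf_ev[OF assms(1) j] by blast
  then show ?thesis using j y_nz units_D(2)[OF one_plus_maxi] by auto
qed

lemma inf_value:
  assumes A: "degree A < p" "coeff A j \<noteq> 0" "j < p"
    "\<And>i. coeff A i \<noteq> 0 \<Longrightarrow> i \<noteq> j \<Longrightarrow> p * degree (coeff A i) + degree f * i < p * degree (coeff A j) + degree f * j"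
    and h: "h \<noteq> 0"
  defines "w \<equiv> p * degree (coeff A j) + degree f * j"
  shows "ev A / emb h \<in> V \<longleftrightarrow> w \<le> p * degree h"
    and "w < p * degree h \<Longrightarrow> ev A / emb h \<in> maxi"
proof -
  obtain \<mu> where \<mu>: "\<mu> \<in> maxi" "ev A = emb (coeff A j) * y ^ j * (1 + \<mu>)" using inf_ev[OF A] by blast
  have \<mu>1: "1 + \<mu> \<in> units" by (rule one_plus_maxi[OF \<mu>(1)])
  obtain u where u: "u \<in> units" "(emb (coeff A j) * y ^ j) ^ p = T ^ w * u" using inf_term[OF A(2)] unfolding w_def by blast
  have evp: "ev A ^ p = T ^ w * (u * (1 + \<mu>) ^ p)" unfolding \<mu>(2) power_mult_distrib[of _ "1 + \<mu>"] u(2) by simp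
  have evu: "u * (1 + \<mu>) ^ p \<in> units" by (intro units_mult units_power u \<mu>1)
  obtain v where v: "v \<in> units" "(emb h * y ^ 0) ^ p = T ^ (p * degree h + degree f * 0) * v" using inf_term[OF h] by blast
  then have hp: "emb h ^ p = T ^ (p * degree h) * v" by simp
  show 1: "ev A / emb h \<in> maxi" if "w < p * degree h"
    by (rule quotient_maxi[OF K_ev K_emb evp hp evu v(1) that])
  have 2: "emb h / ev A \<in> maxi" if "p * degree h < w"
    by (rule quotient_maxi[OF K_emb K_ev hp evp v(1) evu that])
  have nz: "ev A \<noteq> 0" using ev_nonzero[OF A(1)] A(2) by (cases "A = 0") auto
  show "ev A / emb h \<in> V \<longleftrightarrow> w \<le> p * degree h"
  proof
    assume a: "ev A / emb h \<in> V"
    show "w \<le> p * degree h"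
    proof (rule ccontr)
      assume "\<not> ?thesis"
      then have "emb h / ev A \<in> maxi" using 2 by simp
      then have "inverse (emb h / ev A) \<notin> V" using nz h by (intro maxi_inverse_not_V) auto
      then show False using a by simp
    qed
  next
    assume a: "w \<le> p * degree h"
    show "ev A / emb h \<in> V"
    proof (cases "w = p * degree h")
      case False then show ?thesis using a 1 maxi_V by simp
    next
      case True
      have "(ev A / emb h) ^ p = (u * (1 + \<mu>) ^ p) * inverse v"
        unfolding power_divide evp hp True using units_D(2)[OF v(1)] by (simp add: field_simps)
      also have "\<dots> \<in> V" by (intro units_D(1) units_mult[OF evu] units_inverse v(1))
      finally show ?thesis by (intro power_in_V[OF K_I[OF h] p(3)])
    qed
  qed
qed

lemma inf_residue: "z \<in> V \<Longrightarrow> \<exists>c. z - emb [:c:] \<in> maxi"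
proof -
  assume zV: "z \<in> V"
  obtain A0 h where z0: "z = ev A0 / emb h" "h \<noteq> 0" using V(2) zV by (auto simp: K_def)
  obtain B A where A0: "A0 = m0 * B + A" and dA: "degree A < p" using reduce by blast
  have z: "z = ev A / emb h" unfolding z0 A0 by (simp add: ev_simps ev_m0)
  show ?thesis
  proof (cases "A = 0")
    case True
    then have "z - emb [:0:] = 0" by (simp add: z ev_simps)
    then show ?thesis using maxi_0 by metis
  next
    case False
    obtain j where j: "coeff A j \<noteq> 0" "j < p"
      "\<And>i. coeff A i \<noteq> 0 \<Longrightarrow> i \<noteq> j \<Longrightarrow> p * degree (coeff A i) + degree f * i < p * degree (coeff A j) + degree f * j"
      using top_exists[OF False dA] by blast
    have le: "p * degree (coeff A j) + degree f * j \<le> p * degree h" using inf_value(1)[OF dA j z0(2)] zV z by simp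
    show ?thesis
    proof (cases "p * degree (coeff A j) + degree f * j = p * degree h")
      case False
      then have "z \<in> maxi" using inf_value(2)[OF dA j z0(2)] le z by simp
      then show ?thesis by (intro exI[of _ 0]) simp
    next
      case True
      \<comment> \<open>A unit has a dominant term free of \<open>y\<close>: equal weights force
        \<open>p\<close> to divide \<open>degree f * j\<close>, hence \<open>j\<close>. The residue
        is then the quotient of leading coefficients, a constant, as total ramification
        demands.\<close>
      have "p dvd degree f * j" by (metis True dvd_add_right_iff dvd_triv_left)
      then have "p dvd j" using f p by (simp add: prime_dvd_mult_iff)
      then have j0: "j = 0" using j(2) by (auto dest: dvd_imp_le)
      have deg: "degree (coeff A 0) = degree h" using True p j0 by simp
      obtain \<mu> where \<mu>: "\<mu> \<in> maxi" "ev A = emb (coeff A j) * y ^ j * (1 + \<mu>)" using inf_ev[OF dA j] by blast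
      obtain \<nu> where \<nu>: "\<nu> \<in> maxi" "emb (coeff A 0) = T ^ degree h * (emb [:lead_coeff (coeff A 0):] + \<nu>)"
        using inf_emb[of "coeff A 0"] j j0 deg by auto
      obtain \<kappa> where \<kappa>: "\<kappa> \<in> maxi" "emb h = T ^ degree h * (emb [:lead_coeff h:] + \<kappa>)"
        using inf_emb[OF z0(2)] by auto
      define a where "a = emb [:lead_coeff (coeff A 0):]"
      define b where "b = emb [:lead_coeff h:]"
      have b: "b + \<kappa> \<in> units" "b \<in> units" unfolding b_def using z0 by (auto intro!: units_add_maxi const_units \<kappa>)
      have aV: "a \<in> V" unfolding a_def by (rule const_V)
      have t: "T ^ degree h \<noteq> 0" by simp
      have "z = (T ^ degree h * ((a + \<nu>) * (1 + \<mu>))) / (T ^ degree h * (b + \<kappa>))"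
        unfolding z \<mu>(2) j0 \<nu>(2) \<kappa>(2) a_def b_def by (simp only: power_0 mult_1_right mult.assoc)
      then have zz: "z = (a + \<nu>) * (1 + \<mu>) * inverse (b + \<kappa>)"
        unfolding nonzero_mult_divide_mult_cancel_left[OF t] by (simp only: divide_inverse)
      have "z - a * inverse b = (((a + \<nu>) * (1 + \<mu>)) * b - a * (b + \<kappa>)) * (inverse (b + \<kappa>) * inverse b)"
        unfolding zz using units_D(2)[OF b(1)] units_D(2)[OF b(2)] by (simp add: field_simps)
      also have "((a + \<nu>) * (1 + \<mu>)) * b - a * (b + \<kappa>) = \<nu> * ((1 + \<mu>) * b) + \<mu> * (a * b) - \<kappa> * a"
        by (simp add: algebra_simps)
      finally have eq: "z - a * inverse b = (\<nu> * ((1 + \<mu>) * b) + \<mu> * (a * b) - \<kappa> * a) * (inverse (b + \<kappa>) * inverse b)" .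
      have "z - a * inverse b \<in> maxi" unfolding eq
        using \<mu> \<nu> \<kappa> b units_inverse units_D(1) one_plus_maxi
        by (intro maxi_mult maxi_add maxi_diff VR(4) aV) auto
      moreover have "a * inverse b = emb [:lead_coeff (coeff A 0) * inverse (lead_coeff h):]"
        by (simp add: a_def b_def inverse_emb_const emb_const_mult)
      ultimately show ?thesis by metis
    qed
  qed
qed

lemma nrm_inf: "nrm V = CARD('g)"
proof -
  define \<rho> where "\<rho> z = (THE c. z - emb [:c:] \<in> maxi)" for z
  have uniq: "c = c'" if "z - emb [:c:] \<in> maxi" "z - emb [:c':] \<in> maxi" for z c c'
  proof (rule ccontr)
    assume "c \<noteq> c'"
    then have "emb [:c - c':] \<in> units" by (intro const_units) simp
    moreover have "emb [:c - c':] \<in> maxi"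
      using maxi_diff[OF that(2,1)] by (simp add: emb_const_diff[symmetric])
    ultimately show False by (simp add: units_def)
  qed
  have \<rho>: "z - emb [:\<rho> z:] \<in> maxi" if zV: "z \<in> V" for z
  proof -
    obtain c where "z - emb [:c:] \<in> maxi" using inf_residue[OF zV] by blast
    then show ?thesis unfolding \<rho>_def by (rule theI) (use uniq \<open>z - emb [:c:] \<in> maxi\<close> in blast)
  qed
  have "nrm V = card (\<rho> ` V)"
  proof (rule nrm_eq)
    fix z w assume zw: "z \<in> V" "w \<in> V"
    show "\<rho> z = \<rho> w \<longleftrightarrow> w - z \<in> maxi"
    proof
      assume eq: "\<rho> z = \<rho> w"
      have "(w - emb [:\<rho> w:]) - (z - emb [:\<rho> z:]) \<in> maxi" by (rule maxi_diff[OF \<rho>[OF zw(2)] \<rho>[OF zw(1)]])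
      then show "w - z \<in> maxi" unfolding eq by simp
    next
      assume "w - z \<in> maxi"
      then have "(w - emb [:\<rho> w:]) - (w - z) \<in> maxi" by (rule maxi_diff[OF \<rho>[OF zw(2)]])
      then have "z - emb [:\<rho> w:] \<in> maxi" by (simp add: algebra_simps)
      then show "\<rho> z = \<rho> w" using uniq \<rho>[OF zw(1)] by blast
    qed
  qed
  also have "\<rho> ` V = UNIV"
  proof -
    have "c \<in> \<rho> ` V" for c
    proof -
      have "\<rho> (emb [:c:]) = c" using uniq[OF \<rho>[OF const_V[of c]], of c] by simp
      then show ?thesis using const_V by (metis imageI)
    qed
    then show ?thesis by auto
  qed
  finally show ?thesis .
qed

end

context as_field
begin

text \<open>Chevalley's theorem is applied to the ring of polynomials in \<open>inverse T\<close>
  over the constants. It does not contain \<open>T\<close>, since clearing denominators would make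
  \<open>T ^ Suc n\<close> a polynomial of degree at most \<open>n\<close>.\<close>

lemma inf_exists: "\<exists>V. vr K V \<and> cst \<subseteq> V \<and> T \<notin> V"
proof -
  define A where "A = {poly q (inverse T) | q. coeffs_in cst q}"
  have A: "ring_closed A" unfolding A_def by (rule ring_closed_adjoin[OF cst_closed])
  have cA: "cst \<subseteq> A"
  proof
    fix v assume v: "v \<in> cst"
    then have "coeffs_in cst [:v:]" using ring_closedD(2)[OF cst_closed] by (auto simp: coeffs_in_def coeff_pCons split: nat.splits)
    then show "v \<in> A" unfolding A_def by (intro CollectI exI[of _ "[:v:]"]) simp
  qed
  have tA: "inverse T \<in> A"
    unfolding A_def using ring_closedD[OF cst_closed]
    by (intro CollectI exI[of _ "[:0,1:]"]) (auto simp: coeffs_in_def coeff_pCons split: nat.splits)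
  have "T \<notin> A"
  proof
    assume "T \<in> A"
    then obtain q where q: "T = poly q (inverse T)" "coeffs_in cst q" unfolding A_def by blast
    define n where "n = degree q"
    have "\<forall>i. \<exists>c. coeff q i = emb [:c:]" using q(2) by (auto simp: coeffs_in_def cst_def)
    then obtain c where c: "\<And>i. coeff q i = emb [:c i:]" by metis
    have "T * T ^ n = (\<Sum>i\<le>n. coeff q i * inverse T ^ i) * T ^ n"
      by (subst q(1)) (simp only: poly_altdef n_def)
    also have "\<dots> = (\<Sum>i\<le>n. emb [:c i:] * T ^ (n - i))"
      unfolding sum_distrib_right
    proof (rule sum.cong[OF refl])
      fix i assume "i \<in> {..n}"
      then have "T ^ n = T ^ i * T ^ (n - i)" by (simp add: power_add[symmetric])
      then show "coeff q i * inverse T ^ i * T ^ n = emb [:c i:] * T ^ (n - i)"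
        by (simp add: c power_inverse)
    qed
    also have "\<dots> = emb (\<Sum>i\<le>n. [:c i:] * [:0,1:] ^ (n - i))"
      by (simp only: emb_sum emb_simps emb_power)
    finally have "emb ([:0,1:] ^ Suc n) = emb (\<Sum>i\<le>n. [:c i:] * [:0,1:] ^ (n - i))" by (simp only: emb_power power_Suc emb_simps(4))
    then have eq: "[:0,1:] ^ Suc n = (\<Sum>i\<le>n. [:c i:] * [:0,1:] ^ (n - i))" unfolding emb_simps(7) .
    have "degree (\<Sum>i\<le>n. [:c i:] * [:0,1:] ^ (n - i)) \<le> n"
    proof (rule degree_sum_le)
      fix i assume "i \<in> {..n}"
      have "degree ([:c i:] * [:0,1:] ^ (n - i)) \<le> degree [:c i:] + degree ([:0,1:] ^ (n - i) :: 'g poly)" by (rule degree_mult_le)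
      also have "\<dots> \<le> n" by (simp add: degree_linear_power)
      finally show "degree ([:c i:] * [:0,1:] ^ (n - i)) \<le> n" .
    qed simp
    then show False unfolding eq[symmetric] degree_linear_power by simp
  qed
  then obtain V where V: "ring_closed V" "A \<subseteq> V" "\<And>z. z \<in> V \<or> inverse z \<in> V" "T \<notin> V"
    using chevalley[OF A tA] by auto
  have "vr K (V \<inter> K)" by (rule vr_restrict) (use V in auto)
  moreover have "cst \<subseteq> V \<inter> K" using cA V(2) K_emb by (auto simp: cst_def)
  ultimately show ?thesis using V(4) by blast
qed

text \<open>The place at infinity proves that \<open>m0\<close> generates all relations of
  \<open>y\<close>: after reduction modulo \<open>m0\<close>, a nonzero polynomial has a single
  dominant term there and cannot vanish.\<close>

lemma ev_eq_0: "ev A = 0 \<Longrightarrow> \<exists>B. A = m0 * B"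
proof -
  assume A: "ev A = 0"
  obtain V where V: "vr K V" "cst \<subseteq> V" "T \<notin> V" using inf_exists by blast
  interpret as_inf f y p V
    by (intro as_inf.intro as_inf_axioms.intro as_field_axioms V)
  obtain B C where BC: "A = m0 * B + C" "degree C < p" using reduce by blast
  then have "ev C = 0" using A by (simp add: ev_simps ev_m0)
  then have "C = 0" using ev_nonzero BC by blast
  then show ?thesis using BC by auto
qed

lemma inf_unique:
  assumes V: "vr K V" "cst \<subseteq> V" "T \<notin> V" and V': "vr K V'" "cst \<subseteq> V'" "T \<notin> V'"
  shows "V \<subseteq> V'"
proof
  interpret v: as_inf f y p V
    by (intro as_inf.intro as_inf_axioms.intro as_field_axioms V)
  interpret v': as_inf f y p V'
    by (intro as_inf.intro as_inf_axioms.intro as_field_axioms V')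
  fix z assume zV: "z \<in> V"
  obtain A0 h where z0: "z = ev A0 / emb h" "h \<noteq> 0" using v.V(2) zV by (auto simp: K_def)
  obtain B A where A0: "A0 = m0 * B + A" and dA: "degree A < p" using reduce by blast
  have z: "z = ev A / emb h" unfolding z0 A0 by (simp add: ev_simps ev_m0)
  show "z \<in> V'"
  proof (cases "A = 0")
    case True then show ?thesis using v'.VR(2) by (simp add: z ev_simps)
  next
    case False
    obtain j where j: "coeff A j \<noteq> 0" "j < p"
      "\<And>i. coeff A i \<noteq> 0 \<Longrightarrow> i \<noteq> j \<Longrightarrow> p * degree (coeff A i) + degree f * i < p * degree (coeff A j) + degree f * j"
      using top_exists[OF False dA] by blast
    show ?thesis using v.inf_value(1)[OF dA j z0(2)] v'.inf_value(1)[OF dA j z0(2)] zV z by simp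
  qed
qed

definition Vinf :: "'g poly fract alg_closure set" where
  "Vinf = (SOME V. vr K V \<and> cst \<subseteq> V \<and> T \<notin> V)"

lemma Vinf: "vr K Vinf" "cst \<subseteq> Vinf" "T \<notin> Vinf"
  using someI_ex[OF inf_exists] unfolding Vinf_def by auto

lemma Vinf_place: "isplace Vinf" unfolding isplace_def using Vinf K_emb by blast

lemma place_eq_Vinf: "isplace V \<Longrightarrow> T \<notin> V \<Longrightarrow> V = Vinf"
  using inf_unique[of V Vinf] inf_unique[of Vinf V] Vinf by (auto simp: isplace_def)

lemma nrm_Vinf: "nrm Vinf = CARD('g)"
proof -
  interpret as_inf f y p Vinf
    by (intro as_inf.intro as_inf_axioms.intro as_field_axioms Vinf)
  show ?thesis by (rule nrm_inf)
qed

end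

 

subsection \<open>Finite places\<close>

lemma mod_ac: "ac (A mod B) = ac A mod ac B"
proof (cases "B = 0")
  case False
  have "ac A = ac (A div B) * ac B + ac (A mod B)"
    by (simp only: ac_mult[symmetric] ac_add[symmetric] div_mult_mod_eq)
  then have "ac A mod ac B = ac (A mod B) mod ac B" by simp
  also have "\<dots> = ac (A mod B)"
  proof (cases "A mod B = 0")
    case False
    then have "degree (A mod B) < degree B" using degree_mod_less[OF \<open>B \<noteq> 0\<close>, of A] by simp
    then show ?thesis by (intro mod_poly_less) simp
  qed simp
  finally show ?thesis by simp
qed simp

lemma to_ac_lam: "to_ac (lam F g) = lam (ac F) (ac g)"
  by (simp add: lam_def pderiv_ac ac_mult[symmetric] mod_ac[symmetric] coeff_map_poly)

lemma lam_linear: "lam F [:- c, 1:] = poly F c" for c :: "'a::field"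
proof -
  have "[:- c, 1:] dvd F - [:poly F c:]" by (simp add: poly_eq_0_iff_dvd[symmetric])
  then have "lam F [:- c, 1:] = lam [:poly F c:] [:- c, 1:]" by (rule lam_cong_mod)
  also have "\<dots> = poly F c"
    by (simp add: lam_def pderiv_pCons mod_poly_less one_pCons[symmetric])
  finally show ?thesis .
qed

lemma lam_prod:
  assumes "\<And>j. j \<in> S \<Longrightarrow> lead_coeff (g j) = 1"
  shows "lam F (\<Prod>j\<in>S. g j) = (\<Sum>j\<in>S. lam F (g j))"
  using assms
proof (induction S rule: infinite_finite_induct)
  case (insert j S)
  have "lead_coeff (\<Prod>j\<in>S. g j) = 1" using insert by (simp add: lead_coeff_prod)
  then show ?case using insert lam_mult[of "g j" "\<Prod>j\<in>S. g j" F] by simp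
qed simp_all

text \<open>Over the closure \<open>P\<close> is a product of linear factors, on which
  \<open>lam\<close> is evaluation. Hence \<open>lam F P\<close> is the trace of the residue of
  \<open>F\<close> modulo \<open>P\<close>.\<close>

lemma (in irr_root) to_ac_lam_root: "to_ac (lam F P) = (\<Sum>j<m. poly (ac F) \<theta> ^ (CARD('g) ^ j))"
proof -
  have "to_ac (lam F P) = lam (ac F) (\<Prod>j<m. [:- (\<theta> ^ (CARD('g) ^ j)), 1:])"
    unfolding to_ac_lam ac_P_eq ..
  also have "\<dots> = (\<Sum>j<m. poly (ac F) (\<theta> ^ (CARD('g) ^ j)))"
    by (subst lam_prod) (simp_all add: lam_linear)
  finally show ?thesis by (simp add: poly_ac_frob)
qed

lemma freshmans_dream_sum_power:
  fixes h :: "'i \<Rightarrow> 'a::comm_ring_1"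
  assumes "prime CHAR('a)"
  shows "(\<Sum>i\<in>S. h i) ^ (CHAR('a) ^ n) = (\<Sum>i\<in>S. h i ^ (CHAR('a) ^ n))"
proof (induction S rule: infinite_finite_induct)
  case (insert i S)
  then show ?case using freshmans_dream'[OF assms refl, of "h i" "sum h S" n] by simp
qed (use assms prime_gt_0_nat in \<open>simp_all add: power_0_left\<close>)

context as_field
begin

lemma range_emb:
  assumes V: "vr K V" and c: "cst \<subseteq> V" and T: "T \<in> V"
  shows "emb g \<in> V"
proof -
  interpret vr K V by fact
  show ?thesis
  proof (induction g)
    case 0 then show ?case using VR by simp
  next
    case (pCons a g)
    have "emb [:a:] \<in> V" using c by (auto simp: cst_def)
    then show ?case unfolding emb_pCons[of a g] using pCons T by (intro VR)
  qed
qed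

lemma range_ev:
  assumes V: "vr K V" and c: "cst \<subseteq> V" and T: "T \<in> V"
  shows "ev a \<in> V"
proof -
  interpret vr K V by fact
  note emb = range_emb[OF assms]
  have yV: "y \<in> V"
  proof (rule ccontr)
    assume "y \<notin> V"
    then have iy: "inverse y \<in> maxi" and y0: "y \<noteq> 0" using not_V_inverse_maxi[OF K_y] VR(2) by auto
    have "y ^ p = y + emb f" using y by (simp add: algebra_simps)
    moreover have "inverse y ^ p * y ^ p = 1" using y0 by (simp add: power_mult_distrib[symmetric])
    ultimately have e1: "inverse y ^ p * (y + emb f) = 1" by simp
    have "inverse y ^ p * y = inverse y ^ (p - 1) * (inverse y * y)"
      unfolding power_minus_mult[OF p(3), symmetric, of "inverse y"] by (simp only: mult.assoc)
    then have "inverse y ^ p * y = inverse y ^ (p - 1)" using y0 by simp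
    then have "1 = inverse y ^ (p - 1) + inverse y ^ p * emb f" using e1 by (simp only: distrib_left)
    also have "\<dots> \<in> maxi" using p by (intro maxi_add maxi_mult power_maxi iy emb) auto
    finally show False by simp
  qed
  show ?thesis
  proof (induction a)
    case 0 then show ?case using VR by (simp add: ev_simps)
  next
    case (pCons c g) then show ?case using yV emb by (simp add: ev_simps VR)
  qed
qed

end

section \<open>The places over a monic irreducible polynomial\<close>

locale as_fin = as_field f y p + irr_root P \<theta>
  for f :: "'g::{finite_field,field_gcd} poly" and y p and P :: "'g poly" and \<theta> :: "'g alg_closure" +
  fixes y0 :: "'g alg_closure"
  assumes y0: "y0 ^ p - y0 = poly (ac f) \<theta>"
begin

abbreviation "red \<equiv> \<lambda>c. poly (ac c) \<theta>"

lemma rhom_red: "rhom red" by (simp add: rhom_def ac_add ac_mult)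

text \<open>The roots of the reduced Artin--Schreier equation are \<open>y0 + i\<close>. Sending
  \<open>T\<close> to \<open>\<theta>\<close> and \<open>y\<close> to one of them gives
  \<open>p\<close> homomorphisms to the algebraic closure of the constants, whose kernels describe
  all places over \<open>P\<close>.\<close>

definition phi :: "nat \<Rightarrow> 'g poly poly \<Rightarrow> 'g alg_closure" where "phi i = hev red (y0 + of_nat i)"

lemmas phi_simps =
  hev_0[OF rhom_red, of "y0 + of_nat i" for i, folded phi_def]
  hev_1[OF rhom_red, of "y0 + of_nat i" for i, folded phi_def]
  hev_pCons[OF rhom_red, of "y0 + of_nat i" for i, folded phi_def]
  hev_add[OF rhom_red, of "y0 + of_nat i" for i, folded phi_def]
  hev_smult[OF rhom_red, of "y0 + of_nat i" for i, folded phi_def]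
  hev_mult[OF rhom_red, of "y0 + of_nat i" for i, folded phi_def]
  hev_diff[OF rhom_red, of "y0 + of_nat i" for i, folded phi_def]
  hev_power[OF rhom_red, of "y0 + of_nat i" for i, folded phi_def]
  hev_monom[OF rhom_red, of "y0 + of_nat i" for i, folded phi_def]
  hev_prod[OF rhom_red, of "y0 + of_nat i" for i, folded phi_def]

lemma char: "CHAR('g alg_closure) = p" by (simp add: p_eq)

lemma char_prime: "prime CHAR('g alg_closure)" using p by (simp add: char)

lemma freshman: "((a :: 'g alg_closure) + b) ^ (p ^ n) = a ^ (p ^ n) + b ^ (p ^ n)"
  using freshmans_dream'[OF char_prime refl, of a b n] unfolding char .

lemma y_i: "(y0 + of_nat i) ^ p - (y0 + of_nat i) = poly (ac f) \<theta>"
proof (induction i)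
  case (Suc i)
  have "y0 + of_nat (Suc i) = (y0 + of_nat i) + 1" by simp
  then have "(y0 + of_nat (Suc i)) ^ p = ((y0 + of_nat i) + 1) ^ (p ^ 1)" by (simp only: power_one_right)
  also have "\<dots> = (y0 + of_nat i) ^ (p ^ 1) + 1 ^ (p ^ 1)" by (rule freshman)
  also have "\<dots> = (y0 + of_nat i) ^ p + 1" by simp
  finally have e: "(y0 + of_nat (Suc i)) ^ p = (y0 + of_nat i) ^ p + 1" .
  have "(y0 + of_nat i) ^ p + 1 - (y0 + of_nat (Suc i)) = (y0 + of_nat i) ^ p - (y0 + of_nat i)" by simp
  then show ?case unfolding e using Suc by (simp only:)
qed (use y0 in simp)

lemma phi_m0: "phi i m0 = 0"
  using y_i[of i] by (simp add: m0_def phi_simps del: One_nat_def)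

lemma phi_const: "phi i [:c:] = red c" by (simp add: phi_simps)

lemma phi_cong: "ev A = ev B \<Longrightarrow> phi i A = phi i B"
proof -
  assume "ev A = ev B"
  then have "ev (A - B) = 0" by (simp add: ev_simps)
  then obtain C where "A - B = m0 * C" using ev_eq_0 by blast
  then have "phi i (A - B) = 0" by (simp add: phi_simps phi_m0)
  then show ?thesis by (simp add: phi_simps)
qed

lemma of_nat_inj: "i < p \<Longrightarrow> j < p \<Longrightarrow> of_nat i = (of_nat j :: 'g alg_closure) \<Longrightarrow> i = j"
  by (metis of_nat_eq_iff_cong_CHAR char cong_less_modulus_unique_nat)

lemma phi_period: "[i = j] (mod p) \<Longrightarrow> phi i = phi j"
  unfolding phi_def by (metis of_nat_eq_iff_cong_CHAR char)

text \<open>The reduction of \<open>A\<close> has degree below \<open>p\<close> but vanishes at the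
  \<open>p\<close> distinct elements \<open>y0 + i\<close>, so all its coefficients are
  zero.\<close>

lemma all_ker_coeff:
  assumes A: "degree A < p" "\<And>i. i < p \<Longrightarrow> phi i A = 0"
  shows "P dvd coeff A j"
proof -
  have "map_poly red A = 0"
  proof (rule ccontr)
    assume nz: "map_poly red A \<noteq> 0"
    have "(\<lambda>i. y0 + of_nat i) ` {..<p} \<subseteq> {z. poly (map_poly red A) z = 0}"
      using A(2) by (auto simp: phi_def hev_def)
    then have "card ((\<lambda>i. y0 + of_nat i) ` {..<p}) \<le> card {z. poly (map_poly red A) z = 0}"
      by (intro card_mono poly_roots_finite nz)
    also have "\<dots> \<le> degree (map_poly red A)" by (rule card_poly_roots_bound[OF nz])
    also have "\<dots> \<le> degree A" by (rule degree_le) (simp add: coeff_map_poly coeff_eq_0)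
    finally have "card ((\<lambda>i. y0 + of_nat i) ` {..<p}) < p" using A(1) by simp
    moreover have "inj_on (\<lambda>i. y0 + of_nat i) {..<p}" by (rule inj_onI) (use of_nat_inj in auto)
    ultimately show False by (simp add: card_image)
  qed
  then have "coeff (map_poly red A) j = 0" by simp
  then show ?thesis by (simp add: coeff_map_poly eval_0_iff)
qed

lemma all_ker:
  assumes "\<And>i. i < p \<Longrightarrow> phi i A = 0"
  shows "\<exists>A'. ev A = emb P * ev A'"
proof -
  obtain B C where BC: "A = m0 * B + C" "degree C < p" using reduce by blast
  have "phi i C = 0" if "i < p" for i using assms[OF that] by (simp add: BC(1) phi_simps phi_m0)
  then have d: "P dvd coeff C j" for j using all_ker_coeff[OF BC(2)] by blast
  have "C = Polynomial.smult P (map_poly (\<lambda>c. c div P) C)"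
    by (rule poly_eqI) (use d in \<open>simp add: coeff_map_poly\<close>)
  then have "ev C = emb P * ev (map_poly (\<lambda>c. c div P) C)" by (metis ev_simps(6))
  then show ?thesis by (intro exI[of _ "map_poly (\<lambda>c. c div P) C"]) (simp add: BC(1) ev_simps ev_m0)
qed

text \<open>By transitivity of the trace and \<open>to_ac_lam_root\<close>, the absolute trace of
  the residue of \<open>f\<close> at \<open>\<theta>\<close>.\<close>

definition \<tau> :: "'g alg_closure" where "\<tau> = to_ac (abs_tr (lam f P))"

lemma CARD_p: "CARD('g) = p ^ ffexp TYPE('g)" using CARD_ffexp[where 'g='g] by (simp add: p_eq)

text \<open>Iterating \<open>z ^ p = z + f(\<theta>)\<close> accumulates the conjugates of
  \<open>f(\<theta>)\<close>. After as many steps as the residue field has degree over the prime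
  field, they make up the full trace. Frobenius of the residue field thus shifts the index of
  \<open>phi\<close> by \<open>\<tau>\<close>.\<close>

lemma y_frob: "(y0 + of_nat i) ^ (CARD('g) ^ m) = y0 + of_nat i + \<tau>"
proof -
  let ?e = "ffexp TYPE('g)"
  let ?F = "poly (ac f) \<theta>"
  have step: "(y0 + of_nat i) ^ (p ^ n) = y0 + of_nat i + (\<Sum>j<n. ?F ^ (p ^ j))" for n
  proof (induction n)
    case (Suc n)
    have "(y0 + of_nat i) ^ (p ^ Suc n) = ((y0 + of_nat i) ^ p) ^ (p ^ n)" by (simp add: power_mult)
    also have "(y0 + of_nat i) ^ p = (y0 + of_nat i) + ?F" using y_i[of i] by (simp add: algebra_simps)
    also have "((y0 + of_nat i) + ?F) ^ (p ^ n) = (y0 + of_nat i) ^ (p ^ n) + ?F ^ (p ^ n)" by (rule freshman)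
    finally show ?case using Suc by simp
  qed simp
  have to_ac_sum: "to_ac (sum h S) = (\<Sum>i\<in>S. to_ac (h i))" for h :: "nat \<Rightarrow> 'g" and S
    by (induction S rule: infinite_finite_induct) simp_all
  have "\<tau> = (\<Sum>i<?e. to_ac (lam f P) ^ (p ^ i))" unfolding \<tau>_def abs_tr_def p_eq by (simp add: to_ac_sum)
  also have "\<dots> = (\<Sum>i<?e. \<Sum>j<m. ?F ^ (p ^ (j * ?e + i)))"
  proof (rule sum.cong[OF refl])
    fix i
    have "to_ac (lam f P) ^ (p ^ i) = (\<Sum>j<m. (?F ^ (CARD('g) ^ j)) ^ (p ^ i))"
      unfolding to_ac_lam_root using freshmans_dream_sum_power[OF char_prime, of "\<lambda>j. ?F ^ (CARD('g) ^ j)" "{..<m}" i]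
      unfolding char .
    also have "\<dots> = (\<Sum>j<m. ?F ^ (p ^ (j * ?e + i)))"
      by (intro sum.cong refl) (simp add: CARD_p power_mult[symmetric] power_add mult.commute)
    finally show "to_ac (lam f P) ^ (p ^ i) = (\<Sum>j<m. ?F ^ (p ^ (j * ?e + i)))" .
  qed
  also have "\<dots> = (\<Sum>j<m. \<Sum>i<?e. ?F ^ (p ^ (j * ?e + i)))" by (rule sum.swap)
  also have "\<dots> = (\<Sum>j<m. sum (\<lambda>i. ?F ^ (p ^ i)) {j * ?e ..< j * ?e + ?e})"
  proof (rule sum.cong[OF refl])
    fix j
    have "sum (\<lambda>i. ?F ^ (p ^ i)) {j * ?e ..< j * ?e + ?e} = sum (\<lambda>i. ?F ^ (p ^ i)) {0 + j * ?e ..< ?e + j * ?e}"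
      by (simp add: add.commute)
    also have "\<dots> = (\<Sum>i\<in>{0..<?e}. ?F ^ (p ^ (i + j * ?e)))" by (rule sum.shift_bounds_nat_ivl)
    finally show "(\<Sum>i<?e. ?F ^ (p ^ (j * ?e + i))) = sum (\<lambda>i. ?F ^ (p ^ i)) {j * ?e ..< j * ?e + ?e}"
      by (simp add: atLeast0LessThan add.commute)
  qed
  also have "\<dots> = (\<Sum>j<m * ?e. ?F ^ (p ^ j))" by (rule sum.nat_group)
  finally show ?thesis using step[of "m * ?e"] by (simp add: CARD_p power_mult[symmetric] mult.commute)
qed

lemma tau_nat: obtains k where "\<tau> = of_nat k" "psi (lam f P) = 1 \<longleftrightarrow> p dvd k"
proof -
  have "abs_tr (lam f P) ^ p = abs_tr (lam f P)" unfolding p_eq by (rule abs_tr_frob)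
  then obtain k where k: "abs_tr (lam f P) = of_nat k"
    using root_frob_prime_field[of "abs_tr (lam f P)"] p by (auto simp: p_eq)
  then have "\<tau> = of_nat k" by (simp add: \<tau>_def)
  moreover have "psi (lam f P) = 1 \<longleftrightarrow> p dvd k" unfolding psi_eq_1_iff k by (simp add: p_eq of_nat_eq_0_iff_char_dvd)
  ultimately show thesis by (rule that)
qed

lemma hev_frob: "hev red z A ^ (CARD('g) ^ m) = hev red (z ^ (CARD('g) ^ m)) A"
proof (induction A)
  case 0
  then show ?case by (simp add: hev_0[OF rhom_red] power_0_left)
next
  case (pCons a A)
  have "red a ^ (CARD('g) ^ m) = red a" by (simp add: poly_ac_frob frob_m)
  then show ?case using pCons by (simp add: hev_pCons[OF rhom_red] frob_add power_mult_distrib)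
qed

lemma phi_frob:
  assumes "\<tau> = of_nat k"
  shows "phi i A ^ (CARD('g) ^ (m * n)) = phi (i + k * n) A"
proof (induction n)
  case (Suc n)
  have "phi i A ^ (CARD('g) ^ (m * Suc n)) = (phi i A ^ (CARD('g) ^ (m * n))) ^ (CARD('g) ^ m)"
    by (simp add: frob_frob add.commute)
  also have "\<dots> = phi (i + k * n) A ^ (CARD('g) ^ m)" using Suc by simp
  also have "\<dots> = hev red (y0 + of_nat (i + k * n) + of_nat k) A"
    unfolding phi_def hev_frob y_frob assms ..
  also have "\<dots> = phi (i + k * Suc n) A" unfolding phi_def by (simp add: algebra_simps)
  finally show ?case .
qed simp

lemma phi_fixed: "phi i A ^ (CARD('g) ^ (m * p)) = phi i A"
proof -
  obtain k where k: "\<tau> = of_nat k" using tau_nat by blast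
  have "phi (i + k * p) = phi i" by (rule phi_period) (simp add: Cong.cong_def)
  then show ?thesis using phi_frob[OF k, of i A p] by simp
qed

text \<open>All nonzero values of the \<open>phi i\<close> satisfy \<open>z ^ N = 1\<close>. Hence
  \<open>a ^ (N - 1)\<close> serves as an inverse of \<open>a\<close> modulo the kernel without
  leaving the polynomials, and \<open>a ^ N - 1\<close> is an element of the kernel.\<close>

definition N :: nat where "N = CARD('g) ^ (m * p) - 1"

lemma N_pos: "N > 0"
proof -
  have "1 < CARD('g) ^ (m * p)" using CARD_gt_1 m_pos p by (intro one_less_power) auto
  then show ?thesis by (simp add: N_def)
qed

lemma phi_unit: "phi i a \<noteq> 0 \<Longrightarrow> phi i a ^ N = 1"
proof -
  assume a: "phi i a \<noteq> 0"
  have "phi i a * phi i a ^ N = phi i a * 1"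
    unfolding power_Suc[symmetric] using phi_fixed[of i a] N_pos by (simp add: N_def del: power_Suc)
  then show ?thesis using a by simp
qed

lemma phi_unit': "phi i a \<noteq> 0 \<Longrightarrow> phi i (a ^ N - 1) = 0"
  using phi_unit by (simp add: phi_simps)

text \<open>The kernels are maximal ideals, so an inclusion between two of them is an
  equality.\<close>

lemma ker_eq:
  assumes "\<And>a. phi i a = 0 \<Longrightarrow> phi j a = 0" and a: "phi j a = 0"
  shows "phi i a = 0"
proof (rule ccontr)
  assume "phi i a \<noteq> 0"
  then have "phi j (a ^ N - 1) = 0" using assms(1) phi_unit' by blast
  then show False using a N_pos by (simp add: phi_simps power_0_left)
qed

text \<open>Locally at the kernel of a single \<open>phi i\<close>, that kernel is generated by \<open>P\<close>: the other
  kernels are avoided by multiplying with elements of theirs.\<close>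

lemma unram:
  assumes a: "phi i a = 0"
  shows "\<exists>b a'. phi i b \<noteq> 0 \<and> ev b * ev a = emb P * ev a'"
proof -
  have "\<exists>b. phi i b \<noteq> 0 \<and> phi j (b * a) = 0" for j
  proof (cases "\<forall>c. phi j c = 0 \<longrightarrow> phi i c = 0")
    case True
    then have "phi j a = 0" using ker_eq[of j i a] a by blast
    then show ?thesis by (intro exI[of _ 1]) (simp add: phi_simps)
  next
    case False
    then show ?thesis by (auto simp: phi_simps)
  qed
  then obtain b where b: "\<And>j. phi i (b j) \<noteq> 0" "\<And>j. phi j (b j * a) = 0" by metis
  let ?b = "\<Prod>j<p. b j"
  have "phi j (?b * a) = 0" if "j < p" for j
  proof -
    have "?b * a = (\<Prod>j\<in>{..<p} - {j}. b j) * (b j * a)"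
      using that by (simp add: prod.remove[of "{..<p}" j] mult_ac)
    then have "phi j (?b * a) = phi j (\<Prod>j\<in>{..<p} - {j}. b j) * phi j (b j * a)" by (simp only: phi_simps(6))
    then show ?thesis using b(2)[of j] by simp
  qed
  then obtain a' where "ev (?b * a) = emb P * ev a'" using all_ker[of "?b * a"] by blast
  moreover have "phi i ?b \<noteq> 0" using b(1) by (simp add: phi_simps)
  ultimately show ?thesis by (metis ev_simps(7))
qed

text \<open>The candidate places over \<open>P\<close> are the localizations at the kernels of \<open>phi i\<close>; they need not be
  distinct.\<close>

definition Vp :: "nat \<Rightarrow> 'g poly fract alg_closure set" where
  "Vp i = {ev a / ev b | a b. phi i b \<noteq> 0}"

lemma ev_nz: "phi i b \<noteq> 0 \<Longrightarrow> ev b \<noteq> 0"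
  using phi_cong[of b 0 i] by (auto simp: ev_simps phi_simps)

lemma Vp_I: "phi i b \<noteq> 0 \<Longrightarrow> ev a / ev b \<in> Vp i" by (auto simp: Vp_def)

lemma Vp_ev: "ev a \<in> Vp i" using Vp_I[of i 1 a] by (simp add: ev_simps phi_simps)

lemma Vp_emb: "emb h \<in> Vp i" using Vp_ev[of "[:h:]"] by (simp add: ev_simps)

lemma Vp_K: "Vp i \<subseteq> K"
  unfolding Vp_def using K_ring by (auto simp: divide_inverse intro!: ring_closedD(4)[OF K_ring] K_ev K_inverse)

lemma Vp_ring: "ring_closed (Vp i)"
  unfolding ring_closed_def
proof (intro conjI ballI)
  show "1 \<in> Vp i" using Vp_ev[of 1] by (simp add: ev_simps)
  fix u v assume "u \<in> Vp i" "v \<in> Vp i"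
  then obtain a b c d where uv: "u = ev a / ev b" "v = ev c / ev d" "phi i b \<noteq> 0" "phi i d \<noteq> 0" by (auto simp: Vp_def)
  have nz: "ev b \<noteq> 0" "ev d \<noteq> 0" "phi i (b * d) \<noteq> 0" using uv ev_nz by (auto simp: phi_simps)
  have "u - v = ev (a * d - c * b) / ev (b * d)" unfolding uv(1,2) using nz by (simp add: ev_simps field_simps)
  then show "u - v \<in> Vp i" using Vp_I[OF nz(3)] by simp
  have "u * v = ev (a * c) / ev (b * d)" unfolding uv(1,2) by (simp add: ev_simps)
  then show "u * v \<in> Vp i" using Vp_I[OF nz(3)] by simp
qed

lemma phi_unit_maxi:
  assumes V: "vr K V" and R: "\<And>a. ev a \<in> V" and ker: "\<And>a. phi i a = 0 \<Longrightarrow> ev a \<in> vr.maxi V"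
  shows "ev a \<in> vr.maxi V \<longleftrightarrow> phi i a = 0"
proof
  interpret vr K V by fact
  assume a: "ev a \<in> maxi"
  show "phi i a = 0"
  proof (rule ccontr)
    assume "phi i a \<noteq> 0"
    then have "ev (a ^ N - 1) \<in> maxi" using ker phi_unit' by blast
    then have "ev a ^ N - 1 \<in> maxi" by (simp add: ev_simps)
    then have "ev a ^ N - (ev a ^ N - 1) \<in> maxi" by (rule maxi_diff[OF power_maxi[OF a N_pos]])
    then have "1 \<in> maxi" by simp
    then show False using one_notin_maxi by blast
  qed
qed (rule ker)

text \<open>\<open>V\<close> contains the localization because everything outside the kernel is a
  unit of \<open>V\<close>. Conversely, an element of \<open>V\<close> is written with a denominator
  \<open>emb h\<close>, and the factors \<open>P\<close> of \<open>h\<close> are cancelled one at a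
  time by \<open>unram\<close>, at the price of further factors \<open>b\<close> outside the
  kernel.\<close>

lemma place_eq:
  assumes V: "vr K V" and R: "\<And>a. ev a \<in> V" and ker: "\<And>a. phi i a = 0 \<Longrightarrow> ev a \<in> vr.maxi V"
  shows "V = Vp i"
proof
  interpret vr K V by fact
  note mx = phi_unit_maxi[OF assms]
  show "Vp i \<subseteq> V"
  proof
    fix z assume "z \<in> Vp i"
    then obtain a b where z: "z = ev a / ev b" "phi i b \<noteq> 0" by (auto simp: Vp_def)
    then have "inverse (ev b) \<in> V" using R unitD[of "ev b"] mx by blast
    then show "z \<in> V" unfolding z divide_inverse by (intro VR(4) R)
  qed
  have embP: "emb P \<in> maxi" using ker[of "[:P:]"] root by (simp add: phi_const ev_simps)
  have main: "z \<in> Vp i" if "z \<in> V" "z * (ev b * emb h) = ev r" "phi i b \<noteq> 0" "h \<noteq> 0" for z r b h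
    using that
  proof (induction "degree h" arbitrary: h r b rule: less_induct)
    case less
    show ?case
    proof (cases "P dvd h")
      case False
      then have "phi i (b * [:h:]) \<noteq> 0" using less unfolding phi_simps(6) phi_const by (simp add: eval_0_iff)
      moreover then have "z = ev r / ev (b * [:h:])" using less(3) ev_nz[of i "b * [:h:]"] by (simp add: ev_simps field_simps)
      ultimately show ?thesis using Vp_I by simp
    next
      case True
      then obtain h' where h: "h = P * h'" by (elim dvdE)
      have h': "h' \<noteq> 0" using less h by auto
      then have deg: "degree h' < degree h" using h P0 m_pos by (simp add: degree_mult_eq)
      have "emb P * (z * ev b * emb h') \<in> maxi"
        using R[of "[:h':]"] less(2) by (intro maxi_mult embP VR(4) R) (auto simp: ev_simps)
      also have eq: "emb P * (z * ev b * emb h') = ev r" unfolding less(3)[symmetric] h by (simp add: mult_ac)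
      finally have "phi i r = 0" using mx by simp
      then obtain b1 a' where b1: "phi i b1 \<noteq> 0" "ev b1 * ev r = emb P * ev a'" using unram by blast
      have "emb P * (z * (ev (b * b1) * emb h')) = emb P * ev a'"
        unfolding b1(2)[symmetric] eq[symmetric] by (simp add: ev_simps mult_ac)
      then have "z * (ev (b * b1) * emb h') = ev a'" using P0 by simp
      moreover have "phi i (b * b1) \<noteq> 0" using less b1 by (simp add: phi_simps)
      ultimately show ?thesis using less(1)[OF deg less(2)] h' by blast
    qed
  qed
  show "V \<subseteq> Vp i"
  proof
    fix z assume z: "z \<in> V"
    then obtain A h where "z = ev A / emb h" "h \<noteq> 0" using V(2) by (auto simp: K_def)
    then show "z \<in> Vp i" using main[OF z, of 1 h A] by (simp add: phi_simps ev_simps)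
  qed
qed

text \<open>If no kernel lay inside \<open>maxi\<close>, one element of each kernel could be chosen
  outside it. Their product lies in all kernels, is therefore divisible by \<open>P\<close> and
  belongs to \<open>maxi\<close>, which is prime.\<close>

lemma place_over:
  assumes V: "vr K V" and c: "cst \<subseteq> V" and T: "T \<in> V" and embP: "emb P \<in> vr.maxi V"
  shows "\<exists>i<p. V = Vp i"
proof (rule ccontr)
  interpret vr K V by fact
  note R = range_ev[OF vr_axioms c T]
  assume "\<not> ?thesis"
  then have "\<forall>i. \<exists>a. i < p \<longrightarrow> phi i a = 0 \<and> ev a \<notin> maxi" using place_eq[OF vr_axioms R] by blast
  then obtain a where a: "\<And>i. i < p \<Longrightarrow> phi i (a i) = 0" "\<And>i. i < p \<Longrightarrow> ev (a i) \<notin> maxi" by metis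
  have "phi i (\<Prod>i<p. a i) = 0" if "i < p" for i
    using that a by (auto simp: phi_simps)
  then obtain A' where "ev (\<Prod>i<p. a i) = emb P * ev A'" using all_ker by blast
  then have "(\<Prod>i<p. ev (a i)) \<in> maxi" using maxi_mult[OF embP R, of A'] by (simp add: ev_simps)
  then show False using maxi_prod_prime[of "{..<p}" "\<lambda>i. ev (a i)"] a R by auto
qed

text \<open>Chevalley's theorem only provides some valuation ring above the localization in which
  \<open>emb P\<close> is not invertible; \<open>place_eq\<close> identifies it with the
  localization itself.\<close>

lemma Vp_place: "vr K (Vp i)" "\<And>a. phi i a = 0 \<Longrightarrow> ev a \<in> vr.maxi (Vp i)"
proof -
  have "inverse (emb P) \<notin> Vp i"
  proof
    assume "inverse (emb P) \<in> Vp i"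
    then obtain a b where ab: "inverse (emb P) = ev a / ev b" "phi i b \<noteq> 0" by (auto simp: Vp_def)
    then have "ev b = ev ([:P:] * a)" using ev_nz[OF ab(2)] P0 by (simp add: ev_simps field_simps)
    then have "phi i b = phi i ([:P:] * a)" by (rule phi_cong)
    then show False using ab(2) root unfolding phi_simps(6) phi_const by simp
  qed
  then obtain W where W: "ring_closed W" "Vp i \<subseteq> W" "\<And>z. z \<in> W \<or> inverse z \<in> W" "inverse (emb P) \<notin> W"
    using chevalley[OF Vp_ring Vp_emb] by metis
  have V: "vr K (W \<inter> K)" by (rule vr_restrict) (use W in auto)
  interpret vr K "W \<inter> K" by fact
  have sub: "Vp i \<subseteq> W \<inter> K" using W Vp_K by auto
  have embP: "emb P \<in> maxi" using sub Vp_emb[of P i] W(4) by (auto simp: maxi_def)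
  have ker: "ev a \<in> maxi" if a: "phi i a = 0" for a
  proof -
    obtain b a' where b: "phi i b \<noteq> 0" "ev b * ev a = emb P * ev a'" using unram[OF a] by blast
    have "ev b * ev a \<in> maxi" unfolding b(2) using sub Vp_ev by (intro maxi_mult embP) auto
    moreover have "ev b \<notin> maxi"
    proof
      assume "ev b \<in> maxi"
      then have "inverse (ev b) \<notin> W \<inter> K" using ev_nz[OF b(1)] by (rule maxi_inverse_not_V)
      moreover have "inverse (ev b) \<in> Vp i" using Vp_I[OF b(1), of 1] by (simp add: ev_simps divide_inverse)
      ultimately show False using sub by blast
    qed
    ultimately show ?thesis using maxi_prime[of "ev b" "ev a"] sub Vp_ev by blast
  qed
  have eq: "W \<inter> K = Vp i" by (rule place_eq[OF vr_axioms _ ker]) (use sub Vp_ev in blast)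
  show "vr K (Vp i)" using vr_axioms by (simp add: eq)
  show "\<And>a. phi i a = 0 \<Longrightarrow> ev a \<in> vr.maxi (Vp i)" using ker by (simp add: eq)
qed

lemma Vp_maxi: "ev a \<in> vr.maxi (Vp i) \<longleftrightarrow> phi i a = 0"
  by (rule phi_unit_maxi[OF Vp_place(1) Vp_ev Vp_place(2)])

lemma nrm_Vp: "nrm (Vp i) = card (range (phi i))"
proof -
  interpret vr K "Vp i" by (rule Vp_place)
  define \<rho> where "\<rho> z = (THE r. \<exists>a b. z = ev a / ev b \<and> phi i b \<noteq> 0 \<and> r = phi i a / phi i b)" for z
  have \<rho>: "\<rho> (ev a / ev b) = phi i a / phi i b" if b: "phi i b \<noteq> 0" for a b
    unfolding \<rho>_def
  proof (rule the_equality)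
    show "\<exists>a' b'. ev a / ev b = ev a' / ev b' \<and> phi i b' \<noteq> 0 \<and> phi i a / phi i b = phi i a' / phi i b'" using b by blast
    fix r assume "\<exists>a' b'. ev a / ev b = ev a' / ev b' \<and> phi i b' \<noteq> 0 \<and> r = phi i a' / phi i b'"
    then obtain a' b' where r: "ev a / ev b = ev a' / ev b'" "phi i b' \<noteq> 0" "r = phi i a' / phi i b'" by blast
    then have "ev (a * b') = ev (a' * b)" using ev_nz[OF b] ev_nz[OF r(2)] by (simp add: ev_simps frac_eq_eq)
    then have "phi i (a * b') = phi i (a' * b)" by (rule phi_cong)
    then show "r = phi i a / phi i b" using b r by (simp add: phi_simps frac_eq_eq)
  qed
  have "nrm (Vp i) = card (\<rho> ` Vp i)"
  proof (rule nrm_eq)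
    fix z w assume "z \<in> Vp i" "w \<in> Vp i"
    then obtain a b c d where zw: "z = ev a / ev b" "w = ev c / ev d" "phi i b \<noteq> 0" "phi i d \<noteq> 0" by (auto simp: Vp_def)
    have nz: "ev b \<noteq> 0" "ev d \<noteq> 0" "phi i (b * d) \<noteq> 0" using zw ev_nz by (auto simp: phi_simps)
    have eq: "w - z = ev (c * b - a * d) / ev (b * d)" unfolding zw(1,2) using nz by (simp add: ev_simps field_simps)
    have bd: "inverse (ev (b * d)) \<in> Vp i" using Vp_I[OF nz(3), of 1] by (simp add: ev_simps(2) divide_inverse)
    have evnz: "ev (b * d) \<noteq> 0" using nz by (simp add: ev_simps)
    have "w - z \<in> maxi \<longleftrightarrow> ev (c * b - a * d) \<in> maxi"
    proof
      assume "w - z \<in> maxi"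
      then have "(w - z) * ev (b * d) \<in> maxi" by (intro maxi_mult Vp_ev)
      then show "ev (c * b - a * d) \<in> maxi" unfolding eq using evnz by simp
    next
      assume "ev (c * b - a * d) \<in> maxi"
      then show "w - z \<in> maxi" unfolding eq divide_inverse by (rule maxi_mult[OF _ bd])
    qed
    also have "\<dots> \<longleftrightarrow> phi i c * phi i b = phi i a * phi i d" unfolding Vp_maxi by (simp add: phi_simps)
    also have "\<dots> \<longleftrightarrow> \<rho> z = \<rho> w" unfolding zw(1,2) \<rho>[OF zw(3)] \<rho>[OF zw(4)] using zw(3,4) by (auto simp: frac_eq_eq)
    finally show "\<rho> z = \<rho> w \<longleftrightarrow> w - z \<in> maxi" by simp
  qed
  also have "\<rho> ` Vp i = range (phi i)"
  proof
    show "\<rho> ` Vp i \<subseteq> range (phi i)"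
    proof
      fix r assume "r \<in> \<rho> ` Vp i"
      then obtain a b where b: "phi i b \<noteq> 0" "r = phi i a / phi i b" by (auto simp: Vp_def \<rho>)
      have "phi i b * phi i b ^ (N - 1) = 1" using phi_unit[OF b(1)] N_pos by (metis power_minus_mult mult.commute)
      then have "inverse (phi i b) = phi i b ^ (N - 1)" by (rule inverse_unique)
      then have "r = phi i (a * b ^ (N - 1))" unfolding b divide_inverse by (simp add: phi_simps)
      then show "r \<in> range (phi i)" by blast
    qed
    show "range (phi i) \<subseteq> \<rho> ` Vp i"
    proof
      fix r assume "r \<in> range (phi i)"
      then obtain a where "r = phi i a" by blast
      then have "r = \<rho> (ev a / ev 1)" using \<rho>[of 1 a] by (simp add: phi_simps)
      then show "r \<in> \<rho> ` Vp i" using Vp_I[of i 1 a] by (simp add: phi_simps)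
    qed
  qed
  finally show ?thesis .
qed

lemma red_range: "range red \<subseteq> range (phi i)"
  unfolding phi_const[of i, symmetric] by blast

text \<open>With trivial trace Frobenius fixes every \<open>phi i\<close>, so all values lie in the
  residue field of \<open>P\<close>. Then \<open>y0\<close> is the reduction of some
  \<open>c\<close>, and \<open>y - c - i\<close> vanishes under \<open>phi i\<close> but under no
  other \<open>phi j\<close>.\<close>

lemma split_case:
  assumes "psi (lam f P) = 1"
  shows "nrm (Vp i) = CARD('g) ^ m" and "inj_on Vp {..<p}"
proof -
  obtain k where k: "\<tau> = of_nat k" "p dvd k" using tau_nat assms by metis
  have fx: "phi i A ^ (CARD('g) ^ m) = phi i A" for i A
  proof -
    have "phi (i + k * 1) = phi i" using k(2) by (intro phi_period) (auto simp: Cong.cong_def elim!: dvdE)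
    then show ?thesis using phi_frob[OF k(1), of i A 1] by simp
  qed
  have "range (phi i) = {z. z ^ (CARD('g) ^ m) = z}" for i
  proof
    show "range (phi i) \<subseteq> {z. z ^ (CARD('g) ^ m) = z}" using fx by auto
    show "{z. z ^ (CARD('g) ^ m) = z} \<subseteq> range (phi i)" using red_range[of i] by (simp only: residue_field)
  qed
  then show "nrm (Vp i) = CARD('g) ^ m" for i using nrm_Vp frob_fixed_card[OF m_pos] by simp
  have "phi 0 [:0,1:] = y0" by (simp add: phi_simps)
  then have "y0 \<in> range red" unfolding residue_field using fx[of 0 "[:0,1:]"] by simp
  then obtain c where c: "y0 = red c" by blast
  show "inj_on Vp {..<p}"
  proof (rule inj_onI)
    fix i j assume ij: "i \<in> {..<p}" "j \<in> {..<p}" "Vp i = Vp j"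
    let ?a = "[:0, 1:] - [:c + of_nat i:] :: 'g poly poly"
    have nn: "red (of_nat i) = of_nat i"
      by (induction i) (simp_all only: of_nat_0 of_nat_Suc rhomD[OF rhom_red])
    have ph: "phi l ?a = of_nat l - of_nat i" for l
      by (simp only: phi_simps) (simp add: ac_add nn c[symmetric])
    have "phi i ?a = 0" unfolding ph by simp
    then have "phi j ?a = 0" using Vp_maxi ij(3) by metis
    then have "of_nat j = (of_nat i :: 'g alg_closure)" unfolding ph by simp
    then show "i = j" using of_nat_inj[of i j] ij by simp
  qed
qed

text \<open>A shift prime to \<open>p\<close> carries any index to any other, so all
  \<open>phi i\<close> have the same kernel. By \<open>all_ker_coeff\<close> the reduced polynomials
  with coefficients of degree below \<open>m\<close> then have different images, which makes the
  residue field as large as \<open>phi_fixed\<close> permits.\<close>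

lemma inert_case:
  assumes "psi (lam f P) \<noteq> 1"
  shows "nrm (Vp i) = CARD('g) ^ (m * p)" and "Vp i = Vp j"
proof -
  obtain k where k: "\<tau> = of_nat k" "\<not> p dvd k" using tau_nat assms by metis
  have ker: "phi j a = 0" if a: "phi i a = 0" for i j a
  proof -
    have "coprime k p" using prime_imp_coprime[OF p(1) k(2)] by (simp add: coprime_commute)
    \<comment> \<open>The right-hand side is \<open>j - i\<close> modulo \<open>p\<close>, written
      without subtraction of natural numbers.\<close>
    then obtain n where "[k * n = j + (p - 1) * i] (mod p)" using cong_solve_coprime_nat by (metis cong_scalar_right mult.assoc mult_1 One_nat_def)
    then have "[i + k * n = i + (j + (p - 1) * i)] (mod p)" by (simp add: cong_add_lcancel_nat)
    also have "i + (j + (p - 1) * i) = j + p * i" using p by (cases p) (simp_all add: algebra_simps)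
    finally have "phi (i + k * n) = phi j" using phi_period by (metis cong_add_lcancel_0_nat cong_mult_self_left cong_trans)
    then have "phi j a = phi i a ^ (CARD('g) ^ (m * n))" using phi_frob[OF k(1), of i a n] by simp
    then show ?thesis using a by (simp add: power_0_left)
  qed
  show "Vp i = Vp j" using ker unfolding Vp_def by (metis (no_types))
  have sub: "range (phi i) \<subseteq> {z. z ^ (CARD('g) ^ (m * p)) = z}" using phi_fixed by auto
  have fin: "finite {z :: 'g alg_closure. z ^ (CARD('g) ^ (m * p)) = z}" using m_pos p by (intro frob_fixed_finite) simp
  have le: "card (range (phi i)) \<le> CARD('g) ^ (m * p)"
    using card_mono[OF fin sub] frob_fixed_card[where 'g='g, of "m * p"] m_pos p by simp
  let ?S = "{..<p} \<rightarrow>\<^sub>E {c :: 'g poly. degree c < m}"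
  define pol where "pol g = (\<Sum>j<p. Polynomial.monom (g j) j)" for g :: "nat \<Rightarrow> 'g poly"
  have cpol: "coeff (pol g) j = (if j < p then g j else 0)" for g j
    by (simp add: pol_def coeff_sum coeff_monom if_distrib sum.delta cong: if_cong)
  have dpol: "degree (pol g) < p" for g
    using p by (intro degree_lessI) (auto simp: cpol)
  have inj: "inj_on (\<lambda>g. phi i (pol g)) ?S"
  proof (rule inj_onI)
    fix g g' assume g: "g \<in> ?S" "g' \<in> ?S" and eq: "phi i (pol g) = phi i (pol g')"
    have "phi i (pol g - pol g') = 0" using eq by (simp add: phi_simps)
    then have z: "phi j (pol g - pol g') = 0" for j using ker by blast
    have "g j = g' j" for j
    proof (cases "j < p")
      case True
      have "degree (pol g - pol g') < p" using dpol[of g] dpol[of g'] by (rule degree_diff_less)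
      then have dv: "P dvd g j - g' j" using all_ker_coeff[of "pol g - pol g'" j] z True by (simp add: cpol)
      have "degree (g j) < m" "degree (g' j) < m" using g True by (auto simp: PiE_iff)
      then have "degree (g j - g' j) < m" by (rule degree_diff_less)
      then show ?thesis using dv dvd_imp_degree_le[of P "g j - g' j"] by (metis eq_iff_diff_eq_0 not_less)
    qed (use g in \<open>auto simp: PiE_iff extensional_def\<close>)
    then show "g = g'" by blast
  qed
  have "CARD('g) ^ (m * p) = card ?S" using m_pos by (simp add: card_PiE card_degree_less power_mult)
  also have "card ?S = card ((\<lambda>g. phi i (pol g)) ` ?S)" using inj by (simp add: card_image)
  also have "\<dots> \<le> card (range (phi i))" by (intro card_mono finite_subset[OF sub fin]) auto
  finally show "nrm (Vp i) = CARD('g) ^ (m * p)" using le nrm_Vp by simp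
qed

end

context as_field
begin

section \<open>Decomposition of the set of places into fibres\<close>

definition Fib :: "'g poly \<Rightarrow> 'g poly fract alg_closure set set" where
  "Fib P = {V. isplace V \<and> emb P \<in> vr.maxi V}"

lemma Fib_T:
  assumes VF: "V \<in> Fib P" and P: "P \<in> monic_irreducibles" shows "T \<in> V"
proof (rule ccontr)
  assume "T \<notin> V"
  then interpret as_inf f y p V
    by (intro as_inf.intro as_inf_axioms.intro as_field_axioms) (use VF in \<open>auto simp: Fib_def isplace_def\<close>)
  have P0: "P \<noteq> 0" using P by (auto simp: monic_irreducibles_def)
  obtain u where u: "u \<in> units" "emb P = T ^ degree P * u" using inf_emb_unit[OF P0] by blast
  have "emb P * inverse u \<in> V" using VF u units_D(1)[OF units_inverse[OF u(1)]] maxi_V by (intro VR(4)) (auto simp: Fib_def)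
  then have "T ^ degree P \<in> V" using u units_D(2)[OF u(1)] by (simp add: mult.assoc)
  then show False using power_in_V[OF K_emb] monic_irreducible_degree_pos[OF P] \<open>T \<notin> V\<close> by blast
qed

lemma Fib_props:
  assumes P: "P \<in> monic_irreducibles"
  shows "finite (Fib P)"
    and "psi (lam f P) = 1 \<Longrightarrow> card (Fib P) = p \<and> (\<forall>V\<in>Fib P. nrm V = CARD('g) ^ degree P)"
    and "psi (lam f P) \<noteq> 1 \<Longrightarrow> card (Fib P) = 1 \<and> (\<forall>V\<in>Fib P. nrm V = CARD('g) ^ (degree P * p))"
proof -
  obtain \<theta> where \<theta>: "poly (ac P) \<theta> = 0" using monic_irreducible_ac_root[OF P] by blast
  have "degree (Polynomial.monom 1 p - Polynomial.monom 1 1 - [:poly (ac f) \<theta>:] :: 'g alg_closure poly) > 0"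
  proof -
    have "coeff (Polynomial.monom 1 p - Polynomial.monom 1 1 - [:poly (ac f) \<theta>:] :: 'g alg_closure poly) p = 1"
      using p by (simp add: coeff_pCons split: nat.splits)
    then show ?thesis using p le_degree[of "Polynomial.monom 1 p - Polynomial.monom 1 1 - [:poly (ac f) \<theta>:] :: 'g alg_closure poly" p] by simp
  qed
  then obtain y0 where "poly (Polynomial.monom 1 p - Polynomial.monom 1 1 - [:poly (ac f) \<theta>:]) y0 = 0"
    using alg_closed_imp_poly_has_root by blast
  then have y0: "y0 ^ p - y0 = poly (ac f) \<theta>" by (simp add: poly_monom)
  interpret as_fin f y p P \<theta> y0
    by (intro as_fin.intro as_fin_axioms.intro as_field_axioms irr_root.intro P \<theta> y0)
  have Fib: "Fib P = Vp ` {..<p}"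
  proof
    show "Fib P \<subseteq> Vp ` {..<p}"
    proof
      fix V assume V: "V \<in> Fib P"
      then show "V \<in> Vp ` {..<p}" using place_over[of V] Fib_T[OF V P] by (auto simp: Fib_def isplace_def)
    qed
    show "Vp ` {..<p} \<subseteq> Fib P"
    proof
      fix V assume "V \<in> Vp ` {..<p}"
      then obtain i where V: "V = Vp i" by blast
      interpret v: vr K "Vp i" by (rule Vp_place)
      have embP: "emb P \<in> v.maxi" using Vp_maxi[of "[:P:]" i] \<theta> by (simp add: phi_const ev_simps)
      then have "inverse (emb P) \<notin> Vp i" using P0 by (intro v.maxi_inverse_not_V) auto
      then have "Vp i \<noteq> K" using K_inverse[OF K_emb] by blast
      moreover have "cst \<subseteq> Vp i" using Vp_emb by (auto simp: cst_def)
      ultimately show "V \<in> Fib P" using embP Vp_place(1) by (simp add: V Fib_def isplace_def)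
    qed
  qed
  show "finite (Fib P)" unfolding Fib by simp
  show "card (Fib P) = p \<and> (\<forall>V\<in>Fib P. nrm V = CARD('g) ^ degree P)" if "psi (lam f P) = 1"
    using split_case[OF that] by (auto simp: Fib card_image)
  show "card (Fib P) = 1 \<and> (\<forall>V\<in>Fib P. nrm V = CARD('g) ^ (degree P * p))" if "psi (lam f P) \<noteq> 1"
  proof -
    have "Vp ` {..<p} = {Vp 0}" using inert_case(2)[OF that, of _ 0] p by auto
    then show ?thesis using inert_case(1)[OF that] by (simp add: Fib)
  qed
qed

text \<open>If no nonzero polynomial were in \<open>maxi\<close>, all denominators would be units
  and \<open>V\<close> would be \<open>K\<close>. A polynomial of least degree in
  \<open>maxi\<close> has an irreducible factor there, since its cofactor is too short.\<close>

lemma finite_place: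
  assumes V: "isplace V" and T: "T \<in> V"
  shows "\<exists>P\<in>monic_irreducibles. V \<in> Fib P"
proof -
  have cV: "cst \<subseteq> V" and VK: "V \<noteq> K" using V by (simp_all add: isplace_def)
  interpret vr K V using V by (simp add: isplace_def)
  note emb = range_emb[OF vr_axioms cV T]
  have "\<exists>h. h \<noteq> 0 \<and> emb h \<in> maxi"
  proof (rule ccontr)
    assume "\<not> ?thesis"
    then have inv: "inverse (emb h) \<in> V" if "h \<noteq> 0" for h using that unitD[OF emb] by blast
    obtain P where P: "P \<in> (monic_irreducibles :: 'g poly set)" using monic_irreducible_factor_exists[of "[:0,1:]"] by auto
    have "K \<subseteq> V"
    proof
      fix z assume z: "z \<in> K"
      show "z \<in> V" using z inv VR(4) range_ev[OF vr_axioms cV T] by (auto simp: K_def divide_inverse)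
    qed
    then show False using VK V(2) by blast
  qed
  then obtain h0 where h0: "h0 \<noteq> 0 \<and> emb h0 \<in> maxi" by blast
  then obtain h where h: "h \<noteq> 0 \<and> emb h \<in> maxi" "\<And>h'. h' \<noteq> 0 \<and> emb h' \<in> maxi \<Longrightarrow> degree h \<le> degree h'"
    using ex_has_least_nat[of "\<lambda>h. h \<noteq> 0 \<and> emb h \<in> maxi" h0 degree] by blast
  have "degree h > 0"
  proof (rule ccontr)
    assume "\<not> degree h > 0"
    then obtain c where c: "h = [:c:]" "c \<noteq> 0" using h by (auto elim: degree_eq_zeroE)
    then have "inverse (emb h) \<in> V" using cV by (auto simp: inverse_emb_const cst_def)
    then show False using h c maxi_inverse_not_V by auto
  qed
  then obtain P where P: "P \<in> monic_irreducibles" "P dvd h" using monic_irreducible_factor_exists by blast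
  then obtain k where k: "h = P * k" by (elim dvdE)
  have "k \<noteq> 0" "P \<noteq> 0" using h k by auto
  then have "degree k < degree h" using k monic_irreducible_degree_pos[OF P(1)] by (simp add: degree_mult_eq)
  then have "emb k \<notin> maxi" using h(2)[of k] \<open>k \<noteq> 0\<close> by auto
  moreover have "emb P * emb k \<in> maxi" using h k by simp
  ultimately have "emb P \<in> maxi" using maxi_prime[OF emb emb] by blast
  then show ?thesis using P assms(1) by (auto simp: Fib_def)
qed

lemma places_eq: "{V. isplace V} = insert Vinf (\<Union>P\<in>monic_irreducibles. Fib P)"
proof
  show "{V. isplace V} \<subseteq> insert Vinf (\<Union>P\<in>monic_irreducibles. Fib P)"
    using finite_place place_eq_Vinf by blast
  show "insert Vinf (\<Union>P\<in>monic_irreducibles. Fib P) \<subseteq> {V. isplace V}"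
    using Vinf_place by (auto simp: Fib_def)
qed

lemma Vinf_notin: "Vinf \<notin> (\<Union>P\<in>monic_irreducibles. Fib P)"
  using Fib_T Vinf(3) by blast

lemma Fib_disjoint: "disjoint_family_on Fib monic_irreducibles"
  unfolding disjoint_family_on_def
proof (intro ballI impI)
  fix P Q :: "'g poly" assume PQ: "P \<in> monic_irreducibles" "Q \<in> monic_irreducibles" "P \<noteq> Q"
  show "Fib P \<inter> Fib Q = {}"
  proof (rule ccontr)
    assume "\<not> ?thesis"
    then obtain V where V: "V \<in> Fib P" "V \<in> Fib Q" by blast
    have TV: "T \<in> V" using Fib_T V PQ by blast
    have cV: "cst \<subseteq> V" and PV: "emb P \<in> vr.maxi V" "emb Q \<in> vr.maxi V" using V by (simp_all add: Fib_def isplace_def)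
    interpret vr K V using V by (simp add: Fib_def isplace_def)
    note emb = range_emb[OF vr_axioms cV TV]
    have "\<not> P dvd Q" using monic_irreducible_dvd_eq PQ by blast
    then obtain A B where AB: "A * P + B * Q = 1" using monic_irreducible_bezout[of P Q] PQ by (auto simp: monic_irreducibles_def)
    have "emb P * emb A + emb Q * emb B \<in> maxi"
      by (intro maxi_add maxi_mult emb PV)
    also have "emb P * emb A + emb Q * emb B = emb (A * P + B * Q)" by (simp add: mult.commute)
    finally show False unfolding AB by simp
  qed
qed

end

 

subsection \<open>Transfer to rings on natural numbers\<close>

locale field_copy =
  fixes K :: "'k::field set" and L :: "nat ring" and e :: "nat \<Rightarrow> 'k"
  assumes K_closed: "ring_closed K" and K_inv: "\<And>z. z \<in> K \<Longrightarrow> inverse z \<in> K"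
    and L_field: "field L" and bij: "bij_betw e (carrier L) K"
    and e_mult: "\<And>x y. x \<in> carrier L \<Longrightarrow> y \<in> carrier L \<Longrightarrow> e (x \<otimes>\<^bsub>L\<^esub> y) = e x * e y"
    and e_add: "\<And>x y. x \<in> carrier L \<Longrightarrow> y \<in> carrier L \<Longrightarrow> e (x \<oplus>\<^bsub>L\<^esub> y) = e x + e y"
    and e_one: "e \<one>\<^bsub>L\<^esub> = 1"
begin

sublocale L: field L by (fact L_field)

lemma e_inj: "x \<in> carrier L \<Longrightarrow> y \<in> carrier L \<Longrightarrow> e x = e y \<longleftrightarrow> x = y"
  using bij by (auto simp: bij_betw_def inj_on_def)

lemma e_K: "x \<in> carrier L \<Longrightarrow> e x \<in> K" using bij by (auto simp: bij_betw_def)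

lemma e_surj: "z \<in> K \<Longrightarrow> \<exists>x\<in>carrier L. e x = z" using bij by (auto simp: bij_betw_def)

lemma e_zero: "e \<zero>\<^bsub>L\<^esub> = 0"
  by (metis L.l_zero L.zero_closed add_cancel_left_left e_add)

lemma e_eq_0: "x \<in> carrier L \<Longrightarrow> e x = 0 \<longleftrightarrow> x = \<zero>\<^bsub>L\<^esub>"
  using e_inj[of x "\<zero>\<^bsub>L\<^esub>"] by (simp add: e_zero)

lemma e_minus: "x \<in> carrier L \<Longrightarrow> e (\<ominus>\<^bsub>L\<^esub> x) = - e x"
  using e_add[of x "\<ominus>\<^bsub>L\<^esub> x"] by (simp add: L.r_neg e_zero eq_neg_iff_add_eq_0 add.commute)

lemma inv_carrier: "x \<in> carrier L \<Longrightarrow> x \<noteq> \<zero>\<^bsub>L\<^esub> \<Longrightarrow> inv\<^bsub>L\<^esub> x \<in> carrier L"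
  by (intro L.Units_inv_closed) (simp add: L.field_Units)

lemma e_inv: "x \<in> carrier L \<Longrightarrow> x \<noteq> \<zero>\<^bsub>L\<^esub> \<Longrightarrow> e (inv\<^bsub>L\<^esub> x) = inverse (e x)"
proof -
  assume x: "x \<in> carrier L" "x \<noteq> \<zero>\<^bsub>L\<^esub>"
  have "x \<otimes>\<^bsub>L\<^esub> inv\<^bsub>L\<^esub> x = \<one>\<^bsub>L\<^esub>" using x by (intro L.Units_r_inv) (simp add: L.field_Units)
  then have "e x * e (inv\<^bsub>L\<^esub> x) = 1" using e_mult[OF x(1) inv_carrier[OF x]] e_one by simp
  then show ?thesis using inverse_unique by metis
qed

lemma e_pow: "x \<in> carrier L \<Longrightarrow> e (x [^]\<^bsub>L\<^esub> (n::nat)) = e x ^ n"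
  by (induction n) (simp_all add: e_one e_mult mult.commute)

lemma e_mem: "V \<subseteq> carrier L \<Longrightarrow> x \<in> carrier L \<Longrightarrow> e x \<in> e ` V \<longleftrightarrow> x \<in> V"
  using bij by (auto simp: bij_betw_def inj_on_def)

lemma image_subset_K: "V \<subseteq> carrier L \<Longrightarrow> e ` V \<subseteq> K" using e_K by blast

lemma image_eq: "V \<subseteq> carrier L \<Longrightarrow> W \<subseteq> carrier L \<Longrightarrow> e ` V = e ` W \<longleftrightarrow> V = W"
  using bij by (auto simp: bij_betw_def inj_on_image_eq_iff)

lemma image_eq_K: "V \<subseteq> carrier L \<Longrightarrow> e ` V = K \<longleftrightarrow> V = carrier L"
  using image_eq[of V "carrier L"] bij by (simp add: bij_betw_def)

lemma image_subset: "V \<subseteq> carrier L \<Longrightarrow> W \<subseteq> carrier L \<Longrightarrow> e ` V \<subseteq> e ` W \<longleftrightarrow> V \<subseteq> W"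
  using bij by (auto simp: bij_betw_def inj_on_image_subset_iff)

lemma image_exists: "W \<subseteq> K \<Longrightarrow> \<exists>V\<subseteq>carrier L. e ` V = W"
  using bij by (metis bij_betw_def subset_imageE)

lemma subring_iff:
  assumes V: "V \<subseteq> carrier L"
  shows "subring V L \<longleftrightarrow> ring_closed (e ` V)"
proof
  assume s: "subring V L"
  note S = subringE[OF s]
  show "ring_closed (e ` V)" unfolding ring_closed_def
  proof (intro conjI ballI)
    show "1 \<in> e ` V" using S(3) e_one by (metis imageI)
    fix u v assume "u \<in> e ` V" "v \<in> e ` V"
    then obtain a b where ab: "u = e a" "v = e b" "a \<in> V" "b \<in> V" by blast
    then have c: "a \<in> carrier L" "b \<in> carrier L" using V by auto
    have "u - v = e (a \<oplus>\<^bsub>L\<^esub> \<ominus>\<^bsub>L\<^esub> b)" using c by (simp add: ab e_add e_minus)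
    then show "u - v \<in> e ` V" using S(5,7) ab by simp
    have "u * v = e (a \<otimes>\<^bsub>L\<^esub> b)" using c by (simp add: ab e_mult)
    then show "u * v \<in> e ` V" using S(6) ab by simp
  qed
next
  assume r: "ring_closed (e ` V)"
  note R = ring_closedD[OF r]
  show "subring V L"
  proof (rule L.subringI[OF V])
    show "\<one>\<^bsub>L\<^esub> \<in> V" using R(1) e_mem[OF V, of "\<one>\<^bsub>L\<^esub>"] by (simp add: e_one)
    fix h assume h: "h \<in> V"
    then have hc: "h \<in> carrier L" using V by blast
    show "\<ominus>\<^bsub>L\<^esub> h \<in> V" using R(5)[of "e h"] h hc e_mem[OF V, of "\<ominus>\<^bsub>L\<^esub> h"] by (simp add: e_minus)
    fix h' assume h': "h' \<in> V"
    then have h'c: "h' \<in> carrier L" using V by blast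
    show "h \<otimes>\<^bsub>L\<^esub> h' \<in> V" using R(4)[of "e h" "e h'"] h hc h' h'c e_mem[OF V, of "h \<otimes>\<^bsub>L\<^esub> h'"] by (simp add: e_mult)
    show "h \<oplus>\<^bsub>L\<^esub> h' \<in> V" using R(6)[of "e h" "e h'"] h hc h' h'c e_mem[OF V, of "h \<oplus>\<^bsub>L\<^esub> h'"] by (simp add: e_add)
  qed
qed

lemma places_iff:
  assumes k: "k \<subseteq> carrier L"
  shows "V \<in> places k L \<longleftrightarrow> V \<subseteq> carrier L \<and> vr K (e ` V) \<and> e ` k \<subset> e ` V \<and> e ` V \<noteq> K"
proof (cases "V \<subseteq> carrier L")
  case False
  then show ?thesis by (auto simp: places_def)
next
  case V: True
  have iff: "(\<forall>z\<in>carrier L - {\<zero>\<^bsub>L\<^esub>}. z \<in> V \<or> inv\<^bsub>L\<^esub> z \<in> V) \<longleftrightarrow> (\<forall>z\<in>K. z \<in> e ` V \<or> inverse z \<in> e ` V)"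
    if r: "ring_closed (e ` V)"
  proof
    assume a: "\<forall>z\<in>carrier L - {\<zero>\<^bsub>L\<^esub>}. z \<in> V \<or> inv\<^bsub>L\<^esub> z \<in> V"
    show "\<forall>z\<in>K. z \<in> e ` V \<or> inverse z \<in> e ` V"
    proof
      fix z assume "z \<in> K"
      then obtain x where x: "x \<in> carrier L" "e x = z" using e_surj by blast
      show "z \<in> e ` V \<or> inverse z \<in> e ` V"
      proof (cases "x = \<zero>\<^bsub>L\<^esub>")
        case True then show ?thesis using x ring_closedD(2)[OF r] by (auto simp: e_zero)
      next
        case False
        then show ?thesis using a x e_inv[OF x(1) False] by (metis DiffI imageI singletonD)
      qed
    qed
  next
    assume a: "\<forall>z\<in>K. z \<in> e ` V \<or> inverse z \<in> e ` V"
    show "\<forall>z\<in>carrier L - {\<zero>\<^bsub>L\<^esub>}. z \<in> V \<or> inv\<^bsub>L\<^esub> z \<in> V"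
    proof
      fix z assume z: "z \<in> carrier L - {\<zero>\<^bsub>L\<^esub>}"
      then have "e z \<in> e ` V \<or> e (inv\<^bsub>L\<^esub> z) \<in> e ` V" using a e_K by (simp add: e_inv)
      then show "z \<in> V \<or> inv\<^bsub>L\<^esub> z \<in> V" using e_mem[OF V] z inv_carrier by auto
    qed
  qed
  have "subring V L \<and> (\<forall>z\<in>carrier L - {\<zero>\<^bsub>L\<^esub>}. z \<in> V \<or> inv\<^bsub>L\<^esub> z \<in> V) \<longleftrightarrow> vr K (e ` V)"
  proof -
    have "vr K (e ` V) \<longleftrightarrow> ring_closed (e ` V) \<and> (\<forall>z\<in>K. z \<in> e ` V \<or> inverse z \<in> e ` V)"
      unfolding vr_def Ball_def using K_closed K_inv image_subset_K[OF V] by blast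
    then show ?thesis unfolding subring_iff[OF V] using iff by blast
  qed
  moreover have "k \<subset> V \<longleftrightarrow> e ` k \<subset> e ` V"
    unfolding psubset_eq image_subset[OF k V] image_eq[OF k V] ..
  moreover have "V \<subset> carrier L \<longleftrightarrow> e ` V \<noteq> K" unfolding image_eq_K[OF V] using V by blast
  ultimately show ?thesis using V unfolding places_def mem_Collect_eq by argo
qed

lemma maxi_image:
  assumes V: "V \<subseteq> carrier L" and v: "vr K (e ` V)"
  shows "e ` place_ideal L V = vr.maxi (e ` V)"
proof -
  interpret v: vr K "e ` V" by fact
  have iff: "x \<in> place_ideal L V \<longleftrightarrow> e x \<in> v.maxi" if x: "x \<in> V" for x
  proof -
    have xc: "x \<in> carrier L" using V x by blast
    show ?thesis
    proof (cases "x = \<zero>\<^bsub>L\<^esub>")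
      case True then show ?thesis using x by (simp add: place_ideal_def e_zero)
    next
      case False
      then have "e (inv\<^bsub>L\<^esub> x) \<in> e ` V \<longleftrightarrow> inv\<^bsub>L\<^esub> x \<in> V" using e_mem[OF V inv_carrier[OF xc False]] by simp
      then show ?thesis using x False xc by (simp add: place_ideal_def v.maxi_def e_inv e_eq_0)
    qed
  qed
  show ?thesis
  proof
    show "e ` place_ideal L V \<subseteq> v.maxi" using iff by (auto simp: place_ideal_def)
    show "v.maxi \<subseteq> e ` place_ideal L V"
    proof
      fix z assume z: "z \<in> v.maxi"
      then obtain x where "x \<in> V" "z = e x" using v.maxi_V by blast
      then show "z \<in> e ` place_ideal L V" using iff z by blast
    qed
  qed
qed

lemma place_norm_eq:
  assumes V: "V \<subseteq> carrier L" and v: "vr K (e ` V)"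
  shows "place_norm L V = nrm (e ` V)"
proof -
  interpret v: vr K "e ` V" by fact
  let ?I = "place_ideal L V"
  define co where "co a = (\<Union>h\<in>?I. {h \<oplus>\<^bsub>L\<^esub> a})" for a
  have I: "?I \<subseteq> V" by (auto simp: place_ideal_def)
  have "carrier (L\<lparr>carrier := V\<rparr> Quot ?I) = co ` V"
    unfolding FactRing_def A_RCOSETS_def' a_r_coset_def' co_def by auto
  then have "place_norm L V = card (co ` V)" by (simp add: place_norm_def)
  also have "\<dots> = card ((\<lambda>S. e ` S) ` co ` V)"
  proof (rule card_image[symmetric], rule inj_onI)
    fix S S' assume S: "S \<in> co ` V" "S' \<in> co ` V" and eq: "e ` S = e ` S'"
    have "h \<oplus>\<^bsub>L\<^esub> a \<in> carrier L" if "h \<in> ?I" "a \<in> V" for h a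
      using that I V by (intro L.add.m_closed) auto
    then have "S \<subseteq> carrier L" "S' \<subseteq> carrier L" using S by (auto simp: co_def)
    then show "S = S'" using image_eq[of S S'] eq by simp
  qed
  also have "(\<lambda>S. e ` S) ` co ` V = (\<lambda>z. {w\<in>e ` V. w - z \<in> v.maxi}) ` e ` V"
    unfolding image_image
  proof (rule image_cong[OF refl])
    fix a assume a: "a \<in> V"
    have ac: "a \<in> carrier L" using a V by blast
    have "e ` co a = (\<lambda>h. e (h \<oplus>\<^bsub>L\<^esub> a)) ` ?I" unfolding co_def by auto
    also have "\<dots> = (\<lambda>h. e h + e a) ` ?I"
      by (intro image_cong refl e_add ac) (use I V in blast)
    also have "\<dots> = (\<lambda>t. t + e a) ` v.maxi"
      unfolding maxi_image[OF V v, symmetric] image_image ..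
    also have "\<dots> = {w\<in>e ` V. w - e a \<in> v.maxi}"
    proof
      show "(\<lambda>t. t + e a) ` v.maxi \<subseteq> {w\<in>e ` V. w - e a \<in> v.maxi}"
        using v.VR(6)[OF v.maxi_V imageI[OF a]] by auto
      show "{w\<in>e ` V. w - e a \<in> v.maxi} \<subseteq> (\<lambda>t. t + e a) ` v.maxi"
      proof
        fix w assume "w \<in> {w\<in>e ` V. w - e a \<in> v.maxi}"
        then show "w \<in> (\<lambda>t. t + e a) ` v.maxi" by (intro image_eqI[of _ _ "w - e a"]) auto
      qed
    qed
    finally show "e ` co a = {w\<in>e ` V. w - e a \<in> v.maxi}" .
  qed
  finally show ?thesis by (simp add: nrm_def)
qed

text \<open>Polynomials of HOL-Algebra are lists headed by the leading coefficient, hence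
  \<open>rev\<close>.\<close>

lemma e_eval:
  assumes x: "x \<in> carrier L"
  shows "set xs \<subseteq> carrier L \<Longrightarrow> e (L.eval xs x) = poly (Poly (rev (map e xs))) (e x)"
proof (induction xs)
  case (Cons c cs)
  have cc: "c \<in> carrier L" "set cs \<subseteq> carrier L" using Cons by auto
  have "L.eval (c # cs) x = c \<otimes>\<^bsub>L\<^esub> (x [^]\<^bsub>L\<^esub> length cs) \<oplus>\<^bsub>L\<^esub> L.eval cs x" by simp
  then have "e (L.eval (c # cs) x) = e c * e x ^ length cs + e (L.eval cs x)"
    using cc x L.eval_in_carrier[OF cc(2) x] by (simp add: e_add e_mult e_pow)
  also have "\<dots> = poly (Poly (rev (map e (c # cs)))) (e x)"
    using Cons(1)[OF cc(2)] by (simp add: Poly_append poly_monom mult.commute)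
  finally show ?case .
qed (simp add: e_zero)

lemma algebraic_root:
  assumes k: "subring k L" and x: "x \<in> carrier L" and alg: "\<not> L.transcendental k x"
  shows "\<exists>Q. Q \<noteq> 0 \<and> coeffs_in (e ` k) Q \<and> poly Q (e x) = 0"
proof -
  obtain xs where xs: "xs \<in> carrier (k[X]\<^bsub>L\<^esub>)" "xs \<noteq> []" "L.eval xs x = \<zero>\<^bsub>L\<^esub>"
    using L.algebraicE[OF k x] alg by (auto simp: over_def)
  have kc: "k \<subseteq> carrier L" and k0: "\<zero>\<^bsub>L\<^esub> \<in> k" using subringE[OF k] by auto
  obtain c cs where cs: "xs = c # cs" using xs(2) by (cases xs) auto
  have sk: "set xs \<subseteq> k" and c0: "c \<noteq> \<zero>\<^bsub>L\<^esub>"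
    using xs(1,2) unfolding univ_poly_carrier[symmetric] polynomial_def cs by auto
  let ?Q = "Poly (rev (map e xs))"
  have "coeff ?Q (length cs) = e c" by (simp add: cs coeff_Poly_eq nth_default_append)
  moreover have "e c \<noteq> 0" using c0 sk kc cs e_eq_0[of c] by auto
  ultimately have "?Q \<noteq> 0" by (metis coeff_0)
  moreover have "coeffs_in (e ` k) ?Q"
    unfolding coeffs_in_def
  proof
    fix i
    show "coeff ?Q i \<in> e ` k"
    proof (cases "i < length xs")
      case True
      then have "coeff ?Q i = rev (map e xs) ! i" by (simp add: coeff_Poly_eq nth_default_def)
      also have "\<dots> \<in> set (rev (map e xs))" using True by (intro nth_mem) simp
      finally show ?thesis using sk by auto
    next
      case False
      then have "coeff ?Q i = e \<zero>\<^bsub>L\<^esub>" by (simp add: coeff_Poly_eq nth_default_def e_zero)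
      then show ?thesis using k0 by simp
    qed
  qed
  moreover have "poly ?Q (e x) = 0" using e_eval[OF x, of xs] sk kc xs(3) by (auto simp: e_zero)
  ultimately show ?thesis by blast
qed

end

section \<open>The exact constant field\<close>

lemma (in vr) integral_in_V:
  assumes z: "z \<in> L" and Q: "Q \<noteq> 0" "poly Q z = 0" "\<And>i. coeff Q i \<in> V" "lead_coeff Q \<in> units"
  shows "z \<in> V"
proof (rule ccontr)
  assume "z \<notin> V"
  then have w: "inverse z \<in> maxi" and z0: "z \<noteq> 0" using not_V_inverse_maxi[OF z] VR(2) by auto
  define n where "n = degree Q"
  have zz: "inverse z ^ n * z ^ i = inverse z ^ (n - i)" if "i \<le> n" for i
  proof -
    have "inverse z ^ n = inverse z ^ (n - i) * inverse z ^ i" using that by (simp add: power_add[symmetric])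
    then show ?thesis using z0 by (simp add: mult.assoc power_mult_distrib[symmetric])
  qed
  have "0 = inverse z ^ n * (\<Sum>i\<le>n. coeff Q i * z ^ i)" using Q(2) by (simp add: poly_altdef n_def)
  also have "\<dots> = (\<Sum>i\<le>n. inverse z ^ (n - i) * coeff Q i)"
    unfolding sum_distrib_left by (intro sum.cong refl) (simp add: zz[symmetric] mult_ac)
  also have "{..n} = insert n {..<n}" by auto
  finally have "coeff Q n = - (\<Sum>i<n. inverse z ^ (n - i) * coeff Q i)" by (simp add: eq_neg_iff_add_eq_0)
  also have "\<dots> \<in> maxi" by (intro maxi_uminus maxi_sum maxi_mult power_maxi w Q) auto
  finally show False using Q(4) by (simp add: n_def units_def)
qed

lemma coeffs_in_pcompose:
  assumes C: "ring_closed C" and "coeffs_in C A" "coeffs_in C B"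
  shows "coeffs_in C (pcompose A B)"
  using assms(2)
proof (induction A)
  case 0 then show ?case by simp
next
  case (pCons a A)
  have "coeffs_in C A" "a \<in> C"
    using pCons.prems unfolding coeffs_in_def by (metis coeff_pCons_Suc, metis coeff_pCons_0)
  then have 1: "coeffs_in C (B * pcompose A B)"
    using pCons.IH assms(3) by (auto simp: coeffs_in_def coeff_mult intro!: ring_closed_sum[OF C] ring_closedD(4)[OF C])
  have 2: "coeffs_in C [:a:]"
    using \<open>a \<in> C\<close> ring_closedD(2)[OF C] by (auto simp: coeffs_in_def coeff_pCons split: nat.split)
  show ?case unfolding pcompose_pCons coeffs_in_def coeff_add
    using 1 2 ring_closedD(6)[OF C] by (simp add: coeffs_in_def)
qed

context as_field
begin

lemma cst_unit: "z \<in> cst \<Longrightarrow> z \<noteq> 0 \<Longrightarrow> inverse z \<in> cst"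
  by (auto simp: cst_def inverse_emb_const)

lemma algebraic_in_Vinf:
  assumes z: "z \<in> K" and Q: "Q \<noteq> 0" "coeffs_in cst Q" "poly Q z = 0"
  shows "z \<in> Vinf"
proof -
  interpret as_inf f y p Vinf by (intro as_inf.intro as_inf_axioms.intro as_field_axioms Vinf)
  have "lead_coeff Q \<in> units"
  proof -
    obtain c where c: "lead_coeff Q = emb [:c:]" using Q(2) by (auto simp: coeffs_in_def cst_def)
    then have "c \<noteq> 0" using Q(1) by auto
    then show ?thesis unfolding c by (rule const_units)
  qed
  moreover have "coeff Q i \<in> Vinf" for i using Q(2) Vinf(2) by (auto simp: coeffs_in_def)
  ultimately show ?thesis using integral_in_V[OF z Q(1,3)] by blast
qed

text \<open>An algebraic element has a constant residue at infinity. The difference \<open>t\<close>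
  is again algebraic and lies in \<open>maxi\<close>; were it nonzero, its inverse would be
  algebraic, hence in \<open>Vinf\<close>, which is impossible for an element of
  \<open>maxi\<close>.\<close>

lemma algebraic_in_cst:
  assumes z: "z \<in> K" and Q: "Q \<noteq> 0" "coeffs_in cst Q" "poly Q z = 0"
  shows "z \<in> cst"
proof -
  interpret as_inf f y p Vinf by (intro as_inf.intro as_inf_axioms.intro as_field_axioms Vinf)
  obtain c where c: "z - emb [:c:] \<in> maxi" using inf_residue algebraic_in_Vinf[OF assms] by blast
  define t where "t = z - emb [:c:]"
  show ?thesis
  proof (cases "t = 0")
    case True then show ?thesis by (auto simp: t_def cst_def)
  next
    case False
    have t: "t \<in> K" "t \<in> maxi" using c maxi_V V(2) by (auto simp: t_def)
    define R where "R = pcompose Q [:emb [:c:], 1:]"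
    have R0: "R \<noteq> 0" unfolding R_def using Q(1) by (subst pcompose_eq_0_iff) auto
    have "coeffs_in cst [:emb [:c:], 1:]"
      using ring_closedD[OF cst_closed] by (auto simp: coeffs_in_def coeff_pCons cst_def split: nat.split)
    then have Rc: "coeffs_in cst R" unfolding R_def by (intro coeffs_in_pcompose cst_closed Q)
    have Rt: "poly R t = 0" using Q(3) by (simp add: R_def poly_pcompose t_def)
    have "inverse t \<in> Vinf"
    proof (rule algebraic_in_Vinf)
      show "inverse t \<in> K" using t K_inverse by blast
      show "reflect_poly R \<noteq> 0" using R0 by simp
      show "coeffs_in cst (reflect_poly R)" using Rc ring_closedD(2)[OF cst_closed]
        by (auto simp: coeffs_in_def coeff_reflect_poly)
      show "poly (reflect_poly R) (inverse t) = 0" using False Rt by (simp add: poly_reflect_poly_nz)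
    qed
    then show ?thesis using t False maxi_inverse_not_V by blast
  qed
qed

lemma T_notin_cst: "T \<notin> cst" using Vinf by blast

text \<open>\<open>T\<close> or its inverse lies in \<open>V\<close> and neither is constant. This
  provides the strict inclusion that \<open>places\<close> asks for.\<close>

lemma cst_place: "isplace V \<Longrightarrow> cst \<subset> V"
proof -
  assume V: "isplace V"
  then have cV: "cst \<subseteq> V" by (simp add: isplace_def)
  interpret vr K V using V by (simp add: isplace_def)
  have "V \<noteq> cst"
  proof
    assume "V = cst"
    then have "T \<in> cst \<or> inverse T \<in> cst" using val[OF K_emb] by blast
    then have "inverse T \<in> cst" using T_notin_cst by blast
    from cst_unit[OF this] have "inverse (inverse T) \<in> cst" by simp
    then show False using T_notin_cst by simp
  qed
  then show ?thesis using cV by blast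
qed

lemma card_cst: "card cst = CARD('g)"
  unfolding cst_def by (rule card_image) (auto intro: injI)

lemma cst_eq: "cst = {z\<in>K. z ^ CARD('g) = z}"
proof -
  have fin: "finite {z :: 'g poly fract alg_closure. z ^ CARD('g) = z}" and
    le: "card {z :: 'g poly fract alg_closure. z ^ CARD('g) = z} \<le> CARD('g)"
  proof -
    let ?R = "Polynomial.monom 1 CARD('g) - Polynomial.monom 1 1 :: 'g poly fract alg_closure poly"
    have "coeff ?R CARD('g) = 1" using CARD_gt_1[where 'g='g] by simp
    then have nz: "?R \<noteq> 0" by (metis coeff_0 zero_neq_one)
    have eq: "{z. poly ?R z = 0} = {z :: 'g poly fract alg_closure. z ^ CARD('g) = z}" by (auto simp: poly_monom)
    have "degree ?R \<le> CARD('g)" using CARD_gt_1[where 'g='g]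
      by (intro degree_diff_le order_trans[OF degree_monom_le]) auto
    then show "finite {z :: 'g poly fract alg_closure. z ^ CARD('g) = z}"
      "card {z :: 'g poly fract alg_closure. z ^ CARD('g) = z} \<le> CARD('g)"
      using poly_roots_finite[OF nz] card_poly_roots_bound[OF nz] unfolding eq by auto
  qed
  have pw: "[:c:] ^ n = [:c ^ n:]" for c :: 'g and n by (induction n) (simp_all add: one_pCons)
  have sub: "cst \<subseteq> {z. z ^ CARD('g) = z}"
    by (auto simp: cst_def emb_power[symmetric] pw finite_field_power_card_eq_same simp del: emb_power)
  have "cst = {z. z ^ CARD('g) = z}"
    by (rule card_subset_eq[OF fin sub]) (use le card_mono[OF fin sub] card_cst in simp)
  moreover have "cst \<subseteq> K" using K_emb by (auto simp: cst_def)
  ultimately show ?thesis by blast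
qed

lemma countable_K: "countable K"
proof -
  have l: "countable (UNIV :: 'b::zero poly set)" if "countable (UNIV :: 'b set)"
  proof -
    have "(UNIV :: 'b poly set) = Poly ` lists UNIV" using Poly_coeffs by (metis UNIV_I lists_UNIV surj_def)
    then show ?thesis using countable_lists[OF that] by (metis countable_image)
  qed
  have 1: "countable (UNIV :: 'g poly set)" by (rule l) simp
  have 2: "countable (UNIV :: 'g poly poly set)" by (rule l[OF 1])
  have "K \<subseteq> (\<lambda>(A, h). ev A / emb h) ` (UNIV \<times> UNIV)" by (auto simp: K_def)
  then show ?thesis using 1 2 by (meson countable_SIGMA countable_image countable_subset)
qed

lemma infinite_K: "infinite K"
proof -
  have "inj (\<lambda>n. emb (Polynomial.monom 1 n :: 'g poly))" by (auto intro!: injI simp: monom_eq_iff')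
  then have "infinite (range (\<lambda>n. emb (Polynomial.monom 1 n :: 'g poly)))" by (rule range_inj_infinite)
  moreover have "range (\<lambda>n. emb (Polynomial.monom 1 n :: 'g poly)) \<subseteq> K" using K_emb by blast
  ultimately show ?thesis using finite_subset by blast
qed

end

section \<open>A copy of the extension on the natural numbers\<close>

lemma field_copy_exists:
  fixes K :: "'k::field set"
  assumes K: "ring_closed K" "\<And>z. z \<in> K \<Longrightarrow> inverse z \<in> K" and c: "countable K" "infinite K"
  shows "\<exists>L e. field_copy K L e"
proof -
  define e where "e = from_nat_into K"
  have bij: "bij_betw e UNIV K" unfolding e_def by (rule bij_betw_from_nat_into[OF c])
  define g where "g = inv_into UNIV e"
  have eg: "e (g z) = z" if "z \<in> K" for z using bij that unfolding g_def by (simp add: bij_betw_def f_inv_into_f)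
  have eK: "e n \<in> K" for n using bij by (auto simp: bij_betw_def)
  have inj: "e a = e b \<longleftrightarrow> a = b" for a b using bij by (auto simp: bij_betw_def inj_on_def)
  note R = ring_closedD[OF K(1)]
  define L :: "nat ring" where "L = \<lparr>carrier = UNIV, monoid.mult = (\<lambda>a b. g (e a * e b)), one = g 1, ring.zero = g 0, ring.add = (\<lambda>a b. g (e a + e b))\<rparr>"
  have L: "carrier L = UNIV" "\<And>a b. e (a \<otimes>\<^bsub>L\<^esub> b) = e a * e b" "\<And>a b. e (a \<oplus>\<^bsub>L\<^esub> b) = e a + e b" "e \<one>\<^bsub>L\<^esub> = 1" "e \<zero>\<^bsub>L\<^esub> = 0"
    using R eK by (simp_all add: L_def eg)
  have "cring L"
  proof (rule cringI)
    show "abelian_group L"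
    proof (rule abelian_groupI)
      fix x assume "x \<in> carrier L"
      have "g (- e x) \<oplus>\<^bsub>L\<^esub> x = \<zero>\<^bsub>L\<^esub>" unfolding inj[symmetric] L using eK R by (simp add: eg)
      then show "\<exists>w\<in>carrier L. w \<oplus>\<^bsub>L\<^esub> x = \<zero>\<^bsub>L\<^esub>" by (auto simp: L)
    qed (simp_all add: L inj[symmetric] add_ac)
    show "comm_monoid L" by (rule comm_monoidI) (simp_all add: L inj[symmetric] mult_ac)
  qed (simp add: L inj[symmetric] distrib_right)
  then have "field L"
  proof (rule cring.cring_fieldI2)
    show "\<zero>\<^bsub>L\<^esub> \<noteq> \<one>\<^bsub>L\<^esub>" unfolding inj[symmetric] L by simp
    fix a assume "a \<noteq> \<zero>\<^bsub>L\<^esub>"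
    then have "e a \<noteq> 0" unfolding inj[symmetric] L .
    then have "a \<otimes>\<^bsub>L\<^esub> g (inverse (e a)) = \<one>\<^bsub>L\<^esub>" unfolding inj[symmetric] L using eK K(2) by (simp add: eg)
    then show "\<exists>b\<in>carrier L. a \<otimes>\<^bsub>L\<^esub> b = \<one>\<^bsub>L\<^esub>" by (auto simp: L)
  qed
  then have "field_copy K L e" using K L bij by (intro field_copy.intro) auto
  then show ?thesis by blast
qed

text \<open>Intrinsic to the ring, hence preserved by every ring isomorphism; by
  \<open>cst_eq\<close> it corresponds to the constants of the extension.\<close>

definition const_field :: "nat \<Rightarrow> nat ring \<Rightarrow> nat set" where
  "const_field q L = {x\<in>carrier L. x [^]\<^bsub>L\<^esub> q = x}"

locale as_copy = as_field f y p + field_copy K L e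
  for f :: "'g::{finite_field,field_gcd} poly" and y p and L :: "nat ring" and e :: "nat \<Rightarrow> 'g poly fract alg_closure" +
  fixes k :: "nat set"
  assumes k_eq: "k = const_field CARD('g) L"
begin

lemma k_carrier: "k \<subseteq> carrier L" by (auto simp: k_eq const_field_def)

lemma k_iff: "x \<in> carrier L \<Longrightarrow> x \<in> k \<longleftrightarrow> e x \<in> cst"
  using e_inj[of "x [^]\<^bsub>L\<^esub> CARD('g)" x] e_K[of x] by (simp add: k_eq const_field_def cst_eq e_pow)

lemma k_image: "e ` k = cst"
proof
  show "e ` k \<subseteq> cst" using k_iff k_carrier by auto
  show "cst \<subseteq> e ` k"
  proof
    fix z assume z: "z \<in> cst"
    then have "z \<in> K" using cst_eq by blast
    then obtain x where "x \<in> carrier L" "e x = z" using e_surj by blast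
    then show "z \<in> e ` k" using k_iff z by blast
  qed
qed

lemma card_k: "finite k" "card k = CARD('g)"
proof -
  have inj: "inj_on e k" using bij k_carrier by (meson bij_betw_def inj_on_subset)
  have "finite cst" using card_cst CARD_gt_1[where 'g='g] card.infinite by fastforce
  then show "finite k" using finite_imageD[OF _ inj] k_image by simp
  show "card k = CARD('g)" using card_image[OF inj] k_image card_cst by simp
qed

lemma k_subring: "subring k L" using subring_iff[OF k_carrier] cst_closed by (simp add: k_image)

lemma k_subfield: "subfield k L"
proof (rule L.subfieldI'[OF k_subring])
  fix x assume x: "x \<in> k - {\<zero>\<^bsub>L\<^esub>}"
  then have xc: "x \<in> carrier L" "x \<noteq> \<zero>\<^bsub>L\<^esub>" using k_carrier by auto
  have "e (inv\<^bsub>L\<^esub> x) \<in> cst" unfolding e_inv[OF xc] using x k_iff[OF xc(1)] e_eq_0[OF xc(1)] xc by (intro cst_unit) auto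
  then show "inv\<^bsub>L\<^esub> x \<in> k" using k_iff[OF inv_carrier[OF xc]] by simp
qed

lemma function_field_L: "function_field k L"
  unfolding function_field_def
proof (intro conjI)
  show "field L" by (rule L_field)
  show "subfield k L" by (rule k_subfield)
  show "\<forall>x\<in>carrier L. L.algebraic k x \<longrightarrow> x \<in> k"
  proof (intro ballI impI)
    fix x assume x: "x \<in> carrier L" "L.algebraic k x"
    then obtain Q where "Q \<noteq> 0" "coeffs_in cst Q" "poly Q (e x) = 0" using algebraic_root[OF k_subring, of x] k_image by auto
    then have "e x \<in> cst" using algebraic_in_cst e_K x by blast
    then show "x \<in> k" using k_iff x by blast
  qed
  obtain x where x: "x \<in> carrier L" "e x = T" using e_surj K_emb by metis
  show "\<exists>x\<in>carrier L. L.transcendental k x \<and> L.finite_dimension (generate_field L (insert x k)) (carrier L)"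
  proof (intro bexI[of _ x] conjI x)
    show "L.transcendental k x"
    proof (rule ccontr)
      assume "\<not> L.transcendental k x"
      then obtain Q where "Q \<noteq> 0" "coeffs_in cst Q" "poly Q T = 0" using algebraic_root[OF k_subring x(1)] k_image x by auto
      then show False using algebraic_in_Vinf[OF K_emb] Vinf(3) by blast
    qed
    let ?E = "generate_field L (insert x k)"
    have sf: "subfield ?E L" by (rule L.generate_field_is_subfield) (use x k_carrier in auto)
    have sr: "subring ?E L" using sf subfieldE(1) by blast
    have Ec: "?E \<subseteq> carrier L" using subringE(1)[OF sr] .
    have rE: "ring_closed (e ` ?E)" using sr subring_iff[OF Ec] by simp
    note R = ring_closedD[OF rE]
    have cE: "z \<in> e ` ?E" if "z \<in> cst" for z
      using that k_image generate_field.incl[of _ "insert x k" L] by blast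
    have TE: "T \<in> e ` ?E" using x(2) generate_field.incl[of x "insert x k" L] by (metis imageI insertI1)
    have embE: "emb g \<in> e ` ?E" for g
    proof (induction g)
      case 0 then show ?case using R by simp
    next
      case (pCons a g)
      have "emb [:a:] \<in> cst" by (simp add: cst_def)
      then show ?case unfolding emb_pCons[of a g] using pCons TE cE by (intro R) auto
    qed
    have invE: "inverse (emb h) \<in> e ` ?E" if h: "h \<noteq> 0" for h
    proof -
      obtain w where w: "w \<in> ?E" "emb h = e w" using embE by blast
      then have "w \<noteq> \<zero>\<^bsub>L\<^esub>" "w \<in> carrier L" using h Ec e_zero by auto
      then have "e (inv\<^bsub>L\<^esub> w) = inverse (emb h)" using e_inv w by simp
      moreover have "inv\<^bsub>L\<^esub> w \<in> ?E" using w \<open>w \<noteq> \<zero>\<^bsub>L\<^esub>\<close> by (intro generate_field.m_inv)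
      ultimately show ?thesis by (metis imageI)
    qed
    have "\<forall>j. \<exists>u\<in>carrier L. e u = y ^ j" using e_surj ring_closed_power[OF K_ring K_y] by blast
    then obtain u where u: "\<And>j. u j \<in> carrier L" "\<And>j. e (u j) = y ^ j" by metis
    define Us where "Us = map u [0..<p]"
    have Us: "set Us \<subseteq> carrier L" using u by (auto simp: Us_def)
    have "carrier L \<subseteq> L.Span ?E Us"
    proof
      fix z assume z: "z \<in> carrier L"
      obtain A0 h where z0: "e z = ev A0 / emb h" "h \<noteq> 0" using e_K[OF z] by (auto simp: K_def)
      obtain B A where A0: "A0 = m0 * B + A" and dA: "degree A < p" using reduce by blast
      have ez: "e z = ev A / emb h" unfolding z0 A0 by (simp add: ev_simps ev_m0)
      have "\<exists>s\<in>L.Span ?E Us. e s = (\<Sum>j<n. emb (coeff A j) * inverse (emb h) * y ^ j)" if "n \<le> p" for n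
        using that
      proof (induction n)
        case 0 then show ?case using L.Span_subgroup_props(2)[OF sf Us] e_zero by (intro bexI[of _ "\<zero>\<^bsub>L\<^esub>"]) auto
      next
        case (Suc n)
        then obtain s where s: "s \<in> L.Span ?E Us" "e s = (\<Sum>j<n. emb (coeff A j) * inverse (emb h) * y ^ j)" by auto
        have "emb (coeff A n) * inverse (emb h) \<in> e ` ?E" by (intro R(4) embE invE z0)
        then obtain a where a: "a \<in> ?E" "e a = emb (coeff A n) * inverse (emb h)" by auto
        have "u n \<in> set Us" using Suc by (simp add: Us_def)
        then have un: "u n \<in> L.Span ?E Us" using L.Span_base_incl[OF sf Us] by blast
        have au: "a \<otimes>\<^bsub>L\<^esub> u n \<in> L.Span ?E Us" by (rule L.Span_smult_closed[OF sf Us a(1) un])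
        have ac: "a \<in> carrier L" and sc: "s \<in> carrier L" using a Ec s L.Span_subgroup_props(1)[OF sf Us] by auto
        have "e (s \<oplus>\<^bsub>L\<^esub> (a \<otimes>\<^bsub>L\<^esub> u n)) = e s + e a * y ^ n"
          using ac sc u by (simp add: e_add e_mult)
        also have "\<dots> = (\<Sum>j<Suc n. emb (coeff A j) * inverse (emb h) * y ^ j)" by (simp add: s a)
        finally show ?case using L.Span_subgroup_props(3)[OF sf Us s(1) au] by blast
      qed
      from this[of p] obtain s where s: "s \<in> L.Span ?E Us" "e s = (\<Sum>j<p. emb (coeff A j) * inverse (emb h) * y ^ j)" by auto
      have "e z = (\<Sum>j<p. emb (coeff A j) * y ^ j) * inverse (emb h)"
        unfolding ez hev_sum[OF rhom_emb dA] divide_inverse ..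
      also have "\<dots> = e s" unfolding s(2) sum_distrib_right by (simp add: mult_ac)
      finally have "z = s" using e_inj[of z s] z s(1) L.Span_subgroup_props(1)[OF sf Us] by auto
      then show "z \<in> L.Span ?E Us" using s by simp
    qed
    then have "carrier L = L.Span ?E Us" using L.Span_subgroup_props(1)[OF sf Us] by blast
    then show "L.finite_dimension ?E (carrier L)" using L.Span_finite_dimension[OF sf Us] by simp
  qed
qed

lemma L_places: "V \<in> places k L \<longleftrightarrow> V \<subseteq> carrier L \<and> isplace (e ` V)"
  unfolding places_iff[OF k_carrier] k_image using cst_place[of "e ` V"] unfolding isplace_def by blast

lemma L_norm: "V \<in> places k L \<Longrightarrow> place_norm L V = nrm (e ` V)"
  using place_norm_eq by (simp add: L_places isplace_def)

end

 

subsection \<open>The zeta function\<close>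

text \<open>The difference with its singularities removed vanishes on a half-plane and so
  everywhere. Hence \<open>f\<close> and \<open>g\<close> agree near every point, and for nicely
  meromorphic functions the nearby values determine the value at the point, poles included.\<close>

lemma nicely_meromorphic_unique:
  assumes f: "f nicely_meromorphic_on UNIV" and g: "g nicely_meromorphic_on UNIV"
    and eq: "\<And>s. Re s > 1 \<Longrightarrow> f s = g s"
  shows "f = g"
proof
  fix w
  define h where "h = remove_sings (\<lambda>s. f s - g s)"
  have mf: "f meromorphic_on UNIV" and mg: "g meromorphic_on UNIV" using f g by (auto simp: nicely_meromorphic_on_def)
  have md: "(\<lambda>s. f s - g s) meromorphic_on UNIV" by (intro meromorphic_on_diff mf mg)
  have h: "h nicely_meromorphic_on UNIV" unfolding h_def by (rule remove_sings_nicely_meromorphic[OF md])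
  have op: "open {s. Re s > 1}" by (rule open_halfspace_Re_gt)
  have h0: "h s = 0" if "Re s > 1" for s
  proof -
    have "\<forall>\<^sub>F x in nhds s. x \<in> {s. Re s > 1}" using op that by (intro eventually_nhds_in_open) auto
    then have "\<forall>\<^sub>F x in at s. f x - g x = 0" unfolding eventually_at_filter
      by eventually_elim (use eq in auto)
    then have "((\<lambda>x. f x - g x) \<longlongrightarrow> 0) (at s)" by (rule tendsto_eventually)
    then show ?thesis unfolding h_def by (rule remove_sings_eqI)
  qed
  have "\<forall>\<^sub>F x in nhds 2. x \<in> {s. Re s > 1}" using op by (intro eventually_nhds_in_open) auto
  then have "\<forall>\<^sub>F x in at 2. h x = 0" unfolding eventually_at_filter
    by eventually_elim (use h0 in auto)
  then have "\<exists>\<^sub>F x in at 2. h x = 0" by (intro eventually_frequently) auto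
  then have hz: "h w = 0" for w
    using frequently_eq_meromorphic_imp_constant[OF _ h, of 0 2 w] by auto
  have ev: "\<forall>\<^sub>F x in at w. f x = g x" for w
  proof -
    have "\<forall>\<^sub>F x in cosparse UNIV. h x = f x - g x" unfolding h_def by (rule eventually_remove_sings_eq[OF md])
    then have "\<forall>\<^sub>F x in at w. h x = f x - g x" by (auto simp: eventually_cosparse_open_eq)
    then show ?thesis by eventually_elim (use hz in auto)
  qed
  have p: "is_pole f w \<longleftrightarrow> is_pole g w" by (rule is_pole_cong[OF ev refl])
  show "f w = g w"
  proof (cases "is_pole f w")
    case True
    then have "\<not> g \<midarrow>w\<rightarrow> g w" "\<not> f \<midarrow>w\<rightarrow> f w" using p not_tendsto_and_filterlim_at_infinity[of "at w"] by (auto simp: is_pole_def)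
    then show ?thesis using f g unfolding nicely_meromorphic_on_def by (metis UNIV_I)
  next
    case False
    then have "f \<midarrow>w\<rightarrow> f w" "g \<midarrow>w\<rightarrow> g w" using f g p by (auto simp: nicely_meromorphic_on_def)
    moreover have "g \<midarrow>w\<rightarrow> f w" by (rule Lim_transform_eventually[OF \<open>f \<midarrow>w\<rightarrow> f w\<close> ev])
    ultimately show ?thesis using tendsto_unique[of "at w"] by simp
  qed
qed

lemma sum_power_degree_le:
  fixes S :: "'a::{finite,field} poly set"
  assumes c: "c \<ge> 0" "real CARD('a) * c < 1" and S: "finite S" "S \<subseteq> monic_irreducibles"
  shows "(\<Sum>P\<in>S. c ^ degree P) \<le> 1 / (1 - real CARD('a) * c)"
proof -
  define M where "M = Suc (Max (insert 0 (degree ` S)))"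
  have fin: "finite (\<Union>n<M. (monics n :: 'a poly set))" by simp
  have SM: "S \<subseteq> (\<Union>n<M. monics n)"
  proof
    fix P assume "P \<in> S"
    then have "degree P < M" using S(1) by (auto simp: M_def less_Suc_eq_le)
    moreover have "P \<in> monics (degree P)" using \<open>P \<in> S\<close> S(2) by (auto simp: monics_def monic_irreducibles_def)
    ultimately show "P \<in> (\<Union>n<M. monics n)" by blast
  qed
  have "(\<Sum>P\<in>S. c ^ degree P) \<le> (\<Sum>P\<in>(\<Union>n<M. (monics n :: 'a poly set)). c ^ degree P)"
    by (rule sum_mono2[OF fin SM]) (use c in simp)
  also have "\<dots> = (\<Sum>n<M. \<Sum>P\<in>(monics n :: 'a poly set). c ^ degree P)"
  proof (rule sum.UNION_disjoint)
    show "\<forall>i\<in>{..<M}. \<forall>j\<in>{..<M}. i \<noteq> j \<longrightarrow> (monics i :: 'a poly set) \<inter> monics j = {}" by (auto simp: monics_def)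
  qed simp_all
  also have "\<dots> = (\<Sum>n<M. (real CARD('a) * c) ^ n)"
  proof (rule sum.cong[OF refl])
    fix n
    have "(\<Sum>P\<in>(monics n :: 'a poly set). c ^ degree P) = (\<Sum>P\<in>(monics n :: 'a poly set). c ^ n)"
      by (rule sum.cong) (auto simp: monics_def)
    then show "(\<Sum>P\<in>(monics n :: 'a poly set). c ^ degree P) = (real CARD('a) * c) ^ n"
      by (simp add: card_monics power_mult_distrib)
  qed
  also have "\<dots> = (1 - (real CARD('a) * c) ^ M) / (1 - real CARD('a) * c)"
    using c by (subst sum_gp_strict) auto
  also have "\<dots> \<le> 1 / (1 - real CARD('a) * c)"
    using c by (intro divide_right_mono) auto
  finally show ?thesis .
qed

definition zeta_form :: "'g::{finite_field,field_gcd} poly \<Rightarrow> complex \<Rightarrow> complex" where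
  "zeta_form f s = (let u = of_nat CARD('g) powr (- s) in Lprod f u / ((1 - u) * (1 - of_nat CARD('g) * u)))"

lemma Lprod_analytic: "(\<lambda>s. Lprod (f :: 'g::{finite_field,field_gcd} poly) (of_nat CARD('g) powr (- s))) analytic_on A"
proof -
  have "(\<lambda>s. of_nat CARD('g) powr (- s) :: complex) analytic_on A"
    by (intro analytic_on_powr analytic_intros) (use CARD_gt_1[where 'g='g] in auto)
  then show ?thesis unfolding Lprod_def
    by (intro analytic_on_prod analytic_on_sum analytic_on_mult analytic_on_const analytic_on_power)
qed

lemma zeta_form_meromorphic: "zeta_form (f :: 'g::{finite_field,field_gcd} poly) meromorphic_on UNIV"
proof -
  have p: "(\<lambda>s. of_nat CARD('g) powr (- s) :: complex) analytic_on UNIV"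
    by (intro analytic_on_powr analytic_intros) (use CARD_gt_1[where 'g='g] in auto)
  show ?thesis unfolding zeta_form_def Let_def
    by (intro meromorphic_on_divide analytic_on_imp_meromorphic_on Lprod_analytic analytic_intros p)
qed

section \<open>The Euler product of the copy and its continuation\<close>

context as_copy
begin

lemma image_inj: "inj_on ((`) e) (places k L)"
proof (rule inj_onI)
  fix V W assume VW: "V \<in> places k L" "W \<in> places k L" and eq: "e ` V = e ` W"
  have "V \<subseteq> carrier L" "W \<subseteq> carrier L" using VW by (simp_all add: L_places)
  then show "V = W" using image_eq[of V W] eq by simp
qed

lemma image_places: "(`) e ` places k L = {V. isplace V}"
proof
  show "(`) e ` places k L \<subseteq> {V. isplace V}"
  proof
    fix W assume "W \<in> (`) e ` places k L"
    then obtain V where "V \<in> places k L" "W = e ` V" by blast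
    then show "W \<in> {V. isplace V}" by (simp add: L_places)
  qed
  show "{V. isplace V} \<subseteq> (`) e ` places k L"
  proof
    fix V assume V: "V \<in> {V. isplace V}"
    then have "V \<subseteq> K" unfolding mem_Collect_eq isplace_def using vr.V(2) by blast
    then obtain W where "W \<subseteq> carrier L" "e ` W = V" using image_exists[of V] by metis
    then have "W \<in> places k L" using V by (simp add: L_places)
    then show "V \<in> (`) e ` places k L" using \<open>e ` W = V\<close> by blast
  qed
qed

definition LFib :: "'g poly \<Rightarrow> nat set set" where "LFib P = {V\<in>places k L. e ` V \<in> Fib P}"

definition LVinf :: "nat set" where "LVinf = inv_into (places k L) ((`) e) Vinf"

lemma LVinf: "LVinf \<in> places k L" "e ` LVinf = Vinf"
proof -
  have "Vinf \<in> (`) e ` places k L" unfolding image_places using Vinf_place by simp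
  then show "LVinf \<in> places k L" "e ` LVinf = Vinf"
    unfolding LVinf_def by (rule inv_into_into, rule f_inv_into_f)
qed

lemma LFib_bij: "bij_betw ((`) e) (LFib P) (Fib P)"
proof -
  have "inj_on ((`) e) (LFib P)" using image_inj by (rule inj_on_subset) (auto simp: LFib_def)
  moreover have "(`) e ` LFib P = Fib P"
  proof
    show "(`) e ` LFib P \<subseteq> Fib P" by (auto simp: LFib_def)
    show "Fib P \<subseteq> (`) e ` LFib P"
    proof
      fix V assume V: "V \<in> Fib P"
      then have "V \<in> (`) e ` places k L" unfolding image_places by (simp add: Fib_def)
      then show "V \<in> (`) e ` LFib P" using V by (auto simp: LFib_def)
    qed
  qed
  ultimately show ?thesis by (simp add: bij_betw_def)
qed

lemma LFib_props:
  assumes P: "P \<in> monic_irreducibles"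
  shows "finite (LFib P)"
    and "psi (lam f P) = 1 \<Longrightarrow> card (LFib P) = p \<and> (\<forall>V\<in>LFib P. place_norm L V = CARD('g) ^ degree P)"
    and "psi (lam f P) \<noteq> 1 \<Longrightarrow> card (LFib P) = 1 \<and> (\<forall>V\<in>LFib P. place_norm L V = CARD('g) ^ (degree P * p))"
  using Fib_props[OF P] bij_betw_finite[OF LFib_bij[of P]] bij_betw_same_card[OF LFib_bij[of P]]
  by (auto simp: LFib_def L_norm)

lemma L_places_eq: "places k L = insert LVinf (\<Union>P\<in>monic_irreducibles. LFib P)"
proof
  show "places k L \<subseteq> insert LVinf (\<Union>P\<in>monic_irreducibles. LFib P)"
  proof
    fix V assume V: "V \<in> places k L"
    then have "e ` V \<in> {V. isplace V}" using L_places by auto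
    then show "V \<in> insert LVinf (\<Union>P\<in>monic_irreducibles. LFib P)"
      unfolding places_eq using V LVinf inj_onD[OF image_inj, of V LVinf] by (auto simp: LFib_def)
  qed
  show "insert LVinf (\<Union>P\<in>monic_irreducibles. LFib P) \<subseteq> places k L" using LVinf by (auto simp: LFib_def)
qed

lemma LVinf_notin: "LVinf \<notin> (\<Union>P\<in>monic_irreducibles. LFib P)"
  using Vinf_notin LVinf(2) by (auto simp: LFib_def)

lemma LFib_disjoint: "disjoint_family_on LFib monic_irreducibles"
  using Fib_disjoint unfolding disjoint_family_on_def LFib_def by blast

text \<open>In terms of \<open>u\<close> the fibre over \<open>P\<close> contributes
  \<open>eulerfac f u P\<close>, and the place at infinity, of norm \<open>q\<close>, contributes
  \<open>1 / (1 - u)\<close>. Summability holds because there are at most \<open>p\<close> places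
  over \<open>P\<close>, each with a term of size at most \<open>cmod u ^ degree P\<close>.\<close>

lemma euler_product:
  assumes s: "Re s > 1"
  shows "infprod (\<lambda>V. inverse (1 - of_nat (place_norm L V) powr (- s))) (places k L) = zeta_form f s"
proof -
  define q where "q = CARD('g)"
  have q1: "q > 1" using CARD_gt_1[where 'g='g] by (simp add: q_def)
  define u :: complex where "u = of_nat q powr (- s)"
  define x where "x V = (of_nat (place_norm L V) :: complex) powr (- s)" for V
  have pw: "(of_nat (q ^ n) :: complex) powr (- s) = u ^ n" for n
    using q1 by (induction n) (simp_all add: u_def powr_times_real)
  have cu: "cmod u = real q powr (- Re s)" unfolding u_def using q1 by (simp add: norm_powr_real_powr)
  have qu: "real q * cmod u < 1"
  proof -
    have "real q * real q powr (- Re s) = real q powr (1 - Re s)" using q1 by (simp add: powr_diff powr_minus field_simps)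
    also have "\<dots> < real q powr 0" using q1 s by (intro powr_less_mono) auto
    finally show ?thesis using q1 cu by simp
  qed
  have u_half: "cmod u < 1 / 2"
  proof -
    have "2 * cmod u \<le> real q * cmod u" using q1 by (intro mult_right_mono) auto
    then show ?thesis using qu by simp
  qed
  have pn: "cmod (u ^ n) \<le> cmod u" if "n > 0" for n
    using that u_half power_decreasing[of 1 n "cmod u"] by (simp add: norm_power)
  have xF: "x V = (if psi (lam f P) = 1 then u ^ degree P else u ^ (degree P * p))" if "P \<in> monic_irreducibles" "V \<in> LFib P" for P V
    using LFib_props[OF that(1)] that(2) pw by (auto simp: x_def q_def[symmetric])
  have xI: "x LVinf = u"
    using pw[of 1] LVinf nrm_Vinf L_norm by (simp add: x_def q_def)
  have deg: "degree P > 0" if "P \<in> (monic_irreducibles :: 'g poly set)" for P using monic_irreducible_degree_pos[OF that] .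
  have xF_le: "cmod (x V) \<le> cmod u ^ degree P" if "P \<in> monic_irreducibles" "V \<in> LFib P" for P V
    unfolding xF[OF that] using u_half p
    by (auto simp: norm_power intro!: power_decreasing)
  have x_half: "cmod (x V) < 1 / 2" if V: "V \<in> places k L" for V
  proof (cases "V = LVinf")
    case True then show ?thesis using xI u_half by simp
  next
    case False
    then obtain P where P: "P \<in> monic_irreducibles" "V \<in> LFib P" using V L_places_eq by auto
    have "cmod (x V) \<le> cmod u"
      using xF_le[OF P] pn[OF deg[OF P(1)]] by (simp add: norm_power)
    then show ?thesis using u_half by simp
  qed
  have sum_deg: "(\<Sum>P\<in>S. cmod u ^ degree P) \<le> 1 / (1 - real q * cmod u)" if "finite S" "S \<subseteq> monic_irreducibles" for S :: "'g poly set"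
    using sum_power_degree_le[OF _ _ that, of "cmod u"] qu by (simp add: q_def)
  have summ: "(\<lambda>V. cmod (x V)) summable_on places k L"
  proof (rule nonneg_bdd_above_summable_on)
    define Bd where "Bd = 1 + real p * (1 / (1 - real q * cmod u))"
    show "bdd_above (sum (\<lambda>V. cmod (x V)) ` {F. F \<subseteq> places k L \<and> finite F})"
    proof (rule bdd_aboveI2[where M = Bd])
      fix F assume "F \<in> {F. F \<subseteq> places k L \<and> finite F}"
      then have F: "F \<subseteq> places k L" "finite F" by auto
      have "\<forall>V\<in>F - {LVinf}. \<exists>P. P \<in> monic_irreducibles \<and> V \<in> LFib P" using F L_places_eq by auto
      then obtain h where h: "\<And>V. V \<in> F - {LVinf} \<Longrightarrow> h V \<in> monic_irreducibles \<and> V \<in> LFib (h V)" by metis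
      define S where "S = h ` (F - {LVinf})"
      have S: "finite S" "S \<subseteq> monic_irreducibles" using F h by (auto simp: S_def)
      have finU: "finite (\<Union>P\<in>S. LFib P)" using S LFib_props(1) by blast
      have notin: "LVinf \<notin> (\<Union>P\<in>S. LFib P)" using LVinf_notin S by blast
      have "sum (\<lambda>V. cmod (x V)) F \<le> sum (\<lambda>V. cmod (x V)) (insert LVinf (\<Union>P\<in>S. LFib P))"
        by (rule sum_mono2) (use finU h in \<open>auto simp: S_def\<close>)
      also have "\<dots> = cmod u + sum (\<lambda>V. cmod (x V)) (\<Union>P\<in>S. LFib P)" using finU notin xI by simp
      also have "sum (\<lambda>V. cmod (x V)) (\<Union>P\<in>S. LFib P) = (\<Sum>P\<in>S. sum (\<lambda>V. cmod (x V)) (LFib P))"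
        by (rule sum.UNION_disjoint) (use S LFib_props(1) LFib_disjoint in \<open>auto simp: disjoint_family_on_def subset_iff\<close>)
      also have "\<dots> \<le> (\<Sum>P\<in>S. real p * cmod u ^ degree P)"
      proof (rule sum_mono)
        fix P assume "P \<in> S"
        then have P: "P \<in> monic_irreducibles" using S by blast
        have "sum (\<lambda>V. cmod (x V)) (LFib P) \<le> real (card (LFib P)) * cmod u ^ degree P"
          by (rule sum_bounded_above) (rule xF_le[OF P])
        also have "card (LFib P) \<le> p" using LFib_props[OF P] p by (cases "psi (lam f P) = 1") auto
        then have "real (card (LFib P)) * cmod u ^ degree P \<le> real p * cmod u ^ degree P" by (intro mult_right_mono) auto
        finally show "sum (\<lambda>V. cmod (x V)) (LFib P) \<le> real p * cmod u ^ degree P" .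
      qed
      also have "\<dots> \<le> real p * (1 / (1 - real q * cmod u))"
        unfolding sum_distrib_left[symmetric] by (intro mult_left_mono sum_deg S) auto
      finally show "sum (\<lambda>V. cmod (x V)) F \<le> Bd" using u_half by (simp add: Bd_def)
    qed
  qed simp
  have prodF: "(\<Prod>V\<in>LFib P. inverse (1 - x V)) = eulerfac f u P" if P: "P \<in> monic_irreducibles" for P
  proof -
    have "(\<Prod>V\<in>LFib P. inverse (1 - x V)) = (\<Prod>V\<in>LFib P. inverse (1 - (if psi (lam f P) = 1 then u ^ degree P else u ^ (degree P * p))))"
      by (intro prod.cong refl) (simp add: xF[OF P])
    then show ?thesis using LFib_props(2,3)[OF P]
      by (auto simp: eulerfac_def power_inverse p_eq mult.commute)
  qed
  have lim: "((\<lambda>S. \<Prod>P\<in>S. \<Prod>V\<in>LFib P. inverse (1 - x V)) \<longlongrightarrow> Lprod f u / (1 - of_nat q * u)) (finite_subsets_at_top monic_irreducibles)"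
  proof (rule Lim_transform_eventually)
    show "((\<lambda>S. \<Prod>P\<in>S. eulerfac f u P) \<longlongrightarrow> Lprod f u / (1 - of_nat q * u)) (finite_subsets_at_top monic_irreducibles)"
      unfolding q_def by (rule eulerfac_tendsto) (use qu f in \<open>simp_all add: q_def p_eq\<close>)
    show "\<forall>\<^sub>F S in finite_subsets_at_top monic_irreducibles. (\<Prod>P\<in>S. eulerfac f u P) = (\<Prod>P\<in>S. \<Prod>V\<in>LFib P. inverse (1 - x V))"
      unfolding eventually_finite_subsets_at_top
      by (intro exI[of _ "{}"]) (auto intro!: prod.cong prodF[symmetric])
  qed
  have "infprod (\<lambda>V. inverse (1 - x V)) (places k L) = inverse (1 - x LVinf) * (Lprod f u / (1 - of_nat q * u))"
    by (rule prod_tendsto_fibers[OF L_places_eq LVinf_notin LFib_disjoint LFib_props(1) x_half summ lim])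
  also have "\<dots> = zeta_form f s"
    by (simp add: xI zeta_form_def u_def q_def Let_def divide_inverse mult_ac)
  finally show ?thesis by (simp add: x_def)
qed

lemma zeta_eq: "zeta k L = remove_sings (zeta_form f)"
  unfolding zeta_def
proof (rule the_equality)
  let ?F = "remove_sings (zeta_form f)"
  have nice: "?F nicely_meromorphic_on UNIV" by (rule remove_sings_nicely_meromorphic[OF zeta_form_meromorphic])
  have an: "zeta_form f analytic_on {s. Re s > 1}"
  proof -
    have q: "real CARD('g) > 1" using CARD_gt_1[where 'g='g] by simp
    have p: "(\<lambda>s. of_nat CARD('g) powr (- s) :: complex) analytic_on {s. Re s > 1}"
      by (intro analytic_on_powr analytic_intros) (use q in auto)
    have nz: "of_nat CARD('g) powr (- s) \<noteq> (1 :: complex) \<and> of_nat CARD('g) * of_nat CARD('g) powr (- s) \<noteq> (1 :: complex)" if "Re s > 1" for s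
    proof -
      have c: "cmod (of_nat CARD('g) powr (- s)) = real CARD('g) powr (- Re s)" using q by (simp add: norm_powr_real_powr)
      have "real CARD('g) powr (- Re s) < real CARD('g) powr (- 1)" using q that by (intro powr_less_mono) auto
      then have c1: "real CARD('g) * real CARD('g) powr (- Re s) < 1" using q by (simp add: powr_minus field_simps)
      moreover have "1 * real CARD('g) powr (- Re s) \<le> real CARD('g) * real CARD('g) powr (- Re s)"
        using q by (intro mult_right_mono) auto
      ultimately have "real CARD('g) powr (- Re s) < 1" by linarith
      then show ?thesis using c c1 by (metis less_irrefl norm_mult norm_of_nat norm_one)
    qed
    show ?thesis unfolding zeta_form_def Let_def
      by (intro analytic_on_divide Lprod_analytic analytic_intros p) (use nz in auto)
  qed
  have eq: "?F s = zeta_form f s" if "Re s > 1" for s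
    using an that by (intro remove_sings_at_analytic) (auto intro: analytic_on_subset)
  show "?F nicely_meromorphic_on UNIV \<and> (\<forall>s. Re s > 1 \<longrightarrow>
        ?F s = infprod (\<lambda>V. inverse (1 - of_nat (place_norm L V) powr (- s))) (places k L))"
    using nice eq euler_product by simp
  fix g assume g: "g nicely_meromorphic_on UNIV \<and> (\<forall>s. Re s > 1 \<longrightarrow>
        g s = infprod (\<lambda>V. inverse (1 - of_nat (place_norm L V) powr (- s))) (places k L))"
  show "g = ?F" by (rule nicely_meromorphic_unique) (use g nice eq euler_product in auto)
qed

lemma zeta_star_eq:
  assumes s: "zeta_form f analytic_on {s}" and nz: "zeta_form f s \<noteq> 0"
  shows "zeta_star k L s = zeta_form f s"
proof -
  let ?F = "remove_sings (zeta_form f)"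
  have ev: "\<forall>\<^sub>F w in nhds s. ?F w = zeta_form f w" by (rule eventually_remove_sings_eq_nhds[OF s])
  have "laurent_expansion ?F s = laurent_expansion (zeta_form f) s"
    by (rule laurent_expansion_cong[OF _ refl]) (use ev in \<open>auto simp: eventually_at_filter elim: eventually_mono\<close>)
  moreover have "(\<lambda>x. zeta_form f (s + x)) has_fps_expansion fps_expansion (zeta_form f) s"
    by (rule analytic_at_imp_has_fps_expansion[OF s])
  then have le: "(\<lambda>x. zeta_form f (s + x)) has_laurent_expansion fps_to_fls (fps_expansion (zeta_form f) s)"
    by (rule has_laurent_expansion_fps)
  then have "laurent_expansion (zeta_form f) s = fps_to_fls (fps_expansion (zeta_form f) s)"
    using has_laurent_expansion_unique[OF not_essential_has_laurent_expansion[OF isolated_singularity_at_analytic[OF s] not_essential_analytic[OF s]]] by blast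
  moreover have "fps_nth (fps_expansion (zeta_form f) s) 0 = zeta_form f s" by (simp add: fps_expansion_def)
  moreover have "fls_subdegree (fps_to_fls (fps_expansion (zeta_form f) s)) = 0"
    using nz calculation(3) by (simp add: fls_subdegree_fls_to_fps subdegree_eq_0_iff)
  ultimately show ?thesis unfolding zeta_star_def zeta_eq Let_def by simp
qed

end

 

subsection \<open>The bound is positive\<close>

text \<open>\<open>infprod\<close> is a \<open>Lim\<close>, so its sign is known only after
  convergence; hence the summability of logarithms.\<close>

lemma infprod_nonneg:
  fixes f :: "'i \<Rightarrow> real"
  assumes f: "\<And>i. i \<in> A \<Longrightarrow> f i > 0" and s: "(\<lambda>i. ln (f i)) summable_on A"
  shows "infprod f A \<ge> 0"
proof -
  obtain \<sigma> where "((\<lambda>i. ln (f i)) has_sum \<sigma>) A" using s by (auto simp: summable_on_def)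
  then have "(sum (\<lambda>i. ln (f i)) \<longlongrightarrow> \<sigma>) (finite_subsets_at_top A)" by (simp add: has_sum_def)
  then have "((\<lambda>F. exp (sum (\<lambda>i. ln (f i)) F)) \<longlongrightarrow> exp \<sigma>) (finite_subsets_at_top A)" by (rule tendsto_exp)
  then have "(prod f \<longlongrightarrow> exp \<sigma>) (finite_subsets_at_top A)"
  proof (rule Lim_transform_eventually)
    show "\<forall>\<^sub>F F in finite_subsets_at_top A. exp (sum (\<lambda>i. ln (f i)) F) = prod f F"
      unfolding eventually_finite_subsets_at_top
      by (intro exI[of _ "{}"]) (auto simp: exp_sum subset_iff f intro!: prod.cong)
  qed
  then have "infprod f A = exp \<sigma>" by (rule infprod_eqI)
  then show ?thesis by simp
qed

text \<open>With \<open>r = (cmod x)\<^sup>2\<close> the bracket equals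
  \<open>(1 + r) / D + 1 / t\<close>, where \<open>D = (cmod (1 - x\<^sup>2))\<^sup>2\<close> is
  \<open>1\<close> up to order \<open>r\<close>. The term \<open>1 / t\<close> therefore cancels
  against \<open>1 + 1 / t\<close>, and the error of order \<open>r\<close> is summable over primes.
  The constant is half of the \<open>18\<close> found for \<open>ln Y\<close>, the exponents being
  \<open>1 / 2\<close>.\<close>

lemma ln_bracket_le:
  assumes \<alpha>: "0 < Re \<alpha>" and t: "t \<ge> 2"
  defines "r \<equiv> t powr (- 1 - 2 * Re \<alpha>)"
  shows "\<bar>ln (Re (bracket \<alpha> t) powr (1/2) * (1 + 1 / t) powr (- 1/2))\<bar> \<le> 9 * r"
proof -
  define x where "x = 1 / of_real t powr (1/2 + \<alpha>)"
  have cx: "1 / of_real t powr (1/2 + cnj \<alpha>) = cnj x"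
    using t by (simp add: x_def cnj_powr)
  have nx: "(cmod x)\<^sup>2 = r"
  proof -
    have "cmod x = 1 / t powr (1/2 + Re \<alpha>)" using t by (simp add: x_def norm_divide norm_powr_real_powr)
    also have "\<dots> = t powr (- (1/2 + Re \<alpha>))" by (rule powr_minus_divide[symmetric])
    finally have "cmod x = t powr (- (1/2 + Re \<alpha>))" .
    then show ?thesis using t by (simp add: r_def power2_eq_square powr_add[symmetric])
  qed
  have r0: "r > 0" using t by (simp add: r_def)
  have "r \<le> t powr (- 1)" unfolding r_def using t \<alpha> by (intro powr_mono) auto
  also have "\<dots> = 1 / t" using t by (simp add: powr_minus_divide)
  also have "\<dots> \<le> 1 / 2" using t by (intro divide_left_mono) auto
  finally have r2: "r \<le> 1 / 2" .
  have x1: "cmod x < 1"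
  proof -
    have "(cmod x)\<^sup>2 < 1\<^sup>2" using nx r2 by simp
    then show ?thesis using power2_less_imp_less by fastforce
  qed
  have nz: "1 - x \<noteq> 0" "1 + x \<noteq> 0" using x1 by (auto simp: add_eq_0_iff)
  define a where "a = (cmod (1 - x))\<^sup>2"
  define b where "b = (cmod (1 + x))\<^sup>2"
  have ab: "a > 0" "b > 0" using nz by (auto simp: a_def b_def)
  have sum_ab: "a + b = 2 * (1 + r)"
    unfolding a_def b_def nx[symmetric] cmod_power2 by (simp add: power2_eq_square algebra_simps)
  define D where "D = a * b"
  have "a * b = (cmod (1 - x\<^sup>2))\<^sup>2" unfolding a_def b_def
    by (simp add: power_mult_distrib[symmetric] norm_mult[symmetric] power2_eq_square algebra_simps)
  then have D: "D = (cmod (1 - x\<^sup>2))\<^sup>2" by (simp add: D_def)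
  have "cmod (1 - x\<^sup>2) \<le> 1 + r" using norm_triangle_ineq4[of 1 "x\<^sup>2"] by (simp add: norm_power nx)
  then have Dle: "D \<le> (1 + r)\<^sup>2" unfolding D by (intro power_mono) auto
  have "1 - r \<le> cmod (1 - x\<^sup>2)" using norm_triangle_ineq2[of 1 "x\<^sup>2"] by (simp add: norm_power nx)
  then have Dge: "(1 - r)\<^sup>2 \<le> D" unfolding D using r2 by (intro power_mono) auto
  have "(1/2)\<^sup>2 \<le> (1 - r)\<^sup>2" using r2 by (intro power_mono) auto
  then have D4: "D \<ge> 1 / 4" using Dge by (simp add: power2_eq_square)
  have "bracket \<alpha> t = 1/2 * (inverse (1 - x) * cnj (inverse (1 - x)) + inverse (1 + x) * cnj (inverse (1 + x))) + 1 / of_real t"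
    unfolding bracket_def cx by (simp add: x_def)
  also have "\<dots> = of_real (1/2 * ((cmod (inverse (1 - x)))\<^sup>2 + (cmod (inverse (1 + x)))\<^sup>2) + 1 / t)"
    by (simp only: complex_norm_square [symmetric] of_real_add of_real_mult of_real_divide of_real_1 of_real_numeral)
  finally have "Re (bracket \<alpha> t) = 1/2 * ((cmod (inverse (1 - x)))\<^sup>2 + (cmod (inverse (1 + x)))\<^sup>2) + 1 / t"
    by (simp only: Re_complex_of_real)
  also have "\<dots> = 1/2 * (1 / a + 1 / b) + 1 / t" 
  proof -
    have "(cmod (inverse z))\<^sup>2 = 1 / (cmod z)\<^sup>2" for z :: complex
      by (simp add: inverse_eq_divide norm_divide power_divide)
    then show ?thesis by (simp only: a_def b_def)
  qed
  also have "1/2 * (1 / a + 1 / b) = (1 + r) / D" using ab sum_ab by (simp add: D_def field_simps)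
  finally have br: "Re (bracket \<alpha> t) = (1 + r) / D + 1 / t" .
  define Y where "Y = Re (bracket \<alpha> t) / (1 + 1 / t)"
  have t1: "1 + 1 / t > 1" using t by simp
  then have tp: "1 + 1 / t > 0" by linarith
  have "D \<le> (1 + r) * (3 / 2)"
    using Dle r2 r0 mult_left_mono[of "1 + r" "3/2" "1 + r"] by (simp add: power2_eq_square)
  then have "2 / 3 \<le> (1 + r) / D" using D4 by (simp add: field_simps)
  moreover have "2 / 3 * (1 / t) \<le> 1 * (1 / t)" using t by (intro mult_right_mono) auto
  ultimately have "2 / 3 * (1 + 1 / t) \<le> (1 + r) / D + 1 / t" unfolding distrib_left by linarith
  then have Y23: "Y \<ge> 2 / 3" unfolding Y_def br pos_le_divide_eq[OF tp] .
  have Y1: "Y - 1 = ((1 + r) / D - 1) / (1 + 1 / t)"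
  proof -
    have "(1 + 1 / t) / (1 + 1 / t) = 1" using tp by (intro divide_self) linarith
    then have "Y - 1 = ((1 + r) / D + 1 / t - (1 + 1 / t)) / (1 + 1 / t)"
      unfolding Y_def br diff_divide_distrib by simp
    then show ?thesis by simp
  qed
  have "(1 - r)\<^sup>2 = 1 - 2 * r + r * r" by (simp add: power2_eq_square algebra_simps)
  then have "1 + r - D \<le> 3 * r" using Dge zero_le_square[of r] by linarith
  moreover have "D - (1 + r) \<le> 3 * r"
  proof -
    have "r * r \<le> r * (1/2)" using r0 r2 by (intro mult_left_mono) auto
    moreover have "(1 + r)\<^sup>2 = 1 + 2 * r + r * r" by (simp add: power2_eq_square algebra_simps)
    ultimately show ?thesis using Dle r0 by linarith
  qed
  ultimately have "\<bar>1 + r - D\<bar> \<le> 3 * r" by linarith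
  moreover have "(1 + r) / D - 1 = (1 + r - D) / D" using D4 by (simp add: field_simps)
  ultimately have "\<bar>(1 + r) / D - 1\<bar> \<le> 3 * r / D" using D4 by (simp add: divide_right_mono)
  also have "\<dots> \<le> 3 * r / (1 / 4)" using D4 r0 by (intro divide_left_mono) auto
  finally have "\<bar>(1 + r) / D - 1\<bar> \<le> 12 * r" by simp
  moreover have "\<bar>Y - 1\<bar> \<le> \<bar>(1 + r) / D - 1\<bar>"
  proof -
    have "\<bar>Y - 1\<bar> = \<bar>(1 + r) / D - 1\<bar> / (1 + 1 / t)"
      unfolding Y1 abs_divide abs_of_pos[OF tp] ..
    also have "\<dots> \<le> \<bar>(1 + r) / D - 1\<bar> / 1"
      by (rule frac_le[OF abs_ge_zero order_refl zero_less_one less_imp_le[OF t1]])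
    finally show ?thesis by simp
  qed
  ultimately have Yb: "\<bar>Y - 1\<bar> \<le> 12 * r" by linarith
  have Y0: "Y > 0" using Y23 by linarith
  have "ln Y \<le> Y - 1" by (rule ln_le_minus_one[OF Y0])
  moreover have "- ln Y \<le> 18 * r"
  proof -
    have "- ln Y = ln (1 / Y)" using Y0 by (simp add: ln_div)
    also have "\<dots> \<le> 1 / Y - 1" using Y0 by (intro ln_le_minus_one) simp
    also have "\<dots> = (1 - Y) / Y" using Y0 by (simp add: field_simps)
    also have "\<dots> \<le> (12 * r) / Y" using Yb Y0 by (intro divide_right_mono) auto
    also have "\<dots> \<le> (12 * r) / (2 / 3)" using Y23 Y0 r0 by (intro divide_left_mono) auto
    finally show ?thesis by simp
  qed
  ultimately have lnY: "\<bar>ln Y\<bar> \<le> 18 * r" using Yb r0 by linarith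
  have bp: "Re (bracket \<alpha> t) > 0" using t by (intro bracket_pos) auto
  have "ln (Re (bracket \<alpha> t) powr (1/2) * (1 + 1 / t) powr (- 1/2)) = 1/2 * ln Y"
    using bp t1 by (simp add: ln_mult ln_powr Y_def ln_div)
  then show ?thesis using lnY by simp
qed

lemma bound_nonneg:
  assumes \<alpha>: "0 < Re \<alpha>"
  shows "infprod (\<lambda>P::'f::{field,finite} poly. Re (bracket \<alpha> (pnorm P)) powr (1/2) * (1 + 1 / pnorm P) powr (- 1/2)) monic_irreducibles \<ge> 0"
proof (rule infprod_nonneg)
  let ?q = "real CARD('f)"
  have "card {0, 1 :: 'f} \<le> CARD('f)" by (rule card_mono) auto
  then have q2: "?q \<ge> 2" by simp
  have t2: "pnorm P \<ge> 2" if "P \<in> monic_irreducibles" for P :: "'f poly"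
  proof -
    have "degree P > 0" using that
      by (auto simp: monic_irreducibles_def Factorial_Ring.irreducible_def is_unit_iff_degree)
    then have "?q ^ 1 \<le> ?q ^ degree P" using q2 by (intro power_increasing) auto
    then show ?thesis using q2 unfolding pnorm_def power_one_right by linarith
  qed
  show "Re (bracket \<alpha> (pnorm P)) powr (1/2) * (1 + 1 / pnorm P) powr (- 1/2) > 0" if "P \<in> monic_irreducibles" for P :: "'f poly"
  proof -
    have "pnorm P > 0" "1 + 1 / pnorm P > 0" using t2[OF that] by (auto intro!: add_pos_pos)
    then show ?thesis using bracket_pos(2)[of "pnorm P" \<alpha>] by simp
  qed
  define c where "c = ?q powr (- 1 - 2 * Re \<alpha>)"
  have c: "c \<ge> 0" "?q * c < 1"
  proof -
    have "?q * c = ?q powr (- 2 * Re \<alpha>)" using q2 by (simp add: c_def powr_diff powr_minus field_simps)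
    also have "\<dots> < ?q powr 0" using q2 \<alpha> by (intro powr_less_mono) auto
    finally show "?q * c < 1" using q2 by simp
  qed (simp add: c_def)
  have rc: "pnorm P powr (- 1 - 2 * Re \<alpha>) = c ^ degree P" for P :: "'f poly"
    unfolding pnorm_def c_def using q2 by (simp add: powr_power powr_realpow[symmetric] powr_powr mult.commute)
  have "(\<lambda>P :: 'f poly. c ^ degree P) summable_on monic_irreducibles"
  proof (rule nonneg_bdd_above_summable_on)
    show "bdd_above (sum (\<lambda>P :: 'f poly. c ^ degree P) ` {F. F \<subseteq> monic_irreducibles \<and> finite F})"
      using sum_power_degree_le[OF c] by (intro bdd_aboveI2) auto
  qed (use c in simp)
  then have "(\<lambda>P :: 'f poly. 9 * c ^ degree P) summable_on monic_irreducibles" by (rule summable_on_cmult_right)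
  then have "(\<lambda>P :: 'f poly. norm (ln (Re (bracket \<alpha> (pnorm P)) powr (1/2) * (1 + 1 / pnorm P) powr (- 1/2)))) summable_on monic_irreducibles"
    by (rule summable_on_comparison_test) (use ln_bracket_le[OF \<alpha> t2] rc in auto)
  then show "(\<lambda>P :: 'f poly. ln (Re (bracket \<alpha> (pnorm P)) powr (1/2) * (1 + 1 / pnorm P) powr (- 1/2))) summable_on monic_irreducibles"
    by (rule abs_summable_summable)
qed

subsection \<open>Infinitely many small zeta values\<close>

lemma as_copy_exists:
  fixes f :: "'g::{finite_field,field_gcd} poly"
  assumes f: "\<not> CHAR('g) dvd degree f"
  shows "\<exists>y L e. as_copy f y CHAR('g) L e (const_field CARD('g) L)"
proof -
  let ?p = "CHAR('g)"
  have p1: "?p > 1" by (intro prime_gt_1_nat) simp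
  let ?A = "Polynomial.monom 1 ?p - Polynomial.monom 1 1 - [:emb f:] :: 'g poly fract alg_closure poly"
  have "coeff ?A ?p = 1" using p1 by (simp add: coeff_pCons split: nat.splits)
  then have "degree ?A > 0" using p1 le_degree[of ?A ?p] by simp
  then obtain y where "poly ?A y = 0" using alg_closed_imp_poly_has_root by blast
  then have y: "y ^ ?p - y = emb f" by (simp add: poly_monom)
  interpret as_field f y ?p by unfold_locales (use f y in auto)
  obtain L e where "field_copy K L e" using field_copy_exists[OF K_ring K_inverse countable_K infinite_K] by blast
  then have "as_copy f y ?p L e (const_field CARD('g) L)"
    by (intro as_copy.intro as_copy_axioms.intro as_field_axioms) auto
  then show ?thesis by blast
qed

lemma field_copy_iso:
  assumes c: "field_copy K L e" and h: "h \<in> ring_iso M L" and M: "field M"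
  shows "field_copy K M (e \<circ> h)"
proof -
  interpret field_copy K L e by fact
  note H = ring_iso_memE[OF h]
  show ?thesis
  proof (intro field_copy.intro)
    show "bij_betw (e \<circ> h) (carrier M) K" by (rule bij_betw_trans[OF H(5) bij])
  qed (use K_closed K_inv M e_mult e_add e_one H(1-4) in auto)
qed

text \<open>Composed with the isomorphism, \<open>L1\<close> becomes a copy of the second extension
  too, with the same constants because \<open>const_field\<close> is intrinsic. Both forms then
  compute \<open>zeta_star\<close> of the same ring.\<close>

lemma zeta_form_iso:
  fixes f1 f2 :: "'g::{finite_field,field_gcd} poly"
  assumes c1: "as_copy f1 y1 p L1 e1 (const_field CARD('g) L1)" and c2: "as_copy f2 y2 p L2 e2 (const_field CARD('g) L2)"
    and iso: "L1 \<simeq> L2"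
    and an: "zeta_form f1 analytic_on {s}" "zeta_form f2 analytic_on {s}" and nz: "zeta_form f1 s \<noteq> 0" "zeta_form f2 s \<noteq> 0"
  shows "zeta_form f1 s = zeta_form f2 s"
proof -
  obtain h where h: "h \<in> ring_iso L1 L2" using iso by (auto simp: is_ring_iso_def)
  interpret a: as_copy f1 y1 p L1 e1 "const_field CARD('g) L1" by fact
  interpret b: as_copy f2 y2 p L2 e2 "const_field CARD('g) L2" by fact
  interpret c: as_copy f2 y2 p L1 "e2 \<circ> h" "const_field CARD('g) L1"
    by (intro as_copy.intro as_copy_axioms.intro b.as_field_axioms field_copy_iso[OF b.field_copy_axioms h] a.L_field refl)
  show ?thesis using a.zeta_star_eq[OF an(1) nz(1)] c.zeta_star_eq[OF an(2) nz(2)] by simp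
qed

theorem theorem5p10:
  fixes q :: nat and \<alpha> :: complex and B :: real
  assumes "q = CARD('f::{field,finite})"
    and "q mod 4 = 1"
    and "0 < Re \<alpha>" and "Re \<alpha> < 1/2"
    and "B > cmod (1 / ((1 - of_nat q powr (- 1/2 - \<alpha>)) * (1 - of_nat q powr (1/2 - \<alpha>)))) *
             infprod (\<lambda>P::'f poly.
                 Re (bracket \<alpha> (pnorm P)) powr (1/2) * (1 + 1 / pnorm P) powr (- 1/2))
               monic_irreducibles"
  shows "\<not> northcott_property q (1/2 + \<alpha>) B"
proof
  assume "northcott_property q (1/2 + \<alpha>) B"
  then have fin: "finite (northcott_set q (1/2 + \<alpha>) B)" by (simp add: northcott_property_def)
  have B: "B > 0"
    using assms(5) bound_nonneg[where 'f='f, OF assms(3)] by (meson le_less_trans mult_nonneg_nonneg norm_ge_zero)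
  have q: "q = CARD('f fract)" by (simp add: assms(1) card_UNIV_fract_field)
  have q1: "real q > 1" unfolding q using CARD_gt_1[where 'g="'f fract"] by simp
  let ?p = "CHAR('f fract)"
  define s where "s = 1/2 + \<alpha>"
  define u :: complex where "u = of_nat q powr (- s)"
  have cu: "cmod u = real q powr (- 1/2 - Re \<alpha>)" using q1 by (simp add: u_def s_def norm_powr_real_powr)
  \<comment> \<open>\<open>Re \<alpha> < 1/2\<close> is what makes the Euler product at
    \<open>s\<close> diverge absolutely, and \<open>0 < Re \<alpha>\<close> is what makes the mean
    square converge.\<close>
  have u1: "1 / real q < cmod u"
  proof -
    have "real q powr (- 1) < real q powr (- 1/2 - Re \<alpha>)" using q1 assms(4) by (intro powr_less_mono) auto
    then show ?thesis using q1 by (simp add: cu powr_minus_divide)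
  qed
  have u2: "sqrt (real q) * cmod u < 1"
  proof -
    have "sqrt (real q) * cmod u = real q powr (1/2 + (- 1/2 - Re \<alpha>))"
      unfolding cu powr_add using q1 by (simp add: powr_half_sqrt)
    also have "\<dots> < real q powr 0" using q1 assms(3) by (intro powr_less_mono) auto
    finally show ?thesis using q1 by simp
  qed
  have "1 * cmod u \<le> sqrt (real q) * cmod u" using q1 by (intro mult_right_mono) auto
  then have un: "u \<noteq> 1" using u2 by auto
  have qun: "of_nat q * u \<noteq> 1"
  proof
    assume "of_nat q * u = 1"
    then have "real q * cmod u = 1" by (metis norm_mult norm_of_nat norm_one)
    then show False using u1 q1 by (simp add: field_simps)
  qed
  define D where "D = (1 - u) * (1 - of_nat q * u)"
  have D: "cmod D > 0" using un qun by (simp add: D_def)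
  have form: "zeta_form f s = Lprod f u / D" for f :: "'f fract poly"
    by (simp add: zeta_form_def u_def D_def Let_def q)
  have an: "zeta_form f analytic_on {s}" for f :: "'f fract poly"
  proof -
    have pa: "(\<lambda>s. of_nat CARD('f fract) powr (- s) :: complex) analytic_on {s}"
      by (intro analytic_on_powr analytic_intros) (use q1 q in auto)
    show ?thesis unfolding zeta_form_def Let_def
      by (intro analytic_on_divide Lprod_analytic analytic_on_mult analytic_on_diff analytic_on_const pa)
        (use un qun in \<open>auto simp: u_def q\<close>)
  qed
  define Good :: "'f fract poly set" where
    "Good = {f. \<not> ?p dvd degree f \<and> Lprod f u \<noteq> 0 \<and> cmod (zeta_form f s) \<le> B}"
  define val where "val f = cmod (zeta_form f s)" for f :: "'f fract poly"
  have nz: "zeta_form f s \<noteq> 0" if "f \<in> Good" for f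
    using that D by (auto simp: form Good_def)
  have "\<forall>f\<in>Good. \<exists>L. \<exists>y e. as_copy f y ?p L e (const_field q L)"
    using as_copy_exists[where 'g="'f fract"] unfolding Good_def q by blast
  then obtain LL where LL: "\<And>f. f \<in> Good \<Longrightarrow> \<exists>y e. as_copy f y ?p (LL f) e (const_field q (LL f))" by metis
  define cls where "cls f = function_field_iso q `` {LL f}" for f
  have ff: "LL f \<in> function_fields q" and self: "LL f \<in> cls f" and north: "cls f \<in> northcott_set q (1/2 + \<alpha>) B" if fG: "f \<in> Good" for f
  proof -
    obtain y e where "as_copy f y ?p (LL f) e (const_field q (LL f))" using LL[OF fG] by blast
    then interpret as_copy f y ?p "LL f" e "const_field q (LL f)" .
    have k: "function_field (const_field q (LL f)) (LL f) \<and> finite (const_field q (LL f)) \<and> card (const_field q (LL f)) = q"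
      using function_field_L card_k q by simp
    then show ff: "LL f \<in> function_fields q" by (auto simp: function_fields_def)
    then show self: "LL f \<in> cls f" by (simp add: cls_def function_field_iso_def ring_iso_refl)
    have "zeta_star (const_field q (LL f)) (LL f) s = zeta_form f s" by (rule zeta_star_eq[OF an nz[OF fG]])
    then have "cmod (zeta_star (const_field q (LL f)) (LL f) (1/2 + \<alpha>)) \<le> B" using fG by (simp add: Good_def s_def)
    moreover have "cls f \<in> function_fields q // function_field_iso q" unfolding cls_def by (rule quotientI[OF ff])
    ultimately show "cls f \<in> northcott_set q (1/2 + \<alpha>) B" unfolding northcott_set_def using k self by blast
  qed
  have val_cls: "val f1 = val f2" if f: "f1 \<in> Good" "f2 \<in> Good" "cls f1 = cls f2" for f1 f2
  proof -
    have "LL f2 \<in> cls f1" using self[OF f(2)] f(3) by simp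
    then have iso: "LL f1 \<simeq> LL f2" by (simp add: cls_def function_field_iso_def)
    obtain y1 e1 where 1: "as_copy f1 y1 ?p (LL f1) e1 (const_field q (LL f1))" using LL[OF f(1)] by blast
    obtain y2 e2 where 2: "as_copy f2 y2 ?p (LL f2) e2 (const_field q (LL f2))" using LL[OF f(2)] by blast
    show ?thesis
      unfolding val_def using zeta_form_iso[OF 1[unfolded q] 2[unfolded q] iso an an nz[OF f(1)] nz[OF f(2)]] by simp
  qed
  have "finite (cls ` Good)" by (rule finite_subset[OF _ fin]) (use north in blast)
  \<comment> \<open>As \<open>val\<close> is constant on classes, one representative of each class
    already shows all values.\<close>
  moreover have "val ` Good \<subseteq> (\<lambda>C. val (SOME f. f \<in> Good \<and> cls f = C)) ` cls ` Good"
  proof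
    fix v assume "v \<in> val ` Good"
    then obtain f where f: "f \<in> Good" "v = val f" by blast
    have "(SOME g. g \<in> Good \<and> cls g = cls f) \<in> Good \<and> cls (SOME g. g \<in> Good \<and> cls g = cls f) = cls f"
      by (rule someI[where P = "\<lambda>g. g \<in> Good \<and> cls g = cls f"]) (use f in simp)
    then have "v = val (SOME g. g \<in> Good \<and> cls g = cls f)" using f val_cls by metis
    then show "v \<in> (\<lambda>C. val (SOME f. f \<in> Good \<and> cls f = C)) ` cls ` Good" using f by blast
  qed
  ultimately have fv: "finite (insert B (val ` Good))" using finite_subset by blast
  \<comment> \<open>With \<open>B\<close> included the minimum exists and is positive even if
    \<open>Good\<close> is empty, and a value below it is automatically at most \<open>B\<close>, so
    that its polynomial belongs to \<open>Good\<close>.\<close>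
  define \<delta> where "\<delta> = Min (insert B (val ` Good))"
  have "\<delta> \<in> insert B (val ` Good)" unfolding \<delta>_def using fv by (rule Min_in) simp
  then have \<delta>0: "\<delta> > 0" using B nz by (auto simp: val_def)
  have \<delta>le: "\<delta> \<le> v" if "v \<in> insert B (val ` Good)" for v unfolding \<delta>_def using fv that by (rule Min_le)
  obtain f :: "'f fract poly" where f: "\<not> ?p dvd degree f" "Lprod f u \<noteq> 0" "cmod (Lprod f u) < \<delta> * cmod D"
    using small_Lprod[where 'g="'f fract", OF u1[unfolded q] u2[unfolded q], of "\<delta> * cmod D"] \<delta>0 D by auto
  have "val f < \<delta>" using f(3) D by (simp add: val_def form norm_divide divide_less_eq)
  moreover have "f \<in> Good" using f(1,2) \<open>val f < \<delta>\<close> \<delta>le[of B] by (simp add: Good_def val_def)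
  ultimately show False using \<delta>le[of "val f"] by simp
qed

end
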